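(* Under the standing assumptions on the data listed in the context, there exists a variational Nash equilibrium, i.e. there exists $\bar{\mathbf u}=(\bar u_1,\ldots,\bar u_m)\in\mathcal U^1_{ad}\times\cdots\times\mathcal U^m_{ad}$ such that $$0\in\nabla_{u_k}J_k(\bar u_k,\bar u_{-k})+N(\bar u_k;\mathcal U^k_{ad})\qquad\text{for all }k=1,\ldots,m.$$
   Context: Data. Let $m\ge 1$ be an integer and $N\in\{1,2,3\}$. Let $\Omega\subset\mathbb R^N$ be an open bounded domain with Lipschitz boundary $\Gamma$, and let $\mathcal A y=-\sum_{i,j=1}^N\partial_{x_j}(a_{ij}(x)\partial_{x_i}y)$ with $a_{ij}\in L^\infty(\Omega)$ and, for some $\lambda_{\mathcal A}>0$, $\lambda_{\mathcal A}\|\xi\|^2\le\sum_{i,j}a_{ij}(x)\xi_i\xi_j$ for all $\xi\in\mathbb R^N$ and a.a. $x\in\Omega$. Let $\zeta_k,B_k\in L^\infty(\Omega)$ for $k=1,\ldots,m$, with $\zeta_k(x)\ge\zeta_{0k}>0$ for a.a. $x\in\Omega$ ($\zeta_{0k}$ a constant). Let $f,L_1,\ldots,L_m:\Omega\times\mathbb R\to\mathbb R$ be Carathéodory functions of class $C^2$ with respect to the second variable $y$. Assumptions on $f$: $f(\cdot,0)\in L^2(\Omega)$, $\frac{\partial f}{\partial y}(x,y)\ge0$ for a.a. $x\in\Omega$ (and all $y$), and for every $M>0$ there is $C_{f,M}>0$ with $|\frac{\partial f}{\partial y}(x,y)|+|\frac{\partial^2f}{\partial y^2}(x,y)|\le C_{f,M}$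 and $|\frac{\partial^2f}{\partial y^2}(x,y_2)-\frac{\partial^2f}{\partial y^2}(x,y_1)|\le C_{f,M}|y_2-y_1|$ for a.a. $x\in\Omega$ and all $|y|,|y_1|,|y_2|\le M$. Assumptions on $L_k$ (each $k$): $L_k(\cdot,0)\in L^1(\Omega)$, and for every $M>0$ there are $C_{L_k,M}>0$ and $\psi_{k,M}\in L^2(\Omega)$ with $|\frac{\partial L_k}{\partial y}(x,y)|\le\psi_{k,M}(x)$, $|\frac{\partial^2L_k}{\partial y^2}(x,y)|\le C_{L_k,M}$ and $|\frac{\partial^2L_k}{\partial y^2}(x,y_2)-\frac{\partial^2L_k}{\partial y^2}(x,y_1)|\le C_{L_k,M}|y_2-y_1|$ for a.a. $x\in\Omega$ and all $|y|,|y_1|,|y_2|\le M$. State and costs. For $w\in L^2(\Omega)$, $y_w\in H^1_0(\Omega)\cap C(\bar\Omega)$ denotes the unique weak solution of $\mathcal A y+f(x,y)=w$ in $\Omega$, $y=0$ on $\Gamma$. For $(u_1,\ldots,u_m)\in L^2(\Omega)^m$ put $u=\sum_{i=1}^mB_iu_i$ and $$J_k(u_1,\ldots,u_m)=\int_\Omega L_k(x,y_u(x))\,dx+\frac12\int_\Omega\zeta_k(x)u_k(x)^2\,dx .$$ $J_k$ is of class $C^2$ on $L^2(\Omega)^m$; $\nabla_{u_k}J_k$ is its partial gradient in $u_k$. One writes $(u_k,u_{-k})$ for $(u_1,\ldots,u_m)$, where $u_{-k}$ collects the components other than $u_k$. Admissible sets. For each $k$, $\mathcal U^k_{ad}\subset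 L^2(\Omega)$ is nonempty, convex, closed and bounded. $N(u;\Theta)$ is the normal cone of convex analysis to the convex set $\Theta$ at $u$. *)

theory Defs
  imports "HOL-Analysis.Analysis"
begin

text \<open>
  Elements of the Lebesgue and Sobolev spaces over \<open>\<Omega>\<close> are represented by functions on
  the whole of \<open>\<real>\<^sup>N\<close>. Their values outside \<open>\<Omega>\<close> are irrelevant, and every notion below
  is invariant under changes on null subsets of \<open>\<Omega>\<close>, except that continuity is asked of the
  representative itself.
\<close>

subsection \<open>Lebesgue spaces\<close>

definition Linf_fun :: "(real ^ 'n) set \<Rightarrow> (real ^ 'n \<Rightarrow> real) set" where
  "Linf_fun \<Omega> = {u. u \<in> borel_measurable (lebesgue_on \<Omega>) \<and>
                     (\<exists>C. AE x in lebesgue_on \<Omega>. \<bar>u x\<bar> \<le> C)}"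

definition L1_fun :: "(real ^ 'n) set \<Rightarrow> (real ^ 'n \<Rightarrow> real) set" where
  "L1_fun \<Omega> = {u. integrable (lebesgue_on \<Omega>) u}"

definition L2_fun :: "(real ^ 'n) set \<Rightarrow> (real ^ 'n \<Rightarrow> real) set" where
  "L2_fun \<Omega> = {u. u \<in> borel_measurable (lebesgue_on \<Omega>) \<and>
                   integrable (lebesgue_on \<Omega>) (\<lambda>x. (u x)\<^sup>2)}"

definition L2_inner :: "(real ^ 'n) set \<Rightarrow> (real ^ 'n \<Rightarrow> real) \<Rightarrow> (real ^ 'n \<Rightarrow> real) \<Rightarrow> real" where
  "L2_inner \<Omega> u v = (LINT x|lebesgue_on \<Omega>. u x * v x)"

definition L2_norm :: "(real ^ 'n) set \<Rightarrow> (real ^ 'n \<Rightarrow> real) \<Rightarrow> real" where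
  "L2_norm \<Omega> u = sqrt (L2_inner \<Omega> u u)"

definition L2_convex :: "(real ^ 'n \<Rightarrow> real) set \<Rightarrow> bool" where
  "L2_convex K \<longleftrightarrow> (\<forall>u\<in>K. \<forall>v\<in>K. \<forall>t\<in>{0..1}. (\<lambda>x. (1 - t) * u x + t * v x) \<in> K)"

text \<open>Sequential closedness for the seminorm; it makes \<open>K\<close> saturated under almost everywhere
  equality, so that \<open>K\<close> really stands for a closed set of equivalence classes.\<close>

definition L2_closed :: "(real ^ 'n) set \<Rightarrow> (real ^ 'n \<Rightarrow> real) set \<Rightarrow> bool" where
  "L2_closed \<Omega> K \<longleftrightarrow>
     (\<forall>u v. (\<forall>n::nat. u n \<in> K) \<longrightarrow> v \<in> L2_fun \<Omega> \<longrightarrow>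
        (\<lambda>n. L2_norm \<Omega> (\<lambda>x. u n x - v x)) \<longlonglongrightarrow> 0 \<longrightarrow> v \<in> K)"

definition L2_bounded :: "(real ^ 'n) set \<Rightarrow> (real ^ 'n \<Rightarrow> real) set \<Rightarrow> bool" where
  "L2_bounded \<Omega> K \<longleftrightarrow> (\<exists>R. \<forall>u\<in>K. L2_norm \<Omega> u \<le> R)"

definition normal_cone ::
    "(real ^ 'n) set \<Rightarrow> (real ^ 'n \<Rightarrow> real) \<Rightarrow> (real ^ 'n \<Rightarrow> real) set \<Rightarrow> (real ^ 'n \<Rightarrow> real) set" where
  "normal_cone \<Omega> u K =
     (if u \<in> K then {\<nu> \<in> L2_fun \<Omega>. \<forall>v\<in>K. L2_inner \<Omega> \<nu> (\<lambda>x. v x - u x) \<le> 0} else {})"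

text \<open>\<open>g\<close> is the Riesz representative in \<open>L\<^sup>2(\<Omega>)\<close> of the Frechet derivative at \<open>u\<close> of
  \<open>F\<close>, a functional on \<open>L\<^sup>2(\<Omega>)\<close>.\<close>

definition has_L2_gradient ::
    "(real ^ 'n) set \<Rightarrow> ((real ^ 'n \<Rightarrow> real) \<Rightarrow> real) \<Rightarrow> (real ^ 'n \<Rightarrow> real) \<Rightarrow> (real ^ 'n \<Rightarrow> real) \<Rightarrow> bool" where
  "has_L2_gradient \<Omega> F g u \<longleftrightarrow> g \<in> L2_fun \<Omega> \<and>
     (\<forall>e>0. \<exists>d>0. \<forall>h\<in>L2_fun \<Omega>. L2_norm \<Omega> h < d \<longrightarrow>
        \<bar>F (\<lambda>x. u x + h x) - F u - L2_inner \<Omega> g h\<bar> \<le> e * L2_norm \<Omega> h)"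

definition has_partial_gradient ::
    "(real ^ 'n) set \<Rightarrow> ((nat \<Rightarrow> real ^ 'n \<Rightarrow> real) \<Rightarrow> real) \<Rightarrow> nat \<Rightarrow> (real ^ 'n \<Rightarrow> real)
       \<Rightarrow> (nat \<Rightarrow> real ^ 'n \<Rightarrow> real) \<Rightarrow> bool" where
  "has_partial_gradient \<Omega> F k g u \<longleftrightarrow> has_L2_gradient \<Omega> (\<lambda>v. F (u(k := v))) g (u k)"


subsection \<open>Lipschitz domains\<close>

text \<open>Near each boundary point \<open>z\<close> the set lies strictly above the graph of a Lipschitz function
  defined on the hyperplane orthogonal to a unit vector \<open>n\<close>, heights being measured along \<open>n\<close>.
  In dimension one that hyperplane is trivial.\<close>

definition lipschitz_boundary :: "(real ^ 'n) set \<Rightarrow> bool" where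
  "lipschitz_boundary \<Omega> \<longleftrightarrow>
     (\<forall>z\<in>frontier \<Omega>. \<exists>n \<gamma> r C. norm n = 1 \<and> r > 0 \<and> C-lipschitz_on {v. n \<bullet> v = 0} \<gamma> \<and>
        \<Omega> \<inter> ball z r =
          {x \<in> ball z r. n \<bullet> (x - z) > (\<gamma> :: real ^ 'n \<Rightarrow> real) ((x - z) - (n \<bullet> (x - z)) *\<^sub>R n)})"


subsection \<open>Sobolev spaces\<close>

definition partial_deriv :: "'n \<Rightarrow> (real ^ 'n \<Rightarrow> real) \<Rightarrow> real ^ 'n \<Rightarrow> real" where
  "partial_deriv i \<phi> x = frechet_derivative \<phi> (at x) (axis i 1)"

fun Ck_fun :: "nat \<Rightarrow> (real ^ 'n \<Rightarrow> real) \<Rightarrow> bool" where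
  "Ck_fun 0 \<phi> \<longleftrightarrow> continuous_on UNIV \<phi>"
| "Ck_fun (Suc k) \<phi> \<longleftrightarrow> \<phi> differentiable_on UNIV \<and> (\<forall>i. Ck_fun k (partial_deriv i \<phi>))"

definition test_fun :: "(real ^ 'n) set \<Rightarrow> (real ^ 'n \<Rightarrow> real) set" where
  "test_fun \<Omega> = {\<phi>. (\<forall>k. Ck_fun k \<phi>) \<and>
                     compact (closure {x. \<phi> x \<noteq> 0}) \<and> closure {x. \<phi> x \<noteq> 0} \<subseteq> \<Omega>}"

definition is_weak_gradient ::
    "(real ^ 'n) set \<Rightarrow> (real ^ 'n \<Rightarrow> real) \<Rightarrow> (real ^ 'n \<Rightarrow> real ^ 'n) \<Rightarrow> bool" where
  "is_weak_gradient \<Omega> y G \<longleftrightarrow>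
     (\<forall>i. (\<lambda>x. G x $ i) \<in> L2_fun \<Omega> \<and>
        (\<forall>\<phi>\<in>test_fun \<Omega>. (LINT x|lebesgue_on \<Omega>. y x * partial_deriv i \<phi> x)
                          = - (LINT x|lebesgue_on \<Omega>. G x $ i * \<phi> x)))"

definition H1_fun :: "(real ^ 'n) set \<Rightarrow> (real ^ 'n \<Rightarrow> real) set" where
  "H1_fun \<Omega> = {y \<in> L2_fun \<Omega>. \<exists>G. is_weak_gradient \<Omega> y G}"

text \<open>For \<open>y\<close> in \<open>H\<^sup>1(\<Omega>)\<close> the choice is unique almost everywhere in \<open>\<Omega>\<close>.\<close>

definition weak_gradient :: "(real ^ 'n) set \<Rightarrow> (real ^ 'n \<Rightarrow> real) \<Rightarrow> real ^ 'n \<Rightarrow> real ^ 'n" where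
  "weak_gradient \<Omega> y = (SOME G. is_weak_gradient \<Omega> y G)"

definition H1_norm :: "(real ^ 'n) set \<Rightarrow> (real ^ 'n \<Rightarrow> real) \<Rightarrow> real" where
  "H1_norm \<Omega> y = sqrt ((LINT x|lebesgue_on \<Omega>. (y x)\<^sup>2) +
                       (LINT x|lebesgue_on \<Omega>. (norm (weak_gradient \<Omega> y x))\<^sup>2))"

definition H10_fun :: "(real ^ 'n) set \<Rightarrow> (real ^ 'n \<Rightarrow> real) set" where
  "H10_fun \<Omega> = {y \<in> H1_fun \<Omega>. \<exists>\<phi>. (\<forall>n::nat. \<phi> n \<in> test_fun \<Omega>) \<and>
                    (\<lambda>n. H1_norm \<Omega> (\<lambda>x. \<phi> n x - y x)) \<longlonglongrightarrow> 0}"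


subsection \<open>The state equation and the cost functionals\<close>

definition is_weak_solution ::
    "(real ^ 'n) set \<Rightarrow> ('n \<Rightarrow> 'n \<Rightarrow> real ^ 'n \<Rightarrow> real) \<Rightarrow> (real ^ 'n \<Rightarrow> real \<Rightarrow> real)
       \<Rightarrow> (real ^ 'n \<Rightarrow> real) \<Rightarrow> (real ^ 'n \<Rightarrow> real) \<Rightarrow> bool" where
  "is_weak_solution \<Omega> a f w y \<longleftrightarrow>
     y \<in> H10_fun \<Omega> \<and> continuous_on (closure \<Omega>) y \<and>
     (\<forall>v\<in>H10_fun \<Omega>.
        (LINT x|lebesgue_on \<Omega>. (\<Sum>i\<in>UNIV. \<Sum>j\<in>UNIV.
            a i j x * weak_gradient \<Omega> y x $ i * weak_gradient \<Omega> v x $ j))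
        + (LINT x|lebesgue_on \<Omega>. f x (y x) * v x)
        = (LINT x|lebesgue_on \<Omega>. w x * v x))"

text \<open>The weak solution is unique as a function on \<open>closure \<Omega>\<close>; the choice only concerns the
  irrelevant values elsewhere, which is why \<open>THE\<close> would not do.\<close>

definition state ::
    "(real ^ 'n) set \<Rightarrow> ('n \<Rightarrow> 'n \<Rightarrow> real ^ 'n \<Rightarrow> real) \<Rightarrow> (real ^ 'n \<Rightarrow> real \<Rightarrow> real)
       \<Rightarrow> (real ^ 'n \<Rightarrow> real) \<Rightarrow> real ^ 'n \<Rightarrow> real" where
  "state \<Omega> a f w = (SOME y. is_weak_solution \<Omega> a f w y)"

definition cost ::
    "(real ^ 'n) set \<Rightarrow> ('n \<Rightarrow> 'n \<Rightarrow> real ^ 'n \<Rightarrow> real) \<Rightarrow> (real ^ 'n \<Rightarrow> real \<Rightarrow> real) \<Rightarrow> nat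
       \<Rightarrow> (nat \<Rightarrow> real ^ 'n \<Rightarrow> real) \<Rightarrow> (nat \<Rightarrow> real ^ 'n \<Rightarrow> real \<Rightarrow> real) \<Rightarrow> (nat \<Rightarrow> real ^ 'n \<Rightarrow> real)
       \<Rightarrow> nat \<Rightarrow> (nat \<Rightarrow> real ^ 'n \<Rightarrow> real) \<Rightarrow> real" where
  "cost \<Omega> a f m B L \<zeta> k u =
     (LINT x|lebesgue_on \<Omega>. L k x (state \<Omega> a f (\<lambda>x. \<Sum>i=1..m. B i x * u i x) x))
     + 1 / 2 * (LINT x|lebesgue_on \<Omega>. \<zeta> k x * (u k x)\<^sup>2)"


subsection \<open>Assumptions on the nonlinearities\<close>

definition caratheodory :: "(real ^ 'n) set \<Rightarrow> (real ^ 'n \<Rightarrow> real \<Rightarrow> real) \<Rightarrow> bool" where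
  "caratheodory \<Omega> g \<longleftrightarrow>
     (\<forall>y. (\<lambda>x. g x y) \<in> borel_measurable (lebesgue_on \<Omega>)) \<and>
     (AE x in lebesgue_on \<Omega>. continuous_on UNIV (g x))"

definition C2_real :: "(real \<Rightarrow> real) \<Rightarrow> bool" where
  "C2_real g \<longleftrightarrow> (\<forall>t. g field_differentiable at t) \<and>
                  (\<forall>t. deriv g field_differentiable at t) \<and>
                  continuous_on UNIV (deriv (deriv g))"

definition f_assumption :: "(real ^ 'n) set \<Rightarrow> (real ^ 'n \<Rightarrow> real \<Rightarrow> real) \<Rightarrow> bool" where
  "f_assumption \<Omega> f \<longleftrightarrow>
     caratheodory \<Omega> f \<and>
     (AE x in lebesgue_on \<Omega>. C2_real (f x)) \<and>
     (\<lambda>x. f x 0) \<in> L2_fun \<Omega> \<and>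
     (AE x in lebesgue_on \<Omega>. \<forall>y. deriv (f x) y \<ge> 0) \<and>
     (\<forall>M>0. \<exists>C>0.
        (AE x in lebesgue_on \<Omega>. \<forall>y. \<bar>y\<bar> \<le> M \<longrightarrow>
            \<bar>deriv (f x) y\<bar> + \<bar>deriv (deriv (f x)) y\<bar> \<le> C) \<and>
        (AE x in lebesgue_on \<Omega>. \<forall>y1 y2. \<bar>y1\<bar> \<le> M \<longrightarrow> \<bar>y2\<bar> \<le> M \<longrightarrow>
            \<bar>deriv (deriv (f x)) y2 - deriv (deriv (f x)) y1\<bar> \<le> C * \<bar>y2 - y1\<bar>))"

definition L_assumption :: "(real ^ 'n) set \<Rightarrow> (real ^ 'n \<Rightarrow> real \<Rightarrow> real) \<Rightarrow> bool" where
  "L_assumption \<Omega> l \<longleftrightarrow>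
     caratheodory \<Omega> l \<and>
     (AE x in lebesgue_on \<Omega>. C2_real (l x)) \<and>
     (\<lambda>x. l x 0) \<in> L1_fun \<Omega> \<and>
     (\<forall>M>0. \<exists>C>0. \<exists>\<psi>\<in>L2_fun \<Omega>.
        (AE x in lebesgue_on \<Omega>. \<forall>y. \<bar>y\<bar> \<le> M \<longrightarrow>
            \<bar>deriv (l x) y\<bar> \<le> \<psi> x \<and> \<bar>deriv (deriv (l x)) y\<bar> \<le> C) \<and>
        (AE x in lebesgue_on \<Omega>. \<forall>y1 y2. \<bar>y1\<bar> \<le> M \<longrightarrow> \<bar>y2\<bar> \<le> M \<longrightarrow>
            \<bar>deriv (deriv (l x)) y2 - deriv (deriv (l x)) y1\<bar> \<le> C * \<bar>y2 - y1\<bar>))"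


subsection \<open>Variational Nash equilibria\<close>

text \<open>The inclusion is that of the zero function in the Minkowski sum of the partial gradient and the
  normal cone. The pointwise equation loses nothing, since the normal cone is saturated under almost
  everywhere equality.\<close>

definition variational_nash ::
    "(real ^ 'n) set \<Rightarrow> nat \<Rightarrow> (nat \<Rightarrow> (nat \<Rightarrow> real ^ 'n \<Rightarrow> real) \<Rightarrow> real)
       \<Rightarrow> (nat \<Rightarrow> (real ^ 'n \<Rightarrow> real) set) \<Rightarrow> (nat \<Rightarrow> real ^ 'n \<Rightarrow> real) \<Rightarrow> bool" where
  "variational_nash \<Omega> m J U u \<longleftrightarrow>
     (\<forall>k\<in>{1..m}. u k \<in> U k) \<and>
     (\<forall>k\<in>{1..m}. \<exists>g. has_partial_gradient \<Omega> (J k) k g u \<and>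
        (\<lambda>x. 0) \<in> {(\<lambda>x. g x + \<nu> x) | \<nu>. \<nu> \<in> normal_cone \<Omega> (u k) (U k)})"

end

theory Submission
  imports Defs
begin

text \<open>
  By the adjoint calculus the partial gradient of \<open>J\<^sub>k\<close> at \<open>u\<close> is \<open>B\<^sub>k \<phi>\<^sub>k + \<zeta>\<^sub>k u\<^sub>k\<close>, where
  \<open>\<phi>\<^sub>k\<close> solves the adjoint equation at the state \<open>y\<^sub>u\<close>. So \<open>u\<close> is an equilibrium iff each \<open>u\<^sub>k\<close>
  solves a strongly monotone variational inequality with datum \<open>B\<^sub>k \<phi>\<^sub>k\<close>, whose solution depends
  in a Lipschitz way on \<open>\<phi>\<^sub>k\<close>. Equilibria therefore correspond to fixed points of the map
  \<open>y \<mapsto> (\<phi>\<^sub>k)\<^sub>k \<mapsto> (u\<^sub>k)\<^sub>k \<mapsto> y\<^sub>u\<close>, which is Lipschitz on \<open>L\<^sup>2\<close> once \<open>y\<close> is truncated at a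
  common bound of all admissible states. Its range is bounded in \<open>H\<^sub>0\<^sup>1\<close> and in \<open>L\<^sup>\<infinity>\<close>, hence
  totally bounded in \<open>L\<^sup>2\<close>, and Schauder's theorem applies. The uniform bound is Stampacchia's
  (it uses \<open>N \<le> 3\<close>), and the states are continuous up to the boundary by De Giorgi's oscillation
  estimate, the Lipschitz boundary providing exterior density.
\<close>

subsection \<open>Projections and variational inequalities in Hilbert spaces\<close>

text \<open>\<open>J\<^sub>k\<close> need not be convex in \<open>u\<^sub>k\<close>, so genuine best
  responses may be neither unique nor form a convex set. The first-order inequality with the adjoint
  state frozen is strongly monotone because \<open>\<zeta>\<^sub>k\<close> is bounded below, hence
  uniquely solvable. The assumptions on the nonlinearities are local in \<open>y\<close>; clipping
  the argument makes all maps globally Lipschitz and is harmless, since the a priori bound of a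
  state rests on monotonicity and on the value at \<open>y = 0\<close>, neither of which clipping
  affects. Functions on the domain are extended by zero, so \<open>H\<^sub>0\<^sup>1\<close> becomes
  a closed subspace of a product of \<open>L\<^sup>2\<close> spaces and inequalities are closed
  conditions, checked on test functions by averaging over translations. The role of Sobolev's
  embedding is taken by a Faber-Krahn inequality with a free length scale \<open>r\<close>, valid
  once the support has at most half the volume of a ball of radius \<open>r\<close>; fitting
  \<open>r\<close> to shrinking superlevel sets drives both Stampacchia's and De Giorgi's
  iterations. Continuity up to the boundary is indispensable: only a continuous weak solution counts
  as a state.\<close>

lemma parallelogram_midpoint:
 fixes x p q :: "'a::real_inner"
 shows "(norm (p - q))\<^sup>2 = 2 * (norm (x - p))\<^sup>2 + 2 * (norm (x - q))\<^sup>2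
     - 4 * (norm (x - ((1/2) *\<^sub>R p + (1/2) *\<^sub>R q)))\<^sup>2"
 by (simp add: power2_norm_eq_inner inner_simps inner_commute algebra_simps)

text \<open>A minimising sequence is Cauchy: midpoints stay in \<open>S\<close>, cannot come closer
  than \<open>d\<close>, and the parallelogram identity turns this into a bound on
  \<open>s m - s n\<close>. The conclusion is an obtuse angle condition, the form from which
  nonexpansiveness of the projection follows.\<close>

lemma hilbert_projection_exists:
 fixes S :: "'a::{real_inner,complete_space} set"
 assumes S: "closed S" "convex S" "S \<noteq> {}"
 shows "\<exists>p\<in>S. \<forall>y\<in>S. (x - p) \<bullet> (y - p) <= 0"
proof -
 define d where "d = infdist x S"
 have d0: "d \<ge> 0" by (simp add: d_def infdist_nonneg)
 have dle: "d <= norm (x - y)" if "y \<in> S" for y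
  using infdist_le[OF that, of x] by (simp add: d_def dist_norm)
 have "\<exists>y\<in>S. norm (x - y) < d + 1 / real (Suc n)" for n
 proof -
  have "infdist x S < d + 1 / real (Suc n)" by (simp add: d_def)
  then have "(INF y\<in>S. dist x y) < d + 1 / real (Suc n)" using S(3) by (simp add: infdist_notempty)
  then show ?thesis
   using S(3) by (subst (asm) cInf_less_iff) (auto simp: dist_norm bdd_below_def intro!: exI[of _ "0::real"])
 qed
 then obtain s where s: "\<And>n. s n \<in> S" "\<And>n. norm (x - s n) < d + 1 / real (Suc n)" by metis
 have key: "(norm (s m - s n))\<^sup>2 <= (8 * d + 4) / real (Suc N)" if "m \<ge> N" "n \<ge> N" for m n N
 proof -
  define e where "e = 1 / real (Suc N)"
  have e: "0 < e" "e <= 1" by (auto simp: e_def)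
  have b: "norm (x - s k) <= d + e" if "k \<ge> N" for k
   using s(2)[of k] frac_le[of 1 1 "real (Suc N)" "real (Suc k)"] that by (simp add: e_def)
  have sq: "(norm (x - s k))\<^sup>2 <= (d + e)\<^sup>2" if "k \<ge> N" for k using b[OF that] by (intro power_mono) auto
  have "(1/2) *\<^sub>R s m + (1/2) *\<^sub>R s n \<in> S" using S(2) s(1) by (intro convexD) auto
  then have "d\<^sup>2 <= (norm (x - ((1/2) *\<^sub>R s m + (1/2) *\<^sub>R s n)))\<^sup>2" using dle d0 by (intro power_mono) auto
  then have "(norm (s m - s n))\<^sup>2 <= 4 * (d + e)\<^sup>2 - 4 * d\<^sup>2"
   using parallelogram_midpoint[of "s m" "s n" x] sq[OF that(1)] sq[OF that(2)] by linarith
  also have "\<dots> = e * (8 * d + 4 * e)" by (simp add: power2_eq_square algebra_simps)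
  also have "\<dots> <= e * (8 * d + 4)" using e by (intro mult_left_mono) auto
  finally show ?thesis by (simp add: e_def)
 qed
 have "Cauchy s"
 proof (rule metric_CauchyI)
  fix e :: real assume e: "0 < e"
  obtain N where "(8 * d + 4) / e\<^sup>2 < real N" using reals_Archimedean2 by blast
  then have N: "(8 * d + 4) / e\<^sup>2 < real (Suc N)" by simp
  then have N': "(8 * d + 4) / real (Suc N) < e\<^sup>2" using e by (simp add: field_simps)
  show "\<exists>M. \<forall>m\<ge>M. \<forall>n\<ge>M. dist (s m) (s n) < e"
  proof (intro exI allI impI)
   fix m n assume "m \<ge> N" "n \<ge> N"
   then have "(norm (s m - s n))\<^sup>2 < e\<^sup>2" using key N' by fastforce
   then show "dist (s m) (s n) < e" using e by (simp add: dist_norm power2_less_imp_less)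
  qed
 qed
 then obtain p where p: "s \<longlonglongrightarrow> p" using Cauchy_convergent_iff convergent_def by blast
 have pS: "p \<in> S" using closed_sequentially[OF S(1) s(1) p] .
 have "(\<lambda>n. norm (x - s n)) \<longlonglongrightarrow> norm (x - p)" by (intro tendsto_intros p)
 moreover have "(\<lambda>n. d + 1 / real (Suc n)) \<longlonglongrightarrow> d + 0"
  by (rule tendsto_add[OF tendsto_const LIMSEQ_Suc[OF lim_1_over_n]])
 ultimately have pd: "norm (x - p) <= d"
  using LIMSEQ_le[of "\<lambda>n. norm (x - s n)" _ "\<lambda>n. d + 1 / real (Suc n)"] s(2) by (simp add: less_imp_le)
 show ?thesis
 proof (intro bexI ballI)
  fix y assume y: "y \<in> S"
  show "(x - p) \<bullet> (y - p) <= 0"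
  proof (rule ccontr)
   assume c: "\<not> ?thesis"
   define c where "c = (x - p) \<bullet> (y - p)"
   define q where "q = (norm (y - p))\<^sup>2"
   have c0: "c > 0" using c by (simp add: c_def)
   have q0: "q > 0" using c0 by (auto simp: q_def c_def)
   \<comment> \<open>\<open>c / q\<close> minimises \<open>- 2 * t * c + t * (t * q)\<close>, the
     change of the squared distance along the segment towards \<open>y\<close>; the cap at 1 keeps
     the point on the segment.\<close>
   define t where "t = min 1 (c / q)"
   have t: "0 < t" "t <= 1" "t * q <= c" using c0 q0 by (auto simp: t_def min_def field_simps)
   have "(1 - t) *\<^sub>R p + t *\<^sub>R y \<in> S" using S(2) pS y t by (intro convexD) auto
   then have "d <= norm (x - ((1 - t) *\<^sub>R p + t *\<^sub>R y))" by (rule dle)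
   then have "(norm (x - p))\<^sup>2 <= (norm (x - ((1 - t) *\<^sub>R p + t *\<^sub>R y)))\<^sup>2"
    using pd by (intro power_mono) auto
   also have "x - ((1 - t) *\<^sub>R p + t *\<^sub>R y) = (x - p) - t *\<^sub>R (y - p)" by (simp add: algebra_simps)
   also have "(norm \<dots>)\<^sup>2 = (norm (x - p))\<^sup>2 - 2 * t * c + t * (t * q)"
    unfolding c_def q_def power2_norm_eq_inner by (simp add: inner_simps inner_commute algebra_simps)
   finally have "2 * t * c <= t * (t * q)" by simp
   moreover have "t * (t * q) <= t * c" using t by (intro mult_left_mono) auto
   ultimately show False using t c0 by (simp add: algebra_simps)
  qed
 qed (rule pS)
qed

text \<open>Lions--Stampacchia: a variational inequality is a fixed point equation for the projected
 gradient step, which contracts for a small step size.\<close>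

lemma variational_ineq_exists:
 fixes S :: "'a::{real_inner,complete_space} set" and b :: "'a => 'a"
 assumes S: "closed S" "convex S" "S \<noteq> {}"
  and c: "c > 0" and mono: "\<And>u v. u \<in> S ==> v \<in> S ==> c * (norm (u - v))\<^sup>2 <= (b u - b v) \<bullet> (u - v)"
  and lip: "\<And>u v. u \<in> S ==> v \<in> S ==> norm (b u - b v) <= l * norm (u - v)"
 shows "\<exists>u\<in>S. \<forall>v\<in>S. b u \<bullet> (v - u) \<ge> 0"
proof -
 define P where "P x = (SOME p. p \<in> S \<and> (\<forall>y\<in>S. (x - p) \<bullet> (y - p) <= 0))" for x
 have P: "P x \<in> S \<and> (\<forall>y\<in>S. (x - P x) \<bullet> (y - P x) <= 0)" for x
  unfolding P_def by (rule someI_ex) (use hilbert_projection_exists[OF S, of x] in blast)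
 have nonexp: "norm (P x - P y) <= norm (x - y)" for x y
 proof -
  have "(x - P x) \<bullet> (P y - P x) <= 0" "(y - P y) \<bullet> (P x - P y) <= 0" using P by auto
  then have "(norm (P x - P y))\<^sup>2 <= (x - y) \<bullet> (P x - P y)"
   by (simp add: power2_norm_eq_inner inner_simps inner_commute algebra_simps)
  also have "\<dots> <= norm (x - y) * norm (P x - P y)" by (rule norm_cauchy_schwarz)
  finally show ?thesis by (cases "norm (P x - P y) = 0") (auto simp: power2_eq_square)
 qed
 define l' where "l' = max l c"
 have l': "l' > 0" "l <= l'" "c <= l'" using c by (auto simp: l'_def)
 have lip': "norm (b u - b v) <= l' * norm (u - v)" if "u \<in> S" "v \<in> S" for u v
  using lip[OF that] l'(2) mult_right_mono[of l l' "norm (u - v)"] by (meson norm_ge_zero order_trans)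
 \<comment> \<open>This step size minimises
   \<open>1 - 2 * \<rho> * c + \<rho>\<^sup>2 * l'\<^sup>2\<close>, the squared contraction factor.
   Enlarging \<open>l\<close> to \<open>l'\<close>, at least \<open>c\<close>, keeps the minimum
   \<open>1 - c\<^sup>2 / l'\<^sup>2\<close> nonnegative.\<close>
 define \<rho> where "\<rho> = c / l'\<^sup>2"
 have \<rho>: "\<rho> > 0" using c l' by (simp add: \<rho>_def)
 define \<kappa> where "\<kappa> = sqrt (1 - c\<^sup>2 / l'\<^sup>2)"
 have r1: "c\<^sup>2 / l'\<^sup>2 <= 1" "c\<^sup>2 / l'\<^sup>2 > 0" using c l' by (auto simp: power_mono)
 have \<kappa>: "0 <= \<kappa>" "\<kappa> < 1" using r1 by (auto simp: \<kappa>_def)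
 define T where "T u = P (u - \<rho> *\<^sub>R b u)" for u
 have contr: "dist (T u) (T v) <= \<kappa> * dist u v" if "u \<in> S" "v \<in> S" for u v
 proof -
  have "(norm ((u - \<rho> *\<^sub>R b u) - (v - \<rho> *\<^sub>R b v)))\<^sup>2
    = (norm (u - v))\<^sup>2 - 2 * \<rho> * ((b u - b v) \<bullet> (u - v)) + \<rho>\<^sup>2 * (norm (b u - b v))\<^sup>2"
   unfolding power2_norm_eq_inner by (simp add: inner_simps inner_commute algebra_simps power2_eq_square)
  also have "\<dots> <= (norm (u - v))\<^sup>2 - 2 * \<rho> * (c * (norm (u - v))\<^sup>2) + \<rho>\<^sup>2 * (l' * norm (u - v))\<^sup>2"
   using mono[OF that] lip'[OF that] \<rho> by (intro add_mono diff_mono mult_left_mono power_mono) auto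
  also have "\<dots> = (\<kappa> * norm (u - v))\<^sup>2"
  proof -
   have "\<kappa>\<^sup>2 = 1 - c\<^sup>2 / l'\<^sup>2" using r1 by (simp add: \<kappa>_def)
   moreover have "1 - 2 * \<rho> * c + \<rho>\<^sup>2 * l'\<^sup>2 = 1 - c\<^sup>2 / l'\<^sup>2"
    using l' by (simp add: \<rho>_def field_simps power2_eq_square)
   moreover have "(norm (u - v))\<^sup>2 - 2 * \<rho> * (c * (norm (u - v))\<^sup>2) + \<rho>\<^sup>2 * (l' * norm (u - v))\<^sup>2
     = (1 - 2 * \<rho> * c + \<rho>\<^sup>2 * l'\<^sup>2) * (norm (u - v))\<^sup>2" by (simp add: algebra_simps power_mult_distrib)
   ultimately show ?thesis by (simp add: power_mult_distrib)
  qed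
  finally have "norm ((u - \<rho> *\<^sub>R b u) - (v - \<rho> *\<^sub>R b v)) <= \<kappa> * norm (u - v)"
   using \<kappa> by (auto intro: power2_le_imp_le)
  then show ?thesis unfolding T_def dist_norm using nonexp order_trans by blast
 qed
 have "\<exists>!u\<in>S. T u = u"
  using contr \<kappa> S P by (intro Banach_fix[where c = \<kappa>]) (auto simp: T_def complete_eq_closed)
 then obtain u where u: "u \<in> S" "T u = u" by blast
 have "b u \<bullet> (v - u) \<ge> 0" if v: "v \<in> S" for v
 proof -
  have "((u - \<rho> *\<^sub>R b u) - u) \<bullet> (v - u) <= 0" using P[of "u - \<rho> *\<^sub>R b u"] v u(2) unfolding T_def by auto
  then have "- \<rho> * (b u \<bullet> (v - u)) <= 0" by (simp add: inner_simps algebra_simps)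
  then show ?thesis using \<rho> by (simp add: zero_le_mult_iff)
 qed
 with u(1) show ?thesis by blast
qed

text \<open>Testing with \<open>u + v\<close> and \<open>u - v\<close> turns an inequality over a
  subspace into an equation; this is how weak equations are obtained from
  \<open>variational_ineq_exists\<close>.\<close>

lemma variational_eq_on_subspace:
 fixes b :: "'a::real_inner"
 assumes "subspace S" "u \<in> S" "\<And>v. v \<in> S ==> b \<bullet> (v - u) \<ge> 0" "v \<in> S"
 shows "b \<bullet> v = 0"
proof -
 have "u + v \<in> S" "u - v \<in> S" using assms by (auto intro: subspace_add subspace_diff)
 from assms(3)[OF this(1)] assms(3)[OF this(2)] show ?thesis by (simp add: inner_simps)
qed

subsection \<open>The Hilbert space of square integrable functions\<close>

definition sqint :: "('a::euclidean_space => real) => bool" where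
 "sqint f \<longleftrightarrow> f \<in> borel_measurable lebesgue \<and> integrable lebesgue (\<lambda>x. (f x)\<^sup>2)"

lemma sqint_meas [measurable_dest]: "sqint f ==> f \<in> borel_measurable lebesgue"
 by (simp add: sqint_def)

lemma sqint_integrable_sq: "sqint f ==> integrable lebesgue (\<lambda>x. (f x)\<^sup>2)"
 by (simp add: sqint_def)

lemma sqint_mult: 
 assumes "sqint f" "sqint g" 
 shows "integrable lebesgue (\<lambda>x. f x * g x)"
proof (rule Bochner_Integration.integrable_bound)
 show "integrable lebesgue (\<lambda>x. (f x)\<^sup>2 + (g x)\<^sup>2)" using assms by (simp add: sqint_def)
 show "(\<lambda>x. f x * g x) \<in> borel_measurable lebesgue" using assms by measurable
 have "\<bar>a * b\<bar> <= a\<^sup>2 + b\<^sup>2" for a b :: real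
  using sum_squares_bound[of "\<bar>a\<bar>" "\<bar>b\<bar>"] mult_nonneg_nonneg[of "\<bar>a\<bar>" "\<bar>b\<bar>"]
  unfolding abs_mult power2_abs by linarith
 then show "AE x in lebesgue. norm (f x * g x) <= norm ((f x)\<^sup>2 + (g x)\<^sup>2)" by simp
qed

lemma sqint_mono_AE:
 assumes "f \<in> borel_measurable lebesgue" "sqint g" "AE x in lebesgue. \<bar>f x\<bar> <= \<bar>g x\<bar>"
 shows "sqint f"
 unfolding sqint_def
proof
 show "integrable lebesgue (\<lambda>x. (f x)\<^sup>2)"
 proof (rule Bochner_Integration.integrable_bound[OF sqint_integrable_sq[OF assms(2)]])
  show "AE x in lebesgue. norm ((f x)\<^sup>2) <= norm ((g x)\<^sup>2)"
   using assms(3) by eventually_elim (simp add: abs_le_square_iff)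
 qed (use assms in measurable)
qed (rule assms(1))

lemma sqint_scale: "sqint f ==> sqint (\<lambda>x. c * f x)"
 unfolding sqint_def power_mult_distrib by auto

lemma sqint_add: 
 assumes "sqint f" "sqint g" shows "sqint (\<lambda>x. f x + g x)" unfolding sqint_def power2_sum
 using assms sqint_mult[OF assms] by (auto simp: sqint_def mult.assoc)

lemma sqint_uminus: "sqint f ==> sqint (\<lambda>x. - f x)"
 using sqint_scale[of f "-1"] by simp

lemma sqint_diff: "sqint f ==> sqint g ==> sqint (\<lambda>x. f x - g x)"
 using sqint_add[of f "\<lambda>x. - g x"] sqint_uminus[of g] by simp

lemma sqint_zero [simp]: "sqint (\<lambda>x. 0)"
 by (simp add: sqint_def)

lemma sqint_abs: "sqint f ==> sqint (\<lambda>x. \<bar>f x\<bar>)"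
 unfolding sqint_def power2_abs by auto

lemma sqint_sum: "(\<And>i. i \<in> I ==> sqint (f i)) ==> sqint (\<lambda>x. \<Sum>i\<in>I. f i x)"
 by (induction I rule: infinite_finite_induct) (auto intro: sqint_add)

lemma sqint_bounded_mult:
 assumes "c \<in> borel_measurable lebesgue" "\<And>x. \<bar>c x\<bar> <= C" "sqint f"
 shows "sqint (\<lambda>x. c x * f x)"
proof (rule sqint_mono_AE)
 show "sqint (\<lambda>x. C * f x)" using assms by (intro sqint_scale)
 show "AE x in lebesgue. \<bar>c x * f x\<bar> <= \<bar>C * f x\<bar>"
  using assms(2) abs_ge_self[of C] by (intro AE_I2) (auto simp: abs_mult intro!: mult_right_mono intro: order_trans)
qed (use assms in measurable)

lemma sqint_AE_cong:
 assumes "sqint f" "AE x in lebesgue. f x = g x" shows "sqint g"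
proof -
 have m: "g \<in> borel_measurable lebesgue" using borel_measurable_AE[OF sqint_meas[OF assms(1)] assms(2)] .
 show ?thesis by (rule sqint_mono_AE[OF m assms(1)]) (use assms(2) in auto)
qed

\<comment> \<open>The partial relation selects the square integrable functions and identifies them
  almost everywhere in one stroke. One type over the whole space serves every domain, whose
  functions are extended by zero.\<close>
quotient_type (overloaded) 'a L2 = "'a::euclidean_space => real" /
 partial: "\<lambda>f g. sqint f \<and> sqint g \<and> (AE x in lebesgue. f x = g x)"
proof (rule part_equivpI)
 show "\<exists>f::'a => real. sqint f \<and> sqint f \<and> (AE x in lebesgue. f x = f x)" by (rule exI[of _ "\<lambda>_. 0"]) simp
 show "symp (\<lambda>f g::'a => real. sqint f \<and> sqint g \<and> (AE x in lebesgue. f x = g x))" by (rule sympI) auto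
 show "transp (\<lambda>f g::'a => real. sqint f \<and> sqint g \<and> (AE x in lebesgue. f x = g x))"
 proof (rule transpI)
  fix f g h :: "'a => real"
  assume a: "sqint f \<and> sqint g \<and> (AE x in lebesgue. f x = g x)"
   "sqint g \<and> sqint h \<and> (AE x in lebesgue. g x = h x)"
  then have "AE x in lebesgue. f x = g x" "AE x in lebesgue. g x = h x" by auto
  then have "AE x in lebesgue. f x = h x" by eventually_elim auto
  with a show "sqint f \<and> sqint h \<and> (AE x in lebesgue. f x = h x)" by auto
 qed
qed

instantiation L2 :: (euclidean_space) real_inner
begin

lift_definition zero_L2 :: "'a L2" is "\<lambda>x. 0" by simp
lift_definition plus_L2 :: "'a L2 => 'a L2 => 'a L2" is "\<lambda>f g x. f x + g x" by (auto intro: sqint_add)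
lift_definition minus_L2 :: "'a L2 => 'a L2 => 'a L2" is "\<lambda>f g x. f x - g x" by (auto intro: sqint_diff)
lift_definition uminus_L2 :: "'a L2 => 'a L2" is "\<lambda>f x. - f x" by (auto intro: sqint_uminus)
lift_definition scaleR_L2 :: "real => 'a L2 => 'a L2" is "\<lambda>c f x. c * f x" by (auto intro: sqint_scale)
lift_definition inner_L2 :: "'a L2 => 'a L2 => real" is "\<lambda>f g. LINT x|lebesgue. f x * g x"
proof -
 fix f g h k :: "'a => real"
 assume a: "sqint f \<and> sqint g \<and> (AE x in lebesgue. f x = g x)"
  "sqint h \<and> sqint k \<and> (AE x in lebesgue. h x = k x)"
 then have "AE x in lebesgue. f x = g x" "AE x in lebesgue. h x = k x" by auto
 then have "AE x in lebesgue. f x * h x = g x * k x" by eventually_elim simp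
 with a show "(LINT x|lebesgue. f x * h x) = (LINT x|lebesgue. g x * k x)"
  by (intro integral_cong_AE) (auto simp: sqint_def)
qed

definition norm_L2 :: "'a L2 => real" where "norm_L2 u = sqrt (inner u u)"
definition dist_L2 :: "'a L2 => 'a L2 => real" where "dist_L2 u v = norm (u - v)"
definition sgn_L2 :: "'a L2 => 'a L2" where "sgn_L2 u = inverse (norm u) *\<^sub>R u"
definition uniformity_L2 :: "('a L2 \<times> 'a L2) filter" where
 "uniformity_L2 = (INF e\<in>{0 <..}. principal {(x, y). dist x y < e})"
definition open_L2 :: "'a L2 set => bool" where
 "open_L2 S \<longleftrightarrow> (\<forall>x\<in>S. \<forall>\<^sub>F (x', y) in uniformity. x' = x --> y \<in> S)"

instance
proof
 fix u v w :: "'a L2" and c d :: real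
 show "u + v + w = u + (v + w)" by transfer (auto simp: add.assoc intro!: sqint_add)
 show "u + v = v + u" by transfer (auto simp: add.commute intro!: sqint_add)
 show "0 + u = u" by transfer simp
 show "- u + u = 0" by transfer simp
 show "u - v = u + - v" by transfer (auto intro: sqint_add sqint_diff sqint_uminus)
 show "c *\<^sub>R (u + v) = c *\<^sub>R u + c *\<^sub>R v"
  by transfer (auto simp: distrib_left intro!: sqint_add sqint_scale)
 show "(c + d) *\<^sub>R u = c *\<^sub>R u + d *\<^sub>R u"
  by transfer (auto simp: distrib_right intro!: sqint_add sqint_scale)
 show "c *\<^sub>R d *\<^sub>R u = (c * d) *\<^sub>R u" by transfer (auto simp: mult.assoc intro!: sqint_scale)
 show "1 *\<^sub>R u = u" by transfer simp
 show "u \<bullet> v = v \<bullet> u" by transfer (simp add: mult.commute)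
 show "(u + v) \<bullet> w = u \<bullet> w + v \<bullet> w" by transfer (auto simp: distrib_right sqint_mult)
 show "(c *\<^sub>R u) \<bullet> v = c * (u \<bullet> v)" by transfer (simp add: mult.assoc)
 show "0 <= u \<bullet> u" by transfer simp
 show "(u \<bullet> u = 0) = (u = 0)"
 proof (transfer)
  fix u :: "'a => real"
  assume "sqint u \<and> sqint u \<and> (AE x in lebesgue. u x = u x)"
  then show "((LINT x|lebesgue. u x * u x) = 0) = (sqint u \<and> sqint (\<lambda>x. 0::real) \<and> (AE x in lebesgue. u x = 0))"
   using integral_nonneg_eq_0_iff_AE[of lebesgue "\<lambda>x. u x * u x"] sqint_mult[of u u] by simp
 qed
qed (auto simp: norm_L2_def dist_L2_def sgn_L2_def uniformity_L2_def open_L2_def)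

end

abbreviation cls :: "('a::euclidean_space => real) => 'a L2" where "cls \<equiv> abs_L2"

text \<open>A representative fixed once for each class. Operations act on classes, so pointwise
  formulas for \<open>fn\<close> of a difference or a product hold only almost everywhere.\<close>

definition fn :: "'a::euclidean_space L2 => 'a => real" where "fn = rep_L2"

lemma sqint_fn [simp]: "sqint (fn u)"
 using Quotient3_rep_reflp[OF Quotient3_L2, of u] by (simp add: fn_def)

lemma fn_meas [measurable]: "fn u \<in> borel_measurable lebesgue"
 by (rule sqint_meas) simp

lemma cls_fn [simp]: "cls (fn u) = u"
 using Quotient3_abs_rep[OF Quotient3_L2] by (simp add: fn_def)

lemma cls_eq_iff: "sqint f ==> sqint g ==> cls f = cls g \<longleftrightarrow> (AE x in lebesgue. f x = g x)"
 using Quotient3_rel[OF Quotient3_L2, of f g] by auto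

lemma cls_eqI: "sqint f ==> (AE x in lebesgue. f x = g x) ==> cls f = cls g"
 using cls_eq_iff sqint_AE_cong by blast

lemma fn_cls: "sqint f ==> AE x in lebesgue. fn (cls f) x = f x"
 using cls_eq_iff[of "fn (cls f)" f] by simp

lemma L2_eqI: "(AE x in lebesgue. fn u x = fn v x) ==> u = v"
 using cls_eq_iff[of "fn u" "fn v"] by simp

lemma cls_add: "sqint f ==> sqint g ==> cls f + cls g = cls (\<lambda>x. f x + g x)"
 by (subst plus_L2.abs_eq) (auto simp: eq_onp_def)
lemma cls_diff: "sqint f ==> sqint g ==> cls f - cls g = cls (\<lambda>x. f x - g x)"
 by (subst minus_L2.abs_eq) (auto simp: eq_onp_def)
lemma cls_scaleR: "sqint f ==> c *\<^sub>R cls f = cls (\<lambda>x. c * f x)"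
 by (subst scaleR_L2.abs_eq) (auto simp: eq_onp_def)
lemma cls_uminus: "sqint f ==> - cls f = cls (\<lambda>x. - f x)"
 by (subst uminus_L2.abs_eq) (auto simp: eq_onp_def)
lemma cls_zero: "cls (\<lambda>x. 0) = 0"
 by (simp add: zero_L2_def)

lemma fn_diff: "AE x in lebesgue. fn (u - v) x = fn u x - fn v x"
 using fn_cls[OF sqint_diff[of "fn u" "fn v"]] by (simp flip: cls_diff)
lemma fn_scaleR: "AE x in lebesgue. fn (c *\<^sub>R u) x = c * fn u x"
 using fn_cls[OF sqint_scale[of "fn u" c]] by (simp flip: cls_scaleR)
lemma fn_uminus: "AE x in lebesgue. fn (- u) x = - fn u x"
 using fn_cls[OF sqint_uminus[of "fn u"]] by (simp flip: cls_uminus)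
lemma cls_sum: "(\<And>i. i \<in> I ==> sqint (f i)) ==> (\<Sum>i\<in>I. cls (f i)) = cls (\<lambda>x. \<Sum>i\<in>I. f i x)"
 by (induction I rule: infinite_finite_induct) (auto simp: cls_zero cls_add sqint_sum)

lemma inner_cls: "sqint f ==> sqint g ==> cls f \<bullet> cls g = (LINT x|lebesgue. f x * g x)"
 by (subst inner_L2.abs_eq) (auto simp: eq_onp_def)

lemma inner_fn: "u \<bullet> v = (LINT x|lebesgue. fn u x * fn v x)"
 using inner_cls[of "fn u" "fn v"] by simp

lemma norm_sq_cls: "sqint f ==> (norm (cls f))\<^sup>2 = (LINT x|lebesgue. (f x)\<^sup>2)"
 unfolding power2_norm_eq_inner by (simp add: inner_cls power2_eq_square)

lemma norm_sq_fn: "(norm u)\<^sup>2 = (LINT x|lebesgue. (fn u x)\<^sup>2)"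
 using norm_sq_cls[of "fn u"] by simp

lemma norm_cls_mono:
 assumes "sqint f" "sqint g" "AE x in lebesgue. \<bar>f x\<bar> <= \<bar>g x\<bar>"
 shows "norm (cls f) <= norm (cls g)"
proof (rule power2_le_imp_le)
 show "(norm (cls f))\<^sup>2 <= (norm (cls g))\<^sup>2" unfolding norm_sq_cls[OF assms(1)] norm_sq_cls[OF assms(2)]
 proof (rule integral_mono_AE)
  show "AE x in lebesgue. (f x)\<^sup>2 <= (g x)\<^sup>2"
   using assms(3) by eventually_elim (simp add: abs_le_square_iff)
 qed (use assms in \<open>auto simp: sqint_def\<close>)
qed simp

lemma norm_cls_abs: "sqint f ==> norm (cls (\<lambda>x. \<bar>f x\<bar>)) = norm (cls f)"
 by (intro antisym norm_cls_mono) (auto intro: sqint_abs)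

text \<open>Norm convergence is \<open>L\<^sup>1\<close> convergence of the squared differences, for
  which an almost everywhere convergent subsequence is known.\<close>

lemma L2_AE_subseq:
 assumes "u \<longlonglongrightarrow> (l :: 'a::euclidean_space L2)"
 shows "\<exists>r. strict_mono r \<and> (AE x in lebesgue. (\<lambda>n. fn (u (r n)) x) \<longlonglongrightarrow> fn l x)"
proof -
 let ?d = "\<lambda>n x. (fn (u n) x - fn l x)\<^sup>2"
 have sd: "sqint (\<lambda>x. fn (u n) x - fn l x)" for n by (intro sqint_diff) simp_all
 have "(norm (u n - l))\<^sup>2 = (LINT x|lebesgue. ?d n x)" for n
  using norm_sq_cls[OF sd[of n]] by (simp flip: cls_diff)
 moreover have "(\<lambda>n. (norm (u n - l))\<^sup>2) \<longlonglongrightarrow> 0"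
  using tendsto_power[OF tendsto_norm[OF LIM_zero[OF assms]], of 2] by simp
 ultimately have "(\<lambda>n. LINT x|lebesgue. norm (?d n x)) \<longlonglongrightarrow> 0" by simp
 then obtain r where r: "strict_mono r" "AE x in lebesgue. (\<lambda>n. ?d (r n) x) \<longlonglongrightarrow> 0"
  using tendsto_L1_AE_subseq[of lebesgue ?d] sd by (auto simp: sqint_def)
 have "AE x in lebesgue. (\<lambda>n. fn (u (r n)) x) \<longlonglongrightarrow> fn l x" using r(2)
 proof eventually_elim
  case (elim x)
  have "(\<lambda>n. \<bar>fn (u (r n)) x - fn l x\<bar>) \<longlonglongrightarrow> 0" using tendsto_real_sqrt[OF elim] by simp
  then show ?case by (rule LIM_zero_cancel[OF tendsto_rabs_zero_cancel])
 qed
 with r(1) show ?thesis by blast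
qed

text \<open>The limit inherits the bound \<open>g\<close>, so \<open>(2 * g)\<^sup>2\<close>
  dominates the squared differences and scalar dominated convergence applies.\<close>

lemma L2_dominated_convergence:
 assumes m: "\<And>n. f n \<in> borel_measurable lebesgue" "f' \<in> borel_measurable lebesgue"
  and g: "sqint g" and le: "\<And>n. AE x in lebesgue. \<bar>f n x\<bar> <= g x"
  and lim: "AE x in lebesgue. (\<lambda>n. f n x) \<longlonglongrightarrow> f' x"
 shows "\<And>n. sqint (f n)" "sqint f'" "(\<lambda>n. cls (f n)) \<longlonglongrightarrow> cls f'"
proof -
 show s: "sqint (f n)" for n by (rule sqint_mono_AE[OF m(1) g]) (use le[of n] in \<open>eventually_elim, auto\<close>)
 have "AE x in lebesgue. \<forall>n. \<bar>f n x\<bar> <= g x" using le by (simp add: AE_all_countable)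
 then have le': "AE x in lebesgue. \<bar>f' x\<bar> <= g x" using lim
 proof eventually_elim
  case (elim x)
  then show ?case using tendsto_rabs[OF elim(2)] by (auto intro: LIMSEQ_le_const2)
 qed
 show s': "sqint f'" by (rule sqint_mono_AE[OF m(2) g]) (use le' in \<open>eventually_elim, auto\<close>)
 have "(\<lambda>n. LINT x|lebesgue. (f n x - f' x)\<^sup>2) \<longlonglongrightarrow> (LINT (x::'a)|lebesgue. (0::real))"
 proof (rule integral_dominated_convergence[where w = "\<lambda>x. (2 * g x)\<^sup>2"])
  show "integrable lebesgue (\<lambda>x. (2 * g x)\<^sup>2)" using sqint_scale[OF g, of 2] by (simp add: sqint_def)
  show "AE x in lebesgue. (\<lambda>n. (f n x - f' x)\<^sup>2) \<longlonglongrightarrow> 0" using lim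
  proof eventually_elim
   case (elim x)
   show ?case using tendsto_power[OF LIM_zero[OF elim], of 2] by simp
  qed
  show "AE x in lebesgue. norm ((f n x - f' x)\<^sup>2) <= (2 * g x)\<^sup>2" for n using le[of n] le'
  proof eventually_elim
   case (elim x)
   then have "\<bar>f n x - f' x\<bar> <= \<bar>2 * g x\<bar>" by linarith
   then show ?case by (simp add: abs_le_square_iff)
  qed
 qed (use m in measurable)
 then have "(\<lambda>n. (norm (cls (f n) - cls f'))\<^sup>2) \<longlonglongrightarrow> 0"
  using norm_sq_cls[OF sqint_diff[OF s s']] by (simp add: cls_diff s s')
 from tendsto_real_sqrt[OF this] have "(\<lambda>n. norm (cls (f n) - cls f')) \<longlonglongrightarrow> 0" by simp
 then show "(\<lambda>n. cls (f n)) \<longlonglongrightarrow> cls f'" by (rule LIM_zero_cancel[OF tendsto_norm_zero_cancel])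
qed

text \<open>Riesz-Fischer: a subsequence whose increments have norm below \<open>4\<close> to the
  power \<open>-k\<close> converges almost everywhere, and a Cauchy sequence converges with any of
  its subsequences.\<close>

instance L2 :: (euclidean_space) complete_space
proof
 fix X :: "nat => 'a L2" assume C: "Cauchy X"
 have "\<exists>N. \<forall>m\<ge>N. \<forall>n\<ge>N. norm (X m - X n) < (1/4)^k" for k :: nat
  using metric_CauchyD[OF C, of "(1/4)^k"] by (simp add: dist_norm)
 then obtain N where N: "\<And>k m n. m \<ge> N k ==> n \<ge> N k ==> norm (X m - X n) < (1/4)^k" by metis
 define r where "r k = (\<Sum>i\<le>k. N i) + k" for k
 have r: "strict_mono r" by (rule strict_mono_Suc_iff[THEN iffD2]) (simp add: r_def)
 have rN: "r k \<ge> N k" for k by (simp add: r_def member_le_sum trans_le_add1)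
 define Y where "Y k = X (r k)" for k
 define D where "D k x = fn (Y (Suc k)) x - fn (Y k) x" for k x
 have sD: "sqint (D k)" for k unfolding D_def by (intro sqint_diff) simp_all
 have Dk: "(LINT x|lebesgue. (D k x)\<^sup>2) <= (1/16)^k" for k
 proof -
  have "norm (cls (D k)) < (1/4)^k" unfolding D_def by (simp add: Y_def flip: cls_diff)
    (meson N rN lessI order_trans strict_mono_less_eq r le_SucI order_refl)
  then have "(norm (cls (D k)))\<^sup>2 <= ((1/4)^k)\<^sup>2" by (intro power_mono) auto
  also have "\<dots> = (1/16)^k" by (simp add: power2_eq_square flip: power_mult_distrib)
  finally show ?thesis by (simp add: norm_sq_cls sD)
 qed
 \<comment> \<open>The squared increments have integral at most \<open>(1/16)^k\<close>; even after
   weighting by \<open>4^k\<close> their integrals are summable. Finiteness of the weighted sum at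
   almost every \<open>x\<close> then forces \<open>D k x\<close> below \<open>(1/2)^k\<close>
   eventually.\<close>
 have mD: "(\<lambda>x. ennreal (4^k * (D k x)\<^sup>2)) \<in> borel_measurable lebesgue" for k
  by (intro measurable_compose[OF _ measurable_ennreal] borel_measurable_times
     borel_measurable_power sqint_meas sD borel_measurable_const)
 have "(\<integral>\<^sup>+x. (\<Sum>k. ennreal (4^k * (D k x)\<^sup>2)) \<partial>lebesgue) = (\<Sum>k. \<integral>\<^sup>+x. ennreal (4^k * (D k x)\<^sup>2) \<partial>lebesgue)"
  by (intro nn_integral_suminf mD)
 also have "\<dots> <= (\<Sum>k. ennreal ((1/4)^k))"
 proof (rule suminf_le)
  fix k
  have "(\<integral>\<^sup>+x. ennreal (4^k * (D k x)\<^sup>2) \<partial>lebesgue) = ennreal (LINT x|lebesgue. 4^k * (D k x)\<^sup>2)"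
   using sD[of k] by (intro nn_integral_eq_integral) (auto simp: sqint_def)
  also have "(LINT x|lebesgue. 4^k * (D k x)\<^sup>2) <= 4^k * (1/16)^k" using Dk[of k] by simp
  also have "4^k * (1/16)^k = (1/4::real)^k" by (simp flip: power_mult_distrib)
  finally show "(\<integral>\<^sup>+x. ennreal (4^k * (D k x)\<^sup>2) \<partial>lebesgue) <= ennreal ((1/4)^k)" by (simp add: ennreal_leI)
 qed auto
 also have "\<dots> = ennreal (\<Sum>k. (1/4)^k)" by (intro suminf_ennreal2) (auto intro: summable_geometric)
 also have "\<dots> < \<infinity>" by simp
 finally have "AE x in lebesgue. (\<Sum>k. ennreal (4^k * (D k x)\<^sup>2)) \<noteq> \<infinity>"
  by (intro nn_integral_PInf_AE borel_measurable_suminf_order mD) auto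
 then have "AE x in lebesgue. convergent (\<lambda>k. fn (Y k) x)"
 proof eventually_elim
  case (elim x)
  then have "summable (\<lambda>k. 4^k * (D k x)\<^sup>2)" by (intro summable_suminf_not_top) auto
  then have "(\<lambda>k. 4^k * (D k x)\<^sup>2) \<longlonglongrightarrow> 0" by (rule summable_LIMSEQ_zero)
  then obtain K where "\<forall>k\<ge>K. norm (4^k * (D k x)\<^sup>2 - 0) < 1"
   using LIMSEQ_D[of "\<lambda>k. 4^k * (D k x)\<^sup>2" 0 1] by fastforce
  then have K: "4^k * (D k x)\<^sup>2 < 1" if "k \<ge> K" for k using that by auto
  have "norm (D k x) <= (1/2)^k" if "k \<ge> K" for k
  proof -
   have "((2::real)^k)\<^sup>2 = 4^k" by (simp add: power2_eq_square flip: power_mult_distrib)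
   then have "(2^k * \<bar>D k x\<bar>)\<^sup>2 <= 1\<^sup>2" using K[OF that] by (simp add: power_mult_distrib)
   then have "2^k * \<bar>D k x\<bar> <= 1" by (rule power2_le_imp_le) simp
   then show ?thesis by (simp add: power_divide field_simps)
  qed
  then have "\<exists>K. \<forall>k\<ge>K. norm (D k x) <= (1/2)^k" by blast
  then have "summable (\<lambda>k. D k x)" by (rule summable_comparison_test) (simp add: summable_geometric)
  then have "convergent (\<lambda>n. \<Sum>k<n. D k x)" by (simp add: summable_iff_convergent)
  then have "convergent (\<lambda>n. fn (Y 0) x + (\<Sum>k<n. D k x))" by (intro convergent_add convergent_const)
  moreover have "fn (Y 0) x + (\<Sum>k<n. D k x) = fn (Y n) x" for n by (induction n) (simp_all add: D_def)
  ultimately show ?case by simp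
 qed
 then have lim: "AE x in lebesgue. (\<lambda>k. fn (Y k) x) \<longlonglongrightarrow> lim (\<lambda>k. fn (Y k) x)"
  by eventually_elim (simp add: convergent_LIMSEQ_iff)
 define F where "F x = lim (\<lambda>k. fn (Y k) x)" for x
 have mF: "F \<in> borel_measurable lebesgue" unfolding F_def by (intro borel_measurable_lim_metric) simp
 \<comment> \<open>Fatou's lemma bounds the distance of \<open>Y j\<close> to the pointwise limit,
   which both puts the limit into the space and gives norm convergence.\<close>
 have fatou: "(\<integral>\<^sup>+x. ennreal ((fn (Y j) x - F x)\<^sup>2) \<partial>lebesgue) <= ennreal (((1/4)^j)\<^sup>2)" for j
 proof -
  have "(\<integral>\<^sup>+x. ennreal ((fn (Y j) x - F x)\<^sup>2) \<partial>lebesgue)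
    = (\<integral>\<^sup>+x. liminf (\<lambda>k. ennreal ((fn (Y j) x - fn (Y k) x)\<^sup>2)) \<partial>lebesgue)"
  proof (rule nn_integral_cong_AE)
   show "AE x in lebesgue. ennreal ((fn (Y j) x - F x)\<^sup>2) = liminf (\<lambda>k. ennreal ((fn (Y j) x - fn (Y k) x)\<^sup>2))"
    using lim
   proof eventually_elim
    case (elim x)
    have "(\<lambda>k. ennreal ((fn (Y j) x - fn (Y k) x)\<^sup>2)) \<longlonglongrightarrow> ennreal ((fn (Y j) x - F x)\<^sup>2)"
     using elim unfolding F_def[symmetric] by (intro tendsto_ennrealI tendsto_intros)
    then show ?case using lim_imp_Liminf[OF sequentially_bot] by metis
   qed
  qed
  also have "\<dots> <= liminf (\<lambda>k. \<integral>\<^sup>+x. ennreal ((fn (Y j) x - fn (Y k) x)\<^sup>2) \<partial>lebesgue)"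
   by (rule nn_integral_liminf) measurable
  also have "\<dots> <= liminf (\<lambda>k::nat. ennreal (((1/4)^j)\<^sup>2))"
  proof (intro Liminf_mono eventually_sequentiallyI[of j])
   fix k assume k: "j <= k"
   have s: "sqint (\<lambda>x. fn (Y j) x - fn (Y k) x)" by (intro sqint_diff) simp_all
   have "N j <= r k" using k rN[of j] strict_mono_less_eq[OF r, of j k] by linarith
   then have "norm (Y j - Y k) <= (1/4)^j" using N[OF rN[of j]] unfolding Y_def by (simp add: less_imp_le)
   then have "(norm (Y j - Y k))\<^sup>2 <= ((1/4)^j)\<^sup>2" by (intro power_mono) auto
   moreover have "(norm (Y j - Y k))\<^sup>2 = (LINT x|lebesgue. (fn (Y j) x - fn (Y k) x)\<^sup>2)"
    using norm_sq_cls[OF s] by (simp flip: cls_diff)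
   ultimately have "(LINT x|lebesgue. (fn (Y j) x - fn (Y k) x)\<^sup>2) <= ((1/4)^j)\<^sup>2" by linarith
   moreover have "(\<integral>\<^sup>+x. ennreal ((fn (Y j) x - fn (Y k) x)\<^sup>2) \<partial>lebesgue) = ennreal (LINT x|lebesgue. (fn (Y j) x - fn (Y k) x)\<^sup>2)"
    using s by (intro nn_integral_eq_integral) (auto simp: sqint_def)
   ultimately show "(\<integral>\<^sup>+x. ennreal ((fn (Y j) x - fn (Y k) x)\<^sup>2) \<partial>lebesgue) <= ennreal (((1/4)^j)\<^sup>2)"
    by (simp add: ennreal_leI)
  qed
  also have "\<dots> = ennreal (((1/4)^j)\<^sup>2)" by (simp add: Liminf_const)
  finally show ?thesis .
 qed
 have sdiff: "sqint (\<lambda>x. fn (Y j) x - F x)" for j unfolding sqint_def using mF fatou[of j]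
  by (auto intro!: integrableI_bounded order_le_less_trans[OF fatou])
 have "sqint (\<lambda>x. fn (Y 0) x - (fn (Y 0) x - F x))" by (intro sqint_diff sdiff) simp
 then have sF: "sqint F" by simp
 have "norm (Y j - cls F) <= (1/4)^j" for j
 proof (rule power2_le_imp_le)
  have "(norm (Y j - cls F))\<^sup>2 = (LINT x|lebesgue. (fn (Y j) x - F x)\<^sup>2)"
   using norm_sq_cls[OF sdiff[of j]] sF by (simp flip: cls_diff)
  then have "ennreal ((norm (Y j - cls F))\<^sup>2) = (\<integral>\<^sup>+x. ennreal ((fn (Y j) x - F x)\<^sup>2) \<partial>lebesgue)"
   using sdiff[of j] by (subst nn_integral_eq_integral) (auto simp: sqint_def)
  then show "(norm (Y j - cls F))\<^sup>2 <= ((1/4)^j)\<^sup>2" using fatou[of j] by (metis ennreal_le_iff zero_le_power2)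
 qed simp
 then have "(\<lambda>j. norm (Y j - cls F)) \<longlonglongrightarrow> 0"
  by (intro tendsto_sandwich[OF _ _ tendsto_const LIMSEQ_realpow_zero[of "1/4"]]) auto
 then have "(X \<circ> r) \<longlonglongrightarrow> cls F" unfolding Y_def comp_def by (rule LIM_zero_cancel[OF tendsto_norm_zero_cancel])
 then show "convergent X" using Cauchy_converges_subseq[OF C r] convergent_def by blast
qed

section \<open>Multiplication operators by bounded measurable functions\<close>

definition mul :: "('a::euclidean_space => real) => 'a L2 => 'a L2" where
 "mul c u = cls (\<lambda>x. c x * fn u x)"

text \<open>The bound is asked everywhere, not almost everywhere, so that pointwise estimates need
  no exceptional set; the coefficients of the problem are altered on null sets to meet it.\<close>

definition bmeas :: "('a::euclidean_space => real) => bool" where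
 "bmeas c \<longleftrightarrow> c \<in> borel_measurable lebesgue \<and> (\<exists>C. \<forall>x. \<bar>c x\<bar> <= C)"

lemma bmeas_meas [measurable_dest]: "bmeas c ==> c \<in> borel_measurable lebesgue"
 by (simp add: bmeas_def)

lemma sqint_bmeas_mult: "bmeas c ==> sqint f ==> sqint (\<lambda>x. c x * f x)"
 unfolding bmeas_def using sqint_bounded_mult by blast

lemma bmeas_indicator: "A \<in> sets lebesgue ==> bmeas (indicator A)"
 unfolding bmeas_def by (auto intro!: exI[of _ 1] simp: indicator_def)

lemma fn_mul: "bmeas c ==> AE x in lebesgue. fn (mul c u) x = c x * fn u x"
 unfolding mul_def by (intro fn_cls sqint_bmeas_mult) auto

lemma mul_cls: "bmeas c ==> sqint f ==> mul c (cls f) = cls (\<lambda>x. c x * f x)"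
 unfolding mul_def by (intro cls_eqI sqint_bmeas_mult) (use fn_cls[of f] in auto)

lemma mul_add: "bmeas c ==> mul c (u + v) = mul c u + mul c v"
 using mul_cls[of c "\<lambda>x. fn u x + fn v x"]
 by (simp add: sqint_add cls_add sqint_bmeas_mult mul_def distrib_left flip: cls_add)

lemma mul_scaleR: "bmeas c ==> mul c (r *\<^sub>R u) = r *\<^sub>R mul c u"
 by (rule L2_eqI) (use fn_mul[of c "r *\<^sub>R u"] fn_mul[of c u] fn_scaleR[of r u] fn_scaleR[of r "mul c u"] in \<open>auto\<close>)

lemma mul_diff: "bmeas c ==> mul c (u - v) = mul c u - mul c v"
 using mul_add[of c u "- v"] mul_scaleR[of c "-1" v] by simp

lemma norm_mul_le:
 assumes "bmeas c" "\<And>x. \<bar>c x\<bar> <= C"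
 shows "norm (mul c u) <= C * norm u"
proof -
 have C: "C \<ge> 0" using assms(2)[of undefined] by linarith
 have "norm (mul c u) <= norm (cls (\<lambda>x. C * fn u x))" unfolding mul_def using assms C
  by (intro norm_cls_mono sqint_bmeas_mult sqint_scale)
   (auto simp: abs_mult intro!: mult_right_mono)
 also have "cls (\<lambda>x. C * fn u x) = C *\<^sub>R u" by (simp flip: cls_scaleR)
 finally show ?thesis using C by simp
qed

lemma mul_bounded_linear: "bmeas c ==> bounded_linear (mul c)"
proof -
 assume c: "bmeas c"
 then obtain C where "\<And>x. \<bar>c x\<bar> <= C" by (auto simp: bmeas_def)
 then show ?thesis using c
  by (intro bounded_linear_intro[of _ C]) (auto simp: mul_add mul_scaleR norm_mul_le mult.commute)
qed

lemma inner_mul: "bmeas c ==> mul c u \<bullet> v = (LINT x|lebesgue. c x * fn u x * fn v x)"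
 unfolding mul_def using inner_cls[of "\<lambda>x. c x * fn u x" "fn v"] by (simp add: sqint_bmeas_mult)

subsection \<open>Smooth functions and cutoffs\<close>

lemma partial_deriv_eqI: "(\<phi> has_derivative D) (at x) ==> partial_deriv i \<phi> x = D (axis i 1)"
 unfolding partial_deriv_def using frechet_derivative_at by metis

lemma Ck_fun_Suc_imp: "Ck_fun (Suc k) \<phi> ==> Ck_fun k \<phi>"
proof (induction k arbitrary: \<phi>)
 case 0
 then show ?case by (simp add: differentiable_imp_continuous_on)
next
 case (Suc k)
 then show ?case by (metis Ck_fun.simps(2))
qed

lemma differentiable_onD_at: "f differentiable_on UNIV ==> f differentiable (at x)"
 by (simp add: differentiable_on_def)

lemma has_derivative_frechet: "f differentiable (at x) ==> (f has_derivative frechet_derivative f (at x)) (at x)"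
 using frechet_derivative_works by blast

lemma Ck_fun_const: "Ck_fun k (\<lambda>x::real^'n. c)"
proof (induction k arbitrary: c)
 case (Suc k)
 have "partial_deriv i (\<lambda>x::real^'n. c) = (\<lambda>x. 0)" for i
  by (rule ext) (rule partial_deriv_eqI[OF has_derivative_const])
 then show ?case using Suc by (simp add: differentiable_on_const)
qed simp

lemma Ck_fun_coord: "Ck_fun k (\<lambda>x::real^'n. x $ j)"
proof (cases k)
 case (Suc l)
 have d: "((\<lambda>x::real^'n. x $ j) has_derivative (\<lambda>x. x $ j)) (at x)" for x
  by (rule bounded_linear_imp_has_derivative[OF bounded_linear_vec_nth])
 have "partial_deriv i (\<lambda>x::real^'n. x $ j) = (\<lambda>x. axis i 1 $ j)" for i
  using partial_deriv_eqI[OF d] by (intro ext) simp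
 moreover have "(\<lambda>x::real^'n. x $ j) differentiable_on UNIV"
  using d differentiable_def unfolding differentiable_on_def by blast
 ultimately show ?thesis using Suc by (simp add: Ck_fun_const)
qed (auto intro: continuous_intros)

lemma partial_deriv_add:
 assumes "f differentiable (at x)" "g differentiable (at x)"
 shows "partial_deriv i (\<lambda>x. f x + g x) x = partial_deriv i f x + partial_deriv i g x"
 using partial_deriv_eqI[OF has_derivative_add[OF has_derivative_frechet[OF assms(1)] has_derivative_frechet[OF assms(2)]]]
 by (simp add: partial_deriv_def)

lemma partial_deriv_mult:
 assumes "f differentiable (at x)" "g differentiable (at x)"
 shows "partial_deriv i (\<lambda>x. f x * g x) x = f x * partial_deriv i g x + partial_deriv i f x * g x"
 using partial_deriv_eqI[OF has_derivative_mult[OF has_derivative_frechet[OF assms(1)] has_derivative_frechet[OF assms(2)]]]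
 by (simp add: partial_deriv_def)

lemma partial_deriv_compose:
 assumes "f differentiable (at x)" "(h has_field_derivative h') (at (f x))"
 shows "partial_deriv i (\<lambda>x. h (f x)) x = h' * partial_deriv i f x"
 using partial_deriv_eqI[OF has_derivative_compose[OF has_derivative_frechet[OF assms(1)]
   assms(2)[unfolded has_field_derivative_def]]] by (simp add: partial_deriv_def)

lemma Ck_fun_add: "Ck_fun k f ==> Ck_fun k g ==> Ck_fun k (\<lambda>x. f x + g x)"
proof (induction k arbitrary: f g)
 case 0
 then show ?case by (simp add: continuous_on_add)
next
 case (Suc k)
 have "partial_deriv i (\<lambda>x. f x + g x) = (\<lambda>x. partial_deriv i f x + partial_deriv i g x)" for i
  using Suc.prems by (intro ext partial_deriv_add) (auto intro: differentiable_onD_at)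
 then show ?case using Suc by (simp add: differentiable_on_add)
qed

lemma Ck_fun_mult: "Ck_fun k f ==> Ck_fun k g ==> Ck_fun k (\<lambda>x. f x * g x)"
proof (induction k arbitrary: f g)
 case 0
 then show ?case by (simp add: continuous_on_mult)
next
 case (Suc k)
 have "partial_deriv i (\<lambda>x. f x * g x) = (\<lambda>x. f x * partial_deriv i g x + partial_deriv i f x * g x)" for i
  using Suc.prems by (intro ext partial_deriv_mult) (auto intro: differentiable_onD_at)
 moreover have "(\<lambda>x. f x * g x) differentiable_on UNIV"
  using Suc.prems by (auto simp: differentiable_on_def)
 ultimately show ?case
  using Suc.prems Suc.IH Ck_fun_Suc_imp[OF Suc.prems(1)] Ck_fun_Suc_imp[OF Suc.prems(2)]
  by (simp add: Ck_fun_add)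
qed

text \<open>The functions generated from \<open>exp (- 1 / t)\<close> by differentiation. With
  \<open>s = 1 / t\<close>, the derivative of \<open>p(s) exp(-s)\<close> is
  \<open>(p - p')(s) s^2 exp(-s)\<close>, so the family is closed; \<open>[:0, 0, 1:]\<close> stands
  for \<open>s^2\<close>.\<close>

definition flat_exp :: "real poly => real => real" where
 "flat_exp p t = (if t <= 0 then 0 else poly p (1 / t) * exp (- 1 / t))"

text \<open>The factor \<open>s ^ k\<close> generalises the induction: splitting off the constant
  coefficient of \<open>q\<close> leaves the shorter polynomial with one more power of
  \<open>s\<close>.\<close>

lemma power_poly_exp_tendsto_0: "((\<lambda>s::real. s ^ k * poly q s * exp (- s)) \<longlongrightarrow> 0) at_top"
proof (induction q arbitrary: k)
 case 0
 show ?case by simp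
next
 case (pCons a q)
 have "((\<lambda>s::real. a * (s ^ k / exp s) + s ^ Suc k * poly q s * exp (- s)) \<longlongrightarrow> a * 0 + 0) at_top"
  by (intro tendsto_add tendsto_mult tendsto_const tendsto_power_div_exp_0 pCons)
 then show ?case by (simp add: exp_minus field_simps)
qed

lemma flat_exp_tendsto_0: "(flat_exp q \<longlongrightarrow> 0) (at 0)"
proof (rule filterlim_split_at)
 have "eventually (\<lambda>t::real. t < 0) (at_left 0)" by (simp add: eventually_at_filter)
 then show "(flat_exp q \<longlongrightarrow> 0) (at_left 0)"
  by (intro tendsto_eventually) (auto simp: flat_exp_def elim!: eventually_mono)
 have "((\<lambda>t::real. poly q (inverse t) * exp (- inverse t)) \<longlongrightarrow> 0) (at_right 0)"
  using filterlim_compose[OF power_poly_exp_tendsto_0[of 0 q] filterlim_inverse_at_top_right] by simp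
 moreover have "eventually (\<lambda>t::real. t > 0) (at_right 0)" by (simp add: eventually_at_filter)
 then have "eventually (\<lambda>t. poly q (inverse t) * exp (- inverse t) = flat_exp q t) (at_right 0)"
  by eventually_elim (simp add: flat_exp_def inverse_eq_divide)
 ultimately show "(flat_exp q \<longlongrightarrow> 0) (at_right 0)" by (rule Lim_transform_eventually)
qed

lemma flat_exp_deriv:
 "(flat_exp p has_field_derivative flat_exp ((p - pderiv p) * [:0, 0, 1:]) t) (at t)"
proof -
 consider "t < 0" | "t = 0" | "t > 0" by linarith
 then show ?thesis
 proof cases
  case 1
  have "((\<lambda>_. 0) has_field_derivative 0) (at t)" by simp
  then have "(flat_exp p has_field_derivative 0) (at t)"
   by (rule has_field_derivative_transform_within_open[where S = "{..<0}"])
    (use 1 in \<open>auto simp: flat_exp_def\<close>)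
  then show ?thesis using 1 by (simp add: flat_exp_def)
 next
  case 2
  \<comment> \<open>Division by \<open>h\<close> multiplies the polynomial in \<open>1 / h\<close>
    by its variable, so the difference quotient at 0 belongs to the family again and tends to
    0.\<close>
  have "(\<lambda>h. flat_exp p h / h) = flat_exp (pCons 0 p)" by (rule ext) (auto simp: flat_exp_def field_simps)
  then have "((\<lambda>h. (flat_exp p (0 + h) - flat_exp p 0) / h) \<longlongrightarrow> 0) (at 0)"
   using flat_exp_tendsto_0[of "pCons 0 p"] by (simp add: flat_exp_def[of _ 0])
  then show ?thesis using 2 by (simp add: DERIV_def flat_exp_def)
 next
  case 3
  have "((\<lambda>t. poly p (1 / t) * exp (- 1 / t)) has_field_derivative
    flat_exp ((p - pderiv p) * [:0, 0, 1:]) t) (at t)"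
   using 3 by (auto intro!: derivative_eq_intros simp: flat_exp_def field_simps power2_eq_square)
  then show ?thesis by (rule has_field_derivative_transform_within_open[where S = "{0<..}"])
    (use 3 in \<open>auto simp: flat_exp_def\<close>)
 qed
qed

lemma bump_deriv: "(flat_exp 1 has_field_derivative flat_exp [:0, 0, 1:] t) (at t)"
 using flat_exp_deriv[of 1 t] by simp

lemma flat_exp_continuous: "continuous_on A (flat_exp p)"
 using DERIV_continuous_on flat_exp_deriv has_field_derivative_at_within by blast

definition smooth_fun :: "(real^'n => real) => bool" where
 "smooth_fun \<phi> \<longleftrightarrow> (\<forall>k. Ck_fun k \<phi>)"

lemma smooth_fun_const [intro]: "smooth_fun (\<lambda>x. c)"
 and smooth_fun_coord [intro]: "smooth_fun (\<lambda>x. x $ i)"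
 and smooth_fun_add [intro]: "smooth_fun f ==> smooth_fun g ==> smooth_fun (\<lambda>x. f x + g x)"
 and smooth_fun_mult [intro]: "smooth_fun f ==> smooth_fun g ==> smooth_fun (\<lambda>x. f x * g x)"
 by (simp_all add: smooth_fun_def Ck_fun_const Ck_fun_coord Ck_fun_add Ck_fun_mult)

lemma smooth_fun_uminus [intro]: "smooth_fun f ==> smooth_fun (\<lambda>x. - f x)"
 using smooth_fun_mult[OF smooth_fun_const[of "-1"], of f] by simp

lemma smooth_fun_diff [intro]: "smooth_fun f ==> smooth_fun g ==> smooth_fun (\<lambda>x. f x - g x)"
 using smooth_fun_add[of f "\<lambda>x. - g x"] by auto

lemma smooth_fun_sum [intro]: "(\<And>i. i \<in> I ==> smooth_fun (f i)) ==> smooth_fun (\<lambda>x. \<Sum>i\<in>I. f i x)"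
 by (induction I rule: infinite_finite_induct) auto

lemma smooth_fun_prod [intro]: "(\<And>i. i \<in> I ==> smooth_fun (f i)) ==> smooth_fun (\<lambda>x. \<Prod>i\<in>I. f i x)"
 by (induction I rule: infinite_finite_induct) auto

lemma smooth_fun_partial [intro]: "smooth_fun f ==> smooth_fun (partial_deriv i f)"
 unfolding smooth_fun_def by (metis Ck_fun.simps(2))

lemma smooth_fun_differentiable: "smooth_fun f ==> f differentiable (at x)"
 unfolding smooth_fun_def by (metis Ck_fun.simps(2) differentiable_onD_at)

lemma smooth_fun_continuous: "smooth_fun f ==> continuous_on A f"
 unfolding smooth_fun_def by (metis Ck_fun.simps(1) continuous_on_subset subset_UNIV)

text \<open>The induction must vary \<open>p\<close>, since each differentiation replaces it by the
  polynomial from \<open>flat_exp_deriv\<close>.\<close>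

lemma smooth_fun_flat_exp [intro]:
 assumes "smooth_fun f" shows "smooth_fun (\<lambda>x. flat_exp p (f x))"
proof -
 have "Ck_fun k (\<lambda>x. flat_exp p (f x))" for k
 proof (induction k arbitrary: p)
  case 0
  show ?case
   using continuous_on_compose2[OF flat_exp_continuous[of UNIV p] smooth_fun_continuous[OF assms]] by simp
 next
  case (Suc k)
  have "partial_deriv i (\<lambda>x. flat_exp p (f x))
    = (\<lambda>x. flat_exp ((p - pderiv p) * [:0, 0, 1:]) (f x) * partial_deriv i f x)" for i
   by (intro ext partial_deriv_compose smooth_fun_differentiable assms flat_exp_deriv)
  moreover have "Ck_fun k (partial_deriv i f)" for i
   using smooth_fun_partial[OF assms] by (simp add: smooth_fun_def)
  moreover have "(\<lambda>x. flat_exp p (f x)) differentiable (at x)" for x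
   using has_derivative_compose[OF has_derivative_frechet[OF smooth_fun_differentiable[OF assms]]
     flat_exp_deriv[unfolded has_field_derivative_def]] by (auto simp: differentiable_def)
  ultimately show ?case using Suc by (auto simp: differentiable_on_def intro!: Ck_fun_mult)
 qed
 then show ?thesis by (simp add: smooth_fun_def)
qed

section \<open>Smooth truncations and cutoff functions\<close>

abbreviation bump :: "real => real" where "bump \<equiv> flat_exp 1"

lemma bump_simps: "t <= 0 ==> bump t = 0" "t > 0 ==> bump t = exp (- 1 / t)"
 by (auto simp: flat_exp_def)

lemma bump_bounds: "0 <= bump t" "bump t <= 1"
 by (auto simp: flat_exp_def)

lemma bump_pos: "t > 0 ==> 0 < bump t"
 by (auto simp: flat_exp_def)

lemma bump_mono: "s <= t ==> bump s <= bump t"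
 by (auto simp: flat_exp_def frac_le divide_le_cancel)

lemma bump_tendsto_1:
 assumes "t > 0" shows "(\<lambda>n. bump (real n * t)) \<longlonglongrightarrow> 1"
proof -
 have "(\<lambda>n. exp (- (1 / t) * (1 / real n))) \<longlonglongrightarrow> exp (- (1 / t) * 0)" by (intro tendsto_intros lim_1_over_n)
 moreover have "\<forall>\<^sub>F n in sequentially. exp (- (1 / t) * (1 / real n)) = bump (real n * t)"
  using eventually_gt_at_top[of 0] by eventually_elim (use assms in \<open>simp add: bump_simps\<close>)
 ultimately show ?thesis using Lim_transform_eventually by fastforce
qed

text \<open>A smooth approximation of the positive part, vanishing for \<open>t <= 0\<close>. For
  \<open>t > 0\<close> and \<open>n > 0\<close> its derivative is \<open>(1 + s) * exp (- s)\<close>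
  with \<open>s = 1 / (n * t)\<close>, which lies between 0 and 1 for every \<open>n\<close>; this
  uniform bound is what lets the chain rule pass to the limit.\<close>

definition trunc_approx :: "nat => real => real" where
 "trunc_approx n t = t * bump (real n * t)"

definition trunc_approx' :: "nat => real => real" where
 "trunc_approx' n t = bump (real n * t) + t * (real n * flat_exp [:0, 0, 1:] (real n * t))"

lemma trunc_approx_deriv: "(trunc_approx n has_field_derivative trunc_approx' n t) (at t)"
proof -
 have "((\<lambda>t. bump (real n * t)) has_field_derivative flat_exp [:0, 0, 1:] (real n * t) * real n) (at t)"
  by (rule DERIV_chain2[OF bump_deriv]) (auto intro!: derivative_eq_intros)
 then show ?thesis unfolding trunc_approx_def[abs_def] trunc_approx'_def
  by (auto intro!: derivative_eq_intros)
qed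

lemma trunc_approx_bounds: "0 <= trunc_approx n t" "trunc_approx n t <= max 0 t"
 using bump_bounds[of "real n * t"]
 by (cases "t <= 0"; auto simp: trunc_approx_def bump_simps mult_nonneg_nonpos mult_le_cancel_left1)+

lemma trunc_approx'_bounds: "0 <= trunc_approx' n t" "trunc_approx' n t <= 1"
proof -
 have "0 <= trunc_approx' n t \<and> trunc_approx' n t <= 1"
 proof (cases "t <= 0 \<or> n = 0")
  case True
  then have "real n * t <= 0" by (auto simp: mult_nonneg_nonpos)
  then show ?thesis by (simp add: trunc_approx'_def flat_exp_def)
 next
  case False
  define s where "s = 1 / (real n * t)"
  have s: "s > 0" using False by (simp add: s_def)
  have "\<not> real n * t <= 0" using False by (simp add: not_le)
  then have "trunc_approx' n t = (1 + s) * exp (- s)"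
   using False by (simp add: trunc_approx'_def flat_exp_def s_def field_simps power2_eq_square)
  moreover have "(1 + s) * exp (- s) <= 1"
   using exp_ge_add_one_self[of s] by (simp add: exp_minus field_simps)
  ultimately show ?thesis using s by simp
 qed
 then show "0 <= trunc_approx' n t" "trunc_approx' n t <= 1" by auto
qed

lemma trunc_approx_tendsto: "(\<lambda>n. trunc_approx n t) \<longlonglongrightarrow> max 0 t"
proof (cases "t > 0")
 case True
 then show ?thesis
  using tendsto_mult[OF tendsto_const[of t] bump_tendsto_1[of t]] by (simp add: trunc_approx_def)
next
 case False
 then show ?thesis by (simp add: trunc_approx_def bump_simps mult_nonneg_nonpos)
qed

lemma trunc_approx'_tendsto: "(\<lambda>n. trunc_approx' n t) \<longlonglongrightarrow> (if t > 0 then 1 else 0)"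
proof (cases "t > 0")
 case True
 have "(\<lambda>n. (1 + (1 / t) * (1 / real n)) * bump (real n * t)) \<longlonglongrightarrow> (1 + (1 / t) * 0) * 1"
  by (intro tendsto_intros lim_1_over_n bump_tendsto_1 True)
 moreover have "\<forall>\<^sub>F n in sequentially. (1 + (1 / t) * (1 / real n)) * bump (real n * t) = trunc_approx' n t"
  using eventually_gt_at_top[of 0]
  by eventually_elim (use True in \<open>simp add: trunc_approx'_def flat_exp_def field_simps power2_eq_square\<close>)
 ultimately show ?thesis using True Lim_transform_eventually by fastforce
next
 case False
 then show ?thesis by (simp add: trunc_approx'_def flat_exp_def mult_nonneg_nonpos)
qed

lemma smooth_fun_trunc_approx [intro]: "smooth_fun f ==> smooth_fun (\<lambda>x. trunc_approx n (f x))"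
 unfolding trunc_approx_def by (intro smooth_fun_mult smooth_fun_flat_exp smooth_fun_const)

text \<open>\<open>bump (1 - t)\<close> is at least \<open>exp (- 1)\<close> for
  \<open>t <= 0\<close> and 0 for \<open>t \<ge> 1\<close>, so the outer \<open>bump\<close> sees a
  nonpositive argument on the left and the constant \<open>exp (- 1)\<close> on the right. Only
  \<open>bump\<close>, differences and a constant divisor occur, hence smoothness comes from
  \<open>smooth_fun_flat_exp\<close>.\<close>

definition step :: "real => real" where
 "step t = bump (exp (- 1) - bump (1 - t)) / bump (exp (- 1))"

lemma step_0: "t <= 0 ==> step t = 0"
 using bump_mono[of 1 "1 - t"] by (simp add: step_def bump_simps)

lemma step_1: "t \<ge> 1 ==> step t = 1"
 using bump_pos[of "exp (- 1)"] by (simp add: step_def bump_simps(1))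

lemma step_bounds: "0 <= step t" "step t <= 1"
 using bump_pos[of "exp (- 1)"] bump_bounds bump_mono[of "exp (- 1) - bump (1 - t)" "exp (- 1)"]
 by (auto simp: step_def)

lemma step_deriv: "\<exists>s'. (\<forall>t. (step has_field_derivative s' t) (at t)) \<and> (\<exists>C. \<forall>t. \<bar>s' t\<bar> <= C) \<and>
  (\<forall>t. t < 0 \<or> t > 1 --> s' t = 0)"
proof -
 let ?q = "[:0, 0, 1:] :: real poly"
 define s' where "s' t = flat_exp ?q (exp (- 1) - bump (1 - t)) * flat_exp ?q (1 - t) / bump (exp (- 1))" for t
 have b1: "((\<lambda>t. bump (1 - t)) has_field_derivative - flat_exp ?q (1 - t)) (at t)" for t
 proof -
  have "((\<lambda>t. 1 - t) has_field_derivative - 1) (at t)" for t :: real by (auto intro!: derivative_eq_intros)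
  from DERIV_cong[OF DERIV_chain2[OF bump_deriv this]] show ?thesis by simp
 qed
 have "((\<lambda>t. bump (exp (- 1) - bump (1 - t))) has_field_derivative
   flat_exp ?q (exp (- 1) - bump (1 - t)) * flat_exp ?q (1 - t)) (at t)" for t
  by (rule DERIV_chain2[OF bump_deriv]) (use b1[of t] in \<open>auto intro!: derivative_eq_intros\<close>)
 then have d: "(step has_field_derivative s' t) (at t)" for t
  unfolding step_def[abs_def] s'_def by (rule DERIV_cdivide)
 have z: "s' t = 0" if "t < 0 \<or> t > 1" for t
 proof (cases "t > 1")
  case False
  then have "exp (- 1) <= bump (1 - t)" using that bump_mono[of 1 "1 - t"] by (simp add: bump_simps)
  then show ?thesis by (simp add: s'_def flat_exp_def[of ?q "exp (- 1) - _"])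
 qed (simp add: s'_def flat_exp_def[of ?q "1 - t"])
 have "continuous_on {0..1} s'" unfolding s'_def
  by (intro continuous_intros continuous_on_compose2[OF flat_exp_continuous[of UNIV]])
   (auto simp: bump_simps)
 then have "bounded (s' ` {0..1})" by (intro compact_imp_bounded compact_continuous_image) auto
 then obtain C where C: "\<And>t. t \<in> {0..1} ==> \<bar>s' t\<bar> <= C" unfolding bounded_iff by fastforce
 have "\<bar>s' t\<bar> <= max 0 C" for t using C[of t] z[of t] by (cases "t < 0 \<or> t > 1") auto
 with d z show ?thesis by blast
qed

lemma smooth_fun_step: "smooth_fun f ==> smooth_fun (\<lambda>x. step (f x))"
 unfolding step_def divide_inverse
 by (intro smooth_fun_mult smooth_fun_flat_exp smooth_fun_const smooth_fun_diff)

text \<open>The gradient bound has one constant for all centres and radii, as the iterations over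
  shrinking balls require. The gradient is recorded to vanish on the inner ball, so that there the
  truncated function has exactly the truncated gradient.\<close>

definition is_cutoff :: "real => real^'n => real => real => (real^'n => real) => bool" where
 "is_cutoff C z \<rho> R \<eta> \<longleftrightarrow> \<eta> \<in> test_fun (ball z R) \<and> (\<forall>x. 0 <= \<eta> x \<and> \<eta> x <= 1) \<and> (\<forall>x\<in>cball z \<rho>. \<eta> x = 1) \<and>
  (\<forall>i x. \<bar>partial_deriv i \<eta> x\<bar> <= C / (R - \<rho>)) \<and> (\<forall>i. \<forall>x\<in>ball z \<rho>. partial_deriv i \<eta> x = 0)"

text \<open>The step function is composed with a quadratic that is 1 at distance
  \<open>\<rho>\<close> and 0 at distance \<open>R'\<close>; using the squared distance avoids a
  singularity at \<open>z\<close>. Its slope is at most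
  \<open>2 / (R' - \<rho>) = 4 / (R - \<rho>)\<close>, and adding 1 to \<open>4 * C\<close> keeps
  the constant positive.\<close>

lemma cutoff_exists:
 "\<exists>C>0. \<forall>(z::real^'n) \<rho> R. 0 < \<rho> --> \<rho> < R --> (\<exists>\<eta>. is_cutoff C z \<rho> R \<eta>)"
proof -
 obtain s' C where s': "\<And>t. (step has_field_derivative s' t) (at t)" "\<And>t. \<bar>s' t\<bar> <= C"
  "\<And>t. t < 0 \<or> t > 1 ==> s' t = 0" using step_deriv by blast
 have C: "C \<ge> 0" using s'(2)[of 0] by linarith
 show ?thesis
 proof (intro exI[of _ "4 * C + 1"] conjI allI impI)
  show "4 * C + 1 > 0" using C by simp
  fix z :: "real^'n" and \<rho> R :: real
  assume \<rho>: "0 < \<rho>" "\<rho> < R"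
  \<comment> \<open>An intermediate radius makes the support compact inside the open ball of radius
    \<open>R\<close>.\<close>
  define R' where "R' = (\<rho> + R) / 2"
  have R': "\<rho> < R'" "R' < R" "0 < R'" using \<rho> by (auto simp: R'_def)
  have sq: "0 < R'\<^sup>2 - \<rho>\<^sup>2" using power_strict_mono[OF R'(1), of 2] \<rho> by linarith
  define q where "q x = (R'\<^sup>2 - (\<Sum>i\<in>UNIV. (x $ i - z $ i) * (x $ i - z $ i))) * (1 / (R'\<^sup>2 - \<rho>\<^sup>2))" for x
  have q_eq: "q x = (R'\<^sup>2 - (norm (x - z))\<^sup>2) / (R'\<^sup>2 - \<rho>\<^sup>2)" for x
   by (simp add: q_def power2_norm_eq_inner inner_vec_def)
  have "R'\<^sup>2 \<noteq> \<rho>\<^sup>2" using sq by simp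
  have sm: "smooth_fun q"
   unfolding q_def by (intro smooth_fun_mult smooth_fun_diff smooth_fun_sum smooth_fun_const smooth_fun_coord)
  define \<eta> where "\<eta> x = step (q x)" for x
  have dq: "(q has_derivative (\<lambda>h. - (2 * ((x - z) \<bullet> h)) / (R'\<^sup>2 - \<rho>\<^sup>2))) (at x)" for x
   unfolding q_eq[abs_def] power2_norm_eq_inner
   using sq by (auto intro!: derivative_eq_intros simp: inner_commute)
  have pd: "partial_deriv i \<eta> x = s' (q x) * (- (2 * (x $ i - z $ i)) / (R'\<^sup>2 - \<rho>\<^sup>2))" for i x
   unfolding \<eta>_def
   using partial_deriv_compose[OF smooth_fun_differentiable[OF sm, of x] s'(1)] partial_deriv_eqI[OF dq[of x], of i]
   by (simp add: inner_axis)
  have sm\<eta>: "smooth_fun \<eta>" unfolding \<eta>_def by (rule smooth_fun_step[OF sm])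
  show "\<exists>\<eta>. is_cutoff (4 * C + 1) z \<rho> R \<eta>" unfolding is_cutoff_def
  proof (intro exI[of _ \<eta>] conjI allI ballI)
   show "0 <= \<eta> x" "\<eta> x <= 1" for x using step_bounds by (auto simp: \<eta>_def)
   show "\<eta> x = 1" if "x \<in> cball z \<rho>" for x
   proof -
    have "(norm (x - z))\<^sup>2 <= \<rho>\<^sup>2" using that by (auto simp: dist_norm norm_minus_commute intro: power_mono)
    then show ?thesis using sq unfolding \<eta>_def q_eq by (intro step_1) simp
   qed
   have "{x. \<eta> x \<noteq> 0} \<subseteq> cball z R'"
   proof
    fix x assume "x \<in> {x. \<eta> x \<noteq> 0}"
    then have "\<not> q x <= 0" using step_0 by (auto simp: \<eta>_def)
    then have "(norm (x - z))\<^sup>2 <= R'\<^sup>2" using sq by (simp add: q_eq divide_le_0_iff not_le)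
    then have "norm (x - z) <= R'" using R'(3) by (intro power2_le_imp_le[of "norm (x - z)"]) auto
    then show "x \<in> cball z R'" by (simp add: dist_norm norm_minus_commute)
   qed
   then have "closure {x. \<eta> x \<noteq> 0} \<subseteq> cball z R'" by (intro closure_minimal) auto
   then have c: "closure {x. \<eta> x \<noteq> 0} \<subseteq> ball z R" using R' by fastforce
   have "bounded (closure {x. \<eta> x \<noteq> 0})" by (rule bounded_subset[OF bounded_ball c])
   then show "\<eta> \<in> test_fun (ball z R)"
    using sm\<eta> c by (simp add: test_fun_def smooth_fun_def compact_eq_bounded_closed)
   show "partial_deriv i \<eta> x = 0" if "x \<in> ball z \<rho>" for i x
   proof -
    have "(norm (x - z))\<^sup>2 < \<rho>\<^sup>2" using that by (auto simp: dist_norm norm_minus_commute intro!: power_strict_mono)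
    then have "q x > 1" using sq by (simp add: q_eq)
    then show ?thesis using s'(3) by (simp add: pd)
   qed
   show "\<bar>partial_deriv i \<eta> x\<bar> <= (4 * C + 1) / (R - \<rho>)" for i x
   proof (cases "norm (x - z) <= R'")
    case True
    have "\<bar>x $ i - z $ i\<bar> <= R'" using component_le_norm_cart[of "x - z" i] True by simp
    then have "\<bar>partial_deriv i \<eta> x\<bar> <= C * (2 * R' / (R'\<^sup>2 - \<rho>\<^sup>2))"
     unfolding pd abs_mult using s'(2) C sq by (intro mult_mono) (auto simp: divide_right_mono)
    also have "2 * R' / (R'\<^sup>2 - \<rho>\<^sup>2) <= 2 / (R' - \<rho>)"
    proof -
     have "2 * R' * (R' - \<rho>) <= 2 * (R'\<^sup>2 - \<rho>\<^sup>2)" using R' \<rho> by (simp add: power2_eq_square algebra_simps)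
     then show ?thesis using sq R' by (simp add: divide_simps)
    qed
    also have "2 / (R' - \<rho>) = 4 / (R - \<rho>)" using \<rho> by (simp add: R'_def field_simps)
    finally have "\<bar>partial_deriv i \<eta> x\<bar> <= C * (4 / (R - \<rho>))" using C by (meson mult_left_mono order_trans)
    also have "\<dots> <= (4 * C + 1) / (R - \<rho>)" using \<rho> by (simp add: divide_right_mono)
    finally show ?thesis .
   next
    case False
    then have "(norm (x - z))\<^sup>2 > R'\<^sup>2" using R' by (intro power_strict_mono) auto
    then have "q x < 0" using sq by (simp add: q_eq divide_less_0_iff)
    then show ?thesis using s'(3) C \<rho> by (simp add: pd)
   qed
  qed
 qed
qed

subsection \<open>Test functions\<close>

lemma test_fun_iff: "\<phi> \<in> test_fun \<O> \<longleftrightarrow> smooth_fun \<phi> \<and> compact (closure {x. \<phi> x \<noteq> 0}) \<and> closure {x. \<phi> x \<noteq> 0} \<subseteq> \<O>"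
 by (simp add: test_fun_def smooth_fun_def)

lemma test_fun_smooth: "\<phi> \<in> test_fun \<O> ==> smooth_fun \<phi>"
 by (simp add: test_fun_iff)

lemma test_fun_mono: "\<O> \<subseteq> \<O>' ==> \<phi> \<in> test_fun \<O> ==> \<phi> \<in> test_fun \<O>'"
 by (auto simp: test_fun_iff)

lemma test_funI:
 assumes "smooth_fun \<phi>" "compact K" "K \<subseteq> \<O>" "\<And>x. x \<notin> K ==> \<phi> x = 0"
 shows "\<phi> \<in> test_fun \<O>"
proof -
 have "closure {x. \<phi> x \<noteq> 0} \<subseteq> K" using assms by (intro closure_minimal) (auto simp: compact_imp_closed)
 moreover have "compact (closure {x. \<phi> x \<noteq> 0})"
  using calculation assms(2) by (meson bounded_subset closed_closure compact_eq_bounded_closed)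
 ultimately show ?thesis using assms by (auto simp: test_fun_iff)
qed

lemma test_fun_compact_support:
 "\<phi> \<in> test_fun \<O> ==> \<exists>K. compact K \<and> K \<subseteq> \<O> \<and> (\<forall>x. x \<notin> K --> \<phi> x = 0)"
 unfolding test_fun_iff using closure_subset[of "{x. \<phi> x \<noteq> 0}"]
 by (intro exI[of _ "closure {x. \<phi> x \<noteq> 0}"]) auto

lemma test_fun_support:
 assumes "\<phi> \<in> test_fun \<O>"
 obtains K where "compact K" "K \<subseteq> \<O>" "\<And>x. x \<notin> K ==> \<phi> x = 0" "\<And>x i. x \<notin> K ==> partial_deriv i \<phi> x = 0"
proof -
 obtain K where K: "compact K" "K \<subseteq> \<O>" and z: "\<And>x. x \<notin> K ==> \<phi> x = 0"
  using test_fun_compact_support[OF assms] by blast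
 have "partial_deriv i \<phi> x = 0" if "x \<notin> K" for x i
 proof -
  have "((\<lambda>_. 0) has_derivative (\<lambda>_. 0)) (at x)" by simp
  then have "(\<phi> has_derivative (\<lambda>_. 0)) (at x)"
   by (rule has_derivative_transform_within_open[where s = "- K"])
    (use that z compact_imp_closed[OF K(1)] in \<open>auto simp: open_Compl\<close>)
  then show ?thesis by (rule partial_deriv_eqI)
 qed
 then show thesis using that K z by blast
qed

lemma test_fun_zero: "(\<lambda>x. 0) \<in> test_fun \<O>"
 by (rule test_funI[of _ "{}"]) auto

lemma test_fun_add:
 assumes "\<phi> \<in> test_fun \<O>" "\<psi> \<in> test_fun \<O>" shows "(\<lambda>x. \<phi> x + \<psi> x) \<in> test_fun \<O>"
proof -
 obtain K where K: "compact K" "K \<subseteq> \<O>" "\<And>x. x \<notin> K ==> \<phi> x = 0" using test_fun_compact_support[OF assms(1)] by blast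
 obtain K' where K': "compact K'" "K' \<subseteq> \<O>" "\<And>x. x \<notin> K' ==> \<psi> x = 0" using test_fun_compact_support[OF assms(2)] by blast
 show ?thesis
  by (rule test_funI[of _ "K \<union> K'"]) (use assms K K' in \<open>auto simp: test_fun_smooth intro!: smooth_fun_add\<close>)
qed

lemma test_fun_mult:
 assumes "\<phi> \<in> test_fun \<O>" "smooth_fun \<psi>" shows "(\<lambda>x. \<psi> x * \<phi> x) \<in> test_fun \<O>"
proof -
 obtain K where K: "compact K" "K \<subseteq> \<O>" "\<And>x. x \<notin> K ==> \<phi> x = 0" using test_fun_compact_support[OF assms(1)] by blast
 show ?thesis
  by (rule test_funI[of _ K]) (use assms K in \<open>auto simp: test_fun_smooth intro!: smooth_fun_mult\<close>)
qed

lemma test_fun_scale: "\<phi> \<in> test_fun \<O> ==> (\<lambda>x. c * \<phi> x) \<in> test_fun \<O>"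
 by (rule test_fun_mult) auto

lemma test_fun_partial:
 assumes "\<phi> \<in> test_fun \<O>" shows "partial_deriv i \<phi> \<in> test_fun \<O>"
proof (rule test_fun_support[OF assms])
 fix K assume "compact K" "K \<subseteq> \<O>" "\<And>x i. x \<notin> K ==> partial_deriv i \<phi> x = 0"
 then show ?thesis by (intro test_funI[of _ K]) (auto intro: smooth_fun_partial test_fun_smooth assms)
qed

lemma test_fun_cont: "\<phi> \<in> test_fun \<O> ==> continuous_on A \<phi>"
 by (simp add: smooth_fun_continuous test_fun_smooth)

lemma cont_borel: "continuous_on UNIV f ==> f \<in> borel_measurable lebesgue"
 by (simp add: borel_measurable_continuous_onI measurable_completion)

lemma test_fun_meas: "\<phi> \<in> test_fun \<O> ==> \<phi> \<in> borel_measurable lebesgue"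
 by (intro cont_borel test_fun_cont)

lemma test_fun_bounded:
 assumes "\<phi> \<in> test_fun \<O>" shows "\<exists>C. \<forall>x. \<bar>\<phi> x\<bar> <= C"
proof -
 obtain K where K: "compact K" "\<And>x. x \<notin> K ==> \<phi> x = 0" using test_fun_compact_support[OF assms] by blast
 have "bounded (\<phi> ` K)" using K test_fun_cont[OF assms] by (intro compact_imp_bounded compact_continuous_image)
 then obtain C where "\<And>x. x \<in> K ==> \<bar>\<phi> x\<bar> <= C" unfolding bounded_iff by fastforce
 then have "\<bar>\<phi> x\<bar> <= max 0 C" for x using K(2)[of x] by (cases "x \<in> K") force+
 then show ?thesis by blast
qed

lemma test_fun_integrable:
 assumes "\<phi> \<in> test_fun \<O>" shows "integrable lebesgue \<phi>"
proof -
 obtain K where K: "compact K" "\<And>x. x \<notin> K ==> \<phi> x = 0" using test_fun_compact_support[OF assms] by blast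
 have "integrable lborel (\<lambda>x. indicator K x *\<^sub>R \<phi> x)"
  by (intro borel_integrable_compact K test_fun_cont[OF assms])
 also have "(\<lambda>x. indicator K x *\<^sub>R \<phi> x) = \<phi>" using K(2) by (auto simp: indicator_def fun_eq_iff)
 finally show ?thesis
  using borel_measurable_continuous_onI[OF test_fun_cont[OF assms, of UNIV]] by (simp add: integrable_completion)
qed

lemma test_fun_sqint:
 assumes "\<phi> \<in> test_fun \<O>" shows "sqint \<phi>" unfolding sqint_def power2_eq_square
 using assms test_fun_meas test_fun_integrable[OF test_fun_mult[OF assms test_fun_smooth[OF assms]]] by auto

lemma test_fun_bmeas: "\<phi> \<in> test_fun \<O> ==> bmeas \<phi>"
 by (simp add: bmeas_def test_fun_bounded test_fun_meas)

subsection \<open>Translation estimates for test functions\<close>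

text \<open>The \<open>l\<^sup>1\<close> norm of the gradient: it controls every directional
  derivative, and its integral over a set splits into the \<open>L\<^sup>1\<close> norms of the
  partial derivatives.\<close>

definition grad1 :: "(real^'n => real) => real^'n => real" where
 "grad1 \<phi> x = (\<Sum>i\<in>UNIV. \<bar>partial_deriv i \<phi> x\<bar>)"

lemma grad1_nonneg [simp]: "0 <= grad1 \<phi> x"
 by (simp add: grad1_def sum_nonneg)

lemma frechet_derivative_partials:
 assumes "\<phi> differentiable (at x)"
 shows "frechet_derivative \<phi> (at x) h = (\<Sum>i\<in>UNIV. h $ i * partial_deriv i \<phi> x)"
proof -
 interpret D: linear "frechet_derivative \<phi> (at x)" by (rule linear_frechet_derivative[OF assms])
 have "frechet_derivative \<phi> (at x) h = frechet_derivative \<phi> (at x) (\<Sum>i\<in>UNIV. h $ i *\<^sub>R axis i 1)"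
  by (simp add: basis_expansion flip: scalar_mult_eq_scaleR)
 then show ?thesis by (simp add: D.sum D.scale partial_deriv_def)
qed

lemma frechet_derivative_le_grad1:
 assumes "\<phi> differentiable (at x)"
 shows "\<bar>frechet_derivative \<phi> (at x) h\<bar> <= norm h * grad1 \<phi> x"
proof -
 have "\<bar>frechet_derivative \<phi> (at x) h\<bar> <= (\<Sum>i\<in>UNIV. \<bar>h $ i * partial_deriv i \<phi> x\<bar>)"
  unfolding frechet_derivative_partials[OF assms] by (rule sum_abs)
 also have "\<dots> <= (\<Sum>i\<in>UNIV. norm h * \<bar>partial_deriv i \<phi> x\<bar>)"
  unfolding abs_mult by (intro sum_mono mult_right_mono component_le_norm_cart) auto
 finally show ?thesis by (simp add: grad1_def sum_distrib_left)
qed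

lemma test_fun_grad1_cont: "\<phi> \<in> test_fun \<O> ==> continuous_on A (grad1 \<phi>)"
 unfolding grad1_def by (intro continuous_intros test_fun_cont[OF test_fun_partial])

lemma test_fun_line_deriv:
 assumes "\<phi> \<in> test_fun \<O>"
 shows "((\<lambda>t. \<phi> (x + t *\<^sub>R h)) has_vector_derivative frechet_derivative \<phi> (at (x + t *\<^sub>R h)) h) (at t within S)"
proof -
 have d: "\<phi> differentiable (at (x + t *\<^sub>R h))"
  by (intro smooth_fun_differentiable test_fun_smooth[OF assms])
 have "((\<lambda>t. x + t *\<^sub>R h) has_derivative (\<lambda>s. s *\<^sub>R h)) (at t within S)"
  by (auto intro!: derivative_eq_intros)
 from has_derivative_compose[OF this has_derivative_frechet[OF d]]
 show ?thesis unfolding has_vector_derivative_def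
  by (simp add: linear_scale[OF linear_frechet_derivative[OF d]])
qed

text \<open>The fundamental theorem of calculus on a segment, stated with nonnegative extended
  integrals so that the order of integration may later be exchanged without integrability
  conditions.\<close>

lemma test_fun_line_bound:
 fixes \<phi> :: "real^'n => real"
 assumes "\<phi> \<in> test_fun \<O>"
 shows "ennreal \<bar>\<phi> (x + h) - \<phi> x\<bar>
  <= (\<integral>\<^sup>+t. ennreal (indicator {0..1} t * (norm h * grad1 \<phi> (x + t *\<^sub>R h))) \<partial>lborel)"
proof -
 let ?f = "\<lambda>t. frechet_derivative \<phi> (at (x + t *\<^sub>R h)) h"
 have d: "\<phi> differentiable (at y)" for y by (intro smooth_fun_differentiable test_fun_smooth[OF assms])
 have c: "continuous_on {0..1} ?f" unfolding frechet_derivative_partials[OF d]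
  by (intro continuous_intros continuous_on_compose2[OF test_fun_cont[OF test_fun_partial[OF assms], of UNIV]]) auto
 have "(\<integral>t. indicator {0..1} t *\<^sub>R ?f t \<partial>lborel) = \<phi> (x + 1 *\<^sub>R h) - \<phi> (x + 0 *\<^sub>R h)"
  by (rule integral_FTC_atLeastAtMost[OF _ test_fun_line_deriv[OF assms] c]) auto
 moreover have "integrable lborel (\<lambda>t. indicator {0..1} t *\<^sub>R ?f t)"
  by (rule borel_integrable_compact) (auto intro: c)
 ultimately have "ennreal \<bar>\<phi> (x + h) - \<phi> x\<bar> <= (\<integral>\<^sup>+t. ennreal (norm (indicator {0..1} t *\<^sub>R ?f t)) \<partial>lborel)"
  using integral_norm_bound_ennreal[of lborel "\<lambda>t. indicator {0..1} t *\<^sub>R ?f t"] by simp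
 also have "\<dots> <= (\<integral>\<^sup>+t. ennreal (indicator {0..1} t * (norm h * grad1 \<phi> (x + t *\<^sub>R h))) \<partial>lborel)"
  using frechet_derivative_le_grad1[OF d] by (intro nn_integral_mono ennreal_leI) (auto simp: indicator_def)
 finally show ?thesis .
qed

lemma nn_integral_lborel_translate:
 fixes f :: "'a::euclidean_space => ennreal"
 assumes [measurable]: "f \<in> borel_measurable borel"
 shows "(\<integral>\<^sup>+x. f (x + h) \<partial>lborel) = (\<integral>\<^sup>+x. f x \<partial>lborel)"
proof -
 have "(\<integral>\<^sup>+x. f x \<partial>lborel) = (\<integral>\<^sup>+x. f x \<partial>(distr lborel borel ((+) h)))" by (subst lborel_distr_plus) simp
 also have "\<dots> = (\<integral>\<^sup>+x. f (x + h) \<partial>lborel)" by (subst nn_integral_distr) (auto simp: add.commute)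
 finally show ?thesis by simp
qed

lemma test_fun_borel: "\<phi> \<in> test_fun \<O> ==> \<phi> \<in> borel_measurable borel"
 by (intro borel_measurable_continuous_onI test_fun_cont)

lemma test_fun_grad1_borel: "\<phi> \<in> test_fun \<O> ==> grad1 \<phi> \<in> borel_measurable borel"
 by (intro borel_measurable_continuous_onI test_fun_grad1_cont)

text \<open>Every point of the segment from \<open>x\<close> to \<open>x + h\<close> lies in \<open>D\<close>, so Fubini and translation
 invariance bound the average over the segment by the integral over \<open>D\<close>.\<close>

lemma test_fun_translate_le:
 fixes \<phi> :: "real^'n => real"
 assumes \<phi>: "\<phi> \<in> test_fun \<O>" and D: "convex D" and [measurable]: "D \<in> sets borel"
 shows "(\<integral>\<^sup>+x. ennreal (indicator D x * indicator D (x + h) * \<bar>\<phi> (x + h) - \<phi> x\<bar>) \<partial>lborel)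
  <= ennreal (norm h) * (\<integral>\<^sup>+x. ennreal (indicator D x * grad1 \<phi> x) \<partial>lborel)" (is "?L <= _ * ?I")
proof -
 note [measurable] = test_fun_borel[OF \<phi>] test_fun_grad1_borel[OF \<phi>]
 have "?L <= (\<integral>\<^sup>+x. (\<integral>\<^sup>+t. ennreal (norm h) * ennreal (indicator {0..1} t * (indicator D (x + t *\<^sub>R h) * grad1 \<phi> (x + t *\<^sub>R h))) \<partial>lborel) \<partial>lborel)"
 proof (rule nn_integral_mono)
  fix x :: "real^'n"
  show "ennreal (indicator D x * indicator D (x + h) * \<bar>\<phi> (x + h) - \<phi> x\<bar>)
   <= (\<integral>\<^sup>+t. ennreal (norm h) * ennreal (indicator {0..1} t * (indicator D (x + t *\<^sub>R h) * grad1 \<phi> (x + t *\<^sub>R h))) \<partial>lborel)"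
  proof (cases "x \<in> D \<and> x + h \<in> D")
   case True
   have seg: "x + t *\<^sub>R h \<in> D" if "t \<in> {0..1}" for t
   proof -
    have "(1 - t) *\<^sub>R x + t *\<^sub>R (x + h) \<in> D" using D True that by (intro convexD) auto
    then show ?thesis by (simp add: algebra_simps)
   qed
   have "ennreal \<bar>\<phi> (x + h) - \<phi> x\<bar> <= (\<integral>\<^sup>+t. ennreal (indicator {0..1} t * (norm h * grad1 \<phi> (x + t *\<^sub>R h))) \<partial>lborel)"
    by (rule test_fun_line_bound[OF \<phi>])
   also have "\<dots> = (\<integral>\<^sup>+t. ennreal (norm h) * ennreal (indicator {0..1} t * (indicator D (x + t *\<^sub>R h) * grad1 \<phi> (x + t *\<^sub>R h))) \<partial>lborel)"
    using seg by (intro nn_integral_cong) (auto simp: indicator_def ennreal_mult')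
   finally show ?thesis using True by simp
  qed auto
 qed
 also have "\<dots> = (\<integral>\<^sup>+t. (\<integral>\<^sup>+x. ennreal (norm h) * ennreal (indicator {0..1} t * (indicator D (x + t *\<^sub>R h) * grad1 \<phi> (x + t *\<^sub>R h))) \<partial>lborel) \<partial>lborel)"
  by (rule lborel_pair.Fubini') measurable
 also have "\<dots> = (\<integral>\<^sup>+t. indicator {0..1::real} t * (ennreal (norm h) * ?I) \<partial>lborel)"
 proof (rule nn_integral_cong)
  fix t :: real
  have "(\<integral>\<^sup>+x. ennreal (indicator D (x + t *\<^sub>R h) * grad1 \<phi> (x + t *\<^sub>R h)) \<partial>lborel) = ?I"
   by (rule nn_integral_lborel_translate) measurable
  then show "(\<integral>\<^sup>+x. ennreal (norm h) * ennreal (indicator {0..1} t * (indicator D (x + t *\<^sub>R h) * grad1 \<phi> (x + t *\<^sub>R h))) \<partial>lborel)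
    = indicator {0..1} t * (ennreal (norm h) * ?I)" by (auto simp: indicator_def nn_integral_cmult)
 qed
 also have "\<dots> = ennreal (norm h) * ?I" by (subst nn_integral_multc) auto
 finally show ?thesis .
qed

text \<open>Substituting \<open>y = x + h\<close> leaves only shifts with
  \<open>norm h <= d\<close>; the translation estimate bounds each of them, and integrating over
  these shifts produces the volume of the ball.\<close>

lemma test_fun_double_le:
 fixes \<phi> :: "real^'n => real"
 assumes \<phi>: "\<phi> \<in> test_fun \<O>" and D: "convex D" and [measurable]: "D \<in> sets borel"
  and d: "\<And>x y. x \<in> D ==> y \<in> D ==> norm (y - x) <= d" "d > 0"
 shows "(\<integral>\<^sup>+x. (\<integral>\<^sup>+y. ennreal (indicator D x * indicator D y * \<bar>\<phi> y - \<phi> x\<bar>) \<partial>lborel) \<partial>lborel)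
  <= ennreal d * emeasure lborel (cball (0::real^'n) d) * (\<integral>\<^sup>+x. ennreal (indicator D x * grad1 \<phi> x) \<partial>lborel)" (is "?L <= _ * _ * ?I")
proof -
 note [measurable] = test_fun_borel[OF \<phi>]
 have "?L = (\<integral>\<^sup>+x. (\<integral>\<^sup>+h. ennreal (indicator D x * indicator D (x + h) * \<bar>\<phi> (x + h) - \<phi> x\<bar>) \<partial>lborel) \<partial>lborel)"
 proof (rule nn_integral_cong)
  fix x :: "real^'n"
  show "(\<integral>\<^sup>+y. ennreal (indicator D x * indicator D y * \<bar>\<phi> y - \<phi> x\<bar>) \<partial>lborel)
   = (\<integral>\<^sup>+h. ennreal (indicator D x * indicator D (x + h) * \<bar>\<phi> (x + h) - \<phi> x\<bar>) \<partial>lborel)"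
   using nn_integral_lborel_translate[of "\<lambda>y. ennreal (indicator D x * indicator D y * \<bar>\<phi> y - \<phi> x\<bar>)" x]
   by (simp add: add.commute)
 qed
 also have "\<dots> = (\<integral>\<^sup>+h. (\<integral>\<^sup>+x. ennreal (indicator D x * indicator D (x + h) * \<bar>\<phi> (x + h) - \<phi> x\<bar>) \<partial>lborel) \<partial>lborel)"
  by (rule lborel_pair.Fubini') measurable
 also have "\<dots> <= (\<integral>\<^sup>+h. (ennreal d * ?I) * indicator (cball (0::real^'n) d) h \<partial>lborel)"
 proof (rule nn_integral_mono)
  fix h :: "real^'n"
  show "(\<integral>\<^sup>+x. ennreal (indicator D x * indicator D (x + h) * \<bar>\<phi> (x + h) - \<phi> x\<bar>) \<partial>lborel)
    <= (ennreal d * ?I) * indicator (cball 0 d) h"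
  proof (cases "norm h <= d")
   case True
   have "(\<integral>\<^sup>+x. ennreal (indicator D x * indicator D (x + h) * \<bar>\<phi> (x + h) - \<phi> x\<bar>) \<partial>lborel) <= ennreal (norm h) * ?I"
    by (rule test_fun_translate_le[OF \<phi> D]) measurable
   also have "\<dots> <= ennreal d * ?I" using True by (intro mult_right_mono ennreal_leI) auto
   finally show ?thesis using True by simp
  next
   case False
   have z: "indicator D x * indicator D (x + h) * \<bar>\<phi> (x + h) - \<phi> x\<bar> = 0" for x
    using d(1)[of x "x + h"] False by (auto simp: indicator_def)
   show ?thesis unfolding z by simp
  qed
 qed
 also have "\<dots> = ennreal d * ?I * emeasure lborel (cball (0::real^'n) d)"
  by (subst nn_integral_cmult_indicator) auto
 finally show ?thesis by (simp add: mult_ac)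
qed

text \<open>Average \<open>\<bar>\<phi> x\<bar> <= \<bar>\<phi> (x + h) - \<phi> x\<bar> +
  \<bar>\<phi> (x + h)\<bar>\<close> over shifts of length at most \<open>r\<close>. The first term
  costs \<open>r\<close> times the gradient; the second, integrated over all \<open>h\<close>, gives
  the measure of \<open>E\<close> times the integral of \<open>\<bar>\<phi>\<bar>\<close>. This is
  the source of the Faber-Krahn inequality.\<close>

lemma test_fun_average_le:
 fixes \<phi> :: "real^'n => real"
 assumes \<phi>: "\<phi> \<in> test_fun \<O>" and [measurable]: "E \<in> sets borel" and r: "r > 0"
 shows "emeasure lborel (cball (0::real^'n) r) * (\<integral>\<^sup>+x. ennreal (indicator E x * \<bar>\<phi> x\<bar>) \<partial>lborel)
  <= ennreal r * emeasure lborel (cball (0::real^'n) r) * (\<integral>\<^sup>+x. ennreal (grad1 \<phi> x) \<partial>lborel)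
    + emeasure lborel E * (\<integral>\<^sup>+x. ennreal \<bar>\<phi> x\<bar> \<partial>lborel)" (is "?B * ?L <= ?B' * ?I + ?E * ?N")
proof -
 note [measurable] = test_fun_borel[OF \<phi>] test_fun_grad1_borel[OF \<phi>]
 let ?C = "cball (0::real^'n) r"
 have [measurable]: "?C \<in> sets borel" by simp
 have "?B * ?L = (\<integral>\<^sup>+x. ennreal (indicator E x * \<bar>\<phi> x\<bar>) * ?B \<partial>lborel)"
  by (subst nn_integral_multc) (auto simp: mult.commute)
 also have "\<dots> = (\<integral>\<^sup>+x. (\<integral>\<^sup>+h. ennreal (indicator E x * \<bar>\<phi> x\<bar>) * indicator ?C h \<partial>lborel) \<partial>lborel)"
  by (intro nn_integral_cong) (simp add: nn_integral_cmult_indicator)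
 also have "\<dots> <= (\<integral>\<^sup>+x. (\<integral>\<^sup>+h. ennreal \<bar>\<phi> (x + h) - \<phi> x\<bar> * indicator ?C h + ennreal (indicator E x * \<bar>\<phi> (x + h)\<bar>) \<partial>lborel) \<partial>lborel)"
 proof (intro nn_integral_mono)
  fix x h :: "real^'n"
  show "ennreal (indicator E x * \<bar>\<phi> x\<bar>) * indicator ?C h
   <= ennreal \<bar>\<phi> (x + h) - \<phi> x\<bar> * indicator ?C h + ennreal (indicator E x * \<bar>\<phi> (x + h)\<bar>)"
   by (auto simp: indicator_def intro!: ennreal_leI simp flip: ennreal_plus)
 qed
 also have "\<dots> = (\<integral>\<^sup>+x. (\<integral>\<^sup>+h. ennreal \<bar>\<phi> (x + h) - \<phi> x\<bar> * indicator ?C h \<partial>lborel) \<partial>lborel)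
   + (\<integral>\<^sup>+x. (\<integral>\<^sup>+h. ennreal (indicator E x * \<bar>\<phi> (x + h)\<bar>) \<partial>lborel) \<partial>lborel)"
  by (subst nn_integral_add[symmetric]; (measurable)?) (intro nn_integral_cong nn_integral_add; measurable)
 also have "(\<integral>\<^sup>+x. (\<integral>\<^sup>+h. ennreal (indicator E x * \<bar>\<phi> (x + h)\<bar>) \<partial>lborel) \<partial>lborel) = ?E * ?N"
 proof -
  have "(\<integral>\<^sup>+h. ennreal (indicator E x * \<bar>\<phi> (x + h)\<bar>) \<partial>lborel) = indicator E x * ?N" for x
   using nn_integral_lborel_translate[of "\<lambda>h. ennreal \<bar>\<phi> h\<bar>" x] by (auto simp: indicator_def add.commute)
  then show ?thesis by (simp add: nn_integral_multc)
 qed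
 also have "(\<integral>\<^sup>+x. (\<integral>\<^sup>+h. ennreal \<bar>\<phi> (x + h) - \<phi> x\<bar> * indicator ?C h \<partial>lborel) \<partial>lborel)
   = (\<integral>\<^sup>+h. (\<integral>\<^sup>+x. ennreal \<bar>\<phi> (x + h) - \<phi> x\<bar> * indicator ?C h \<partial>lborel) \<partial>lborel)"
  by (rule lborel_pair.Fubini') measurable
 also have "\<dots> <= (\<integral>\<^sup>+h. (ennreal r * ?I) * indicator ?C h \<partial>lborel)"
 proof (rule nn_integral_mono)
  fix h :: "real^'n"
  show "(\<integral>\<^sup>+x. ennreal \<bar>\<phi> (x + h) - \<phi> x\<bar> * indicator ?C h \<partial>lborel) <= (ennreal r * ?I) * indicator ?C h"
  proof (cases "norm h <= r")
   case True
   have "(\<integral>\<^sup>+x. ennreal \<bar>\<phi> (x + h) - \<phi> x\<bar> \<partial>lborel) <= ennreal (norm h) * ?I"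
    using test_fun_translate_le[OF \<phi>, of UNIV h] by simp
   also have "\<dots> <= ennreal r * ?I" using True by (intro mult_right_mono ennreal_leI) auto
   finally show ?thesis using True by simp
  qed simp
 qed
 also have "\<dots> = ?B' * ?I" by (subst nn_integral_cmult_indicator) (auto simp: mult_ac)
 finally show ?thesis by (simp add: add_mono)
qed

section \<open>Poincare-type inequalities for test functions\<close>

lemma nn_integral_lborel_eq_lebesgue:
 assumes "f \<in> borel_measurable borel" "integrable lebesgue f" "\<And>x. 0 <= f x"
 shows "(\<integral>\<^sup>+x. ennreal (f x) \<partial>lborel) = ennreal (LINT x|lebesgue. f x)"
proof -
 have "integrable lborel f" using assms by (simp add: integrable_completion)
 then show ?thesis using assms by (simp add: nn_integral_eq_integral integral_completion)
qed

lemma emeasure_cball_eq: "emeasure lborel (cball z r) = ennreal (measure lborel (cball (z::'a::euclidean_space) r))"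
 using emeasure_lborel_cball_finite[of z r] by (intro emeasure_eq_ennreal_measure) auto

text \<open>Average \<open>\<bar>\<phi> x\<bar> <= \<bar>\<phi> y - \<phi> x\<bar> + \<bar>\<phi>
  y\<bar>\<close> over \<open>x\<close> in \<open>D\<close> and \<open>y\<close> in
  \<open>Z\<close>. When the function vanishes on \<open>Z\<close>, this becomes the Poincare
  inequality behind De Giorgi's level set estimate.\<close>

lemma test_fun_poincare_add:
 fixes \<phi> :: "real^'n => real"
 assumes \<phi>: "\<phi> \<in> test_fun \<O>" and D: "convex D" and [measurable]: "D \<in> sets borel" "Z \<in> sets borel" and Z: "Z \<subseteq> D"
  and d: "\<And>x y. x \<in> D ==> y \<in> D ==> norm (y - x) <= d" "d > 0" and fin: "emeasure lborel D < \<infinity>"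
 shows "measure lborel Z * (LINT x|lebesgue. indicator D x * \<bar>\<phi> x\<bar>)
  <= d * measure lborel (cball (0::real^'n) d) * (LINT x|lebesgue. indicator D x * grad1 \<phi> x)
    + measure lborel D * (LINT x|lebesgue. indicator Z x * \<bar>\<phi> x\<bar>)"
proof -
 note [measurable] = test_fun_borel[OF \<phi>] test_fun_grad1_borel[OF \<phi>]
 let ?P = "\<lambda>A. \<integral>\<^sup>+x. ennreal (indicator A x * \<bar>\<phi> x\<bar>) \<partial>lborel"
 let ?G = "\<integral>\<^sup>+x. ennreal (indicator D x * grad1 \<phi> x) \<partial>lborel"
 have "?P D * emeasure lborel Z = (\<integral>\<^sup>+x. ennreal (indicator D x * \<bar>\<phi> x\<bar>) * emeasure lborel Z \<partial>lborel)"
  by (simp add: nn_integral_multc)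
 also have "\<dots> = (\<integral>\<^sup>+x. (\<integral>\<^sup>+y. ennreal (indicator D x * \<bar>\<phi> x\<bar>) * indicator Z y \<partial>lborel) \<partial>lborel)"
  by (intro nn_integral_cong) (simp add: nn_integral_cmult_indicator)
 also have "\<dots> <= (\<integral>\<^sup>+x. (\<integral>\<^sup>+y. ennreal (indicator D x * indicator D y * \<bar>\<phi> y - \<phi> x\<bar>)
   + indicator D x * ennreal (indicator Z y * \<bar>\<phi> y\<bar>) \<partial>lborel) \<partial>lborel)"
 proof (intro nn_integral_mono)
  fix x y :: "real^'n"
  show "ennreal (indicator D x * \<bar>\<phi> x\<bar>) * indicator Z y
   <= ennreal (indicator D x * indicator D y * \<bar>\<phi> y - \<phi> x\<bar>) + indicator D x * ennreal (indicator Z y * \<bar>\<phi> y\<bar>)"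
   using Z by (auto simp: indicator_def intro!: ennreal_leI simp flip: ennreal_plus)
 qed
 also have "\<dots> = (\<integral>\<^sup>+x. (\<integral>\<^sup>+y. ennreal (indicator D x * indicator D y * \<bar>\<phi> y - \<phi> x\<bar>) \<partial>lborel) \<partial>lborel)
  + (\<integral>\<^sup>+x. (\<integral>\<^sup>+y. indicator D x * ennreal (indicator Z y * \<bar>\<phi> y\<bar>) \<partial>lborel) \<partial>lborel)"
  by (subst nn_integral_add[symmetric]; (measurable)?) (intro nn_integral_cong nn_integral_add; measurable)
 also have "\<dots> <= ennreal d * emeasure lborel (cball (0::real^'n) d) * ?G + emeasure lborel D * ?P Z"
  using test_fun_double_le[OF \<phi> D _ d] by (intro add_mono) (simp_all add: nn_integral_cmult nn_integral_multc)
 finally have *: "?P D * emeasure lborel Z <= ennreal d * emeasure lborel (cball (0::real^'n) d) * ?G + emeasure lborel D * ?P Z" .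
 have iP: "integrable lebesgue (\<lambda>x. indicator A x * \<bar>\<phi> x\<bar>)" if "A \<in> sets borel" for A
  using integrable_mult_indicator[OF _ integrable_abs[OF test_fun_integrable[OF \<phi>]], of A] that by simp
 have P: "?P A = ennreal (LINT x|lebesgue. indicator A x * \<bar>\<phi> x\<bar>)" if [measurable]: "A \<in> sets borel" for A
  by (rule nn_integral_lborel_eq_lebesgue[OF _ iP]) (use that in auto)
 have ig: "integrable lebesgue (grad1 \<phi>)"
  unfolding grad1_def by (intro Bochner_Integration.integrable_sum integrable_abs test_fun_integrable[OF test_fun_partial[OF \<phi>]])
 have G: "?G = ennreal (LINT x|lebesgue. indicator D x * grad1 \<phi> x)"
  by (rule nn_integral_lborel_eq_lebesgue) (use integrable_mult_indicator[OF _ ig, of D] in auto)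
 have eD: "emeasure lborel D = ennreal (measure lborel D)"
  using fin by (intro emeasure_eq_ennreal_measure) auto
 have "emeasure lborel Z <= emeasure lborel D" using Z by (intro emeasure_mono) auto
 then have eZ: "emeasure lborel Z = ennreal (measure lborel Z)"
  using fin by (intro emeasure_eq_ennreal_measure) (auto simp: top_unique)
 have nn: "0 <= (LINT x|lebesgue. indicator A x * \<bar>\<phi> x\<bar>)" "0 <= (LINT x|lebesgue. indicator D x * grad1 \<phi> x)" for A
  by (auto intro!: integral_nonneg_AE)
 show ?thesis
  using * d(2) nn unfolding P[OF \<open>D \<in> sets borel\<close>] P[OF \<open>Z \<in> sets borel\<close>] G eD eZ emeasure_cball_eq
  by (simp add: mult.commute flip: ennreal_mult ennreal_plus)
qed

text \<open>\<open>measure lborel D * \<phi> x\<close> minus the integral of \<open>\<phi>\<close>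
  is the integral over \<open>y\<close> in \<open>D\<close> of \<open>\<phi> x - \<phi> y\<close>,
  so the double integral estimate applies. The mean value inequality is kept multiplied by the
  volume to avoid a division.\<close>

lemma test_fun_mean_le:
 fixes \<phi> :: "real^'n => real"
 assumes \<phi>: "\<phi> \<in> test_fun \<O>" and D: "convex D" and [measurable]: "D \<in> sets borel"
  and d: "\<And>x y. x \<in> D ==> y \<in> D ==> norm (y - x) <= d" "d > 0" and fin: "emeasure lborel D < \<infinity>"
 shows "(LINT x|lebesgue. indicator D x * \<bar>measure lborel D * \<phi> x - (LINT y|lebesgue. indicator D y * \<phi> y)\<bar>)
  <= d * measure lborel (cball (0::real^'n) d) * (LINT x|lebesgue. indicator D x * grad1 \<phi> x)"
proof -
 note [measurable] = test_fun_borel[OF \<phi>] test_fun_grad1_borel[OF \<phi>]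
 let ?m = "measure lborel D"
 let ?F = "\<lambda>x. indicator D x * \<bar>?m * \<phi> x - (LINT y|lebesgue. indicator D y * \<phi> y)\<bar>"
 have iphi: "integrable lborel \<phi>" using test_fun_integrable[OF \<phi>] by (simp add: integrable_completion)
 have i1: "integrable lborel (\<lambda>y. indicator D y * \<phi> y)"
  using integrable_mult_indicator[OF _ iphi, of D] by simp
 have i2: "integrable lborel (\<lambda>y. indicator D y * c)" for c :: real
  using fin by (simp add: integrable_indicator_iff)
 have "(\<integral>\<^sup>+x. ennreal (?F x) \<partial>lborel)
   <= (\<integral>\<^sup>+x. (\<integral>\<^sup>+y. ennreal (indicator D x * indicator D y * \<bar>\<phi> y - \<phi> x\<bar>) \<partial>lborel) \<partial>lborel)"
 proof (rule nn_integral_mono)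
  fix x :: "real^'n"
  have "?m * \<phi> x = (LINT y|lborel. indicator D y * \<phi> x)" using fin by simp
  moreover have "(LINT y|lebesgue. indicator D y * \<phi> y) = (LINT y|lborel. indicator D y * \<phi> y)"
   by (rule integral_completion) measurable
  ultimately have "(LINT y|lebesgue. indicator D y * \<phi> y) - ?m * \<phi> x = (LINT y|lborel. indicator D y * (\<phi> y - \<phi> x))"
   using Bochner_Integration.integral_diff[OF i1 i2[of "\<phi> x"]] by (simp add: right_diff_distrib)
  moreover have "integrable lborel (\<lambda>y. indicator D y * (\<phi> y - \<phi> x))"
   using Bochner_Integration.integrable_diff[OF i1 i2[of "\<phi> x"]] by (simp add: right_diff_distrib)
  ultimately have "ennreal \<bar>?m * \<phi> x - (LINT y|lebesgue. indicator D y * \<phi> y)\<bar> <= (\<integral>\<^sup>+y. ennreal (norm (indicator D y * (\<phi> y - \<phi> x))) \<partial>lborel)"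
   using integral_norm_bound_ennreal[of lborel "\<lambda>y. indicator D y * (\<phi> y - \<phi> x)"]
   by (subst abs_minus_commute) simp
  then show "ennreal (?F x) <= (\<integral>\<^sup>+y. ennreal (indicator D x * indicator D y * \<bar>\<phi> y - \<phi> x\<bar>) \<partial>lborel)"
   by (cases "x \<in> D") (auto simp: abs_mult)
 qed
 also have "\<dots> <= ennreal d * emeasure lborel (cball (0::real^'n) d) * (\<integral>\<^sup>+x. ennreal (indicator D x * grad1 \<phi> x) \<partial>lborel)"
  using test_fun_double_le[OF \<phi> D _ d] by simp
 finally have *: "(\<integral>\<^sup>+x. ennreal (?F x) \<partial>lborel) <= \<dots>" .
 have ig: "integrable lebesgue (grad1 \<phi>)"
  unfolding grad1_def by (intro Bochner_Integration.integrable_sum integrable_abs test_fun_integrable[OF test_fun_partial[OF \<phi>]])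
 have G: "(\<integral>\<^sup>+x. ennreal (indicator D x * grad1 \<phi> x) \<partial>lborel) = ennreal (LINT x|lebesgue. indicator D x * grad1 \<phi> x)"
  by (rule nn_integral_lborel_eq_lebesgue) (use integrable_mult_indicator[OF _ ig, of D] in auto)
 have "integrable lborel (\<lambda>x. ?m * (indicator D x * \<phi> x) - indicator D x * (LINT y|lebesgue. indicator D y * \<phi> y))"
  by (intro Bochner_Integration.integrable_diff integrable_mult_right i1 i2)
 then have "integrable lborel (\<lambda>x. \<bar>?m * (indicator D x * \<phi> x) - indicator D x * (LINT y|lebesgue. indicator D y * \<phi> y)\<bar>)"
  by (rule integrable_abs)
 also have "(\<lambda>x. \<bar>?m * (indicator D x * \<phi> x) - indicator D x * (LINT y|lebesgue. indicator D y * \<phi> y)\<bar>) = ?F"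
  by (auto simp: indicator_def fun_eq_iff)
 finally have iF: "integrable lebesgue ?F" by (subst integrable_completion) auto
 have F: "(\<integral>\<^sup>+x. ennreal (?F x) \<partial>lborel) = ennreal (LINT x|lebesgue. ?F x)"
  by (rule nn_integral_lborel_eq_lebesgue[OF _ iF]) auto
 have nn: "0 <= (LINT x|lebesgue. indicator D x * grad1 \<phi> x)" by (auto intro!: integral_nonneg_AE)
 show ?thesis using * d(2) nn unfolding F G emeasure_cball_eq by (simp flip: ennreal_mult)
qed

text \<open>Difference quotients have integral 0 by translation invariance. They are bounded by a
  common constant and vanish off the ball of radius \<open>R + 1\<close>, since the shifts have
  length at most 1, so dominated convergence passes this on to the derivative.\<close>

lemma test_fun_partial_integral_0:
 fixes \<phi> :: "real^'n => real"
 assumes \<phi>: "\<phi> \<in> test_fun \<O>"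
 shows "(LINT x|lebesgue. partial_deriv i \<phi> x) = 0"
proof -
 have d: "\<phi> differentiable (at y)" for y by (intro smooth_fun_differentiable test_fun_smooth[OF \<phi>])
 let ?e = "axis i 1 :: real^'n"
 obtain K where K: "compact K" "\<And>x. x \<notin> K ==> \<phi> x = 0" using test_fun_compact_support[OF \<phi>] by blast
 obtain C where C: "\<And>x. \<bar>partial_deriv i \<phi> x\<bar> <= C" using test_fun_bounded[OF test_fun_partial[OF \<phi>]] by blast
 obtain R where R: "\<And>x. x \<in> K ==> norm x <= R" using compact_imp_bounded[OF K(1)] unfolding bounded_iff by blast
 define s where "s n x = real (Suc n) * (\<phi> (x + (1 / real (Suc n)) *\<^sub>R ?e) - \<phi> x)" for n x
 have i\<phi>: "integrable lborel \<phi>" using test_fun_integrable[OF \<phi>] test_fun_borel[OF \<phi>] by (simp add: integrable_completion)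
 have "(\<lambda>n. LINT x|lborel. s n x) \<longlonglongrightarrow> (LINT x|lborel. partial_deriv i \<phi> x)"
 proof (rule integral_dominated_convergence[where w = "\<lambda>x. C * indicator (cball (0::real^'n) (R + 1)) x"])
  show "partial_deriv i \<phi> \<in> borel_measurable lborel" using test_fun_borel[OF test_fun_partial[OF \<phi>]] by simp
  show "s n \<in> borel_measurable lborel" for n using test_fun_borel[OF \<phi>] unfolding s_def by measurable
  show "integrable lborel (\<lambda>x. C * indicator (cball (0::real^'n) (R + 1)) x)"
   by (intro integrable_mult_right) (use emeasure_lborel_cball_finite[of "0::real^'n" "R + 1"] in \<open>simp add: integrable_indicator_iff\<close>)
  have "(\<lambda>n. s n x) \<longlonglongrightarrow> partial_deriv i \<phi> x" for x
  proof -
   have "((\<lambda>t. \<phi> (x + t *\<^sub>R ?e)) has_field_derivative partial_deriv i \<phi> x) (at 0)"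
    using test_fun_line_deriv[OF \<phi>, of x ?e 0 UNIV]
    by (simp add: has_real_derivative_iff_has_vector_derivative partial_deriv_def)
   then have "((\<lambda>h. (\<phi> (x + h *\<^sub>R ?e) - \<phi> x) / h) \<longlongrightarrow> partial_deriv i \<phi> x) (at 0)" by (simp add: DERIV_def)
   moreover have "filterlim (\<lambda>n. 1 / real (Suc n)) (at 0) sequentially"
    unfolding filterlim_at using LIMSEQ_Suc[OF lim_1_over_n] by auto
   ultimately have "(\<lambda>n. (\<phi> (x + (1 / real (Suc n)) *\<^sub>R ?e) - \<phi> x) / (1 / real (Suc n))) \<longlonglongrightarrow> partial_deriv i \<phi> x"
    by (rule filterlim_compose)
   then show ?thesis unfolding s_def by (simp add: mult.commute del: of_nat_Suc)
  qed
  then show "AE x in lborel. (\<lambda>n. s n x) \<longlonglongrightarrow> partial_deriv i \<phi> x" by simp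
  have "norm (s n x) <= C * indicator (cball (0::real^'n) (R + 1)) x" for n x
  proof (cases "norm x <= R + 1")
   case True
   have "\<bar>\<phi> (x + (1 / real (Suc n)) *\<^sub>R ?e) - \<phi> (x + 0 *\<^sub>R ?e)\<bar> <= C * \<bar>1 / real (Suc n) - 0\<bar>"
   proof (rule field_differentiable_bound[of UNIV "\<lambda>t. \<phi> (x + t *\<^sub>R ?e)" "\<lambda>t. partial_deriv i \<phi> (x + t *\<^sub>R ?e)", simplified real_norm_def])
    show "((\<lambda>t. \<phi> (x + t *\<^sub>R ?e)) has_field_derivative partial_deriv i \<phi> (x + t *\<^sub>R ?e)) (at t within UNIV)" for t
     using test_fun_line_deriv[OF \<phi>, of x ?e t UNIV]
     by (simp add: has_real_derivative_iff_has_vector_derivative partial_deriv_def)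
   qed (use C in auto)
   then have "real (Suc n) * \<bar>\<phi> (x + (1 / real (Suc n)) *\<^sub>R ?e) - \<phi> x\<bar> <= C"
    by (simp add: pos_le_divide_eq mult.commute del: of_nat_Suc)
   then show ?thesis using True by (simp add: s_def abs_mult del: of_nat_Suc)
  next
   case False
   have "norm x <= norm (x + (1 / real (Suc n)) *\<^sub>R ?e) + norm ((1 / real (Suc n)) *\<^sub>R ?e)"
    using norm_triangle_ineq4[of "x + (1 / real (Suc n)) *\<^sub>R ?e" "(1 / real (Suc n)) *\<^sub>R ?e"] by simp
   moreover have "norm ((1 / real (Suc n)) *\<^sub>R ?e) <= 1" by simp
   ultimately have "\<not> norm x <= R" "\<not> norm (x + (1 / real (Suc n)) *\<^sub>R ?e) <= R" using False by linarith+
   then have "x \<notin> K" "x + (1 / real (Suc n)) *\<^sub>R ?e \<notin> K" using R by blast+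
   then show ?thesis using K(2) False by (simp add: s_def)
  qed
  then show "AE x in lborel. norm (s n x) <= C * indicator (cball (0::real^'n) (R + 1)) x" for n by simp
 qed
 moreover have "(LINT x|lborel. s n x) = 0" for n
 proof -
  let ?h = "(1 / real (Suc n)) *\<^sub>R ?e"
  have "(LINT x|lborel. \<phi> x) = (LINT x|lborel. \<phi> (x + ?h))"
   using lborel_integral_real_affine[of 1] lborel_distr_plus[of ?h] integral_distr[of "(+) ?h" lborel borel \<phi>] test_fun_borel[OF \<phi>]
   by (simp add: add.commute)
  moreover have "integrable lborel (\<lambda>x. \<phi> (x + ?h))"
   using lborel_distr_plus[of ?h] integrable_distr_eq[of "(+) ?h" lborel borel \<phi>] test_fun_borel[OF \<phi>] i\<phi>
   by (simp add: add.commute)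
  ultimately show ?thesis using i\<phi> by (simp add: s_def)
 qed
 ultimately have "(LINT x|lborel. partial_deriv i \<phi> x) = 0" by (simp add: LIMSEQ_const_iff)
 then show ?thesis using test_fun_borel[OF test_fun_partial[OF \<phi>]] by (simp add: integral_completion)
qed

lemma test_fun_integration_by_parts:
 fixes \<phi> \<psi> :: "real^'n => real"
 assumes \<phi>: "\<phi> \<in> test_fun \<O>" and \<psi>: "\<psi> \<in> test_fun \<O>'"
 shows "(LINT x|lebesgue. \<phi> x * partial_deriv i \<psi> x) = - (LINT x|lebesgue. partial_deriv i \<phi> x * \<psi> x)"
proof -
 have "partial_deriv i (\<lambda>x. \<phi> x * \<psi> x) x = \<phi> x * partial_deriv i \<psi> x + partial_deriv i \<phi> x * \<psi> x" for x
  by (intro partial_deriv_mult smooth_fun_differentiable test_fun_smooth[OF \<phi>] test_fun_smooth[OF \<psi>])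
 moreover have "(\<lambda>x. \<phi> x * \<psi> x) \<in> test_fun \<O>'" by (rule test_fun_mult[OF \<psi> test_fun_smooth[OF \<phi>]])
 ultimately have "(LINT x|lebesgue. \<phi> x * partial_deriv i \<psi> x + partial_deriv i \<phi> x * \<psi> x) = 0"
  using test_fun_partial_integral_0[of "\<lambda>x. \<phi> x * \<psi> x" \<O>' i] by simp
 moreover have "integrable lebesgue (\<lambda>x. \<phi> x * partial_deriv i \<psi> x)" "integrable lebesgue (\<lambda>x. partial_deriv i \<phi> x * \<psi> x)"
  by (intro sqint_mult test_fun_sqint[OF \<phi>] test_fun_sqint[OF \<psi>] test_fun_sqint[OF test_fun_partial[OF \<phi>]] test_fun_sqint[OF test_fun_partial[OF \<psi>]])+
 ultimately show ?thesis by simp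
qed

lemma tendsto_norm_bound:
 fixes f :: "nat => 'a::real_normed_vector"
 assumes "\<And>m. norm (f m - l) <= g m" "g \<longlonglongrightarrow> 0"
 shows "f \<longlonglongrightarrow> l"
proof -
 have "(\<lambda>m. norm (f m - l)) \<longlonglongrightarrow> 0"
  by (rule tendsto_sandwich[OF _ _ tendsto_const assms(2)]) (use assms(1) in auto)
 then show ?thesis by (rule LIM_zero_cancel[OF tendsto_norm_zero_cancel])
qed

subsection \<open>The Sobolev space as a closed subspace of a product of \<open>L\<^sup>2\<close> spaces\<close>

type_synonym 'n sob = "(real^'n) L2 \<times> (((real^'n) L2)^'n)"

definition emb :: "(real^'n => real) => 'n sob" where
 "emb \<phi> = (cls \<phi>, \<chi> i. cls (partial_deriv i \<phi>))"

text \<open>\<open>H\<^sub>0\<^sup>1\<close> by completion: functions together with their gradients,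
  inside the Hilbert space of tuples. Being a closed subspace by construction, it carries Hilbert
  space arguments directly.\<close>

definition sob0 :: "(real^'n) set => 'n sob set" where
 "sob0 \<O> = closure (emb ` test_fun \<O>)"

lemma closed_sob0: "closed (sob0 \<O>)"
 by (simp add: sob0_def)

lemma emb_in_sob0: "\<phi> \<in> test_fun \<O> ==> emb \<phi> \<in> sob0 \<O>"
 unfolding sob0_def by (rule subsetD[OF closure_subset]) simp

text \<open>The density principle used throughout: a condition defining a closed set needs checking
  on test functions only.\<close>

lemma sob0_minimal:
 assumes "p \<in> sob0 \<O>" "closed S" "\<And>\<phi>. \<phi> \<in> test_fun \<O> ==> emb \<phi> \<in> S"
 shows "p \<in> S"
 using closure_minimal[of "emb ` test_fun \<O>" S] assms by (auto simp: sob0_def)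

lemma sob0_le:
 assumes "p \<in> sob0 \<O>" "continuous_on UNIV f" "continuous_on UNIV g"
  "\<And>\<phi>. \<phi> \<in> test_fun \<O> ==> f (emb \<phi>) <= (g (emb \<phi>) :: real)"
 shows "f p <= g p"
proof -
 have "p \<in> {p. f p <= g p}"
  by (rule sob0_minimal[OF assms(1)]) (use assms in \<open>auto intro: closed_Collect_le\<close>)
 then show ?thesis by simp
qed

lemma emb_add:
 assumes "\<phi> \<in> test_fun \<O>" "\<psi> \<in> test_fun \<O>" shows "emb \<phi> + emb \<psi> = emb (\<lambda>x. \<phi> x + \<psi> x)"
proof -
 have "partial_deriv i (\<lambda>x. \<phi> x + \<psi> x) = (\<lambda>x. partial_deriv i \<phi> x + partial_deriv i \<psi> x)" for i
  using assms by (intro ext partial_deriv_add smooth_fun_differentiable) (auto simp: test_fun_smooth)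
 then show ?thesis using test_fun_sqint[OF assms(1)] test_fun_sqint[OF assms(2)]
   test_fun_sqint[OF test_fun_partial[OF assms(1)]] test_fun_sqint[OF test_fun_partial[OF assms(2)]]
  by (simp add: emb_def cls_add vec_eq_iff)
qed

lemma emb_scaleR:
 assumes "\<phi> \<in> test_fun \<O>" shows "c *\<^sub>R emb \<phi> = emb (\<lambda>x. c * \<phi> x)"
proof -
 have "partial_deriv i (\<lambda>x. c * \<phi> x) = (\<lambda>x. c * partial_deriv i \<phi> x)" for i
 proof
  fix x
  have "partial_deriv i (\<lambda>x::real^'a. c) x = 0" by (rule partial_deriv_eqI[OF has_derivative_const])
  then show "partial_deriv i (\<lambda>x. c * \<phi> x) x = c * partial_deriv i \<phi> x"
   using partial_deriv_mult[of "\<lambda>x. c" x \<phi> i] smooth_fun_differentiable[OF test_fun_smooth[OF assms]]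
   by (simp add: differentiable_const)
 qed
 then show ?thesis using test_fun_sqint[OF assms] test_fun_sqint[OF test_fun_partial[OF assms]]
  by (simp add: emb_def cls_scaleR vec_eq_iff)
qed

lemma subspace_sob0: "subspace (sob0 \<O>)"
proof -
 have s: "subspace (emb ` test_fun \<O>)" unfolding subspace_def
 proof (intro conjI ballI allI)
  have "0 *\<^sub>R emb (\<lambda>x. 0) = (0 :: 'a sob)" by simp
  moreover have "0 *\<^sub>R emb (\<lambda>x. 0) \<in> emb ` test_fun \<O>"
   unfolding emb_scaleR[OF test_fun_zero[of \<O>]] by (intro imageI test_fun_scale test_fun_zero)
  ultimately show "0 \<in> emb ` test_fun \<O>" by simp
 qed (auto simp: emb_add[of _ \<O>] emb_scaleR[of _ \<O>] intro: test_fun_add test_fun_scale)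
 have c: "((\<lambda>n. f n + g n) \<longlonglongrightarrow> x + y)" if "f \<longlonglongrightarrow> x" "g \<longlonglongrightarrow> y" for f g and x y :: "'a sob"
  using that by (rule tendsto_add)
 show ?thesis unfolding subspace_def sob0_def
 proof (intro conjI ballI allI)
  show "0 \<in> closure (emb ` test_fun \<O>)" by (rule subsetD[OF closure_subset subspace_0[OF s]])
  fix x y assume "x \<in> closure (emb ` test_fun \<O>)" "y \<in> closure (emb ` test_fun \<O>)"
  then obtain f g where "\<And>n::nat. f n \<in> emb ` test_fun \<O>" "f \<longlonglongrightarrow> x" "\<And>n::nat. g n \<in> emb ` test_fun \<O>" "g \<longlonglongrightarrow> y"
   unfolding closure_sequential by blast
  then show "x + y \<in> closure (emb ` test_fun \<O>)"
   unfolding closure_sequential using c subspace_add[OF s] by (intro exI[of _ "\<lambda>n. f n + g n"]) auto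
 next
  fix c :: real and x assume "x \<in> closure (emb ` test_fun \<O>)"
  then obtain f where "\<And>n::nat. f n \<in> emb ` test_fun \<O>" "f \<longlonglongrightarrow> x" unfolding closure_sequential by blast
  then show "c *\<^sub>R x \<in> closure (emb ` test_fun \<O>)" unfolding closure_sequential using subspace_scale[OF s]
   by (intro exI[of _ "\<lambda>n. c *\<^sub>R f n"]) (auto intro: tendsto_scaleR)
 qed
qed

lemma sob0_seq:
 assumes "p \<in> sob0 \<O>"
 obtains \<phi> where "\<And>n::nat. \<phi> n \<in> test_fun \<O>" "(\<lambda>n. emb (\<phi> n)) \<longlonglongrightarrow> p"
proof -
 obtain f where f: "\<And>n::nat. f n \<in> emb ` test_fun \<O>" "f \<longlonglongrightarrow> p"
  using assms unfolding sob0_def closure_sequential by blast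
 then have "\<forall>n. \<exists>\<phi>. \<phi> \<in> test_fun \<O> \<and> f n = emb \<phi>" by blast
 then obtain \<phi> where \<phi>: "\<And>n. \<phi> n \<in> test_fun \<O>" "\<And>n. f n = emb (\<phi> n)" by metis
 then have "f = (\<lambda>n. emb (\<phi> n))" by auto
 then show thesis using f(2) by (intro that[of \<phi>] \<phi>(1)) simp
qed

lemma tendsto_sobD:
 assumes "(f \<longlongrightarrow> (p :: 'n::finite sob)) F"
 shows "((\<lambda>n. fst (f n)) \<longlongrightarrow> fst p) F" "((\<lambda>n. snd (f n) $ i) \<longlongrightarrow> snd p $ i) F"
 using assms by (auto intro: tendsto_fst tendsto_snd tendsto_vec_nth)

lemma tendsto_sobI:
 assumes "((\<lambda>n. fst (f n)) \<longlongrightarrow> fst p) F" "\<And>i. ((\<lambda>n. snd (f n) $ i) \<longlongrightarrow> snd p $ i) F"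
 shows "(f \<longlongrightarrow> (p :: 'n::finite sob)) F"
proof -
 have "((\<lambda>n. (fst (f n), snd (f n))) \<longlongrightarrow> (fst p, snd p)) F"
  using assms by (intro tendsto_Pair vec_tendstoI) auto
 then show ?thesis by simp
qed

lemma continuous_on_mul: "bmeas c ==> continuous_on A f ==> continuous_on A (\<lambda>p. mul c (f p))"
 using bounded_linear.continuous_on[OF mul_bounded_linear] .

lemma mul_indicator_eq_0: "A \<in> sets lebesgue ==> mul (indicator A) u = 0 \<longleftrightarrow> (AE x\<in>A in lebesgue. fn u x = 0)"
proof -
 assume A: "A \<in> sets lebesgue"
 have "mul (indicator A) u = 0 \<longleftrightarrow> (AE x in lebesgue. indicator A x * fn u x = 0)"
  unfolding mul_def cls_zero[symmetric]
  by (rule cls_eq_iff) (auto intro!: sqint_bmeas_mult bmeas_indicator A)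
 also have "\<dots> \<longleftrightarrow> (AE x\<in>A in lebesgue. fn u x = 0)" by (intro AE_cong) (auto simp: indicator_def)
 finally show ?thesis .
qed

text \<open>Vanishing off \<open>\<O>\<close> means that a continuous multiplication operator sends
  the class to 0, which is a closed condition and true for test functions.\<close>

lemma sob0_zero_outside:
 assumes p: "p \<in> sob0 \<O>" and "open \<O>"
 shows "AE x in lebesgue. x \<notin> \<O> --> fn (fst p) x = 0" "AE x in lebesgue. x \<notin> \<O> --> fn (snd p $ i) x = 0"
proof -
 have m: "- \<O> \<in> sets lebesgue" using assms by (auto simp: borel_open)
 note b = bmeas_indicator[OF m]
 have z: "mul (indicator (- \<O>)) (cls \<phi>) = 0" if t: "\<phi> \<in> test_fun \<O>" for \<phi>
 proof -
  obtain K where "K \<subseteq> \<O>" "\<And>x. x \<notin> K ==> \<phi> x = 0" using test_fun_compact_support[OF t] by blast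
  then have "(\<lambda>x. indicator (- \<O>) x * \<phi> x) = (\<lambda>x. 0)" by (auto simp: indicator_def fun_eq_iff)
  then show ?thesis using mul_cls[OF b test_fun_sqint[OF t]] by (simp add: cls_zero)
 qed
 have "p \<in> {p. mul (indicator (- \<O>)) (fst p) = 0}" by (rule sob0_minimal[OF p])
   (auto intro!: closed_Collect_eq continuous_on_mul[OF b] continuous_intros simp: emb_def z)
 then show "AE x in lebesgue. x \<notin> \<O> --> fn (fst p) x = 0" using mul_indicator_eq_0[OF m] by simp
 have "p \<in> {p. mul (indicator (- \<O>)) (snd p $ i) = 0}" by (rule sob0_minimal[OF p])
   (auto intro!: closed_Collect_eq continuous_on_mul[OF b] continuous_intros simp: emb_def z test_fun_partial)
 then show "AE x in lebesgue. x \<notin> \<O> --> fn (snd p $ i) x = 0" using mul_indicator_eq_0[OF m] by simp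
qed

subsection \<open>Functional inequalities\<close>

definition L1_on :: "'a::euclidean_space set => 'a L2 => real" where
 "L1_on A u = (LINT x|lebesgue. indicator A x * \<bar>fn u x\<bar>)"

lemma indicator_power2: "(indicator A x :: real)\<^sup>2 = indicator A x"
 by (simp add: indicator_def)

lemma sqint_indicator: "A \<in> lmeasurable ==> sqint (indicator A)"
 unfolding sqint_def by (auto simp: fmeasurable_def integrable_indicator_iff indicator_power2 intro!: integrable_real_indicator)

lemma L1_on_eq_inner: "A \<in> lmeasurable ==> L1_on A u = cls (indicator A) \<bullet> cls (\<lambda>x. \<bar>fn u x\<bar>)"
 by (subst inner_cls) (auto simp: L1_on_def sqint_indicator sqint_abs)

lemma L1_on_integrable: "A \<in> lmeasurable ==> integrable lebesgue (\<lambda>x. indicator A x * \<bar>fn u x\<bar>)"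
 by (intro sqint_mult sqint_indicator sqint_abs) auto

lemma L1_on_cls: "sqint f ==> A \<in> sets lebesgue ==> L1_on A (cls f) = (LINT x|lebesgue. indicator A x * \<bar>f x\<bar>)"
 unfolding L1_on_def
 by (rule integral_cong_AE) (use fn_cls[of f] in \<open>auto dest: sqint_meas intro!: borel_measurable_times\<close>)

lemma L1_on_nonneg: "0 <= L1_on A u"
 unfolding L1_on_def by (intro integral_nonneg_AE) auto

lemma norm_cls_indicator: "A \<in> lmeasurable ==> norm (cls (indicator A)) = sqrt (measure lebesgue A)"
proof -
 assume A: "A \<in> lmeasurable"
 have "(norm (cls (indicator A :: 'a => real)))\<^sup>2 = measure lebesgue A"
  unfolding norm_sq_cls[OF sqint_indicator[OF A]] using A by (simp add: indicator_power2)
 then show ?thesis by (metis norm_ge_zero real_sqrt_unique)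
qed

lemma L1_on_le: "A \<in> lmeasurable ==> L1_on A u <= sqrt (measure lebesgue A) * norm u"
 using norm_cauchy_schwarz[of "cls (indicator A)" "cls (\<lambda>x. \<bar>fn u x\<bar>)"]
 by (simp add: L1_on_eq_inner norm_cls_indicator norm_cls_abs[of "fn u"])

lemma L1_on_diff_le:
 assumes "A \<in> lmeasurable" shows "\<bar>L1_on A u - L1_on A v\<bar> <= L1_on A (u - v)"
proof -
 have *: "L1_on A u <= L1_on A v + L1_on A (u - v)" for u v :: "'a L2"
 proof -
  have "L1_on A u <= (LINT x|lebesgue. indicator A x * \<bar>fn v x\<bar> + indicator A x * \<bar>fn (u - v) x\<bar>)"
   unfolding L1_on_def
  proof (rule integral_mono_AE)
   show "AE x in lebesgue. indicator A x * \<bar>fn u x\<bar> <= indicator A x * \<bar>fn v x\<bar> + indicator A x * \<bar>fn (u - v) x\<bar>"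
    using fn_diff[of u v] by eventually_elim (auto simp: indicator_def)
  qed (intro Bochner_Integration.integrable_add L1_on_integrable assms)+
  also have "\<dots> = L1_on A v + L1_on A (u - v)"
   unfolding L1_on_def by (intro Bochner_Integration.integral_add L1_on_integrable assms)
  finally show ?thesis .
 qed
 have "L1_on A (v - u) = L1_on A (u - v)" unfolding L1_on_def
  by (rule integral_cong_AE) (use fn_diff[of u v] fn_diff[of v u] assms in auto)
 then show ?thesis using *[of u v] *[of v u] by linarith
qed

text \<open>On a set of finite measure Cauchy-Schwarz makes the \<open>L\<^sup>1\<close> norm
  Lipschitz for the \<open>L\<^sup>2\<close> norm; this lets the \<open>L\<^sup>1\<close>
  inequalities pass from test functions to their closure.\<close>

lemma continuous_on_L1_on:
 assumes "A \<in> lmeasurable" "continuous_on S f" shows "continuous_on S (\<lambda>p. L1_on A (f p))"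
proof -
 have "continuous_on UNIV (L1_on A)"
 proof (rule continuous_onI)
  fix u :: "'a L2" and e :: real assume e: "e > 0"
  define s where "s = sqrt (measure lebesgue A)"
  have s: "s \<ge> 0" by (simp add: s_def)
  show "\<exists>d>0. \<forall>v\<in>UNIV. dist v u < d --> dist (L1_on A v) (L1_on A u) <= e"
  proof (intro exI[of _ "e / (s + 1)"] conjI ballI impI)
   show "e / (s + 1) > 0" using e s by simp
   fix v assume v: "dist v u < e / (s + 1)"
   have "dist (L1_on A v) (L1_on A u) <= s * dist v u"
    using L1_on_diff_le[OF assms(1), of v u] L1_on_le[OF assms(1), of "v - u"]
    by (simp add: dist_norm s_def)
   also have "\<dots> <= s * (e / (s + 1))" using v s by (intro mult_left_mono) auto
   also have "\<dots> <= e" using e s by (simp add: field_simps)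
   finally show "dist (L1_on A v) (L1_on A u) <= e" .
  qed
 qed
 from continuous_on_compose2[OF this assms(2)] show ?thesis by auto
qed

lemma bounded_borel_lmeasurable: "bounded A ==> A \<in> sets borel ==> A \<in> lmeasurable"
 by (intro bounded_set_imp_lmeasurable) auto

lemma lmeasurable_emeasure_finite: "A \<in> lmeasurable ==> A \<in> sets borel ==> emeasure lborel A < \<infinity>"
 by (simp add: fmeasurable_def)

lemma L1_on_grad1:
 assumes "\<phi> \<in> test_fun \<O>" "D \<in> lmeasurable"
 shows "(LINT x|lebesgue. indicator D x * grad1 \<phi> x) = (\<Sum>i\<in>UNIV. L1_on D (cls (partial_deriv i \<phi>)))"
proof -
 have "integrable lebesgue (\<lambda>x. indicator D x * \<bar>partial_deriv i \<phi> x\<bar>)" for i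
  by (intro sqint_mult sqint_indicator assms sqint_abs test_fun_sqint[OF test_fun_partial[OF assms(1)]])
 then have "(LINT x|lebesgue. indicator D x * grad1 \<phi> x) = (\<Sum>i\<in>UNIV. LINT x|lebesgue. indicator D x * \<bar>partial_deriv i \<phi> x\<bar>)"
  unfolding grad1_def sum_distrib_left by (intro Bochner_Integration.integral_sum) auto
 then show ?thesis
  using assms(2) test_fun_sqint[OF test_fun_partial[OF assms(1)]] by (simp add: L1_on_cls fmeasurableD)
qed

lemma sob0_poincare_add:
 fixes p :: "'n::finite sob"
 assumes p: "p \<in> sob0 \<O>" and D: "convex D" "D \<in> sets borel" "bounded D" and Z: "Z \<subseteq> D" "Z \<in> sets borel"
  and d: "\<And>x y. x \<in> D ==> y \<in> D ==> norm (y - x) <= d" "d > 0"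
 shows "measure lborel Z * L1_on D (fst p)
  <= d * measure lborel (cball (0::real^'n) d) * (\<Sum>i\<in>UNIV. L1_on D (snd p $ i))
    + measure lborel D * L1_on Z (fst p)"
proof -
 have lD: "D \<in> lmeasurable" and lZ: "Z \<in> lmeasurable"
  using D Z bounded_subset by (auto intro!: bounded_borel_lmeasurable)
 show ?thesis
 proof (rule sob0_le[OF p])
  fix \<phi> assume \<phi>: "\<phi> \<in> test_fun \<O>"
  show "measure lborel Z * L1_on D (fst (emb \<phi>))
  <= d * measure lborel (cball (0::real^'n) d) * (\<Sum>i\<in>UNIV. L1_on D (snd (emb \<phi>) $ i))
    + measure lborel D * L1_on Z (fst (emb \<phi>))"
   using test_fun_poincare_add[OF \<phi> D(1,2) Z(2,1) d lmeasurable_emeasure_finite[OF lD D(2)]]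
    L1_on_grad1[OF \<phi> lD] lD lZ test_fun_sqint[OF \<phi>] by (simp add: emb_def L1_on_cls fmeasurableD)
 qed (intro continuous_intros continuous_on_L1_on lD lZ)+
qed

lemma sob0_mean_le:
 fixes p :: "'n::finite sob"
 assumes p: "p \<in> sob0 \<O>" and D: "convex D" "D \<in> sets borel" "bounded D"
  and d: "\<And>x y. x \<in> D ==> y \<in> D ==> norm (y - x) <= d" "d > 0"
 shows "L1_on D (measure lborel D *\<^sub>R fst p - (cls (indicator D) \<bullet> fst p) *\<^sub>R cls (indicator D))
  <= d * measure lborel (cball (0::real^'n) d) * (\<Sum>i\<in>UNIV. L1_on D (snd p $ i))"
proof -
 have lD: "D \<in> lmeasurable" using D by (auto intro!: bounded_borel_lmeasurable)
 show ?thesis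
 proof (rule sob0_le[OF p])
  fix \<phi> assume \<phi>: "\<phi> \<in> test_fun \<O>"
  note s = test_fun_sqint[OF \<phi>] sqint_indicator[OF lD]
  let ?c = "LINT y|lebesgue. indicator D y * \<phi> y"
  have "measure lborel D *\<^sub>R cls \<phi> - (cls (indicator D) \<bullet> cls \<phi>) *\<^sub>R cls (indicator D)
    = cls (\<lambda>x. measure lborel D * \<phi> x - ?c * indicator D x)"
   by (simp add: s cls_scaleR inner_cls cls_diff sqint_scale)
  then have "L1_on D (measure lborel D *\<^sub>R cls \<phi> - (cls (indicator D) \<bullet> cls \<phi>) *\<^sub>R cls (indicator D))
    = (LINT x|lebesgue. indicator D x * \<bar>measure lborel D * \<phi> x - ?c * indicator D x\<bar>)"
   using lD by (simp add: L1_on_cls s sqint_scale sqint_diff fmeasurableD)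
  also have "\<dots> = (LINT x|lebesgue. indicator D x * \<bar>measure lborel D * \<phi> x - ?c\<bar>)"
   by (intro Bochner_Integration.integral_cong) (auto simp: indicator_def)
  finally show "L1_on D (measure lborel D *\<^sub>R fst (emb \<phi>) - (cls (indicator D) \<bullet> fst (emb \<phi>)) *\<^sub>R cls (indicator D))
  <= d * measure lborel (cball (0::real^'n) d) * (\<Sum>i\<in>UNIV. L1_on D (snd (emb \<phi>) $ i))"
   using test_fun_mean_le[OF \<phi> D(1,2) d lmeasurable_emeasure_finite[OF lD D(2)]] L1_on_grad1[OF \<phi> lD]
   by (simp add: emb_def)
 qed (intro continuous_intros continuous_on_L1_on lD)+
qed

lemma sqint_prod_le: "sqint f ==> sqint g ==> (LINT x|lebesgue. \<bar>f x\<bar> * \<bar>g x\<bar>) <= norm (cls f) * norm (cls g)"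
 using norm_cauchy_schwarz[of "cls (\<lambda>x. \<bar>f x\<bar>)" "cls (\<lambda>x. \<bar>g x\<bar>)"]
 by (simp add: inner_cls sqint_abs norm_cls_abs)

text \<open>\<open>test_fun_average_le\<close> applied to \<open>\<phi>\<^sup>2\<close>: its
  gradient is \<open>2 * \<phi>\<close> times that of \<open>\<phi>\<close>, and Cauchy-Schwarz
  bounds its integral by a product of norms.\<close>

lemma test_fun_average_sq_le:
 fixes \<phi> :: "real^'n => real"
 assumes \<phi>: "\<phi> \<in> test_fun \<O>" and E[measurable]: "E \<in> sets borel" "emeasure lborel E < \<infinity>" and r: "r > 0"
 shows "measure lborel (cball (0::real^'n) r) * (LINT x|lebesgue. indicator E x * (\<phi> x)\<^sup>2)
  <= r * measure lborel (cball (0::real^'n) r) * (2 * norm (cls \<phi>) * (\<Sum>i\<in>UNIV. norm (cls (partial_deriv i \<phi>))))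
    + measure lborel E * (norm (cls \<phi>))\<^sup>2"
proof -
 note s = test_fun_sqint[OF \<phi>] test_fun_sqint[OF test_fun_partial[OF \<phi>]]
 have \<psi>: "(\<lambda>x. \<phi> x * \<phi> x) \<in> test_fun \<O>" by (rule test_fun_mult[OF \<phi> test_fun_smooth[OF \<phi>]])
 note [measurable] = test_fun_borel[OF \<phi>] test_fun_grad1_borel[OF \<psi>]
 have pd: "partial_deriv i (\<lambda>x. \<phi> x * \<phi> x) x = 2 * (\<phi> x * partial_deriv i \<phi> x)" for i x
  by (subst partial_deriv_mult) (auto intro: smooth_fun_differentiable test_fun_smooth[OF \<phi>])
 let ?B = "measure lborel (cball (0::real^'n) r)"
 have ig: "integrable lebesgue (grad1 (\<lambda>x. \<phi> x * \<phi> x))"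
  unfolding grad1_def by (intro Bochner_Integration.integrable_sum integrable_abs test_fun_integrable[OF test_fun_partial[OF \<psi>]])
 have "(LINT x|lebesgue. grad1 (\<lambda>x. \<phi> x * \<phi> x) x) = (\<Sum>i\<in>UNIV. LINT x|lebesgue. 2 * (\<bar>\<phi> x\<bar> * \<bar>partial_deriv i \<phi> x\<bar>))"
  unfolding grad1_def pd abs_mult abs_numeral
  by (intro Bochner_Integration.integral_sum integrable_mult_right sqint_mult sqint_abs s)
 also have "\<dots> <= (\<Sum>i\<in>UNIV. 2 * (norm (cls \<phi>) * norm (cls (partial_deriv i \<phi>))))"
  by (intro sum_mono) (simp add: sqint_prod_le s)
 also have "\<dots> = 2 * norm (cls \<phi>) * (\<Sum>i\<in>UNIV. norm (cls (partial_deriv i \<phi>)))"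
  by (simp add: sum_distrib_left mult.assoc)
 finally have g: "(LINT x|lebesgue. grad1 (\<lambda>x. \<phi> x * \<phi> x) x) <= \<dots>" .
 have g0: "0 <= (LINT x|lebesgue. grad1 (\<lambda>x. \<phi> x * \<phi> x) x)" by (auto intro!: integral_nonneg_AE)
 have nG: "(\<integral>\<^sup>+x. ennreal (grad1 (\<lambda>x. \<phi> x * \<phi> x) x) \<partial>lborel) = ennreal (LINT x|lebesgue. grad1 (\<lambda>x. \<phi> x * \<phi> x) x)"
  by (rule nn_integral_lborel_eq_lebesgue[OF _ ig]) auto
 have iq: "integrable lebesgue (\<lambda>x. (\<phi> x)\<^sup>2)" using s by (simp add: sqint_def)
 have nN: "(\<integral>\<^sup>+x. ennreal \<bar>\<phi> x * \<phi> x\<bar> \<partial>lborel) = ennreal ((norm (cls \<phi>))\<^sup>2)"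
  unfolding norm_sq_cls[OF s(1)] using nn_integral_lborel_eq_lebesgue[OF _ iq]
  by (simp add: power2_eq_square)
 have iE: "integrable lebesgue (\<lambda>x. indicator E x * (\<phi> x)\<^sup>2)"
  using integrable_mult_indicator[OF _ iq, of E] by simp
 have nE: "(\<integral>\<^sup>+x. ennreal (indicator E x * \<bar>\<phi> x * \<phi> x\<bar>) \<partial>lborel) = ennreal (LINT x|lebesgue. indicator E x * (\<phi> x)\<^sup>2)"
  using nn_integral_lborel_eq_lebesgue[OF _ iE] by (simp add: power2_eq_square)
 have E0: "0 <= (LINT x|lebesgue. indicator E x * (\<phi> x)\<^sup>2)" by (auto intro!: integral_nonneg_AE)
 have eE: "emeasure lborel E = ennreal (measure lborel E)"
  using E by (intro emeasure_eq_ennreal_measure) auto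
 have "?B * (LINT x|lebesgue. indicator E x * (\<phi> x)\<^sup>2) <= r * ?B * (LINT x|lebesgue. grad1 (\<lambda>x. \<phi> x * \<phi> x) x)
    + measure lborel E * (norm (cls \<phi>))\<^sup>2" using test_fun_average_le[OF \<psi> E(1) r] r g0 E0
  unfolding nG nN nE eE emeasure_cball_eq by (simp flip: ennreal_mult ennreal_plus)
 also have "\<dots> <= r * ?B * (2 * norm (cls \<phi>) * (\<Sum>i\<in>UNIV. norm (cls (partial_deriv i \<phi>)))) + measure lborel E * (norm (cls \<phi>))\<^sup>2"
  using g r by (intro add_mono mult_left_mono) auto
 finally show ?thesis .
qed

text \<open>Faber--Krahn: averaging over a ball much larger than the support halves the function.\<close>

lemma sob0_faber_krahn:
 fixes p :: "'n::finite sob"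
 assumes p: "p \<in> sob0 \<O>" and E: "E \<in> lmeasurable" and z: "AE x in lebesgue. x \<notin> E --> fn (fst p) x = 0"
  and r: "r > 0" "2 * measure lebesgue E <= measure lborel (cball (0::real^'n) r)"
 shows "norm (fst p) <= 4 * r * (\<Sum>i\<in>UNIV. norm (snd p $ i))"
proof -
 have "E \<in> sets (completion lborel)" using E by (simp add: fmeasurableD)
 \<comment> \<open>The averaging estimate needs a Borel set, while superlevel sets are only Lebesgue
   measurable; a Borel part that misses only a null set suffices.\<close>
 then obtain S N N' where S: "E = S \<union> N" "N \<subseteq> N'" "N' \<in> null_sets lborel" "S \<in> sets lborel"
  by (rule sets_completionE)
 have nN: "AE x in lebesgue. x \<notin> N'" using S(3) by (intro AE_completion AE_not_in)
 have m: "measure lborel S <= measure lebesgue E"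
  using S E measure_mono_fmeasurable[of S E lebesgue] by (auto simp: measure_completion)
 have fS: "S \<in> lmeasurable" using S E by (intro fmeasurableI2[OF E]) auto
 have zS: "AE x in lebesgue. x \<notin> S --> fn (fst p) x = 0" using z nN by eventually_elim (use S in auto)
 let ?B = "measure lborel (cball (0::real^'n) r)"
 have B: "?B > 0" using r(1) by (simp add: content_cball_pos)
 have bS: "bmeas (indicator S)" using S by (intro bmeas_indicator) auto
 have "?B * (norm (mul (indicator S) (fst p)))\<^sup>2
  <= r * ?B * (2 * norm (fst p) * (\<Sum>i\<in>UNIV. norm (snd p $ i))) + measure lborel S * (norm (fst p))\<^sup>2"
 proof (rule sob0_le[OF p])
  fix \<phi> assume \<phi>: "\<phi> \<in> test_fun \<O>"
  have "(norm (mul (indicator S) (cls \<phi>)))\<^sup>2 = (LINT x|lebesgue. indicator S x * (\<phi> x)\<^sup>2)"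
   using test_fun_sqint[OF \<phi>] by (simp add: mul_cls[OF bS] norm_sq_cls sqint_bmeas_mult[OF bS] power_mult_distrib indicator_power2)
  then show "?B * (norm (mul (indicator S) (fst (emb \<phi>))))\<^sup>2
  <= r * ?B * (2 * norm (fst (emb \<phi>)) * (\<Sum>i\<in>UNIV. norm (snd (emb \<phi>) $ i))) + measure lborel S * (norm (fst (emb \<phi>)))\<^sup>2"
   using test_fun_average_sq_le[OF \<phi> _ _ r(1), of S] S lmeasurable_emeasure_finite[OF fS] by (simp add: emb_def)
 qed (intro continuous_intros continuous_on_mul[OF bS])+
 moreover have "mul (indicator S) (fst p) = fst p"
  by (rule L2_eqI) (use fn_mul[OF bS, of "fst p"] zS in \<open>eventually_elim, auto simp: indicator_def\<close>)
 \<comment> \<open>Here the scale \<open>r\<close> pays off: the term without a gradient is at most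
   half of the left side and is absorbed, which doubles the constant 2 to 4.\<close>
 moreover have "measure lborel S * (norm (fst p))\<^sup>2 <= (?B / 2) * (norm (fst p))\<^sup>2"
  using m r(2) by (intro mult_right_mono) auto
 ultimately have "?B * (norm (fst p))\<^sup>2 <= r * ?B * (2 * norm (fst p) * (\<Sum>i\<in>UNIV. norm (snd p $ i))) + (?B / 2) * (norm (fst p))\<^sup>2"
  by simp
 then have "?B * (norm (fst p) * norm (fst p)) <= ?B * (norm (fst p) * (4 * r * (\<Sum>i\<in>UNIV. norm (snd p $ i))))"
  by (simp add: power2_eq_square algebra_simps)
 then have "norm (fst p) * norm (fst p) <= norm (fst p) * (4 * r * (\<Sum>i\<in>UNIV. norm (snd p $ i)))"
  using B by (simp only: mult_le_cancel_left_pos)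
 then show ?thesis using r(1) by (cases "norm (fst p) = 0") (auto intro!: mult_nonneg_nonneg sum_nonneg)
qed

subsection \<open>Truncations\<close>

text \<open>The pair formed by \<open>\<eta>\<close> times the positive part of \<open>u - k\<close>
  and the gradient that the product and chain rules predict. On the level set itself the gradient is
  taken to be 0, in agreement with the limit of \<open>trunc_approx'\<close> at 0.\<close>

definition trunc :: "(real^'n => real) => real => 'n sob => 'n sob" where
 "trunc \<eta> k p = (cls (\<lambda>x. \<eta> x * max 0 (fn (fst p) x - k)),
  \<chi> i. cls (\<lambda>x. partial_deriv i \<eta> x * max 0 (fn (fst p) x - k) + \<eta> x * (if fn (fst p) x > k then fn (snd p $ i) x else 0)))"

lemma trunc_approx_lipschitz: "\<bar>trunc_approx n s - trunc_approx n t\<bar> <= \<bar>s - t\<bar>"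
 using field_differentiable_bound[of UNIV "trunc_approx n" "trunc_approx' n" 1 s t]
  trunc_approx_deriv trunc_approx'_bounds by (auto simp: has_field_derivative_at_within abs_le_iff)

lemma trunc_approx_cont: "continuous_on A (trunc_approx n)"
 using DERIV_continuous_on[of A "trunc_approx n"] trunc_approx_deriv has_field_derivative_at_within by blast

lemma trunc_approx'_cont: "continuous_on A (trunc_approx' n)"
 unfolding trunc_approx'_def
 by (intro continuous_intros continuous_on_compose2[OF flat_exp_continuous[of UNIV]]) auto

lemma trunc_approx_meas [measurable]: "trunc_approx n \<in> borel_measurable borel" "trunc_approx' n \<in> borel_measurable borel"
 by (intro borel_measurable_continuous_onI trunc_approx_cont trunc_approx'_cont)+

lemma sqint_cutoff_affine:
 assumes c: "c \<in> test_fun \<O>" shows "sqint (\<lambda>x. \<bar>c x\<bar> * (\<bar>fn u x\<bar> + \<bar>k\<bar>))"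
proof -
 have "sqint (\<lambda>x. c x * fn u x)" by (intro sqint_bmeas_mult test_fun_bmeas[OF c]) simp
 then have "sqint (\<lambda>x. \<bar>c x * fn u x\<bar> + \<bar>k\<bar> * \<bar>c x\<bar>)"
  by (intro sqint_add sqint_abs sqint_scale test_fun_sqint[OF c])
 then show ?thesis by (simp add: abs_mult algebra_simps)
qed

text \<open>There are two ways to keep the support inside \<open>\<O>\<close>: for
  \<open>k \<ge> 0\<close> the truncation vanishes wherever \<open>\<phi>\<close> does, otherwise
  the cutoff must itself be supported in \<open>\<O>\<close>. The first case makes boundary points
  accessible to De Giorgi's method.\<close>

lemma trunc_test_fun:
 assumes \<phi>: "\<phi> \<in> test_fun \<O>" and \<eta>: "\<eta> \<in> test_fun UNIV" and k: "k \<ge> 0 \<or> closure {x. \<eta> x \<noteq> 0} \<subseteq> \<O>"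
 shows "(\<lambda>x. \<eta> x * trunc_approx n (\<phi> x - k)) \<in> test_fun \<O>"
proof -
 have sm: "smooth_fun (\<lambda>x. \<eta> x * trunc_approx n (\<phi> x - k))"
  using \<phi> \<eta> by (intro smooth_fun_mult smooth_fun_trunc_approx smooth_fun_diff) (auto simp: test_fun_smooth)
 show ?thesis
 proof (cases "k \<ge> 0")
  case True
  obtain K where K: "compact K" "K \<subseteq> \<O>" "\<And>x. x \<notin> K ==> \<phi> x = 0" using test_fun_compact_support[OF \<phi>] by blast
  have "trunc_approx n (0 - k) = 0" using True trunc_approx_bounds[of n "- k"] by simp
  then show ?thesis by (intro test_funI[OF sm K(1,2)]) (use K(3) in auto)
 next
  case False
  show ?thesis by (rule test_funI[OF sm, of "closure {x. \<eta> x \<noteq> 0}"])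
    (use False k \<eta> closure_subset[of "{x. \<eta> x \<noteq> 0}"] in \<open>auto simp: test_fun_iff\<close>)
 qed
qed

text \<open>Smooth truncation sends test functions to test functions. For an approximating sequence
  the terms without derivative converge by Lipschitz continuity, the gradient terms along a
  subsequence that also converges almost everywhere.\<close>

lemma trunc_approx_in_sob0:
 fixes p :: "'n::finite sob"
 assumes p: "p \<in> sob0 \<O>" and \<eta>: "\<eta> \<in> test_fun UNIV" and k: "k \<ge> 0 \<or> closure {x. \<eta> x \<noteq> 0} \<subseteq> \<O>"
 shows "(cls (\<lambda>x. \<eta> x * trunc_approx n (fn (fst p) x - k)),
  \<chi> i. cls (\<lambda>x. partial_deriv i \<eta> x * trunc_approx n (fn (fst p) x - k) + \<eta> x * (trunc_approx' n (fn (fst p) x - k) * fn (snd p $ i) x)))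
  \<in> sob0 \<O>" (is "?q \<in> _")
proof -
 obtain \<phi>0 where \<phi>0: "\<And>m::nat. \<phi>0 m \<in> test_fun \<O>" "(\<lambda>m. emb (\<phi>0 m)) \<longlonglongrightarrow> p" using sob0_seq[OF p] by blast
 have "(\<lambda>m. cls (\<phi>0 m)) \<longlonglongrightarrow> fst p" using tendsto_sobD(1)[OF \<phi>0(2)] by (simp add: emb_def)
 then obtain r where r: "strict_mono r" "AE x in lebesgue. (\<lambda>m. fn (cls (\<phi>0 (r m))) x) \<longlonglongrightarrow> fn (fst p) x"
  using L2_AE_subseq by blast
 define \<phi> where "\<phi> m = \<phi>0 (r m)" for m
 have \<phi>: "\<phi> m \<in> test_fun \<O>" for m using \<phi>0 by (simp add: \<phi>_def)
 have l\<phi>: "(\<lambda>m. emb (\<phi> m)) \<longlonglongrightarrow> p" using LIMSEQ_subseq_LIMSEQ[OF \<phi>0(2) r(1)] by (simp add: \<phi>_def comp_def)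
 have l1: "(\<lambda>m. cls (\<phi> m)) \<longlonglongrightarrow> fst p" using tendsto_sobD(1)[OF l\<phi>] by (simp add: emb_def)
 have l2: "(\<lambda>m. cls (partial_deriv i (\<phi> m))) \<longlonglongrightarrow> snd p $ i" for i using tendsto_sobD(2)[OF l\<phi>, of i] by (simp add: emb_def)
 have "AE x in lebesgue. \<forall>m. fn (cls (\<phi> m)) x = \<phi> m x"
  using fn_cls[OF test_fun_sqint[OF \<phi>]] by (simp add: AE_all_countable)
 with r(2) have ae: "AE x in lebesgue. (\<lambda>m. \<phi> m x) \<longlonglongrightarrow> fn (fst p) x" by eventually_elim (simp add: \<phi>_def)
 have m\<phi>[measurable]: "\<phi> m \<in> borel_measurable lebesgue" "partial_deriv i (\<phi> m) \<in> borel_measurable lebesgue" for m i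
  using test_fun_meas[OF \<phi>] test_fun_meas[OF test_fun_partial[OF \<phi>]] by auto
 have sv: "sqint (\<lambda>x. c x * trunc_approx n (v x - k))" if c: "c \<in> test_fun UNIV" and v: "sqint v" for c v
 proof (rule sqint_mono_AE[OF _ sqint_cutoff_affine[OF c, of "cls v" k]])
  have [measurable]: "c \<in> borel_measurable lebesgue" "v \<in> borel_measurable lebesgue"
   using c v by (auto simp: test_fun_meas sqint_meas)
  show "(\<lambda>x. c x * trunc_approx n (v x - k)) \<in> borel_measurable lebesgue" by measurable
  show "AE x in lebesgue. \<bar>c x * trunc_approx n (v x - k)\<bar> <= \<bar>\<bar>c x\<bar> * (\<bar>fn (cls v) x\<bar> + \<bar>k\<bar>)\<bar>"
   using fn_cls[OF v]
  proof eventually_elim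
   case (elim x)
   have "\<bar>trunc_approx n (v x - k)\<bar> <= \<bar>v x\<bar> + \<bar>k\<bar>"
    using trunc_approx_bounds[of n "v x - k"] by (auto simp: max_def split: if_splits)
   then show ?case using elim by (auto simp: abs_mult intro!: mult_left_mono)
  qed
 qed
 have lin: "(\<lambda>m. cls (\<lambda>x. c x * trunc_approx n (\<phi> m x - k))) \<longlonglongrightarrow> cls (\<lambda>x. c x * trunc_approx n (fn (fst p) x - k))"
  if c: "c \<in> test_fun UNIV" for c
 proof -
  obtain C where C: "\<And>x. \<bar>c x\<bar> <= C" using test_fun_bounded[OF c] by blast
  have C0: "C \<ge> 0" using C[of 0] by linarith
  have "norm (cls (\<lambda>x. c x * trunc_approx n (\<phi> m x - k)) - cls (\<lambda>x. c x * trunc_approx n (fn (fst p) x - k))) <= C * norm (cls (\<phi> m) - fst p)" for m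
  proof -
   have "norm (cls (\<lambda>x. c x * trunc_approx n (\<phi> m x - k) - c x * trunc_approx n (fn (fst p) x - k)))
     <= norm (cls (\<lambda>x. C * (\<phi> m x - fn (fst p) x)))"
   proof (rule norm_cls_mono)
    show "sqint (\<lambda>x. C * (\<phi> m x - fn (fst p) x))"
     by (intro sqint_scale sqint_diff test_fun_sqint[OF \<phi>]) simp
    show "AE x in lebesgue. \<bar>c x * trunc_approx n (\<phi> m x - k) - c x * trunc_approx n (fn (fst p) x - k)\<bar> <= \<bar>C * (\<phi> m x - fn (fst p) x)\<bar>"
    proof (rule AE_I2)
     fix x
     have "\<bar>c x\<bar> * \<bar>trunc_approx n (\<phi> m x - k) - trunc_approx n (fn (fst p) x - k)\<bar> <= C * \<bar>\<phi> m x - fn (fst p) x\<bar>"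
      using C trunc_approx_lipschitz[of n "\<phi> m x - k" "fn (fst p) x - k"] C0 by (intro mult_mono) auto
     then show "\<bar>c x * trunc_approx n (\<phi> m x - k) - c x * trunc_approx n (fn (fst p) x - k)\<bar> <= \<bar>C * (\<phi> m x - fn (fst p) x)\<bar>"
      using C0 by (simp add: abs_mult flip: right_diff_distrib)
    qed
   qed (intro sqint_diff sv c test_fun_sqint[OF \<phi>] sqint_fn)
   also have "cls (\<lambda>x. C * (\<phi> m x - fn (fst p) x)) = C *\<^sub>R (cls (\<phi> m) - cls (fn (fst p)))"
    by (simp add: cls_diff cls_scaleR sqint_diff test_fun_sqint[OF \<phi>] del: cls_fn)
   finally show ?thesis using C0 by (simp add: cls_diff sv c test_fun_sqint[OF \<phi>])
  qed
  moreover have "(\<lambda>m. C * norm (cls (\<phi> m) - fst p)) \<longlonglongrightarrow> 0"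
   using tendsto_mult[OF tendsto_const[of C] tendsto_norm[OF LIM_zero[OF l1]]] by simp
  ultimately show ?thesis by (rule tendsto_norm_bound)
 qed
 obtain C where C: "\<And>x. \<bar>\<eta> x\<bar> <= C" using test_fun_bounded[OF \<eta>] by blast
 have C0: "C \<ge> 0" using C[of 0] by linarith
 have [measurable]: "\<eta> \<in> borel_measurable lebesgue" using test_fun_meas[OF \<eta>] .
 have bm: "bmeas (\<lambda>x. \<eta> x * trunc_approx' n (\<phi> m x - k))" for m
 proof -
  have "\<bar>\<eta> x * trunc_approx' n (\<phi> m x - k)\<bar> <= C" for x
   using mult_mono[OF C[of x], of "\<bar>trunc_approx' n (\<phi> m x - k)\<bar>" 1] trunc_approx'_bounds C0 by (simp add: abs_mult)
  then show ?thesis unfolding bmeas_def by (intro conjI exI[of _ C]) auto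
 qed
 have le: "\<bar>\<eta> x * trunc_approx' n t\<bar> <= C" for x t
  using mult_mono[OF C[of x], of "\<bar>trunc_approx' n t\<bar>" 1] trunc_approx'_bounds C0 by (simp add: abs_mult)
 \<comment> \<open>A product of varying bounded factors with convergent derivatives is split: the
   uniform bound handles the change of the derivative, dominated convergence the change of the
   factor on the fixed limit derivative.\<close>
 have g2: "(\<lambda>m. mul (\<lambda>x. \<eta> x * trunc_approx' n (\<phi> m x - k)) (cls (partial_deriv i (\<phi> m))))
   \<longlonglongrightarrow> cls (\<lambda>x. \<eta> x * (trunc_approx' n (fn (fst p) x - k) * fn (snd p $ i) x))" (is "?f \<longlonglongrightarrow> ?l") for i
 proof -
  have "(\<lambda>m. cls (\<lambda>x. \<eta> x * (trunc_approx' n (\<phi> m x - k) * fn (snd p $ i) x))) \<longlonglongrightarrow> ?l"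
  proof (rule L2_dominated_convergence(3))
   show "sqint (\<lambda>x. C * \<bar>fn (snd p $ i) x\<bar>)" by (intro sqint_scale sqint_abs) simp
   show "AE x in lebesgue. \<bar>\<eta> x * (trunc_approx' n (\<phi> m x - k) * fn (snd p $ i) x)\<bar> <= C * \<bar>fn (snd p $ i) x\<bar>" for m
    using mult_right_mono[OF le] by (auto simp: abs_mult simp flip: mult.assoc)
   show "AE x in lebesgue. (\<lambda>m. \<eta> x * (trunc_approx' n (\<phi> m x - k) * fn (snd p $ i) x)) \<longlonglongrightarrow> \<eta> x * (trunc_approx' n (fn (fst p) x - k) * fn (snd p $ i) x)"
    using ae
   proof eventually_elim
    case (elim x)
    have "(\<lambda>m. trunc_approx' n (\<phi> m x - k)) \<longlonglongrightarrow> trunc_approx' n (fn (fst p) x - k)"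
     by (rule continuous_on_tendsto_compose[OF trunc_approx'_cont[of UNIV]]) (auto intro!: tendsto_intros elim)
    then show ?case by (intro tendsto_intros)
   qed
  qed measurable
  then have a: "(\<lambda>m. mul (\<lambda>x. \<eta> x * trunc_approx' n (\<phi> m x - k)) (snd p $ i)) \<longlonglongrightarrow> ?l"
   by (simp add: mul_def mult.assoc)
  have "(\<lambda>m. mul (\<lambda>x. \<eta> x * trunc_approx' n (\<phi> m x - k)) (cls (partial_deriv i (\<phi> m)) - snd p $ i)) \<longlonglongrightarrow> 0"
  proof (rule tendsto_norm_zero_cancel, rule tendsto_sandwich[OF _ _ tendsto_const])
   show "(\<lambda>m. C * norm (cls (partial_deriv i (\<phi> m)) - snd p $ i)) \<longlonglongrightarrow> 0"
    using tendsto_mult[OF tendsto_const[of C] tendsto_norm[OF LIM_zero[OF l2[of i]]]] by simp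
  qed (use norm_mul_le[OF bm le] in auto)
  from tendsto_add[OF this a] show ?thesis by (simp add: mul_diff[OF bm])
 qed
 let ?\<psi> = "\<lambda>m x. \<eta> x * trunc_approx n (\<phi> m x - k)"
 have pd: "partial_deriv i (?\<psi> m) x = partial_deriv i \<eta> x * trunc_approx n (\<phi> m x - k) + \<eta> x * (trunc_approx' n (\<phi> m x - k) * partial_deriv i (\<phi> m) x)" for i m x
 proof -
  have d: "\<phi> m differentiable (at x)" "\<eta> differentiable (at x)"
   using smooth_fun_differentiable test_fun_smooth[OF \<phi>] test_fun_smooth[OF \<eta>] by auto
  have sm: "smooth_fun (\<lambda>x. \<phi> m x - k)" using test_fun_smooth[OF \<phi>] by auto
  have "(\<lambda>x. - k) differentiable (at x)" by (rule differentiable_const)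
  moreover have "partial_deriv i (\<lambda>x. - k) x = 0" by (rule partial_deriv_eqI[OF has_derivative_const])
  ultimately have "partial_deriv i (\<lambda>x. \<phi> m x - k) x = partial_deriv i (\<phi> m) x"
   using partial_deriv_add[OF d(1), of "\<lambda>x. - k" i] by simp
  moreover have "partial_deriv i (\<lambda>x. trunc_approx n (\<phi> m x - k)) x = trunc_approx' n (\<phi> m x - k) * partial_deriv i (\<lambda>x. \<phi> m x - k) x"
   by (rule partial_deriv_compose[OF smooth_fun_differentiable[OF sm] trunc_approx_deriv])
  moreover have "partial_deriv i (?\<psi> m) x = \<eta> x * partial_deriv i (\<lambda>x. trunc_approx n (\<phi> m x - k)) x + partial_deriv i \<eta> x * trunc_approx n (\<phi> m x - k)"
   by (rule partial_deriv_mult[OF d(2) smooth_fun_differentiable[OF smooth_fun_trunc_approx[OF sm]]])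
  ultimately show ?thesis by simp
 qed
 have lim: "(\<lambda>m. emb (?\<psi> m)) \<longlonglongrightarrow> ?q"
 proof (rule tendsto_sobI)
  show "(\<lambda>m. fst (emb (?\<psi> m))) \<longlonglongrightarrow> fst ?q" using lin[OF \<eta>] by (simp add: emb_def)
  fix i
  have sG: "sqint (\<lambda>x. \<eta> x * (trunc_approx' n (fn (fst p) x - k) * fn (snd p $ i) x))"
   using sqint_bounded_mult[of "\<lambda>x. \<eta> x * trunc_approx' n (fn (fst p) x - k)" C "fn (snd p $ i)"] le
   by (simp add: mult.assoc)
  have s2: "sqint (\<lambda>x. \<eta> x * (trunc_approx' n (\<phi> m x - k) * partial_deriv i (\<phi> m) x))" for m
   using sqint_bmeas_mult[OF bm test_fun_sqint[OF test_fun_partial[OF \<phi>]]] by (simp add: mult.assoc)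
  have "cls (partial_deriv i (?\<psi> m)) = cls (\<lambda>x. partial_deriv i \<eta> x * trunc_approx n (\<phi> m x - k))
   + mul (\<lambda>x. \<eta> x * trunc_approx' n (\<phi> m x - k)) (cls (partial_deriv i (\<phi> m)))" for m
   unfolding pd[abs_def] mul_cls[OF bm test_fun_sqint[OF test_fun_partial[OF \<phi>]]]
   by (subst cls_add) (auto simp: mult.assoc intro!: sv test_fun_partial[OF \<eta>] test_fun_sqint[OF \<phi>] s2)
  moreover have "snd ?q $ i = cls (\<lambda>x. partial_deriv i \<eta> x * trunc_approx n (fn (fst p) x - k))
   + cls (\<lambda>x. \<eta> x * (trunc_approx' n (fn (fst p) x - k) * fn (snd p $ i) x))"
   by (simp add: cls_add sv sG test_fun_partial[OF \<eta>])
  ultimately show "(\<lambda>m. snd (emb (?\<psi> m)) $ i) \<longlonglongrightarrow> snd ?q $ i"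
   using tendsto_add[OF lin[OF test_fun_partial[OF \<eta>]] g2[of i]] by (simp add: emb_def)
 qed
 have "emb (?\<psi> m) \<in> sob0 \<O>" for m by (intro emb_in_sob0 trunc_test_fun \<phi> \<eta> k)
 then show ?thesis by (rule closed_sequentially[OF closed_sob0 _ lim])
qed

lemma sqint_cutoff_pos:
 assumes c: "c \<in> test_fun UNIV" shows "sqint (\<lambda>x. c x * max 0 (fn u x - k))"
proof (rule sqint_mono_AE[OF _ sqint_cutoff_affine[OF c, of u k]])
 have [measurable]: "c \<in> borel_measurable lebesgue" using test_fun_meas[OF c] .
 show "(\<lambda>x. c x * max 0 (fn u x - k)) \<in> borel_measurable lebesgue" by measurable
 show "AE x in lebesgue. \<bar>c x * max 0 (fn u x - k)\<bar> <= \<bar>\<bar>c x\<bar> * (\<bar>fn u x\<bar> + \<bar>k\<bar>)\<bar>"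
  by (intro AE_I2) (auto simp: abs_mult intro!: mult_left_mono)
qed

lemma sqint_cutoff_grad:
 assumes c: "c \<in> test_fun UNIV" shows "sqint (\<lambda>x. c x * (if fn u x > k then fn v x else 0))"
proof (rule sqint_mono_AE)
 show "sqint (\<lambda>x. c x * fn v x)" by (intro sqint_bmeas_mult test_fun_bmeas[OF c]) simp
 have [measurable]: "c \<in> borel_measurable lebesgue" using test_fun_meas[OF c] .
 show "(\<lambda>x. c x * (if fn u x > k then fn v x else 0)) \<in> borel_measurable lebesgue" by measurable
qed auto

text \<open>Let the smoothing parameter tend to infinity in \<open>trunc_approx_in_sob0\<close>; the
  bounds on \<open>trunc_approx\<close> and its derivative are independent of \<open>n\<close>, so
  dominated convergence applies, and \<open>sob0\<close> is closed.\<close>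

lemma trunc_in_sob0:
 fixes p :: "'n::finite sob"
 assumes p: "p \<in> sob0 \<O>" and \<eta>: "\<eta> \<in> test_fun UNIV" and k: "k \<ge> 0 \<or> closure {x. \<eta> x \<noteq> 0} \<subseteq> \<O>"
 shows "trunc \<eta> k p \<in> sob0 \<O>"
proof -
 let ?u = "fn (fst p)"
 let ?q = "\<lambda>n. (cls (\<lambda>x. \<eta> x * trunc_approx n (?u x - k)),
  \<chi> i. cls (\<lambda>x. partial_deriv i \<eta> x * trunc_approx n (?u x - k) + \<eta> x * (trunc_approx' n (?u x - k) * fn (snd p $ i) x))) :: 'n sob"
 have le: "\<bar>trunc_approx n (?u x - k)\<bar> <= \<bar>?u x\<bar> + \<bar>k\<bar>" for n x
  using trunc_approx_bounds[of n "?u x - k"] by (auto simp: max_def split: if_splits)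
 have [measurable]: "\<eta> \<in> borel_measurable lebesgue" "partial_deriv i \<eta> \<in> borel_measurable lebesgue" for i
  using test_fun_meas[OF \<eta>] test_fun_meas[OF test_fun_partial[OF \<eta>]] by auto
 have lim: "?q \<longlonglongrightarrow> trunc \<eta> k p"
 proof (rule tendsto_sobI)
  have "(\<lambda>n. cls (\<lambda>x. \<eta> x * trunc_approx n (?u x - k))) \<longlonglongrightarrow> cls (\<lambda>x. \<eta> x * max 0 (?u x - k))"
  proof (rule L2_dominated_convergence(3)[OF _ _ sqint_cutoff_affine[OF \<eta>, of "fst p" k]])
   show "AE x in lebesgue. \<bar>\<eta> x * trunc_approx n (?u x - k)\<bar> <= \<bar>\<eta> x\<bar> * (\<bar>?u x\<bar> + \<bar>k\<bar>)" for n
    using le by (auto simp: abs_mult intro!: mult_left_mono)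
   show "AE x in lebesgue. (\<lambda>n. \<eta> x * trunc_approx n (?u x - k)) \<longlonglongrightarrow> \<eta> x * max 0 (?u x - k)"
    by (intro AE_I2 tendsto_mult tendsto_const trunc_approx_tendsto)
  qed measurable
  then show "(\<lambda>n. fst (?q n)) \<longlonglongrightarrow> fst (trunc \<eta> k p)" by (simp add: trunc_def)
  fix i
  have "(\<lambda>n. cls (\<lambda>x. partial_deriv i \<eta> x * trunc_approx n (?u x - k) + \<eta> x * (trunc_approx' n (?u x - k) * fn (snd p $ i) x)))
   \<longlonglongrightarrow> cls (\<lambda>x. partial_deriv i \<eta> x * max 0 (?u x - k) + \<eta> x * (if ?u x > k then fn (snd p $ i) x else 0))"
  proof (rule L2_dominated_convergence(3))
   show "sqint (\<lambda>x. \<bar>partial_deriv i \<eta> x\<bar> * (\<bar>?u x\<bar> + \<bar>k\<bar>) + \<bar>\<eta> x * fn (snd p $ i) x\<bar>)"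
    by (intro sqint_add sqint_cutoff_affine[OF test_fun_partial[OF \<eta>]] sqint_abs sqint_bmeas_mult test_fun_bmeas[OF \<eta>]) simp
   show "AE x in lebesgue. \<bar>partial_deriv i \<eta> x * trunc_approx n (?u x - k) + \<eta> x * (trunc_approx' n (?u x - k) * fn (snd p $ i) x)\<bar>
    <= \<bar>partial_deriv i \<eta> x\<bar> * (\<bar>?u x\<bar> + \<bar>k\<bar>) + \<bar>\<eta> x * fn (snd p $ i) x\<bar>" for n
   proof (rule AE_I2)
    fix x
    have "\<bar>partial_deriv i \<eta> x * trunc_approx n (?u x - k)\<bar> <= \<bar>partial_deriv i \<eta> x\<bar> * (\<bar>?u x\<bar> + \<bar>k\<bar>)"
     using le by (auto simp: abs_mult intro!: mult_left_mono)
    moreover have "\<bar>trunc_approx' n (?u x - k) * fn (snd p $ i) x\<bar> <= 1 * \<bar>fn (snd p $ i) x\<bar>"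
     unfolding abs_mult using trunc_approx'_bounds by (intro mult_right_mono) auto
    then have "\<bar>\<eta> x * (trunc_approx' n (?u x - k) * fn (snd p $ i) x)\<bar> <= \<bar>\<eta> x * fn (snd p $ i) x\<bar>"
     by (simp add: abs_mult[of "\<eta> x"] mult_left_mono)
    ultimately show "\<bar>partial_deriv i \<eta> x * trunc_approx n (?u x - k) + \<eta> x * (trunc_approx' n (?u x - k) * fn (snd p $ i) x)\<bar>
    <= \<bar>partial_deriv i \<eta> x\<bar> * (\<bar>?u x\<bar> + \<bar>k\<bar>) + \<bar>\<eta> x * fn (snd p $ i) x\<bar>" by linarith
   qed
   have "(\<lambda>n. trunc_approx' n (?u x - k) * fn (snd p $ i) x) \<longlonglongrightarrow> (if ?u x > k then fn (snd p $ i) x else 0)" for x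
    using tendsto_mult[OF trunc_approx'_tendsto[of "?u x - k"] tendsto_const[of "fn (snd p $ i) x"]] by (cases "?u x > k") auto
   then show "AE x in lebesgue. (\<lambda>n. partial_deriv i \<eta> x * trunc_approx n (?u x - k) + \<eta> x * (trunc_approx' n (?u x - k) * fn (snd p $ i) x))
    \<longlonglongrightarrow> partial_deriv i \<eta> x * max 0 (?u x - k) + \<eta> x * (if ?u x > k then fn (snd p $ i) x else 0)"
    by (intro AE_I2 tendsto_add tendsto_mult tendsto_const trunc_approx_tendsto)
  qed measurable
  then show "(\<lambda>n. snd (?q n) $ i) \<longlonglongrightarrow> snd (trunc \<eta> k p) $ i" by (simp add: trunc_def)
 qed
 have "?q n \<in> sob0 \<O>" for n by (rule trunc_approx_in_sob0[OF p \<eta> k])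
 then show ?thesis by (rule closed_sequentially[OF closed_sob0 _ lim])
qed

subsection \<open>Uniqueness of weak gradients\<close>

text \<open>\<open>ennreal\<close> cuts off negative values, so the two densities are the positive
  and negative parts of \<open>h\<close>. The finite measures they define agree on boxes, an
  intersection-stable generator, hence everywhere.\<close>

lemma AE_zero_if_box_integrals_zero:
 fixes h :: "'a::euclidean_space => real"
 assumes i: "integrable lborel h" and z: "\<And>c d. (LINT x|lborel. indicator (box c d) x * h x) = 0"
 shows "AE x in lborel. h x = 0"
proof -
 have [measurable]: "h \<in> borel_measurable borel" using i by auto
 have fin: "(\<integral>\<^sup>+x. ennreal (h x) \<partial>lborel) \<noteq> \<infinity>" "(\<integral>\<^sup>+x. ennreal (- h x) \<partial>lborel) \<noteq> \<infinity>"
  using i by (auto simp: real_integrable_def)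
 have "density lborel (\<lambda>x. ennreal (h x)) = density lborel (\<lambda>x. ennreal (- h x))" (is "?M = ?N")
 proof (rule measure_eqI_generator_eq)
  let ?E = "range (\<lambda>(a, b). box a b :: 'a set)"
  show "Int_stable ?E" by (auto simp: Int_stable_def box_Int_box)
  show "?E \<subseteq> Pow UNIV" "sets ?M = sigma_sets UNIV ?E" "sets ?N = sigma_sets UNIV ?E"
   by (simp_all add: borel_eq_box)
  let ?A = "\<lambda>n::nat. box (- (real n *\<^sub>R One)) (real n *\<^sub>R One) :: 'a set"
  show "range ?A \<subseteq> ?E" "(\<Union>i. ?A i) = UNIV" unfolding UN_box_eq_UNIV by auto
  show "emeasure ?M (?A i) \<noteq> \<infinity>" for i
  proof -
   have "emeasure ?M (?A i) <= (\<integral>\<^sup>+x. ennreal (h x) \<partial>lborel)"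
    by (subst emeasure_density) (auto intro!: nn_integral_mono simp: indicator_def)
   then show ?thesis using fin(1) by (auto simp: top_unique)
  qed
  fix X assume "X \<in> ?E"
  then obtain c d where X: "X = box c d" by auto
  let ?f = "\<lambda>x. indicator X x * h x"
  have if': "integrable lborel ?f" using integrable_mult_indicator[OF _ i, of X] X by simp
  have "(\<integral>\<^sup>+x. ennreal (?f x) \<partial>lborel) \<noteq> \<infinity>" "(\<integral>\<^sup>+x. ennreal (- ?f x) \<partial>lborel) \<noteq> \<infinity>"
   using if' by (auto simp: real_integrable_def)
  moreover have "enn2real (\<integral>\<^sup>+x. ennreal (?f x) \<partial>lborel) = enn2real (\<integral>\<^sup>+x. ennreal (- ?f x) \<partial>lborel)"
   using real_lebesgue_integral_def[OF if'] z[of c d] X by simp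
  ultimately have "(\<integral>\<^sup>+x. ennreal (?f x) \<partial>lborel) = (\<integral>\<^sup>+x. ennreal (- ?f x) \<partial>lborel)"
   by (metis ennreal_enn2real_if infinity_ennreal_def)
  moreover have "emeasure ?M X = (\<integral>\<^sup>+x. ennreal (?f x) \<partial>lborel)"
   using X by (subst emeasure_density) (auto intro!: nn_integral_cong simp: indicator_def)
  moreover have "emeasure ?N X = (\<integral>\<^sup>+x. ennreal (- ?f x) \<partial>lborel)"
   using X by (subst emeasure_density) (auto intro!: nn_integral_cong simp: indicator_def)
  ultimately show "emeasure ?M X = emeasure ?N X" by simp
 qed
 then have "AE x in lborel. ennreal (h x) = ennreal (- h x)"
  by (subst (asm) finite_density_unique) (use fin in auto)
 then show ?thesis
 proof eventually_elim
  case (elim x)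
  then show ?case by (cases "h x \<ge> 0") (auto simp: ennreal_neg ennreal_eq_0_iff)
 qed
qed

lemma box_bumps_tendsto:
 fixes a b x :: "real^'n"
 shows "(\<lambda>n. \<Prod>i\<in>UNIV. bump (real n * (x $ i - a $ i)) * bump (real n * (b $ i - x $ i))) \<longlonglongrightarrow> indicator (box a b) x"
proof (cases "x \<in> box a b")
 case True
 then have "(\<lambda>n. bump (real n * (x $ i - a $ i)) * bump (real n * (b $ i - x $ i))) \<longlonglongrightarrow> 1 * 1" for i
  by (intro tendsto_mult bump_tendsto_1) (auto simp: mem_box_cart)
 then have "(\<lambda>n. \<Prod>i\<in>UNIV. bump (real n * (x $ i - a $ i)) * bump (real n * (b $ i - x $ i))) \<longlonglongrightarrow> (\<Prod>i\<in>(UNIV::'n set). 1)"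
  by (intro tendsto_prod) simp
 then show ?thesis using True by simp
next
 case False
 then obtain i where "x $ i <= a $ i \<or> b $ i <= x $ i" by (auto simp: mem_box_cart not_less)
 then have "bump (real n * (x $ i - a $ i)) * bump (real n * (b $ i - x $ i)) = 0" for n
  by (auto simp: bump_simps mult_nonneg_nonpos)
 then have z: "(\<Prod>i\<in>UNIV. bump (real n * (x $ i - a $ i)) * bump (real n * (b $ i - x $ i))) = 0" for n
  by (intro prod_zero) auto
 show ?thesis using False unfolding z by simp
qed

lemma box_bumps_bounds:
 "0 <= (\<Prod>i\<in>I. bump (f i) * bump (g i))" "(\<Prod>i\<in>I. bump (f i) * bump (g i)) <= 1"
 using bump_bounds by (auto intro!: prod_nonneg prod_le_1 mult_nonneg_nonneg mult_le_one)

text \<open>The fundamental lemma of the calculus of variations, proved on closed boxes inside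
  \<open>\<O>\<close>, countably many of which cover it, so that the exceptional null sets can be
  united.\<close>

lemma AE_zero_if_test_integrals_zero:
 fixes u :: "(real^'n) L2"
 assumes \<O>: "open \<O>" and z: "\<And>\<phi>. \<phi> \<in> test_fun \<O> ==> u \<bullet> cls \<phi> = 0"
 shows "AE x\<in>\<O> in lebesgue. fn u x = 0"
proof -
 have cb: "AE x\<in>cbox a b in lebesgue. fn u x = 0" if ab: "cbox a b \<subseteq> \<O>" for a b
 proof -
  let ?h = "\<lambda>x. indicator (box a b) x * fn u x"
  have ih: "integrable lebesgue ?h" by (intro sqint_mult sqint_indicator) auto
  have box0: "(LINT x|lebesgue. indicator (box c d) x * ?h x) = 0" for c d
  proof -
   \<comment> \<open>The first product confines the support to the given closed box, hence to
     \<open>\<O>\<close>; the second approximates the indicator of an arbitrary box on which the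
     integral is to be evaluated.\<close>
   define \<phi> where "\<phi> n x = (\<Prod>i\<in>UNIV. bump (real n * (x $ i - a $ i)) * bump (real n * (b $ i - x $ i)))
    * (\<Prod>i\<in>UNIV. bump (real n * (x $ i - c $ i)) * bump (real n * (d $ i - x $ i)))" for n x
   have sm: "smooth_fun (\<phi> n)" for n unfolding \<phi>_def
    by (intro smooth_fun_mult smooth_fun_prod smooth_fun_flat_exp smooth_fun_const smooth_fun_diff smooth_fun_coord)
   have supp: "\<phi> n x = 0" if xo: "x \<notin> cbox a b" for n x
   proof -
    obtain i where "x $ i < a $ i \<or> b $ i < x $ i" using xo by (auto simp: mem_box_cart not_le)
    then have "bump (real n * (x $ i - a $ i)) * bump (real n * (b $ i - x $ i)) = 0"
     by (auto simp: bump_simps mult_nonneg_nonpos)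
    then have "(\<Prod>i\<in>UNIV. bump (real n * (x $ i - a $ i)) * bump (real n * (b $ i - x $ i))) = 0"
     by (intro prod_zero) auto
    then show ?thesis by (simp add: \<phi>_def)
   qed
   have t: "\<phi> n \<in> test_fun \<O>" for n by (rule test_funI[OF sm compact_cbox ab]) (rule supp)
   have bd: "\<bar>\<phi> n x\<bar> <= indicator (cbox a b) x" for n x
   proof (cases "x \<in> cbox a b")
    case True
    have "\<bar>\<phi> n x\<bar> <= 1"
     unfolding \<phi>_def abs_mult by (intro mult_le_one) (simp_all only: abs_of_nonneg[OF box_bumps_bounds(1)] box_bumps_bounds)
    then show ?thesis using True by simp
   qed (simp add: supp)
   have "(\<lambda>n. LINT x|lebesgue. fn u x * \<phi> n x) \<longlonglongrightarrow> (LINT x|lebesgue. indicator (box c d) x * ?h x)"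
   proof (rule integral_dominated_convergence)
    show "integrable lebesgue (\<lambda>x. indicator (cbox a b) x * \<bar>fn u x\<bar>)"
     by (intro sqint_mult sqint_indicator sqint_abs) auto
    show "(\<lambda>x. indicator (box c d) x * ?h x) \<in> borel_measurable lebesgue"
     by (intro borel_measurable_times fn_meas borel_measurable_indicator) auto
    show "(\<lambda>x. fn u x * \<phi> n x) \<in> borel_measurable lebesgue" for n
     using test_fun_meas[OF t] by (intro borel_measurable_times) auto
    have "(\<lambda>n. fn u x * \<phi> n x) \<longlonglongrightarrow> fn u x * (indicator (box a b) x * indicator (box c d) x)" for x
     unfolding \<phi>_def by (intro tendsto_mult tendsto_const box_bumps_tendsto)
    then show "AE x in lebesgue. (\<lambda>n. fn u x * \<phi> n x) \<longlonglongrightarrow> indicator (box c d) x * ?h x" by (simp add: mult_ac)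
    show "AE x in lebesgue. norm (fn u x * \<phi> n x) <= indicator (cbox a b) x * \<bar>fn u x\<bar>" for n
     using mult_right_mono[OF bd abs_ge_zero, of n _ "fn u _"] by (auto simp: abs_mult mult.commute)
   qed
   moreover have "(LINT x|lebesgue. fn u x * \<phi> n x) = 0" for n
    using z[OF t[of n]] inner_cls[of "fn u" "\<phi> n"] test_fun_sqint[OF t[of n]] by simp
   ultimately show ?thesis by (simp add: LIMSEQ_const_iff)
  qed
  have "?h \<in> borel_measurable (completion lborel)" using ih by auto
  from completion_ex_borel_measurable_real[OF this]
  obtain h' where h': "h' \<in> borel_measurable lborel" "AE x in lborel. ?h x = h' x" by blast
  then have ae: "AE x in lebesgue. ?h x = h' x" by (intro AE_completion)
  have [measurable]: "h' \<in> borel_measurable borel" using h'(1) by simp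
  have mh': "h' \<in> borel_measurable lebesgue" using h'(1) by (rule measurable_completion)
  have "integrable lebesgue h'" using ih mh' ae by (subst integrable_cong_AE[of _ _ ?h]) auto
  then have ih': "integrable lborel h'" using h' by (simp add: integrable_completion)
  have "AE x in lborel. h' x = 0"
  proof (rule AE_zero_if_box_integrals_zero[OF ih'])
   fix c d :: "real^'n"
   have "(LINT x|lborel. indicator (box c d) x * h' x) = (LINT x|lebesgue. indicator (box c d) x * h' x)"
    by (intro integral_completion[symmetric]) measurable
   also have "\<dots> = (LINT x|lebesgue. indicator (box c d) x * ?h x)"
    using ae mh' by (intro integral_cong_AE borel_measurable_times fn_meas borel_measurable_indicator) auto
   finally show "(LINT x|lborel. indicator (box c d) x * h' x) = 0" using box0 by simp
  qed
  then have "AE x in lebesgue. h' x = 0" by (rule AE_completion)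
  moreover have "AE x in lebesgue. x \<notin> cbox a b - box a b"
  proof (rule AE_not_in)
   have "negligible (cbox a b - box a b)" by (rule negligible_frontier_interval) 
   then show "cbox a b - box a b \<in> null_sets lebesgue" by (simp add: negligible_iff_null_sets)
  qed
  ultimately show ?thesis using ae by eventually_elim auto
 qed
 show ?thesis
 proof (rule open_countable_Union_open_cbox[OF \<O>])
  fix \<D> :: "(real^'n) set set"
  assume D: "countable \<D>" "\<D> \<subseteq> Pow \<O>" "\<And>X. X \<in> \<D> ==> \<exists>a b. X = cbox a b" "\<Union>\<D> = \<O>"
  have "AE x\<in>X in lebesgue. fn u x = 0" if X: "X \<in> \<D>" for X
  proof -
   obtain a b where ab: "X = cbox a b" using D(3)[OF X] by blast
   have "cbox a b \<subseteq> \<O>" using D(2) X ab by blast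
   then show ?thesis unfolding ab by (rule cb)
  qed
  then have "AE x in lebesgue. \<forall>X\<in>\<D>. x \<in> X --> fn u x = 0"
   by (intro AE_ball_countable[OF D(1), THEN iffD2] ballI)
  then show ?thesis by eventually_elim (use D(4) in auto)
 qed
qed

subsection \<open>Functions on a domain as elements of \<open>L\<^sup>2\<close>\<close>

definition ext :: "'a set => ('a => real) => 'a => real" where
 "ext \<O> f x = (if x \<in> \<O> then f x else 0)"

text \<open>The bridge from functions on a domain to classes over the whole space: under it
  \<open>L2_inner\<close> and \<open>L2_norm\<close> become the Hilbert space operations.\<close>

definition l2 :: "'a::euclidean_space set => ('a => real) => 'a L2" where
 "l2 \<O> f = cls (ext \<O> f)"

lemma ext_simps [simp]: "ext \<O> (\<lambda>x. f x + g x) = (\<lambda>x. ext \<O> f x + ext \<O> g x)"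
 "ext \<O> (\<lambda>x. f x - g x) = (\<lambda>x. ext \<O> f x - ext \<O> g x)"
 "ext \<O> (\<lambda>x. c * f x) = (\<lambda>x. c * ext \<O> f x)"
 "ext \<O> (\<lambda>x. f x * g x) = (\<lambda>x. ext \<O> f x * ext \<O> g x)" by (auto simp: ext_def)

lemma ext_indicator: "ext \<O> f x = indicator \<O> x *\<^sub>R f x"
 by (simp add: ext_def indicator_def)

lemma integral_lebesgue_on: "open \<O> ==> (LINT x|lebesgue_on \<O>. f x) = (LINT x|lebesgue. ext \<O> f x)"
 unfolding ext_indicator[abs_def] by (rule integral_restrict_space) (auto simp: borel_open)

lemma integrable_lebesgue_on: "open \<O> ==> integrable (lebesgue_on \<O>) f \<longleftrightarrow> integrable lebesgue (ext \<O> f)"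
 for f :: "'a::euclidean_space => real"
 unfolding ext_indicator[abs_def] by (rule integrable_restrict_space) (auto simp: borel_open)

lemma AE_lebesgue_on: "open \<O> ==> (AE x in lebesgue_on \<O>. P x) \<longleftrightarrow> (AE x\<in>\<O> in lebesgue. P x)"
 by (rule AE_restrict_space_iff) (auto simp: borel_open)

lemma measurable_lebesgue_on: "open \<O> ==> f \<in> borel_measurable (lebesgue_on \<O>) \<longleftrightarrow> ext \<O> f \<in> borel_measurable lebesgue"
 for f :: "'a::euclidean_space => real"
 unfolding ext_def[abs_def] by (rule borel_measurable_if[symmetric]) (auto simp: borel_open)

lemma L2_fun_iff: "open \<O> ==> f \<in> L2_fun \<O> \<longleftrightarrow> sqint (ext \<O> f)"
 unfolding L2_fun_def sqint_def power2_eq_square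
 by (simp add: measurable_lebesgue_on integrable_lebesgue_on)

lemma L2_inner_eq: "open \<O> ==> u \<in> L2_fun \<O> ==> v \<in> L2_fun \<O> ==> L2_inner \<O> u v = l2 \<O> u \<bullet> l2 \<O> v"
 by (simp add: L2_inner_def integral_lebesgue_on l2_def inner_cls L2_fun_iff)

lemma L2_norm_eq: "open \<O> ==> u \<in> L2_fun \<O> ==> L2_norm \<O> u = norm (l2 \<O> u)"
 by (simp add: L2_norm_def L2_inner_eq norm_eq_sqrt_inner)

lemma l2_linear:
 assumes "open \<O>" "u \<in> L2_fun \<O>"
 shows "v \<in> L2_fun \<O> ==> l2 \<O> (\<lambda>x. u x + v x) = l2 \<O> u + l2 \<O> v"
  "v \<in> L2_fun \<O> ==> l2 \<O> (\<lambda>x. u x - v x) = l2 \<O> u - l2 \<O> v"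
  "l2 \<O> (\<lambda>x. c * u x) = c *\<^sub>R l2 \<O> u"
 using assms by (simp_all add: l2_def cls_add cls_diff cls_scaleR L2_fun_iff)

lemma L2_fun_linear:
 assumes "open \<O>" "u \<in> L2_fun \<O>"
 shows "v \<in> L2_fun \<O> ==> (\<lambda>x. u x + v x) \<in> L2_fun \<O>"
  "v \<in> L2_fun \<O> ==> (\<lambda>x. u x - v x) \<in> L2_fun \<O>"
  "(\<lambda>x. c * u x) \<in> L2_fun \<O>" using assms by (auto simp: L2_fun_iff intro: sqint_add sqint_diff sqint_scale)

lemma l2_eqI:
 assumes "open \<O>" "u \<in> L2_fun \<O>" "AE x\<in>\<O> in lebesgue. u x = v x"
 shows "v \<in> L2_fun \<O>" "l2 \<O> u = l2 \<O> v"
proof -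
 have "AE x in lebesgue. ext \<O> u x = ext \<O> v x" using assms(3) by eventually_elim (simp add: ext_def)
 then show "v \<in> L2_fun \<O>" "l2 \<O> u = l2 \<O> v"
  using assms(1,2) sqint_AE_cong cls_eqI by (auto simp: L2_fun_iff l2_def)
qed

lemma fn_l2: "open \<O> ==> u \<in> L2_fun \<O> ==> AE x in lebesgue. fn (l2 \<O> u) x = ext \<O> u x"
 unfolding l2_def L2_fun_iff by (rule fn_cls)

lemma fn_in_L2_fun: "open \<O> ==> fn u \<in> L2_fun \<O>"
 unfolding L2_fun_iff ext_indicator[abs_def] real_scaleR_def
 by (intro sqint_bmeas_mult bmeas_indicator) auto

lemma l2_fn:
 fixes u :: "(real^'n) L2"
 assumes a: "open \<O>" "AE x in lebesgue. x \<notin> \<O> --> fn u x = 0"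
 shows "l2 \<O> (fn u) = u"
proof -
 show ?thesis
  by (rule L2_eqI) (use fn_l2[OF a(1) fn_in_L2_fun[OF a(1)], of u] a(2) in \<open>eventually_elim, auto simp: ext_def\<close>)
qed

lemma test_fun_ext: "\<phi> \<in> test_fun \<O> ==> ext \<O> \<phi> = \<phi>"
 using test_fun_compact_support[of \<phi> \<O>] by (auto simp: ext_def fun_eq_iff)

lemma test_fun_l2: 
 assumes "open \<O>" "\<phi> \<in> test_fun \<O>" shows "l2 \<O> \<phi> = cls \<phi>" "\<phi> \<in> L2_fun \<O>"
 using assms test_fun_sqint[OF assms(2)] by (simp_all add: l2_def test_fun_ext L2_fun_iff)

lemma l2_inner_ext: "open \<O> ==> u \<in> L2_fun \<O> ==> sqint v ==> l2 \<O> u \<bullet> cls v = (LINT x|lebesgue. ext \<O> u x * v x)"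
 by (simp add: l2_def inner_cls L2_fun_iff)

lemma is_weak_gradient_iff:
 assumes \<O>: "open \<O>" and y: "y \<in> L2_fun \<O>"
 shows "is_weak_gradient \<O> y G \<longleftrightarrow> (\<forall>i. (\<lambda>x. G x $ i) \<in> L2_fun \<O> \<and>
  (\<forall>\<phi>\<in>test_fun \<O>. l2 \<O> y \<bullet> cls (partial_deriv i \<phi>) = - (l2 \<O> (\<lambda>x. G x $ i) \<bullet> cls \<phi>)))"
proof -
 have "(LINT x|lebesgue_on \<O>. u x * \<phi> x) = l2 \<O> u \<bullet> cls \<phi>" if "u \<in> L2_fun \<O>" "\<phi> \<in> test_fun \<O>" for u \<phi>
  using that \<O> L2_inner_eq[of \<O> u \<phi>] test_fun_l2[of \<O> \<phi>] by (simp add: L2_inner_def)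
 then show ?thesis unfolding is_weak_gradient_def using y by (auto simp: test_fun_partial)
qed

lemma l2_zero_outside: "open \<O> ==> u \<in> L2_fun \<O> ==> AE x in lebesgue. x \<notin> \<O> --> fn (l2 \<O> u) x = 0"
 using fn_l2[of \<O> u] by (auto simp: ext_def elim!: eventually_mono)

lemma weak_gradient_unique:
 assumes \<O>: "open \<O>" and y: "y \<in> L2_fun \<O>" and G: "is_weak_gradient \<O> y G" "is_weak_gradient \<O> y G'"
 shows "l2 \<O> (\<lambda>x. G x $ i) = l2 \<O> (\<lambda>x. G' x $ i)"
proof -
 note g = G[unfolded is_weak_gradient_iff[OF \<O> y], rule_format]
 let ?d = "l2 \<O> (\<lambda>x. G x $ i) - l2 \<O> (\<lambda>x. G' x $ i)"
 have "?d \<bullet> cls \<phi> = 0" if t: "\<phi> \<in> test_fun \<O>" for \<phi>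
 proof -
  have "l2 \<O> y \<bullet> cls (partial_deriv i \<phi>) = - (l2 \<O> (\<lambda>x. G x $ i) \<bullet> cls \<phi>)"
   "l2 \<O> y \<bullet> cls (partial_deriv i \<phi>) = - (l2 \<O> (\<lambda>x. G' x $ i) \<bullet> cls \<phi>)" using g t by blast+
  then show ?thesis by (simp add: inner_diff_left)
 qed
 from AE_zero_if_test_integrals_zero[OF \<O> this]
 have "AE x\<in>\<O> in lebesgue. fn ?d x = 0" by blast
 moreover have "AE x in lebesgue. x \<notin> \<O> --> fn (l2 \<O> (\<lambda>x. G x $ i)) x = 0"
  "AE x in lebesgue. x \<notin> \<O> --> fn (l2 \<O> (\<lambda>x. G' x $ i)) x = 0"
  using g by (auto intro!: l2_zero_outside[OF \<O>])
 moreover note fn_diff[of "l2 \<O> (\<lambda>x. G x $ i)" "l2 \<O> (\<lambda>x. G' x $ i)"]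
 ultimately have "AE x in lebesgue. fn (l2 \<O> (\<lambda>x. G x $ i)) x = fn (l2 \<O> (\<lambda>x. G' x $ i)) x"
  by eventually_elim auto
 then show ?thesis by (rule L2_eqI)
qed

definition wsob :: "(real^'n) set => (real^'n => real) => (real^'n => real^'n) => 'n sob" where
 "wsob \<O> y G = (l2 \<O> y, \<chi> i. l2 \<O> (\<lambda>x. G x $ i))"

lemma weak_gradient_wsob:
 assumes "open \<O>" "y \<in> L2_fun \<O>" "is_weak_gradient \<O> y G"
 shows "is_weak_gradient \<O> y (weak_gradient \<O> y)" "wsob \<O> y (weak_gradient \<O> y) = wsob \<O> y G"
proof -
 show w: "is_weak_gradient \<O> y (weak_gradient \<O> y)"
  unfolding weak_gradient_def by (rule someI[of _ G]) (rule assms(3))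
 then show "wsob \<O> y (weak_gradient \<O> y) = wsob \<O> y G"
  using weak_gradient_unique[OF assms(1,2) w assms(3)] by (simp add: wsob_def)
qed

text \<open>\<open>H1_norm\<close> is defined through a chosen weak gradient; by uniqueness almost
  everywhere, any weak gradient computes it.\<close>

lemma H1_norm_eq:
 assumes \<O>: "open \<O>" and y: "y \<in> L2_fun \<O>" and G: "is_weak_gradient \<O> y G"
 shows "H1_norm \<O> y = norm (wsob \<O> y G)"
proof -
 let ?W = "weak_gradient \<O> y"
 have g: "(\<lambda>x. ?W x $ i) \<in> L2_fun \<O>" for i
  using weak_gradient_wsob(1)[OF assms] by (simp add: is_weak_gradient_iff[OF \<O> y])
 have n: "(LINT x|lebesgue_on \<O>. (u x)\<^sup>2) = (norm (l2 \<O> u))\<^sup>2" if "u \<in> L2_fun \<O>" for u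
  using L2_inner_eq[OF \<O> that that] by (simp add: L2_inner_def power2_eq_square power2_norm_eq_inner[unfolded power2_eq_square])
 have i: "integrable (lebesgue_on \<O>) (\<lambda>x. (u x)\<^sup>2)" if "u \<in> L2_fun \<O>" for u
  using that by (simp add: L2_fun_def)
 have "(LINT x|lebesgue_on \<O>. (norm (?W x))\<^sup>2) = (\<Sum>i\<in>UNIV. LINT x|lebesgue_on \<O>. (?W x $ i)\<^sup>2)"
  unfolding norm_vec_def L2_set_def by (simp add: sum_nonneg Bochner_Integration.integral_sum i g)
 also have "\<dots> = (\<Sum>i\<in>UNIV. (norm (l2 \<O> (\<lambda>x. ?W x $ i)))\<^sup>2)" by (simp add: n g)
 finally have "H1_norm \<O> y = norm (wsob \<O> y ?W)"
  unfolding H1_norm_def wsob_def norm_Pair n[OF y] by (simp add: norm_vec_def L2_set_def sum_nonneg)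
 then show ?thesis using weak_gradient_wsob(2)[OF assms] by simp
qed

text \<open>For fixed \<open>\<psi>\<close>, integration by parts is a closed condition on the pair
  and holds for test functions; so the second component of an element of \<open>sob0\<close> is a
  weak gradient of the first.\<close>

lemma sob0_is_weak_gradient:
 fixes p :: "'n::finite sob"
 assumes \<O>: "open \<O>" and p: "p \<in> sob0 \<O>" and y: "AE x\<in>\<O> in lebesgue. y x = fn (fst p) x"
 shows "y \<in> L2_fun \<O>" "is_weak_gradient \<O> y (\<lambda>x. \<chi> i. fn (snd p $ i) x)" "wsob \<O> y (\<lambda>x. \<chi> i. fn (snd p $ i) x) = p"
proof -
 have y': "AE x\<in>\<O> in lebesgue. fn (fst p) x = y x" using y by (auto elim: eventually_mono)
 show yL: "y \<in> L2_fun \<O>" by (rule l2_eqI(1)[OF \<O> fn_in_L2_fun[OF \<O>] y'])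
 have f: "l2 \<O> y = fst p"
  using l2_eqI(2)[OF \<O> fn_in_L2_fun[OF \<O>] y'] l2_fn[OF \<O> sob0_zero_outside(1)[OF p \<O>]] by simp
 have s: "l2 \<O> (\<lambda>x. fn (snd p $ i) x) = snd p $ i" for i
  using l2_fn[OF \<O> sob0_zero_outside(2)[OF p \<O>], of i] by simp
 show "is_weak_gradient \<O> y (\<lambda>x. \<chi> i. fn (snd p $ i) x)" unfolding is_weak_gradient_iff[OF \<O> yL]
 proof (intro allI conjI ballI)
  fix i show "(\<lambda>x. (\<chi> i. fn (snd p $ i) x) $ i) \<in> L2_fun \<O>" using fn_in_L2_fun[OF \<O>] by simp
  fix \<psi> assume \<psi>: "\<psi> \<in> test_fun \<O>"
  have "p \<in> {p. fst p \<bullet> cls (partial_deriv i \<psi>) = - ((snd p $ i) \<bullet> cls \<psi>)}"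
  proof (rule sob0_minimal[OF p])
   show "closed {p::'n sob. fst p \<bullet> cls (partial_deriv i \<psi>) = - ((snd p $ i) \<bullet> cls \<psi>)}"
    by (intro closed_Collect_eq continuous_intros)
   fix \<phi> assume \<phi>: "\<phi> \<in> test_fun \<O>"
   note sq = test_fun_sqint[OF \<phi>] test_fun_sqint[OF \<psi>] test_fun_sqint[OF test_fun_partial[OF \<phi>]] test_fun_sqint[OF test_fun_partial[OF \<psi>]]
   show "emb \<phi> \<in> {p. fst p \<bullet> cls (partial_deriv i \<psi>) = - ((snd p $ i) \<bullet> cls \<psi>)}"
    using test_fun_integration_by_parts[OF \<phi> \<psi>, of i] by (simp add: emb_def inner_cls sq)
  qed
  then show "l2 \<O> y \<bullet> cls (partial_deriv i \<psi>) = - (l2 \<O> (\<lambda>x. (\<chi> i. fn (snd p $ i) x) $ i) \<bullet> cls \<psi>)"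
   using f s by simp
 qed
 show "wsob \<O> y (\<lambda>x. \<chi> i. fn (snd p $ i) x) = p" by (simp add: wsob_def f s prod_eq_iff vec_eq_iff)
qed

lemma test_fun_weak_gradient:
 assumes \<O>: "open \<O>" and \<phi>: "\<phi> \<in> test_fun \<O>"
 shows "is_weak_gradient \<O> \<phi> (\<lambda>x. \<chi> i. partial_deriv i \<phi> x)" "wsob \<O> \<phi> (\<lambda>x. \<chi> i. partial_deriv i \<phi> x) = emb \<phi>"
proof -
 show "is_weak_gradient \<O> \<phi> (\<lambda>x. \<chi> i. partial_deriv i \<phi> x)"
  unfolding is_weak_gradient_iff[OF \<O> test_fun_l2(2)[OF \<O> \<phi>]]
 proof (intro allI conjI ballI)
  fix i show "(\<lambda>x. (\<chi> i. partial_deriv i \<phi> x) $ i) \<in> L2_fun \<O>"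
   using test_fun_l2(2)[OF \<O> test_fun_partial[OF \<phi>]] by simp
  fix \<psi> assume \<psi>: "\<psi> \<in> test_fun \<O>"
  note sq = test_fun_sqint[OF \<phi>] test_fun_sqint[OF \<psi>] test_fun_sqint[OF test_fun_partial[OF \<phi>]] test_fun_sqint[OF test_fun_partial[OF \<psi>]]
  show "l2 \<O> \<phi> \<bullet> cls (partial_deriv i \<psi>) = - (l2 \<O> (\<lambda>x. (\<chi> i. partial_deriv i \<phi> x) $ i) \<bullet> cls \<psi>)"
   using test_fun_integration_by_parts[OF \<phi> \<psi>, of i] test_fun_l2(1)[OF \<O> \<phi>] test_fun_l2(1)[OF \<O> test_fun_partial[OF \<phi>]]
   by (simp add: inner_cls sq)
 qed
 show "wsob \<O> \<phi> (\<lambda>x. \<chi> i. partial_deriv i \<phi> x) = emb \<phi>"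
  using test_fun_l2(1)[OF \<O> \<phi>] test_fun_l2(1)[OF \<O> test_fun_partial[OF \<phi>]] by (simp add: wsob_def emb_def)
qed

lemma weak_gradient_diff:
 assumes \<O>: "open \<O>" and y: "y \<in> L2_fun \<O>" "z \<in> L2_fun \<O>" and G: "is_weak_gradient \<O> y G" "is_weak_gradient \<O> z H"
 shows "is_weak_gradient \<O> (\<lambda>x. y x - z x) (\<lambda>x. G x - H x)" "wsob \<O> (\<lambda>x. y x - z x) (\<lambda>x. G x - H x) = wsob \<O> y G - wsob \<O> z H"
proof -
 have G': "(\<lambda>x. G x $ i) \<in> L2_fun \<O>" "\<phi> \<in> test_fun \<O> ==> l2 \<O> y \<bullet> cls (partial_deriv i \<phi>) = - (l2 \<O> (\<lambda>x. G x $ i) \<bullet> cls \<phi>)" for i \<phi>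
  using G(1) by (auto simp: is_weak_gradient_iff[OF \<O> y(1)])
 have H': "(\<lambda>x. H x $ i) \<in> L2_fun \<O>" "\<phi> \<in> test_fun \<O> ==> l2 \<O> z \<bullet> cls (partial_deriv i \<phi>) = - (l2 \<O> (\<lambda>x. H x $ i) \<bullet> cls \<phi>)" for i \<phi>
  using G(2) by (auto simp: is_weak_gradient_iff[OF \<O> y(2)])
 show "is_weak_gradient \<O> (\<lambda>x. y x - z x) (\<lambda>x. G x - H x)"
  unfolding is_weak_gradient_iff[OF \<O> L2_fun_linear(2)[OF \<O> y]]
  using G' H' by (auto simp: l2_linear[OF \<O>] y inner_diff_left intro!: L2_fun_linear(2)[OF \<O>])
 show "wsob \<O> (\<lambda>x. y x - z x) (\<lambda>x. G x - H x) = wsob \<O> y G - wsob \<O> z H"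
  by (simp add: wsob_def l2_linear[OF \<O>] y G' H' vec_eq_iff)
qed

text \<open>With \<open>H10_funD\<close> this identifies \<open>H10_fun\<close> with
  \<open>sob0\<close>: for test functions, convergence in \<open>H1_norm\<close> is convergence of
  their images under \<open>emb\<close>.\<close>

lemma H10_funI:
 fixes p :: "'n::finite sob"
 assumes \<O>: "open \<O>" and p: "p \<in> sob0 \<O>" and y: "AE x\<in>\<O> in lebesgue. y x = fn (fst p) x"
 shows "y \<in> H10_fun \<O>" "wsob \<O> y (weak_gradient \<O> y) = p"
proof -
 note w = sob0_is_weak_gradient[OF assms]
 show "wsob \<O> y (weak_gradient \<O> y) = p" using weak_gradient_wsob(2)[OF \<O> w(1,2)] w(3) by simp
 obtain \<phi> where \<phi>: "\<And>n::nat. \<phi> n \<in> test_fun \<O>" "(\<lambda>n. emb (\<phi> n)) \<longlonglongrightarrow> p" using sob0_seq[OF p] by blast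
 have "H1_norm \<O> (\<lambda>x. \<phi> n x - y x) = norm (emb (\<phi> n) - p)" for n
  using H1_norm_eq[OF \<O> _ weak_gradient_diff(1)[OF \<O> test_fun_l2(2)[OF \<O> \<phi>(1)] w(1) test_fun_weak_gradient(1)[OF \<O> \<phi>(1)] w(2)], of n]
   weak_gradient_diff(2)[OF \<O> test_fun_l2(2)[OF \<O> \<phi>(1)] w(1) test_fun_weak_gradient(1)[OF \<O> \<phi>(1)] w(2), of n]
   L2_fun_linear(2)[OF \<O> test_fun_l2(2)[OF \<O> \<phi>(1)] w(1), of n] test_fun_weak_gradient(2)[OF \<O> \<phi>(1)] w(3) by simp
 moreover have "(\<lambda>n. norm (emb (\<phi> n) - p)) \<longlonglongrightarrow> 0" using tendsto_norm[OF LIM_zero[OF \<phi>(2)]] by simp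
 ultimately show "y \<in> H10_fun \<O>"
  using w(1,2) \<phi>(1) unfolding H10_fun_def H1_fun_def by (simp, intro conjI exI[of _ \<phi>]) auto
qed

lemma H10_funD:
 fixes v :: "real^'n => real"
 assumes \<O>: "open \<O>" and v: "v \<in> H10_fun \<O>"
 shows "wsob \<O> v (weak_gradient \<O> v) \<in> sob0 \<O>" "v \<in> L2_fun \<O>" "(\<lambda>x. weak_gradient \<O> v x $ i) \<in> L2_fun \<O>"
proof -
 obtain G \<phi> where G: "is_weak_gradient \<O> v G" and \<phi>: "\<And>n::nat. \<phi> n \<in> test_fun \<O>" "(\<lambda>n. H1_norm \<O> (\<lambda>x. \<phi> n x - v x)) \<longlonglongrightarrow> 0"
  and vL: "v \<in> L2_fun \<O>" using v by (auto simp: H10_fun_def H1_fun_def)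
 show "v \<in> L2_fun \<O>" by (rule vL)
 note w = weak_gradient_wsob[OF \<O> vL G]
 show "(\<lambda>x. weak_gradient \<O> v x $ i) \<in> L2_fun \<O>" using w(1) by (simp add: is_weak_gradient_iff[OF \<O> vL])
 let ?q = "wsob \<O> v (weak_gradient \<O> v)"
 have "H1_norm \<O> (\<lambda>x. \<phi> n x - v x) = norm (emb (\<phi> n) - ?q)" for n
  using H1_norm_eq[OF \<O> _ weak_gradient_diff(1)[OF \<O> test_fun_l2(2)[OF \<O> \<phi>(1)] vL test_fun_weak_gradient(1)[OF \<O> \<phi>(1)] w(1)], of n]
   weak_gradient_diff(2)[OF \<O> test_fun_l2(2)[OF \<O> \<phi>(1)] vL test_fun_weak_gradient(1)[OF \<O> \<phi>(1)] w(1), of n]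
   L2_fun_linear(2)[OF \<O> test_fun_l2(2)[OF \<O> \<phi>(1)] vL, of n] test_fun_weak_gradient(2)[OF \<O> \<phi>(1)] by simp
 then have "(\<lambda>n. norm (emb (\<phi> n) - ?q)) \<longlonglongrightarrow> 0" using \<phi>(2) by simp
 then have lim: "(\<lambda>n. emb (\<phi> n)) \<longlonglongrightarrow> ?q" by (rule LIM_zero_cancel[OF tendsto_norm_zero_cancel])
 have "emb (\<phi> n) \<in> sob0 \<O>" for n by (rule emb_in_sob0[OF \<phi>(1)])
 then show "?q \<in> sob0 \<O>" by (rule closed_sequentially[OF closed_sob0 _ lim])
qed

subsection \<open>Superposition operators\<close>

text \<open>Rounding \<open>u\<close> down to multiples of \<open>1 / (n + 1)\<close> leaves
  countably many values, for which measurability at fixed second argument suffices; continuity in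
  that argument gives the limit.\<close>

lemma caratheodory_measurable:
 fixes F :: "'a => real => real"
 assumes m: "\<And>t. (\<lambda>x. F x t) \<in> borel_measurable M" and c: "\<And>x. continuous_on UNIV (F x)"
  and u: "u \<in> borel_measurable M"
 shows "(\<lambda>x. F x (u x)) \<in> borel_measurable M"
proof (rule borel_measurable_LIMSEQ_real)
 define g where "g n x = \<lfloor>real (Suc n) * u x\<rfloor>" for n x
 show "(\<lambda>x. F x (real_of_int (g n x) / real (Suc n))) \<in> borel_measurable M" for n
 proof (rule measurable_compose_countable'[where I = UNIV and g = "g n" and f = "\<lambda>i x. F x (real_of_int i / real (Suc n))"])
  show "g n \<in> measurable M (count_space UNIV)" unfolding g_def using u by measurable
 qed (use m in auto)
 fix x
 have "(\<lambda>n. real_of_int (g n x) / real (Suc n)) \<longlonglongrightarrow> u x"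
 proof (rule tendsto_norm_bound)
  show "norm (real_of_int (g n x) / real (Suc n) - u x) <= 1 / real (Suc n)" for n
  proof -
   have "real_of_int (g n x) <= real (Suc n) * u x" "real (Suc n) * u x < real_of_int (g n x) + 1"
    unfolding g_def by linarith+
   then have "\<bar>real_of_int (g n x) - real (Suc n) * u x\<bar> <= 1" by linarith
   then have "\<bar>(real_of_int (g n x) - real (Suc n) * u x) / real (Suc n)\<bar> <= 1 / real (Suc n)"
    unfolding abs_divide by (simp add: divide_right_mono)
   then show ?thesis by (simp add: diff_divide_distrib del: of_nat_Suc)
  qed
  show "(\<lambda>n. 1 / real (Suc n)) \<longlonglongrightarrow> 0" by (rule LIMSEQ_Suc[OF lim_1_over_n])
 qed
 then show "(\<lambda>n. F x (real_of_int (g n x) / real (Suc n))) \<longlonglongrightarrow> F x (u x)"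
  by (rule continuous_on_tendsto_compose[OF c]) auto
qed

text \<open>The class in which superposition acts on \<open>L\<^sup>2\<close> as a Lipschitz
  monotone operator. The nonlinearity of the state equation enters it only after its argument has
  been clipped.\<close>

definition lip_mono :: "('a::euclidean_space => real => real) => real => bool" where
 "lip_mono F K \<longleftrightarrow> (\<forall>t. (\<lambda>x. F x t) \<in> borel_measurable lebesgue) \<and> sqint (\<lambda>x. F x 0) \<and>
  (\<forall>x s t. \<bar>F x s - F x t\<bar> <= K * \<bar>s - t\<bar>) \<and> (\<forall>x s t. s <= t --> F x s <= F x t)"

lemma lip_monoD:
 assumes "lip_mono F K"
 shows "(\<lambda>x. F x t) \<in> borel_measurable lebesgue" "sqint (\<lambda>x. F x 0)"
  "\<bar>F x s - F x t\<bar> <= K * \<bar>s - t\<bar>" "s <= t ==> F x s <= F x t" using assms unfolding lip_mono_def by blast+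

definition nem :: "('a::euclidean_space => real => real) => 'a L2 => 'a L2" where
 "nem F u = cls (\<lambda>x. F x (fn u x))"

lemma lip_mono_nonneg:
 assumes "lip_mono F K" shows "K \<ge> 0"
proof -
 have "\<bar>F undefined 1 - F undefined 0\<bar> <= K * \<bar>1 - 0\<bar>" by (rule lip_monoD(3)[OF assms])
 then show ?thesis by simp
qed

lemma lip_mono_cont: "lip_mono F K ==> continuous_on UNIV (F x)"
proof -
 assume l: "lip_mono F K"
 have K: "K \<ge> 0" by (rule lip_mono_nonneg[OF l])
 have "K-lipschitz_on UNIV (F x)"
  unfolding lipschitz_on_def dist_real_def using lip_monoD(3)[OF l] K by auto
 then show ?thesis by (rule lipschitz_on_continuous_on)
qed

lemma sqint_nem: "lip_mono F K ==> sqint u ==> sqint (\<lambda>x. F x (u x))"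
proof -
 assume l: "lip_mono F K" and u: "sqint u"
 have m: "(\<lambda>x. F x (u x)) \<in> borel_measurable lebesgue"
  by (rule caratheodory_measurable[OF lip_monoD(1)[OF l] lip_mono_cont[OF l] sqint_meas[OF u]])
 show ?thesis
 proof (rule sqint_mono_AE[OF m])
  show "sqint (\<lambda>x. \<bar>F x 0\<bar> + K * \<bar>u x\<bar>)" by (intro sqint_add sqint_scale sqint_abs lip_monoD(2)[OF l] u)
  show "AE x in lebesgue. \<bar>F x (u x)\<bar> <= \<bar>\<bar>F x 0\<bar> + K * \<bar>u x\<bar>\<bar>"
  proof (rule AE_I2)
   fix x
   have "\<bar>F x (u x) - F x 0\<bar> <= K * \<bar>u x - 0\<bar>" by (rule lip_monoD(3)[OF l])
   then show "\<bar>F x (u x)\<bar> <= \<bar>\<bar>F x 0\<bar> + K * \<bar>u x\<bar>\<bar>" by simp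
  qed
 qed
qed

lemma nem_diff:
 assumes l: "lip_mono F K" shows "nem F u - nem F v = cls (\<lambda>x. F x (fn u x) - F x (fn v x))"
 unfolding nem_def by (rule cls_diff[OF sqint_nem[OF l sqint_fn] sqint_nem[OF l sqint_fn]])

lemma nem_lipschitz:
 assumes l: "lip_mono F K" shows "norm (nem F u - nem F v) <= K * norm (u - v)"
proof -
 have K: "K \<ge> 0" by (rule lip_mono_nonneg[OF l])
 have s: "sqint (\<lambda>x. fn u x - fn v x)" by (intro sqint_diff) auto
 have "norm (nem F u - nem F v) <= norm (cls (\<lambda>x. K * (fn u x - fn v x)))" unfolding nem_diff[OF l]
 proof (intro norm_cls_mono sqint_diff sqint_nem[OF l sqint_fn] sqint_scale s AE_I2)
  fix x
  have "\<bar>F x (fn u x) - F x (fn v x)\<bar> <= K * \<bar>fn u x - fn v x\<bar>" by (rule lip_monoD(3)[OF l])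
  then show "\<bar>F x (fn u x) - F x (fn v x)\<bar> <= \<bar>K * (fn u x - fn v x)\<bar>" using K by (simp add: abs_mult)
 qed simp_all
 also have "cls (\<lambda>x. K * (fn u x - fn v x)) = K *\<^sub>R (u - v)"
  using cls_scaleR[OF s] cls_diff[of "fn u" "fn v"] by simp
 finally show ?thesis using K by simp
qed

lemma nem_monotone:
 assumes l: "lip_mono F K" shows "0 <= (nem F u - nem F v) \<bullet> (u - v)"
proof -
 have s: "sqint (\<lambda>x. fn u x - fn v x)" by (intro sqint_diff) auto
 have "(nem F u - nem F v) \<bullet> cls (\<lambda>x. fn u x - fn v x) = (LINT x|lebesgue. (F x (fn u x) - F x (fn v x)) * (fn u x - fn v x))"
  unfolding nem_diff[OF l] by (intro inner_cls sqint_diff sqint_nem[OF l sqint_fn] s)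
 also have "\<dots> \<ge> 0"
 proof (intro integral_nonneg_AE AE_I2)
  fix x show "0 <= (F x (fn u x) - F x (fn v x)) * (fn u x - fn v x)"
  proof (cases "fn u x <= fn v x")
   case True
   then have "F x (fn u x) <= F x (fn v x)" by (rule lip_monoD(4)[OF l])
   with True show ?thesis by (intro mult_nonpos_nonpos) auto
  next
   case False
   then have "F x (fn v x) <= F x (fn u x)" by (intro lip_monoD(4)[OF l]) simp
   with False show ?thesis by (intro mult_nonneg_nonneg) auto
  qed
 qed
 finally show ?thesis using cls_diff[of "fn u" "fn v"] by simp
qed

lemma chebyshev_L2:
 assumes A: "A \<in> lmeasurable" and v: "AE x\<in>A in lebesgue. d <= \<bar>fn v x\<bar>" and d: "d \<ge> 0"
 shows "d\<^sup>2 * measure lebesgue A <= (norm v)\<^sup>2"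
proof -
 have "norm (cls (\<lambda>x. d * indicator A x)) <= norm (cls (fn v))"
 proof (rule norm_cls_mono)
  show "AE x in lebesgue. \<bar>d * indicator A x\<bar> <= \<bar>fn v x\<bar>"
   using v by eventually_elim (use d in \<open>auto simp: indicator_def\<close>)
 qed (auto intro: sqint_scale sqint_indicator A)
 then have "d * sqrt (measure lebesgue A) <= norm v"
  using d by (simp add: norm_cls_indicator[OF A] sqint_indicator[OF A] flip: cls_scaleR)
 then have "(d * sqrt (measure lebesgue A))\<^sup>2 <= (norm v)\<^sup>2" using d by (intro power_mono) auto
 then show ?thesis by (simp add: power_mult_distrib)
qed

lemma measure_cball_eq:
 "r \<ge> 0 ==> measure lborel (cball (z::real^'n) r) = measure lborel (cball (0::real^'n) 1) * r ^ CARD('n)"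
 by (simp add: content_cball)

lemma measure_cball1_pos: "measure lborel (cball (0::real^'n) 1) > 0"
 by (rule content_cball_pos) simp

lemma norm_fst_le_norm: "norm (fst p) <= norm p" and norm_snd_le_norm: "norm (snd p) <= norm p"
 for p :: "'a::real_normed_vector \<times> 'b::real_normed_vector" by (cases p; simp add: norm_fst_le norm_snd_le)+

lemma sum_squares_card: "(\<Sum>i\<in>(UNIV::'n::finite set). f i :: real)\<^sup>2 <= real CARD('n) * (\<Sum>i\<in>UNIV. (f i)\<^sup>2)"
 using sum_squared_le_sum_of_squares[of f UNIV] by (simp add: mult.commute)

subsection \<open>Elliptic equations with monotone lower order term\<close>

text \<open>The bounds hold at every point: the given coefficients are first altered on a null set
  and off the domain. No symmetry is assumed.\<close>

locale elliptic =
 fixes a :: "'n::finite => 'n => real^'n => real" and lam Lam :: real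
 assumes a_meas: "\<And>i j. a i j \<in> borel_measurable lebesgue"
  and a_bound: "\<And>i j x. \<bar>a i j x\<bar> <= Lam"
  and lam_pos: "lam > 0"
  and elliptic: "\<And>x \<xi>. lam * (\<Sum>i\<in>UNIV. (\<xi> i)\<^sup>2) <= (\<Sum>i\<in>UNIV. \<Sum>j\<in>UNIV. a i j x * \<xi> i * \<xi> j)"
begin

lemma bmeas_a: "bmeas (a i j)"
 unfolding bmeas_def using a_meas a_bound by blast

lemma Lam_nonneg: "Lam \<ge> 0"
 using a_bound[of undefined undefined undefined] by linarith

text \<open>The transposed coefficients define the adjoint operator; they satisfy the same bounds,
  so all results for states become available for adjoint states.\<close>

lemma elliptic_transpose: "elliptic (\<lambda>i j. a j i) lam Lam"
proof
 fix x \<xi>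
 have "(\<Sum>i\<in>UNIV. \<Sum>j\<in>UNIV. a j i x * \<xi> i * \<xi> j) = (\<Sum>j\<in>UNIV. \<Sum>i\<in>UNIV. a j i x * \<xi> i * \<xi> j)" by (rule sum.swap)
 then show "lam * (\<Sum>i\<in>UNIV. (\<xi> i)\<^sup>2) <= (\<Sum>i\<in>UNIV. \<Sum>j\<in>UNIV. a j i x * \<xi> i * \<xi> j)"
  using elliptic[of \<xi> x] by (simp add: mult_ac)
qed (use a_meas a_bound lam_pos in auto)

text \<open>The vector representing \<open>form V\<close> in the inner product; it lets the bilinear
  form enter a monotone operator on the product space.\<close>

definition flux :: "((real^'n) L2)^'n => ((real^'n) L2)^'n" where
 "flux V = (\<chi> j. \<Sum>i\<in>UNIV. mul (a i j) (V $ i))"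

definition form :: "((real^'n) L2)^'n => ((real^'n) L2)^'n => real" where
 "form V W = flux V \<bullet> W"

lemma form_eq: "form V W = (\<Sum>i\<in>UNIV. \<Sum>j\<in>UNIV. mul (a i j) (V $ i) \<bullet> (W $ j))"
proof -
 have "form V W = (\<Sum>j\<in>UNIV. \<Sum>i\<in>UNIV. mul (a i j) (V $ i) \<bullet> (W $ j))"
  by (simp add: form_def flux_def inner_vec_def inner_sum_left)
 also have "\<dots> = (\<Sum>i\<in>UNIV. \<Sum>j\<in>UNIV. mul (a i j) (V $ i) \<bullet> (W $ j))" by (rule sum.swap)
 finally show ?thesis .
qed

lemma flux_bounded_linear: "bounded_linear flux"
proof (rule bounded_linear_intro)
 fix V W and c :: real
 show "flux (V + W) = flux V + flux W" by (simp add: flux_def vec_eq_iff mul_add[OF bmeas_a] sum.distrib)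
 show "flux (c *\<^sub>R V) = c *\<^sub>R flux V"
  by (simp add: flux_def vec_eq_iff mul_scaleR[OF bmeas_a] scaleR_sum_right)
 have "norm (flux V) <= (\<Sum>j\<in>UNIV. norm (flux V $ j))" unfolding norm_vec_def by (rule L2_set_le_sum) auto
 also have "\<dots> <= (\<Sum>j\<in>(UNIV::'n set). \<Sum>i\<in>(UNIV::'n set). Lam * norm V)"
 proof (rule sum_mono)
  fix j :: 'n
  have "norm (flux V $ j) <= (\<Sum>i\<in>UNIV. norm (mul (a i j) (V $ i)))"
   unfolding flux_def by (simp add: norm_sum)
  also have "\<dots> <= (\<Sum>i\<in>(UNIV::'n set). Lam * norm V)"
   by (intro sum_mono order_trans[OF norm_mul_le[OF bmeas_a a_bound]] mult_left_mono Finite_Cartesian_Product.norm_nth_le Lam_nonneg)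
  finally show "norm (flux V $ j) <= (\<Sum>i\<in>(UNIV::'n set). Lam * norm V)" .
 qed
 finally show "norm (flux V) <= norm V * (real CARD('n) * (real CARD('n) * Lam))" by (simp add: mult_ac)
qed

lemma form_linear:
 "form (V + V') W = form V W + form V' W" "form V (W + W') = form V W + form V W'"
 "form (V - V') W = form V W - form V' W" "form V (W - W') = form V W - form V W'"
 "form (c *\<^sub>R V) W = c * form V W" "form V (c *\<^sub>R W) = c * form V W"
 "form (- V) W = - form V W" "form V (- W) = - form V W" using bounded_linear.linear[OF flux_bounded_linear]
 by (simp_all add: form_def linear_add linear_diff linear_scale linear_neg inner_simps)

lemma form_le: "\<bar>form V W\<bar> <= Lam * (\<Sum>i\<in>UNIV. norm (V $ i)) * (\<Sum>j\<in>UNIV. norm (W $ j))"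
proof -
 have "\<bar>form V W\<bar> <= (\<Sum>i\<in>UNIV. \<Sum>j\<in>UNIV. \<bar>mul (a i j) (V $ i) \<bullet> (W $ j)\<bar>)"
  unfolding form_eq by (rule order_trans[OF sum_abs sum_mono[OF sum_abs]])
 also have "\<dots> <= (\<Sum>i\<in>UNIV. \<Sum>j\<in>UNIV. (Lam * norm (V $ i)) * norm (W $ j))"
  by (intro sum_mono order_trans[OF Cauchy_Schwarz_ineq2] mult_right_mono norm_mul_le bmeas_a a_bound) auto
 also have "\<dots> = Lam * ((\<Sum>i\<in>UNIV. norm (V $ i)) * (\<Sum>j\<in>UNIV. norm (W $ j)))"
  by (subst sum_product) (simp add: sum_distrib_left mult.assoc)
 finally show ?thesis by (simp add: mult.assoc)
qed

lemma form_coercive: "lam * (\<Sum>i\<in>UNIV. (norm (V $ i))\<^sup>2) <= form V V"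
proof -
 have i: "integrable lebesgue (\<lambda>x. a i j x * fn (V $ i) x * fn (V $ j) x)" for i j
  by (intro sqint_mult sqint_bmeas_mult bmeas_a) auto
 have "lam * (\<Sum>i\<in>UNIV. (norm (V $ i))\<^sup>2) = (LINT x|lebesgue. lam * (\<Sum>i\<in>UNIV. (fn (V $ i) x)\<^sup>2))"
  unfolding norm_sq_fn by (simp add: Bochner_Integration.integral_sum sqint_integrable_sq)
 also have "\<dots> <= (LINT x|lebesgue. (\<Sum>i\<in>UNIV. \<Sum>j\<in>UNIV. a i j x * fn (V $ i) x * fn (V $ j) x))"
  by (intro integral_mono elliptic integrable_mult_right Bochner_Integration.integrable_sum i sqint_integrable_sq sqint_fn)
 also have "\<dots> = form V V"
  unfolding form_eq inner_mul[OF bmeas_a] by (simp add: Bochner_Integration.integral_sum i)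
 finally show ?thesis .
qed

lemma form_coercive': "lam * (\<Sum>i\<in>UNIV. norm (V $ i))\<^sup>2 <= real CARD('n) * form V V"
proof -
 have "lam * (\<Sum>i\<in>UNIV. norm (V $ i))\<^sup>2 <= lam * (real CARD('n) * (\<Sum>i\<in>UNIV. (norm (V $ i))\<^sup>2))"
  using lam_pos by (intro mult_left_mono sum_squares_card) auto
 also have "\<dots> <= real CARD('n) * form V V"
  using mult_left_mono[OF form_coercive[of V], of "real CARD('n)"] by (simp add: mult_ac)
 finally show ?thesis .
qed

end

section \<open>Poincare inequality, solvability and stability on a bounded open set\<close>

locale elliptic_domain = elliptic a lam Lam
 for a :: "'n::finite => 'n => real^'n => real" and lam Lam +
 fixes \<O> :: "(real^'n) set"
 assumes open_\<O>: "open \<O>" and bounded_\<O>: "bounded \<O>" and dim_le: "CARD('n) <= 3"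
begin

lemma elliptic_domain_transpose: "elliptic_domain (\<lambda>i j. a j i) lam Lam \<O>"
 by (intro elliptic_domain.intro elliptic_transpose elliptic_domain_axioms.intro open_\<O> bounded_\<O> dim_le)

lemma form_transpose: "elliptic.form (\<lambda>i j. a j i) V W = form W V"
proof -
 have "elliptic.form (\<lambda>i j. a j i) V W = (\<Sum>i\<in>UNIV. \<Sum>j\<in>UNIV. mul (a j i) (V $ i) \<bullet> (W $ j))"
  by (rule elliptic.form_eq[OF elliptic_transpose])
 also have "\<dots> = (\<Sum>i\<in>UNIV. \<Sum>j\<in>UNIV. mul (a j i) (W $ j) \<bullet> (V $ i))"
  unfolding inner_mul[OF bmeas_a] by (simp add: mult_ac)
 also have "\<dots> = form W V" unfolding form_eq by (rule sum.swap)
 finally show ?thesis .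
qed

lemma \<O>_lmeasurable: "\<O> \<in> lmeasurable"
 using bounded_\<O> open_\<O> by (rule lmeasurable_open)

text \<open>A radius at which Faber-Krahn applies to all of \<open>\<O>\<close>. The summand 1 makes
  \<open>rad0 \<ge> 1\<close>, so that its power \<open>CARD('n)\<close> is at least
  \<open>rad0\<close> itself.\<close>

definition rad0 :: real where
 "rad0 = 1 + 2 * measure lebesgue \<O> / measure lborel (cball (0::real^'n) 1)"

lemma rad0_ge: "rad0 \<ge> 1"
 by (simp add: rad0_def)

lemma rad0_measure: "2 * measure lebesgue \<O> <= measure lborel (cball (0::real^'n) rad0)"
proof -
 let ?w = "measure lborel (cball (0::real^'n) 1)"
 have "2 * measure lebesgue \<O> <= ?w * rad0"
  using measure_cball1_pos[where 'n='n] by (simp add: rad0_def distrib_left)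
 also have "\<dots> <= ?w * rad0 ^ CARD('n)"
  using rad0_ge measure_cball1_pos[where 'n='n] by (intro mult_left_mono self_le_power) auto
 finally show ?thesis using rad0_ge measure_cball_eq[of rad0 "0::real^'n"] by simp
qed

lemma poincare: "p \<in> sob0 \<O> ==> norm (fst p) <= 4 * rad0 * (\<Sum>i\<in>UNIV. norm (snd p $ i))"
 using rad0_ge by (intro sob0_faber_krahn[OF _ \<O>_lmeasurable] sob0_zero_outside(1) open_\<O> rad0_measure) auto

text \<open>The coercivity constant for the full norm: \<open>poincare\<close> and the comparison of
  a squared sum with a sum of squares bound \<open>(norm p)\<^sup>2\<close> by the denominator times
  the squared gradient norm.\<close>

definition coer :: real where
 "coer = lam / (1 + 16 * rad0\<^sup>2 * real CARD('n))"

lemma coer_pos: "coer > 0"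
 unfolding coer_def using lam_pos by (intro divide_pos_pos add_pos_nonneg) auto

lemma sob_norm_sq: "(norm (p::'n sob))\<^sup>2 = (norm (fst p))\<^sup>2 + (\<Sum>i\<in>UNIV. (norm (snd p $ i))\<^sup>2)"
proof -
 have "(norm p)\<^sup>2 = (norm (fst p))\<^sup>2 + (norm (snd p))\<^sup>2" by (cases p) (simp add: norm_Pair)
 then show ?thesis by (simp add: norm_vec_def L2_set_def sum_nonneg)
qed

lemma form_coer: assumes p: "p \<in> sob0 \<O>" shows "coer * (norm p)\<^sup>2 <= form (snd p) (snd p)"
proof -
 let ?s = "\<Sum>i\<in>UNIV. (norm (snd p $ i))\<^sup>2"
 have "(norm (fst p))\<^sup>2 <= (4 * rad0 * (\<Sum>i\<in>UNIV. norm (snd p $ i)))\<^sup>2" by (intro power_mono poincare p) auto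
 also have "\<dots> = 16 * rad0\<^sup>2 * (\<Sum>i\<in>UNIV. norm (snd p $ i))\<^sup>2" by (simp add: power_mult_distrib)
 also have "\<dots> <= 16 * rad0\<^sup>2 * (real CARD('n) * ?s)" by (intro mult_left_mono sum_squares_card) auto
 finally have "(norm p)\<^sup>2 <= (1 + 16 * rad0\<^sup>2 * real CARD('n)) * ?s"
  unfolding sob_norm_sq by (simp add: algebra_simps)
 then have "coer * (norm p)\<^sup>2 <= coer * ((1 + 16 * rad0\<^sup>2 * real CARD('n)) * ?s)"
  using coer_pos by (intro mult_left_mono) auto
 also have "\<dots> = lam * ?s"
 proof -
  have "1 + 16 * rad0\<^sup>2 * real CARD('n) > 0" by (intro add_pos_nonneg) auto
  then show ?thesis unfolding coer_def by simp
 qed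
 also have "\<dots> <= form (snd p) (snd p)" by (rule form_coercive)
 finally show ?thesis .
qed

lemma energy_bound:
 assumes "p \<in> sob0 \<O>" "form (snd p) (snd p) <= m * norm (fst p)" "m \<ge> 0"
 shows "norm p <= m / coer"
proof -
 have "coer * (norm p)\<^sup>2 <= m * norm p"
  using form_coer[OF assms(1)] assms(2) mult_left_mono[OF norm_fst_le_norm[of p] assms(3)] by linarith
 then have "norm p * (coer * norm p) <= norm p * m" by (simp add: power2_eq_square mult_ac)
 then have "coer * norm p <= m \<or> norm p = 0" using norm_ge_zero[of p] by (metis mult_le_cancel_left_pos order_le_less)
 then show ?thesis using coer_pos assms(3) by (auto simp: pos_le_divide_eq mult.commute)
qed

text \<open>The right-hand side of the equation is absorbed into \<open>F\<close>, so one notion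
  covers linear, clipped semilinear and adjoint equations.\<close>

definition solves :: "(real^'n => real => real) => 'n sob => bool" where
 "solves F p \<longleftrightarrow> p \<in> sob0 \<O> \<and> (\<forall>q\<in>sob0 \<O>. form (snd p) (snd q) + nem F (fst p) \<bullet> fst q = 0)"

text \<open>The operator made of \<open>nem F\<close> and \<open>flux\<close> is Lipschitz, and
  strongly monotone on \<open>sob0\<close> by \<open>form_coer\<close> and the monotonicity of
  \<open>F\<close>; the variational inequality over this subspace is the equation.\<close>

lemma solves_exists:
 assumes l: "lip_mono F K" shows "\<exists>p. solves F p"
proof -
 define b where "b p = (nem F (fst p), flux (snd p))" for p :: "'n sob"
 have b: "b p \<bullet> q = nem F (fst p) \<bullet> fst q + form (snd p) (snd q)" for p q
  by (cases q) (simp add: b_def form_def)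
 obtain C where C: "\<And>V. norm (flux V) <= C * norm V" "C > 0"
  using bounded_linear.pos_bounded[OF flux_bounded_linear] by (auto simp: mult.commute)
 have "\<exists>u\<in>sob0 \<O>. \<forall>v\<in>sob0 \<O>. b u \<bullet> (v - u) \<ge> 0"
 proof (rule variational_ineq_exists[OF closed_sob0 _ _ coer_pos])
  show "convex (sob0 \<O>)" by (rule subspace_imp_convex[OF subspace_sob0])
  show "sob0 \<O> \<noteq> {}" using subspace_0[OF subspace_sob0] by blast
  fix u v :: "'n sob" assume uv: "u \<in> sob0 \<O>" "v \<in> sob0 \<O>"
  have "(b u - b v) \<bullet> (u - v) = (nem F (fst u) - nem F (fst v)) \<bullet> (fst u - fst v) + form (snd (u - v)) (snd (u - v))"
   by (simp add: b inner_diff_left form_linear)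
  then show "coer * (norm (u - v))\<^sup>2 <= (b u - b v) \<bullet> (u - v)"
   using form_coer[OF subspace_diff[OF subspace_sob0 uv]] nem_monotone[OF l, of "fst u" "fst v"] by simp
  have "b u - b v = (nem F (fst u) - nem F (fst v), flux (snd (u - v)))"
   using linear_diff[OF bounded_linear.linear[OF flux_bounded_linear]] by (simp add: b_def)
  then have "norm (b u - b v) <= norm (nem F (fst u) - nem F (fst v)) + norm (flux (snd (u - v)))"
   by (simp add: norm_Pair sqrt_sum_squares_le_sum)
  also have "\<dots> <= K * norm (u - v) + C * norm (u - v)"
  proof (intro add_mono)
   have "norm (nem F (fst u) - nem F (fst v)) <= K * norm (fst (u - v))" using nem_lipschitz[OF l] by simp
   also have "\<dots> <= K * norm (u - v)" by (intro mult_left_mono norm_fst_le_norm lip_mono_nonneg[OF l])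
   finally show "norm (nem F (fst u) - nem F (fst v)) <= K * norm (u - v)" .
   have "norm (flux (snd (u - v))) <= C * norm (snd (u - v))" by (rule C)
   also have "\<dots> <= C * norm (u - v)" using C(2) by (intro mult_left_mono norm_snd_le_norm) auto
   finally show "norm (flux (snd (u - v))) <= C * norm (u - v)" .
  qed
  finally show "norm (b u - b v) <= (K + C) * norm (u - v)" by (simp add: distrib_right)
 qed
 then obtain u where u: "u \<in> sob0 \<O>" "\<And>v. v \<in> sob0 \<O> ==> b u \<bullet> (v - u) \<ge> 0" by blast
 have "b u \<bullet> q = 0" if "q \<in> sob0 \<O>" for q by (rule variational_eq_on_subspace[OF subspace_sob0 u that])
 then have "\<forall>q\<in>sob0 \<O>. form (snd u) (snd q) + nem F (fst u) \<bullet> fst q = 0" by (simp add: b add.commute)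
 then show ?thesis unfolding solves_def using u(1) by blast
qed

text \<open>Test both equations with the difference and discard the monotone term. The two
  nonlinearities are compared at the second solution only, so a bound on that solution controls the
  error; this is decisive for adjoint states.\<close>

lemma solves_stable:
 assumes p: "solves F p" "solves G q" and l: "lip_mono F K"
 shows "norm (p - q) <= norm (nem F (fst q) - nem G (fst q)) / coer"
proof (rule energy_bound)
 have pq: "p \<in> sob0 \<O>" "q \<in> sob0 \<O>" using p by (auto simp: solves_def)
 show d: "p - q \<in> sob0 \<O>" by (rule subspace_diff[OF subspace_sob0 pq])
 have "form (snd p) (snd (p - q)) + nem F (fst p) \<bullet> fst (p - q) = 0"
  "form (snd q) (snd (p - q)) + nem G (fst q) \<bullet> fst (p - q) = 0" using p d unfolding solves_def by blast+
 then have "form (snd (p - q)) (snd (p - q)) = - ((nem F (fst p) - nem F (fst q)) \<bullet> (fst p - fst q))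
   - (nem F (fst q) - nem G (fst q)) \<bullet> fst (p - q)"
  by (simp add: form_linear inner_diff_left inner_diff_right)
 also have "\<dots> <= norm (nem F (fst q) - nem G (fst q)) * norm (fst (p - q))"
  using nem_monotone[OF l, of "fst p" "fst q"] norm_cauchy_schwarz[of "- (nem F (fst q) - nem G (fst q))" "fst (p - q)"]
  by (simp only: inner_minus_left norm_minus_cancel)
 finally show "form (snd (p - q)) (snd (p - q)) <= norm (nem F (fst q) - nem G (fst q)) * norm (fst (p - q))" .
qed simp

section \<open>Superlevel truncations and uniform bounds\<close>

definition cut :: "real => 'n sob => 'n sob" where
 "cut k p = (cls (\<lambda>x. max 0 (fn (fst p) x - k)), \<chi> i. mul (indicator {x. fn (fst p) x > k}) (snd p $ i))"

lemma bmeas_level: "bmeas (indicator {x. fn u x > k})"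
proof (rule bmeas_indicator)
 have "{x \<in> space lebesgue. fn u x > k} \<in> sets lebesgue" by measurable
 then show "{x. fn u x > k} \<in> sets lebesgue" by simp
qed

text \<open>For \<open>k \<ge> 0\<close> the truncated function vanishes off \<open>\<O>\<close>, so
  a cutoff equal to 1 on a large ball containing \<open>\<O>\<close> changes nothing and
  \<open>trunc_in_sob0\<close> applies.\<close>

lemma cut_in_sob0:
 assumes p: "p \<in> sob0 \<O>" and k: "k \<ge> 0"
 shows "cut k p \<in> sob0 \<O>" "sqint (\<lambda>x. max 0 (fn (fst p) x - k))"
proof -
 obtain R where R: "R > 0" "\<O> \<subseteq> ball 0 R" using bounded_\<O> bounded_subset_ballD[of \<O> 0] by blast
 obtain C where "\<forall>(z::real^'n) \<rho> R. 0 < \<rho> --> \<rho> < R --> (\<exists>\<eta>. is_cutoff C z \<rho> R \<eta>)"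
  using cutoff_exists[where 'n='n] by blast
 then obtain \<eta> where c: "is_cutoff C (0::real^'n) R (R + 1) \<eta>" using R(1) by (meson less_add_one)
 then have \<eta>: "\<forall>x\<in>cball 0 R. \<eta> x = 1" "\<forall>i. \<forall>x\<in>ball 0 R. partial_deriv i \<eta> x = 0"
  unfolding is_cutoff_def by blast+
 have t: "\<eta> \<in> test_fun UNIV"
  using c test_fun_mono[of "ball 0 (R + 1)" UNIV \<eta>] unfolding is_cutoff_def by blast
 note z = sob0_zero_outside[OF p open_\<O>]
 have 1: "AE x in lebesgue. \<eta> x * max 0 (fn (fst p) x - k) = max 0 (fn (fst p) x - k)" using z(1)
 proof eventually_elim
  case (elim x)
  then show ?case using \<eta>(1) R(2) k by (cases "x \<in> \<O>") auto
 qed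
 from sqint_cutoff_pos[OF t] have s: "sqint (\<lambda>x. \<eta> x * max 0 (fn (fst p) x - k))" .
 show "sqint (\<lambda>x. max 0 (fn (fst p) x - k))" by (rule sqint_AE_cong[OF s 1])
 have f: "fst (trunc \<eta> k p) = fst (cut k p)" unfolding trunc_def cut_def using cls_eqI[OF s 1] by simp
 have g: "snd (trunc \<eta> k p) $ i = snd (cut k p) $ i" for i
 proof -
  have "AE x in lebesgue. partial_deriv i \<eta> x * max 0 (fn (fst p) x - k) + \<eta> x * (if fn (fst p) x > k then fn (snd p $ i) x else 0)
    = indicator {x. fn (fst p) x > k} x * fn (snd p $ i) x" using z(1) z(2)[of i]
  proof eventually_elim
   case (elim x)
   then show ?case using \<eta> R(2) k by (cases "x \<in> \<O>") (auto simp: indicator_def)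
  qed
  then show ?thesis unfolding trunc_def cut_def mul_def
   by (auto intro!: cls_eqI sqint_add sqint_cutoff_pos sqint_cutoff_grad test_fun_partial t)
 qed
 have "trunc \<eta> k p = cut k p" using f g by (simp add: prod_eq_iff vec_eq_iff)
 then show "cut k p \<in> sob0 \<O>" using trunc_in_sob0[OF p t, of k] k by simp
qed

text \<open>The gradient of \<open>p\<close> coincides with that of its truncation wherever the
  latter can be nonzero, so the form sees only the truncation.\<close>

lemma form_cut: "form (snd p) (snd (cut k p)) = form (snd (cut k p)) (snd (cut k p))"
proof -
 let ?I = "indicator {x. fn (fst p) x > k} :: real^'n => real"
 have "mul (a i j) (snd p $ i) \<bullet> mul ?I (snd p $ j) = mul (a i j) (mul ?I (snd p $ i)) \<bullet> mul ?I (snd p $ j)" for i j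
  unfolding inner_mul[OF bmeas_a]
 proof (rule integral_cong_AE)
  show "AE x in lebesgue. a i j x * fn (snd p $ i) x * fn (mul ?I (snd p $ j)) x = a i j x * fn (mul ?I (snd p $ i)) x * fn (mul ?I (snd p $ j)) x"
   using fn_mul[OF bmeas_level[where u = "fst p" and k = k], of "snd p $ i"] fn_mul[OF bmeas_level[where u = "fst p" and k = k], of "snd p $ j"]
   by eventually_elim (auto simp: indicator_def)
 qed (use a_meas in measurable)
 then show ?thesis by (simp add: form_eq cut_def)
qed

text \<open>Stampacchia's bound: the levels increase to \<open>K m\<close> while the superlevel sets shrink
 geometrically; the step needs \<open>4 / N > 1\<close>.\<close>

lemma sup_bound_pos:
 "\<exists>K>0. \<forall>p\<in>sob0 \<O>. \<forall>m>0. (\<forall>k\<ge>0. form (snd p) (snd (cut k p)) <= m * norm (fst (cut k p)))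
  --> (AE x in lebesgue. fn (fst p) x <= K * m)"
proof -
 define w where "w = measure lborel (cball (0::real^'n) 1)"
 have w: "w > 0" using measure_cball1_pos by (simp add: w_def)
 let ?n = "real CARD('n)"
 \<comment> \<open>Faber-Krahn contributes the factor \<open>4 * r\<close> twice and coercivity for
   the sum of norms the factor \<open>?n / lam\<close>; this gives \<open>key\<close>, a bound
   quadratic in \<open>r\<close>.\<close>
 define C where "C = 16 * ?n / lam"
 have C: "C > 0" using lam_pos by (simp add: C_def)
 \<comment> \<open>Chosen to close the induction: \<open>512 = 4 * 128\<close>, where 4 comes from
   the squared level gap and \<open>128 = 2 * 4 ^ 3\<close> covers the doubled measure and one more
   reduction of the radius in dimension 3.\<close>
 define K where "K = sqrt (512 * C\<^sup>2 * rad0 ^ 4 / (w * rad0 ^ CARD('n)))"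
 have K: "K > 0" using C w rad0_ge by (simp add: K_def)
 have K2: "K\<^sup>2 * (w * rad0 ^ CARD('n)) = 512 * C\<^sup>2 * rad0 ^ 4" using C w rad0_ge by (simp add: K_def)
 show ?thesis
 proof (intro exI[of _ K] conjI K ballI allI impI)
  fix p m assume p: "p \<in> sob0 \<O>" and m: "m > 0"
   and F: "\<forall>k\<ge>0. form (snd p) (snd (cut k p)) <= m * norm (fst (cut k p))"
  define A where "A k = {x \<in> \<O>. fn (fst p) x > k}" for k
  have Al: "A k \<in> lmeasurable" for k
  proof (rule fmeasurableI2[OF \<O>_lmeasurable])
   have "A k = \<O> \<inter> {x. fn (fst p) x > k}" by (auto simp: A_def)
   moreover have "\<O> \<in> sets lebesgue" using open_\<O> by (auto simp: borel_open)
   ultimately show "A k \<in> sets lebesgue" by simp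
  qed (auto simp: A_def)
  have key: "norm (fst (cut k p)) <= C * m * r\<^sup>2" if k: "k \<ge> 0" and r: "r > 0" "2 * measure lebesgue (A k) <= w * r ^ CARD('n)" for k r
  proof -
   let ?q = "cut k p"
   let ?s = "\<Sum>i\<in>UNIV. norm (snd ?q $ i)"
   have q: "?q \<in> sob0 \<O>" "sqint (\<lambda>x. max 0 (fn (fst p) x - k))" using cut_in_sob0[OF p k] by auto
   have "AE x in lebesgue. x \<notin> A k --> fn (fst ?q) x = 0"
    using fn_cls[OF q(2)] sob0_zero_outside(1)[OF p open_\<O>]
    by eventually_elim (use k in \<open>auto simp: cut_def A_def\<close>)
   then have fk: "norm (fst ?q) <= 4 * r * ?s"
    using r measure_cball_eq[of r "0::real^'n"] by (intro sob0_faber_krahn[OF q(1) Al[of k]]) (auto simp: w_def)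
   have "lam * ?s\<^sup>2 <= ?n * form (snd ?q) (snd ?q)" by (rule form_coercive')
   also have "\<dots> <= ?n * (m * norm (fst ?q))" using F k form_cut[of p k] by (intro mult_left_mono) auto
   also have "\<dots> <= ?n * (m * (4 * r * ?s))" using fk m by (intro mult_left_mono) auto
   finally have "?s * (lam * ?s) <= ?s * (4 * ?n * m * r)" by (simp add: power2_eq_square mult_ac)
   moreover have s0: "?s \<ge> 0" by (intro sum_nonneg) auto
   ultimately have "lam * ?s <= 4 * ?n * m * r"
    using m r by (cases "?s = 0") (auto simp: mult_le_cancel_left)
   then have "?s <= 4 * ?n * m * r / lam" using lam_pos by (simp add: pos_le_divide_eq mult.commute)
   then have "4 * r * ?s <= 4 * r * (4 * ?n * m * r / lam)" using r by (intro mult_left_mono) auto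
   with fk have "norm (fst ?q) <= 4 * r * (4 * ?n * m * r / lam)" by linarith
   then show ?thesis by (simp add: C_def power2_eq_square mult_ac)
  qed
  define k where "k j = K * m * (1 - 1 / 2 ^ j)" for j :: nat
  have k0: "k j \<ge> 0" for j using K m by (simp add: k_def)
  \<comment> \<open>Twice the measure of the superlevel set at \<open>k j\<close> is to stay below
    the volume of a ball of radius \<open>r j\<close>. Level gaps halve while radii shrink by 4, so
    the quadratic bound from \<open>key\<close> more than compensates.\<close>
  define r where "r j = rad0 / 4 ^ j" for j :: nat
  have r0: "r j > 0" for j using rad0_ge by (simp add: r_def)
  have small: "2 * measure lebesgue (A (k j)) <= w * r j ^ CARD('n)" for j
  proof (induction j)
   case 0
   have "measure lebesgue (A (k 0)) <= measure lebesgue \<O>"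
    using Al by (intro measure_mono_fmeasurable[OF _ _ \<O>_lmeasurable]) (auto simp: A_def fmeasurableD)
   then show ?case using rad0_measure measure_cball_eq[of rad0 "0::real^'n"] rad0_ge by (simp add: r_def w_def)
  next
   case (Suc j)
   have "(k (Suc j) - k j)\<^sup>2 * measure lebesgue (A (k (Suc j))) <= (norm (fst (cut (k j) p)))\<^sup>2"
   proof (rule chebyshev_L2[OF Al])
    show "AE x in lebesgue. x \<in> A (k (Suc j)) --> k (Suc j) - k j <= \<bar>fn (fst (cut (k j) p)) x\<bar>"
     using fn_cls[OF cut_in_sob0(2)[OF p k0[of j]]] by eventually_elim (auto simp: cut_def A_def)
    show "0 <= k (Suc j) - k j" using K m by (simp add: k_def field_simps)
   qed
   also have "\<dots> <= (C * m * (r j)\<^sup>2)\<^sup>2" by (intro power_mono key k0 r0 Suc) auto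
   also have "k (Suc j) - k j = K * m / (2 * 2 ^ j)" by (simp add: k_def field_simps)
   finally have "(K * m / (2 * 2 ^ j))\<^sup>2 * measure lebesgue (A (k (Suc j))) <= (C * m * (r j)\<^sup>2)\<^sup>2" .
   moreover have "(K * m / (2 * 2 ^ j))\<^sup>2 = m\<^sup>2 * (K\<^sup>2 / (4 * 4 ^ j))"
    by (simp add: power_mult_distrib power_divide power2_eq_square flip: power_mult_distrib)
   moreover have "(C * m * (r j)\<^sup>2)\<^sup>2 = m\<^sup>2 * (C\<^sup>2 * rad0 ^ 4 / (4 ^ j) ^ 4)"
    by (simp add: r_def power_mult_distrib power_divide power2_eq_square power4_eq_xxxx mult_ac)
   ultimately have "m\<^sup>2 * (K\<^sup>2 / (4 * 4 ^ j) * measure lebesgue (A (k (Suc j)))) <= m\<^sup>2 * (C\<^sup>2 * rad0 ^ 4 / (4 ^ j) ^ 4)"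
    by (simp add: mult.assoc)
   then have "K\<^sup>2 / (4 * 4 ^ j) * measure lebesgue (A (k (Suc j))) <= C\<^sup>2 * rad0 ^ 4 / (4 ^ j) ^ 4"
    using m by (simp only: mult_le_cancel_left_pos zero_less_power)
   then have "K\<^sup>2 * measure lebesgue (A (k (Suc j))) <= 4 * 4 ^ j * (C\<^sup>2 * rad0 ^ 4 / (4 ^ j) ^ 4)"
    by (simp add: field_simps)
   also have "\<dots> = 4 * (C\<^sup>2 * rad0 ^ 4) / (4 ^ j) ^ 3"
    by (simp add: power3_eq_cube power4_eq_xxxx field_simps)
   also have "\<dots> = K\<^sup>2 * (w * rad0 ^ CARD('n)) / 128 / (4 ^ j) ^ 3" unfolding K2 by simp
   finally have "K\<^sup>2 * measure lebesgue (A (k (Suc j))) <= K\<^sup>2 * (w * rad0 ^ CARD('n) / 128 / (4 ^ j) ^ 3)" by simp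
   then have m1: "measure lebesgue (A (k (Suc j))) <= w * rad0 ^ CARD('n) / 128 / (4 ^ j) ^ 3"
    using K by (simp only: mult_le_cancel_left_pos zero_less_power)
   \<comment> \<open>The estimate yields the decay exponent 3 for \<open>4 ^ j\<close>, which
     suffices because the dimension is at most 3.\<close>
   have m2: "w * rad0 ^ CARD('n) / (2 * (64 * (4 ^ j) ^ 3)) <= w * rad0 ^ CARD('n) / (2 * (4 ^ Suc j) ^ CARD('n))"
   proof (intro divide_left_mono mult_left_mono)
    have "(4 ^ Suc j :: real) ^ CARD('n) <= (4 ^ Suc j) ^ 3"
     using dim_le by (intro power_increasing one_le_power) auto
    also have "\<dots> = 64 * (4 ^ j) ^ 3" by (simp add: power3_eq_cube)
    finally show "(4 ^ Suc j) ^ CARD('n) <= 64 * (4 ^ j :: real) ^ 3" .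
   qed (use w rad0_ge in auto)
   have m3: "w * rad0 ^ CARD('n) / 128 / (4 ^ j) ^ 3 = w * rad0 ^ CARD('n) / (2 * (64 * (4 ^ j) ^ 3))" by simp
   have "2 * measure lebesgue (A (k (Suc j))) <= 2 * (w * rad0 ^ CARD('n) / (2 * (4 ^ Suc j) ^ CARD('n)))"
    by (rule mult_left_mono[OF order_trans[OF m1[unfolded m3] m2]]) simp
   also have "\<dots> = w * rad0 ^ CARD('n) / (4 ^ Suc j) ^ CARD('n)" by simp
   finally have "2 * measure lebesgue (A (k (Suc j))) <= w * rad0 ^ CARD('n) / (4 ^ Suc j) ^ CARD('n)" .
   then show ?case by (simp add: r_def power_divide)
  qed
  have mb: "measure lebesgue (A (K * m)) <= w * rad0 ^ CARD('n) * (1 / 4) ^ j" for j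
  proof -
   have "measure lebesgue (A (K * m)) <= measure lebesgue (A (k j))"
   proof (rule measure_mono_fmeasurable[OF _ fmeasurableD[OF Al] Al])
    have "k j <= K * m" using K m by (simp add: k_def)
    then show "A (K * m) \<subseteq> A (k j)" by (auto simp: A_def)
   qed
   also have "\<dots> <= w * (rad0 / 4 ^ j) ^ CARD('n)"
    using small[of j] w rad0_ge measure_nonneg[of lebesgue "A (k j)"] unfolding r_def by linarith
   also have "\<dots> <= w * (rad0 ^ CARD('n) * (1 / 4) ^ j)"
   proof (intro mult_left_mono)
    have "((1 / 4 :: real) ^ j) ^ CARD('n) <= ((1 / 4) ^ j) ^ 1"
     by (intro power_decreasing) (auto simp: power_le_one)
    then have "rad0 ^ CARD('n) * ((1 / 4) ^ j) ^ CARD('n) <= rad0 ^ CARD('n) * ((1 / 4) ^ j) ^ 1"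
     using rad0_ge by (intro mult_left_mono) auto
    moreover have "rad0 / 4 ^ j = rad0 * (1 / 4) ^ j" by (simp add: power_one_over)
    ultimately show "(rad0 / 4 ^ j) ^ CARD('n) <= rad0 ^ CARD('n) * (1 / 4) ^ j"
     by (simp only: power_mult_distrib power_one_right)
   qed (use w in auto)
   finally show ?thesis by (simp add: mult.assoc)
  qed
  have ml: "(\<lambda>j. w * rad0 ^ CARD('n) * (1 / 4) ^ j) \<longlonglongrightarrow> w * rad0 ^ CARD('n) * 0"
   by (intro tendsto_mult tendsto_const LIMSEQ_realpow_zero) auto
  have "measure lebesgue (A (K * m)) <= w * rad0 ^ CARD('n) * 0"
   by (rule LIMSEQ_le_const[OF ml]) (use mb in blast)
  then have "measure lebesgue (A (K * m)) <= 0" by simp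
  then have "A (K * m) \<in> null_sets lebesgue" using Al[of "K * m"] measure_nonneg[of lebesgue "A (K * m)"]
   by (simp add: null_sets_def fmeasurable_def emeasure_eq_ennreal_measure less_top)
  from AE_not_in[OF this] sob0_zero_outside(1)[OF p open_\<O>]
  show "AE x in lebesgue. fn (fst p) x <= K * m"
  proof eventually_elim
   case (elim x)
   then show ?case using K m by (cases "x \<in> \<O>") (auto simp: A_def)
  qed
 qed
qed

text \<open>The case \<open>m = 0\<close> follows by applying \<open>sup_bound_pos\<close> to
  \<open>m + 1 / (n + 1)\<close> and intersecting countably many sets of full measure.\<close>

lemma sup_bound:
 "\<exists>K>0. \<forall>p\<in>sob0 \<O>. \<forall>m\<ge>0. (\<forall>k\<ge>0. form (snd p) (snd (cut k p)) <= m * norm (fst (cut k p)))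
  --> (AE x in lebesgue. fn (fst p) x <= K * m)"
proof -
 obtain K where K: "K > 0" "\<And>p m. p \<in> sob0 \<O> ==> m > 0 ==> \<forall>k\<ge>0. form (snd p) (snd (cut k p)) <= m * norm (fst (cut k p))
  ==> AE x in lebesgue. fn (fst p) x <= K * m" using sup_bound_pos by blast
 show ?thesis
 proof (intro exI[of _ K] conjI K(1) ballI allI impI)
  fix p m assume p: "p \<in> sob0 \<O>" and m: "0 <= m"
   and F: "\<forall>k\<ge>0. form (snd p) (snd (cut k p)) <= m * norm (fst (cut k p))"
  have "AE x in lebesgue. fn (fst p) x <= K * (m + 1 / real (Suc n))" for n
  proof (rule K(2)[OF p])
   show "\<forall>k\<ge>0. form (snd p) (snd (cut k p)) <= (m + 1 / real (Suc n)) * norm (fst (cut k p))"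
   proof (intro allI impI)
    fix k :: real assume "k \<ge> 0"
    then have "form (snd p) (snd (cut k p)) <= m * norm (fst (cut k p))" using F by blast
    also have "\<dots> <= (m + 1 / real (Suc n)) * norm (fst (cut k p))" by (intro mult_right_mono) auto
    finally show "form (snd p) (snd (cut k p)) <= (m + 1 / real (Suc n)) * norm (fst (cut k p))" .
   qed
   show "m + 1 / real (Suc n) > 0" using m by (intro add_nonneg_pos) auto
  qed
  then have "AE x in lebesgue. \<forall>n. fn (fst p) x <= K * (m + 1 / real (Suc n))" by (simp only: AE_all_countable) blast
  then show "AE x in lebesgue. fn (fst p) x <= K * m"
  proof eventually_elim
   case (elim x)
   have ml: "(\<lambda>n. K * (m + 1 / real (Suc n))) \<longlonglongrightarrow> K * (m + 0)"
    by (intro tendsto_mult tendsto_add tendsto_const LIMSEQ_Suc[OF lim_1_over_n])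
   have "fn (fst p) x <= K * (m + 0)" by (rule LIMSEQ_le_const[OF ml]) (use elim in blast)
   then show ?case by simp
  qed
 qed
qed

lemma lip_mono_reflect: "lip_mono F K ==> lip_mono (\<lambda>x t. - F x (- t)) K"
proof -
 assume l: "lip_mono F K"
 have "\<bar>- F x (- s) - - F x (- t)\<bar> <= K * \<bar>s - t\<bar>" for x s t
  using lip_monoD(3)[OF l, of x "- t" "- s"] by (simp add: abs_minus_commute)
 moreover have "(\<lambda>x. - F x (- t)) \<in> borel_measurable lebesgue" for t
  using lip_monoD(1)[OF l, of "- t"] by simp
 moreover have "- F x (- s) <= - F x (- t)" if "s <= t" for x s t
  using lip_monoD(4)[OF l, of "- t" "- s" x] that by simp
 ultimately show ?thesis using sqint_uminus[OF lip_monoD(2)[OF l]] unfolding lip_mono_def by simp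
qed

lemma nem_reflect:
 assumes "lip_mono F K" shows "nem (\<lambda>x t. - F x (- t)) (- u) = - nem F u"
proof -
 have "AE x in lebesgue. - F x (- fn (- u) x) = - F x (fn u x)"
  using fn_uminus[of u] by eventually_elim simp
 then have "nem (\<lambda>x t. - F x (- t)) (- u) = cls (\<lambda>x. - F x (fn u x))"
  unfolding nem_def by (rule cls_eqI[OF sqint_nem[OF lip_mono_reflect[OF assms] sqint_fn]])
 then show ?thesis unfolding nem_def by (simp add: cls_uminus sqint_nem[OF assms])
qed

text \<open>Reflection in the origin preserves \<open>lip_mono\<close>, so every upper bound for
  solutions also gives a lower bound.\<close>

lemma solves_reflect:
 assumes s: "solves F p" and l: "lip_mono F K" shows "solves (\<lambda>x t. - F x (- t)) (- p)"
 using s subspace_neg[OF subspace_sob0, of p \<O>]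
 unfolding solves_def by (auto simp: nem_reflect[OF l] form_linear)

text \<open>Where \<open>u > k \<ge> 0\<close>, monotonicity gives
  \<open>F x (u x) \<ge> F x 0\<close>. Hence only \<open>F x 0\<close> enters the bound and the
  Lipschitz constant does not, which makes sup bounds independent of the clipping level.\<close>

lemma solves_cut_le:
 assumes s: "solves F p" and l: "lip_mono F K" and k: "k \<ge> 0"
 shows "form (snd p) (snd (cut k p)) <= norm (cls (\<lambda>x. F x 0)) * norm (fst (cut k p))"
proof -
 have p: "p \<in> sob0 \<O>" using s by (simp add: solves_def)
 let ?v = "\<lambda>x. max 0 (fn (fst p) x - k)"
 note sv = cut_in_sob0(2)[OF p k]
 have "form (snd p) (snd (cut k p)) = - (nem F (fst p) \<bullet> cls ?v)"
  using s cut_in_sob0(1)[OF p k] unfolding solves_def by (force simp: cut_def)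
 also have "\<dots> <= - (cls (\<lambda>x. F x 0) \<bullet> cls ?v)"
 proof -
  have "(LINT x|lebesgue. F x 0 * ?v x) <= (LINT x|lebesgue. F x (fn (fst p) x) * ?v x)"
  proof (intro integral_mono sqint_mult lip_monoD(2)[OF l] sqint_nem[OF l sqint_fn] sv)
   fix x
   show "F x 0 * ?v x <= F x (fn (fst p) x) * ?v x" using lip_monoD(4)[OF l, of 0 "fn (fst p) x" x] k
    by (cases "fn (fst p) x > k") (auto intro: mult_right_mono)
  qed
  then show ?thesis
   unfolding nem_def by (simp add: inner_cls lip_monoD(2)[OF l] sqint_nem[OF l sqint_fn] sv)
 qed
 also have "\<dots> <= norm (cls (\<lambda>x. F x 0)) * norm (cls ?v)"
  using norm_cauchy_schwarz[of "- cls (\<lambda>x. F x 0)" "cls ?v"] by simp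
 finally show ?thesis by (simp add: cut_def)
qed

text \<open>Choosing one constant for the given coefficients and domain makes the a priori bound of
  a state an explicit function of its source.\<close>

definition supc :: real where
 "supc = (SOME K. K > 0 \<and> (\<forall>p\<in>sob0 \<O>. \<forall>m\<ge>0. (\<forall>k\<ge>0. form (snd p) (snd (cut k p)) <= m * norm (fst (cut k p)))
  --> (AE x in lebesgue. fn (fst p) x <= K * m)))"

lemma supc: "supc > 0" "p \<in> sob0 \<O> ==> m \<ge> 0 ==> (\<And>k. k \<ge> 0 ==> form (snd p) (snd (cut k p)) <= m * norm (fst (cut k p)))
  ==> AE x in lebesgue. fn (fst p) x <= supc * m"
proof -
 have *: "supc > 0 \<and> (\<forall>p\<in>sob0 \<O>. \<forall>m\<ge>0. (\<forall>k\<ge>0. form (snd p) (snd (cut k p)) <= m * norm (fst (cut k p)))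
  --> (AE x in lebesgue. fn (fst p) x <= supc * m))"
  unfolding supc_def by (rule someI_ex) (use sup_bound in blast)
 then show "supc > 0" by blast
 show "p \<in> sob0 \<O> ==> m \<ge> 0 ==> (\<And>k. k \<ge> 0 ==> form (snd p) (snd (cut k p)) <= m * norm (fst (cut k p)))
  ==> AE x in lebesgue. fn (fst p) x <= supc * m" using * by blast
qed

lemma solves_sup_bound:
 assumes s: "solves F p" and l: "lip_mono F K"
 shows "AE x in lebesgue. \<bar>fn (fst p) x\<bar> <= supc * norm (cls (\<lambda>x. F x 0))"
proof -
 have p: "p \<in> sob0 \<O>" using s by (simp add: solves_def)
 have 1: "AE x in lebesgue. fn (fst p) x <= supc * norm (cls (\<lambda>x. F x 0))"
  by (rule supc(2)[OF p _ solves_cut_le[OF s l]]) auto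
 have "norm (cls (\<lambda>x. - F x (- 0))) = norm (cls (\<lambda>x. F x 0))"
  using cls_uminus[OF lip_monoD(2)[OF l]] by (metis minus_zero norm_minus_cancel)
 then have 2: "AE x in lebesgue. fn (fst (- p)) x <= supc * norm (cls (\<lambda>x. F x 0))"
  using supc(2)[OF subspace_neg[OF subspace_sob0 p] _ solves_cut_le[OF solves_reflect[OF s l] lip_mono_reflect[OF l]]] by simp
 from 1 2 fn_uminus[of "fst p"] show ?thesis by eventually_elim auto
qed

end

subsection \<open>De Giorgi's oscillation estimate\<close>

lemma test_fun_outside: "\<eta> \<in> test_fun S ==> x \<notin> S ==> \<eta> x = 0 \<and> partial_deriv i \<eta> x = 0"
 by (rule test_fun_support[of \<eta> S]) auto

text \<open>The Poincare estimates use Borel sets, while sublevel sets are only Lebesgue measurable;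
  this supplies a Borel subset of full measure.\<close>

lemma lmeasurable_borel_core:
 assumes "E \<in> lmeasurable"
 obtains S where "S \<in> sets borel" "S \<subseteq> E" "measure lborel S = measure lebesgue E" "AE x\<in>E in lebesgue. x \<in> S"
proof -
 have "E \<in> sets (completion lborel)" using assms by (simp add: fmeasurableD)
 then obtain S N N' where S: "E = S \<union> N" "N \<subseteq> N'" "N' \<in> null_sets lborel" "S \<in> sets lborel"
  by (rule sets_completionE)
 have "AE x in lebesgue. x \<notin> N'" using S(3) by (intro AE_completion AE_not_in)
 then have ae: "AE x\<in>E in lebesgue. x \<in> S" by eventually_elim (use S in auto)
 have "measure lebesgue S = measure lebesgue E"
  by (rule measure_eq_AE) (use ae S(1) assms S(4) in \<open>auto elim!: eventually_mono\<close>)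
 then have "measure lborel S = measure lebesgue E" using S(4) by simp
 then show thesis using that[of S] S(1,4) ae by auto
qed

lemma measure_ball_eq: "r \<ge> 0 ==> measure lebesgue (ball (z::real^'n) r) = measure lborel (cball (0::real^'n) 1) * r ^ CARD('n)"
 by (simp add: content_ball content_cball)

context elliptic_domain
begin

definition lvl :: "'n sob => real => real^'n => real => (real^'n) set" where
 "lvl p k z R = {x \<in> ball z R. fn (fst p) x > k}"

lemma level_set_meas: "{x. fn u x > k} \<in> sets lebesgue" "{x. fn u x <= k} \<in> sets lebesgue"
proof -
 have "{x \<in> space lebesgue. fn u x > k} \<in> sets lebesgue" "{x \<in> space lebesgue. fn u x <= k} \<in> sets lebesgue" by measurable
 then show "{x. fn u x > k} \<in> sets lebesgue" "{x. fn u x <= k} \<in> sets lebesgue" by simp_all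
qed

lemma lvl_lmeasurable: "lvl p k z R \<in> lmeasurable"
proof (rule fmeasurableI2[of "ball z R"])
 have "lvl p k z R = ball z R \<inter> {x. fn (fst p) x > k}" by (auto simp: lvl_def)
 then show "lvl p k z R \<in> sets lebesgue" using sets.Int[OF fmeasurableD[OF lmeasurable_ball] level_set_meas(1)] by simp
qed (auto simp: lvl_def)

lemma lvl_measure_mono: "k <= h ==> \<rho> <= R ==> measure lebesgue (lvl p h z \<rho>) <= measure lebesgue (lvl p k z R)"
 by (rule measure_mono_fmeasurable[OF _ fmeasurableD[OF lvl_lmeasurable] lvl_lmeasurable]) (auto simp: lvl_def)

lemma lvl_null:
 assumes "measure lebesgue (lvl p k z R) <= 0" shows "AE x\<in>ball z R in lebesgue. fn (fst p) x <= k"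
proof -
 have "measure lebesgue (lvl p k z R) = 0" using assms by (intro antisym) auto
 then have "lvl p k z R \<in> null_sets lebesgue" using lvl_lmeasurable[of p k z R]
  by (simp add: null_sets_def fmeasurable_def emeasure_eq_ennreal_measure less_top)
 from AE_not_in[OF this] show ?thesis by eventually_elim (auto simp: lvl_def)
qed

text \<open>A solution of the homogeneous equation in a ball that may cross the boundary: the tests
  vanish off the ball, and \<open>p\<close> keeps its zero boundary values through
  \<open>sob0\<close>.\<close>

definition harm :: "'n sob => real^'n => real => bool" where
 "harm p z s \<longleftrightarrow> p \<in> sob0 \<O> \<and> (\<forall>q\<in>sob0 \<O>. (AE x in lebesgue. x \<notin> ball z s --> fn (fst q) x = 0) --> form (snd p) (snd q) = 0)"

text \<open>The levels for which a cutoff of the ball times \<open>(u - k)\<^sup>+\<close> vanishes outside \<open>\<Omega>\<close>.\<close>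

definition adm :: "real => real^'n => real => bool" where
 "adm k z R \<longleftrightarrow> k \<ge> 0 \<or> ball z R \<subseteq> \<O>"

text \<open>With \<open>cY\<close>, one of the two halves of the gradient of the localised
  truncation: here the cutoff multiplies the gradient of the function, there the function multiplies
  the gradient of the cutoff.\<close>

definition cX :: "(real^'n => real) => real => 'n sob => ((real^'n) L2)^'n" where
 "cX \<eta> k p = (\<chi> i. cls (\<lambda>x. \<eta> x * (if fn (fst p) x > k then fn (snd p $ i) x else 0)))"

definition cY :: "(real^'n => real) => real => 'n sob => ((real^'n) L2)^'n" where
 "cY \<eta> k p = (\<chi> i. cls (\<lambda>x. partial_deriv i \<eta> x * max 0 (fn (fst p) x - k)))"

lemma snd_trunc: "\<eta> \<in> test_fun UNIV ==> snd (trunc \<eta> k p) $ i = cY \<eta> k p $ i + cX \<eta> k p $ i"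
 unfolding trunc_def cX_def cY_def
 by (simp add: cls_add sqint_cutoff_pos[OF test_fun_partial] sqint_cutoff_grad)

lemma trunc_adm:
 assumes "p \<in> sob0 \<O>" "\<eta> \<in> test_fun (ball z R)" "adm k z R"
 shows "trunc \<eta> k p \<in> sob0 \<O>"
 using assms by (intro trunc_in_sob0) (auto simp: adm_def test_fun_iff)

lemma fn_trunc:
 assumes "\<eta> \<in> test_fun UNIV"
 shows "AE x in lebesgue. fn (fst (trunc \<eta> k p)) x = \<eta> x * max 0 (fn (fst p) x - k)"
 unfolding trunc_def using fn_cls[OF sqint_cutoff_pos[OF assms]] by simp

text \<open>Test with \<open>\<eta>\<^sup>2\<close> times the positive part of \<open>u - k\<close>.
  The form then equals \<open>form X X + 2 * form X Y\<close> for the two halves \<open>X\<close>,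
  \<open>Y\<close> of the gradient, so coercivity lets \<open>Y\<close> control
  \<open>X\<close>.\<close>

lemma caccioppoli:
 assumes h: "harm p z s" and R: "R <= s" and \<eta>: "\<eta> \<in> test_fun (ball z R)" and k: "adm k z R"
 shows "lam * (\<Sum>i\<in>UNIV. norm (cX \<eta> k p $ i)) <= 2 * real CARD('n) * Lam * (\<Sum>i\<in>UNIV. norm (cY \<eta> k p $ i))"
proof -
 have p: "p \<in> sob0 \<O>" using h by (simp add: harm_def)
 let ?u = "fn (fst p)"
 let ?X = "cX \<eta> k p" and ?Y = "cY \<eta> k p"
 have t: "\<eta> \<in> test_fun UNIV" using test_fun_mono[OF _ \<eta>] by blast
 have e2: "(\<lambda>x. \<eta> x * \<eta> x) \<in> test_fun (ball z R)" by (rule test_fun_mult[OF \<eta> test_fun_smooth[OF \<eta>]])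
 have t2: "(\<lambda>x. \<eta> x * \<eta> x) \<in> test_fun UNIV" using test_fun_mono[OF _ e2] by blast
 let ?V = "trunc (\<lambda>x. \<eta> x * \<eta> x) k p"
 have pd: "partial_deriv i (\<lambda>x. \<eta> x * \<eta> x) x = 2 * (\<eta> x * partial_deriv i \<eta> x)" for i x
  by (subst partial_deriv_mult) (auto intro: smooth_fun_differentiable test_fun_smooth[OF \<eta>])
 have "AE x in lebesgue. x \<notin> ball z s --> fn (fst ?V) x = 0" using fn_trunc[OF t2, of k p]
 proof eventually_elim
  case (elim x)
  then show ?case using test_fun_outside[OF \<eta>, of x] R by auto
 qed
 then have 0: "form (snd p) (snd ?V) = 0" using h trunc_adm[OF p e2 k] unfolding harm_def by blast
 have sX: "sqint (\<lambda>x. \<eta> x * (if ?u x > k then fn (snd p $ i) x else 0))" for i by (rule sqint_cutoff_grad[OF t])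
 have sY: "sqint (\<lambda>x. partial_deriv i \<eta> x * max 0 (?u x - k))" for i by (rule sqint_cutoff_pos[OF test_fun_partial[OF t]])
 have eq: "mul (a i j) (snd p $ i) \<bullet> (snd ?V $ j) = mul (a i j) (?X $ i) \<bullet> (?X $ j) + 2 * (mul (a i j) (?X $ i) \<bullet> (?Y $ j))" for i j
 proof -
  have fX: "AE x in lebesgue. fn (?X $ i) x = \<eta> x * (if ?u x > k then fn (snd p $ i) x else 0)" for i
   using fn_cls[OF sX] by (simp add: cX_def)
  have fY: "AE x in lebesgue. fn (?Y $ i) x = partial_deriv i \<eta> x * max 0 (?u x - k)" for i
   using fn_cls[OF sY] by (simp add: cY_def)
  have "AE x in lebesgue. fn (snd ?V $ j) x = partial_deriv j (\<lambda>x. \<eta> x * \<eta> x) x * max 0 (?u x - k) + \<eta> x * \<eta> x * (if ?u x > k then fn (snd p $ j) x else 0)"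
   unfolding trunc_def
   using fn_cls[OF sqint_add[OF sqint_cutoff_pos[OF test_fun_partial[OF t2]] sqint_cutoff_grad[OF t2]]] by simp
  then have ae: "AE x in lebesgue. a i j x * fn (snd p $ i) x * fn (snd ?V $ j) x
   = a i j x * fn (?X $ i) x * fn (?X $ j) x + 2 * (a i j x * fn (?X $ i) x * fn (?Y $ j) x)"
   using fX[of i] fX[of j] fY[of j] by eventually_elim (auto simp: pd algebra_simps max_def)
  have m: "a i j \<in> borel_measurable lebesgue" by (rule a_meas)
  have int: "integrable lebesgue (\<lambda>x. a i j x * fn u x * fn v x)" for u v
   by (intro sqint_mult sqint_bmeas_mult bmeas_a sqint_fn)
  have "(LINT x|lebesgue. a i j x * fn (snd p $ i) x * fn (snd ?V $ j) x)
   = (LINT x|lebesgue. a i j x * fn (?X $ i) x * fn (?X $ j) x + 2 * (a i j x * fn (?X $ i) x * fn (?Y $ j) x))"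
   by (rule integral_cong_AE[OF _ _ ae]) (use m in measurable)
  also have "\<dots> = (LINT x|lebesgue. a i j x * fn (?X $ i) x * fn (?X $ j) x) + 2 * (LINT x|lebesgue. a i j x * fn (?X $ i) x * fn (?Y $ j) x)"
   using int by simp
  finally show ?thesis unfolding inner_mul[OF bmeas_a] .
 qed
 have "form (snd p) (snd ?V) = form ?X ?X + 2 * form ?X ?Y"
  unfolding form_eq eq by (simp add: sum.distrib sum_distrib_left)
 then have "form ?X ?X = - 2 * form ?X ?Y" using 0 by simp
 then have "form ?X ?X <= 2 * (Lam * (\<Sum>i\<in>UNIV. norm (?X $ i)) * (\<Sum>j\<in>UNIV. norm (?Y $ j)))"
  using form_le[of ?X ?Y] by linarith
 then have "real CARD('n) * form ?X ?X <= real CARD('n) * (2 * (Lam * (\<Sum>i\<in>UNIV. norm (?X $ i)) * (\<Sum>j\<in>UNIV. norm (?Y $ j))))"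
  by (intro mult_left_mono) auto
 from order_trans[OF form_coercive'[of ?X] this]
 have *: "(\<Sum>i\<in>UNIV. norm (?X $ i)) * (lam * (\<Sum>i\<in>UNIV. norm (?X $ i))) <= (\<Sum>i\<in>UNIV. norm (?X $ i)) * (2 * real CARD('n) * Lam * (\<Sum>j\<in>UNIV. norm (?Y $ j)))"
  by (simp add: power2_eq_square mult_ac)
 have X0: "(\<Sum>i\<in>UNIV. norm (?X $ i)) \<ge> 0" by (intro sum_nonneg) auto
 have Y0: "(\<Sum>i\<in>UNIV. norm (?Y $ i)) \<ge> 0" by (intro sum_nonneg) auto
 show ?thesis
 proof (cases "(\<Sum>i\<in>UNIV. norm (?X $ i)) = 0")
  case True
  then show ?thesis using Y0 Lam_nonneg by simp
 next
  case False
  then have "(\<Sum>i\<in>UNIV. norm (?X $ i)) > 0" using X0 by linarith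
  with * show ?thesis by (simp only: mult_le_cancel_left_pos)
 qed
qed

lemma cY_le:
 assumes \<eta>: "\<eta> \<in> test_fun (ball z R)" "\<And>i x. \<bar>partial_deriv i \<eta> x\<bar> <= g"
  and u: "AE x\<in>ball z R in lebesgue. fn (fst p) x <= k + d" and d: "d \<ge> 0"
 shows "norm (cY \<eta> k p $ i) <= g * d * sqrt (measure lebesgue (lvl p k z R))"
proof -
 have t: "\<eta> \<in> test_fun UNIV" using test_fun_mono[OF _ \<eta>(1)] by blast
 have g: "g \<ge> 0" using \<eta>(2)[of undefined undefined] by linarith
 have "norm (cls (\<lambda>x. partial_deriv i \<eta> x * max 0 (fn (fst p) x - k))) <= norm (cls (\<lambda>x. (g * d) * indicator (lvl p k z R) x))"
 proof (rule norm_cls_mono)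
  show "AE x in lebesgue. \<bar>partial_deriv i \<eta> x * max 0 (fn (fst p) x - k)\<bar> <= \<bar>g * d * indicator (lvl p k z R) x\<bar>"
   using u
  proof eventually_elim
   case (elim x)
   show ?case
   proof (cases "x \<in> lvl p k z R")
    case True
    then have "\<bar>max 0 (fn (fst p) x - k)\<bar> <= d" using elim by (auto simp: lvl_def)
    then show ?thesis using True mult_mono[OF \<eta>(2)[of i x], of "\<bar>max 0 (fn (fst p) x - k)\<bar>" d] g d by (simp add: abs_mult)
   next
    case False
    then have "partial_deriv i \<eta> x = 0 \<or> max 0 (fn (fst p) x - k) = 0"
     using test_fun_outside[OF \<eta>(1), of x i] by (auto simp: lvl_def)
    then show ?thesis by auto
   qed
  qed
 qed (intro sqint_cutoff_pos[OF test_fun_partial[OF t]] sqint_scale sqint_indicator lvl_lmeasurable)+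
 also have "\<dots> = g * d * sqrt (measure lebesgue (lvl p k z R))"
  using g d by (simp add: norm_cls_indicator[OF lvl_lmeasurable] sqint_indicator[OF lvl_lmeasurable] flip: cls_scaleR)
 finally show ?thesis by (simp add: cY_def)
qed

text \<open>Chebyshev bounds the left side by the norm of the localised truncation, Faber-Krahn
  bounds that by \<open>r\<close> times its gradient, and Caccioppoli with \<open>cY_le\<close>
  estimates the gradient by \<open>d / (R - \<rho>)\<close> times the root of the measure. The scale
  \<open>r\<close> stays free for the iteration.\<close>

lemma dg_step:
 "\<exists>C>0. \<forall>p z s k h d \<rho> R r. harm p z s --> 0 < \<rho> --> \<rho> < R --> R <= s --> adm k z R --> d \<ge> 0 -->
  (AE x\<in>ball z R in lebesgue. fn (fst p) x <= k + d) --> k < h --> r > 0 -->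
  2 * measure lebesgue (lvl p k z R) <= measure lborel (cball (0::real^'n) r) -->
  (h - k)\<^sup>2 * measure lebesgue (lvl p h z \<rho>) <= C * (r * d / (R - \<rho>))\<^sup>2 * measure lebesgue (lvl p k z R)"
proof -
 obtain C0 where C0: "C0 > 0" "\<forall>(z::real^'n) \<rho> R. 0 < \<rho> --> \<rho> < R --> (\<exists>\<eta>. is_cutoff C0 z \<rho> R \<eta>)"
  using cutoff_exists[where 'n='n] by blast
 \<comment> \<open>The summand 1 accounts for the half \<open>cY\<close> of the gradient, the
   quotient for \<open>cX\<close> by Caccioppoli.\<close>
 define cc where "cc = 1 + 2 * real CARD('n) * Lam / lam"
 have cc: "cc > 0" unfolding cc_def using Lam_nonneg lam_pos by (intro add_pos_nonneg) auto
 define C where "C = (4 * cc * real CARD('n) * C0)\<^sup>2"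
 show ?thesis
 proof (intro exI[of _ C] conjI allI impI)
  show "C > 0" using cc C0 by (simp add: C_def)
  fix p z s k h d \<rho> R r
  assume hm: "harm p z s" and \<rho>: "0 < \<rho>" "\<rho> < R" "R <= s" and k: "adm k z R" and d: "(d::real) \<ge> 0"
   and u: "AE x\<in>ball z R in lebesgue. fn (fst p) x <= k + d" and kh: "k < h" and r: "r > 0"
   and small: "2 * measure lebesgue (lvl p k z R) <= measure lborel (cball (0::real^'n) r)"
  have p: "p \<in> sob0 \<O>" using hm by (simp add: harm_def)
  obtain \<eta> where \<eta>: "\<eta> \<in> test_fun (ball z R)" "\<forall>x\<in>cball z \<rho>. \<eta> x = 1" "\<forall>i x. \<bar>partial_deriv i \<eta> x\<bar> <= C0 / (R - \<rho>)"
   using C0(2) \<rho> unfolding is_cutoff_def by blast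
  have t: "\<eta> \<in> test_fun UNIV" using test_fun_mono[OF _ \<eta>(1)] by blast
  let ?q = "trunc \<eta> k p"
  let ?A = "measure lebesgue (lvl p k z R)"
  let ?Y = "\<Sum>i\<in>UNIV. norm (cY \<eta> k p $ i)"
  have q: "?q \<in> sob0 \<O>" by (rule trunc_adm[OF p \<eta>(1) k])
  have "lam * (\<Sum>i\<in>UNIV. norm (cX \<eta> k p $ i)) <= 2 * real CARD('n) * Lam * ?Y"
   by (rule caccioppoli[OF hm \<rho>(3) \<eta>(1) k])
  then have X: "(\<Sum>i\<in>UNIV. norm (cX \<eta> k p $ i)) <= 2 * real CARD('n) * Lam / lam * ?Y"
   using lam_pos by (simp add: field_simps)
  have "(\<Sum>i\<in>UNIV. norm (snd ?q $ i)) <= (\<Sum>i\<in>UNIV. norm (cY \<eta> k p $ i) + norm (cX \<eta> k p $ i))"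
   unfolding snd_trunc[OF t] by (intro sum_mono norm_triangle_ineq)
  also have "\<dots> <= cc * ?Y" using X by (simp add: sum.distrib cc_def distrib_right)
  also have "\<dots> <= cc * (\<Sum>i\<in>(UNIV::'n set). C0 / (R - \<rho>) * d * sqrt ?A)"
   using cc \<eta>(3) by (intro mult_left_mono sum_mono cY_le[OF \<eta>(1) _ u d]) auto
  finally have S: "(\<Sum>i\<in>UNIV. norm (snd ?q $ i)) <= cc * (real CARD('n) * (C0 / (R - \<rho>) * d * sqrt ?A))" by simp
  have "norm (fst ?q) <= 4 * r * (\<Sum>i\<in>UNIV. norm (snd ?q $ i))"
  proof (rule sob0_faber_krahn[OF q lvl_lmeasurable[of p k z R] _ r small])
   show "AE x in lebesgue. x \<notin> lvl p k z R --> fn (fst ?q) x = 0" using fn_trunc[OF t, of k p]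
   proof eventually_elim
    case (elim x)
    then show ?case using test_fun_outside[OF \<eta>(1), of x] by (auto simp: lvl_def)
   qed
  qed
  also have "\<dots> <= 4 * r * (cc * (real CARD('n) * (C0 / (R - \<rho>) * d * sqrt ?A)))"
   using r by (intro mult_left_mono S) auto
  finally have "(norm (fst ?q))\<^sup>2 <= (4 * r * (cc * (real CARD('n) * (C0 / (R - \<rho>) * d * sqrt ?A))))\<^sup>2"
   by (intro power_mono) auto
  also have "\<dots> = C * (r * d / (R - \<rho>))\<^sup>2 * ?A" by (simp add: C_def power_mult_distrib power_divide)
  finally have n: "(norm (fst ?q))\<^sup>2 <= C * (r * d / (R - \<rho>))\<^sup>2 * ?A" .
  have "(h - k)\<^sup>2 * measure lebesgue (lvl p h z \<rho>) <= (norm (fst ?q))\<^sup>2"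
  proof (rule chebyshev_L2[OF lvl_lmeasurable])
   show "AE x in lebesgue. x \<in> lvl p h z \<rho> --> h - k <= \<bar>fn (fst ?q) x\<bar>"
    using fn_trunc[OF t, of k p] by eventually_elim (use \<eta>(2) kh in \<open>auto simp: lvl_def\<close>)
  qed (use kh in simp)
  with n show "(h - k)\<^sup>2 * measure lebesgue (lvl p h z \<rho>) <= C * (r * d / (R - \<rho>))\<^sup>2 * ?A" by linarith
 qed
qed

text \<open>With radii \<open>R/2 (1 + 2\<^sup>-\<^sup>j)\<close>, levels \<open>k\<^sub>0 + d/2 (1 - 2\<^sup>-\<^sup>j)\<close> and Faber--Krahn scale
 \<open>\<tau> R 4\<^sup>-\<^sup>j\<close> the powers of two cancel.\<close>

lemma dg_small:
 "\<exists>\<nu>>0. \<forall>p z s R k0 d. harm p z s --> 0 < R --> R <= s --> adm k0 z R --> d \<ge> 0 -->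
  (AE x\<in>ball z R in lebesgue. fn (fst p) x <= k0 + d) -->
  measure lebesgue (lvl p k0 z R) <= \<nu> * R ^ CARD('n) -->
  (AE x\<in>ball z (R / 2) in lebesgue. fn (fst p) x <= k0 + d / 2)"
proof -
 obtain C where C: "C > 0" "\<And>p z s k h d \<rho> R r. harm p z s ==> 0 < \<rho> ==> \<rho> < R ==> R <= s ==> adm k z R ==> d \<ge> 0 ==>
  (AE x\<in>ball z R in lebesgue. fn (fst p) x <= k + d) ==> k < h ==> r > 0 ==>
  2 * measure lebesgue (lvl p k z R) <= measure lborel (cball (0::real^'n) r) ==>
  (h - k)\<^sup>2 * measure lebesgue (lvl p h z \<rho>) <= C * (r * d / (R - \<rho>))\<^sup>2 * measure lebesgue (lvl p k z R)"
  using dg_step by blast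
 define w where "w = measure lborel (cball (0::real^'n) 1)"
 have w: "w > 0" using measure_cball1_pos by (simp add: w_def)
 \<comment> \<open>Makes \<open>256 * (C * \<tau>\<^sup>2) = 1 / 4 ^ 3\<close>, so one step shrinks
   the measure by at least \<open>4 ^ CARD('n)\<close>, the rate of the Faber-Krahn scale. The two
   factors 16 in 256 come from the squared gaps between levels and between radii.\<close>
 define \<tau> where "\<tau> = 1 / (128 * sqrt C)"
 have \<tau>: "\<tau> > 0" using C by (simp add: \<tau>_def)
 have \<tau>2: "256 * (C * \<tau>\<^sup>2) = 1 / 64" using C by (simp add: \<tau>_def power_divide power_mult_distrib)
 show ?thesis
 proof (intro exI[of _ "w * \<tau> ^ CARD('n) / 2"] conjI allI impI)
  show "w * \<tau> ^ CARD('n) / 2 > 0" using w \<tau> by simp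
  fix p z s R k0 d
  assume hm: "harm p z s" and R: "0 < R" "R <= s" and k0: "adm k0 z R" and d0: "(d::real) \<ge> 0"
   and u: "AE x\<in>ball z R in lebesgue. fn (fst p) x <= k0 + d"
   and small: "measure lebesgue (lvl p k0 z R) <= w * \<tau> ^ CARD('n) / 2 * R ^ CARD('n)"
  show "AE x\<in>ball z (R / 2) in lebesgue. fn (fst p) x <= k0 + d / 2"
  proof (cases "d = 0")
   case True
   then show ?thesis using u R by (auto elim!: eventually_mono)
  next
   case False
   then have d: "d > 0" using d0 by simp
   define k where "k j = k0 + d / 2 * (1 - 1 / 2 ^ j)" for j :: nat
   define Q where "Q j = R / 2 * (1 + 1 / 2 ^ j)" for j :: nat
   define r where "r j = \<tau> * R / 4 ^ j" for j :: nat
   have kk: "k0 <= k j" for j using d by (simp add: k_def)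
   have QR: "0 < Q j" "Q j <= R" "R / 2 <= Q j" for j
   proof -
    have e: "0 <= (1::real) / 2 ^ j" "(1::real) / 2 ^ j <= 1" by (auto simp: divide_le_eq)
    show "R / 2 <= Q j" using mult_left_mono[of 1 "1 + 1 / 2 ^ j" "R / 2"] e R by (simp add: Q_def)
    then show "0 < Q j" using R by linarith
    show "Q j <= R" using mult_left_mono[of "1 + 1 / 2 ^ j" 2 "R / 2"] e R by (simp add: Q_def)
   qed
   have r0: "r j > 0" for j using \<tau> R by (simp add: r_def)
   have adm: "adm (k j) z (Q j)" for j using k0 kk[of j] QR(2)[of j] by (auto simp: adm_def)
   have claim: "2 * measure lebesgue (lvl p (k j) z (Q j)) <= w * r j ^ CARD('n)" for j
   proof (induction j)
    case 0
    then show ?case using small by (simp add: k_def Q_def r_def power_mult_distrib)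
   next
    case (Suc j)
    let ?A = "measure lebesgue (lvl p (k j) z (Q j))" and ?A' = "measure lebesgue (lvl p (k (Suc j)) z (Q (Suc j)))"
    have dk: "k (Suc j) - k j = d / (4 * 2 ^ j)" by (simp add: k_def field_simps)
    have dQ: "Q j - Q (Suc j) = R / (4 * 2 ^ j)" by (simp add: Q_def field_simps)
    have uj: "AE x\<in>ball z (Q j) in lebesgue. fn (fst p) x <= k j + d" using u
    proof eventually_elim
     case (elim x)
     then show ?case using kk[of j] QR(2)[of j] by fastforce
    qed
    have dk0: "k j < k (Suc j)" using dk d by (metis diff_gt_0_iff_gt divide_pos_pos mult_pos_pos zero_less_numeral zero_less_power)
    have dQ0: "Q (Suc j) < Q j" using dQ R by (metis diff_gt_0_iff_gt divide_pos_pos mult_pos_pos zero_less_numeral zero_less_power)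
    have e1: "(k (Suc j) - k j)\<^sup>2 * ?A' <= C * (r j * d / (Q j - Q (Suc j)))\<^sup>2 * ?A"
    proof (rule C(2)[OF hm QR(1) dQ0 _ adm d0 uj dk0 r0])
     show "Q j <= s" using QR(2)[of j] R by linarith
     show "2 * ?A <= measure lborel (cball (0::real^'n) (r j))"
      using Suc measure_cball_eq[of "r j" "0::real^'n"] r0[of j] by (simp add: w_def)
    qed
    have e2: "r j * d / (Q j - Q (Suc j)) = d * (4 * \<tau> / 2 ^ j)"
    proof -
     have "(4::real) ^ j = 2 ^ j * 2 ^ j" by (simp flip: power_mult_distrib)
     then show ?thesis unfolding dQ r_def using R by simp
    qed
    have "((2::real) ^ j)\<^sup>2 = 4 ^ j" by (simp add: power2_eq_square flip: power_mult_distrib)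
    then have e3: "(d / (4 * 2 ^ j))\<^sup>2 = d\<^sup>2 / (16 * 4 ^ j)" "(d * (4 * \<tau> / 2 ^ j))\<^sup>2 = d\<^sup>2 * (16 * \<tau>\<^sup>2 / 4 ^ j)"
     by (simp_all add: power_divide power_mult_distrib)
    have "d\<^sup>2 * (?A' / (16 * 4 ^ j)) <= d\<^sup>2 * (16 * (C * \<tau>\<^sup>2) / 4 ^ j * ?A)"
     using e1 unfolding e2 dk e3 by (simp add: mult_ac)
    then have "?A' / (16 * 4 ^ j) <= 16 * (C * \<tau>\<^sup>2) / 4 ^ j * ?A"
     using d by (simp only: mult_le_cancel_left_pos zero_less_power)
    then have "?A' <= 256 * (C * \<tau>\<^sup>2) * ?A" by (simp add: field_simps)
    then have "?A' <= ?A / 64" unfolding \<tau>2 by simp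
    also have "\<dots> <= ?A / 4 ^ CARD('n)"
    proof (intro divide_left_mono)
     have "(4::real) ^ CARD('n) <= 4 ^ 3" using dim_le by (intro power_increasing) auto
     then show "(4::real) ^ CARD('n) <= 64" by simp
    qed auto
    finally have "2 * ?A' <= (2 * ?A) / 4 ^ CARD('n)" by simp
    also have "\<dots> <= (w * r j ^ CARD('n)) / 4 ^ CARD('n)" by (intro divide_right_mono Suc) auto
    also have "\<dots> = w * r (Suc j) ^ CARD('n)" by (simp add: r_def power_divide power_mult_distrib)
    finally show ?case .
   qed
   have mb: "measure lebesgue (lvl p (k0 + d / 2) z (R / 2)) <= w * (r j) ^ CARD('n)" for j
   proof -
    have "measure lebesgue (lvl p (k0 + d / 2) z (R / 2)) <= measure lebesgue (lvl p (k j) z (Q j))"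
     using d QR(3) by (intro lvl_measure_mono) (auto simp: k_def)
    then show ?thesis using claim[of j] measure_nonneg[of lebesgue "lvl p (k j) z (Q j)"] by linarith
   qed
   have "(\<lambda>j. \<tau> * R * (1 / 4) ^ j) \<longlonglongrightarrow> \<tau> * R * 0"
    by (intro tendsto_mult tendsto_const LIMSEQ_realpow_zero) auto
   then have "r \<longlonglongrightarrow> 0" unfolding r_def[abs_def] by (simp add: power_one_over)
   then have ml: "(\<lambda>j. w * (r j) ^ CARD('n)) \<longlonglongrightarrow> w * 0 ^ CARD('n)"
    by (intro tendsto_mult tendsto_const tendsto_power)
   have "measure lebesgue (lvl p (k0 + d / 2) z (R / 2)) <= w * 0 ^ CARD('n)"
    by (rule LIMSEQ_le_const[OF ml]) (use mb in blast)
   then show ?thesis by (intro lvl_null) (simp add: power_0_left)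
  qed
 qed
qed

text \<open>De Giorgi's isoperimetric argument. The slice of \<open>u\<close> between the levels
  \<open>k\<close> and \<open>h\<close> vanishes on a large part of the ball, so Poincare bounds it
  by its gradient, which lives only where \<open>k < u <= h\<close>; Cauchy-Schwarz on that set
  yields the measure lost between the levels.\<close>

lemma dg_shrink_step:
 "\<exists>C>0. \<forall>p z s R k M \<theta>. harm p z s --> 0 < R --> 2 * R <= s --> adm k z (2 * R) --> k < M --> \<theta> > 0 -->
  (AE x\<in>ball z (2 * R) in lebesgue. fn (fst p) x <= M) -->
  \<theta> * R ^ CARD('n) <= measure lebesgue {x \<in> ball z R. fn (fst p) x <= k} -->
  (\<theta> * measure lebesgue (lvl p ((k + M) / 2) z R))\<^sup>2
   <= C * R ^ CARD('n) * (measure lebesgue (lvl p k z R) - measure lebesgue (lvl p ((k + M) / 2) z R))"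
proof -
 obtain C0 where C0: "C0 > 0" "\<forall>(z::real^'n) \<rho> R. 0 < \<rho> --> \<rho> < R --> (\<exists>\<eta>. is_cutoff C0 z \<rho> R \<eta>)"
  using cutoff_exists[where 'n='n] by blast
 define w where "w = measure lborel (cball (0::real^'n) 1)"
 have w: "w > 0" using measure_cball1_pos by (simp add: w_def)
 let ?n = "CARD('n)"
 \<comment> \<open>Collects the constants of Caccioppoli and of \<open>cY_le\<close> on the doubled
   ball, whose volume is \<open>w * 2 ^ ?n * R ^ ?n\<close>.\<close>
 define b where "b = 2 * real ?n * Lam / lam * (real ?n * C0) * sqrt (w * 2 ^ ?n)"
 have b: "b \<ge> 0" using Lam_nonneg lam_pos C0 w by (simp add: b_def)
 define C where "C = (2 * (2 * (w * 2 ^ ?n) * b))\<^sup>2 + 1"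
 show ?thesis
 proof (intro exI[of _ C] conjI allI impI)
  show "C > 0" unfolding C_def by (intro add_nonneg_pos) auto
  fix p z s R k M \<theta>
  assume hm: "harm p z s" and R: "0 < R" "2 * R <= s" and k: "adm k z (2 * R)" and kM: "k < M" and \<theta>: "\<theta> > (0::real)"
   and u: "AE x\<in>ball z (2 * R) in lebesgue. fn (fst p) x <= M"
   and big: "\<theta> * R ^ ?n <= measure lebesgue {x \<in> ball z R. fn (fst p) x <= k}"
  have p: "p \<in> sob0 \<O>" using hm by (simp add: harm_def)
  define h where "h = (k + M) / 2"
  have kh: "k < h" "h - k = (M - k) / 2" using kM by (auto simp: h_def)
  have hadm: "adm h z (2 * R)" using k kh by (auto simp: adm_def)
  obtain \<eta> where \<eta>: "\<eta> \<in> test_fun (ball z (2 * R))" "\<forall>x\<in>cball z R. \<eta> x = 1" "\<forall>i x. \<bar>partial_deriv i \<eta> x\<bar> <= C0 / (2 * R - R)"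
   "\<forall>i. \<forall>x\<in>ball z R. partial_deriv i \<eta> x = 0" "\<forall>x. 0 <= \<eta> x \<and> \<eta> x <= 1"
   using C0(2)[rule_format, of R "2 * R" z] R unfolding is_cutoff_def by auto
  have t: "\<eta> \<in> test_fun UNIV" using test_fun_mono[OF _ \<eta>(1)] by blast
  let ?u = "fn (fst p)"
  \<comment> \<open>Inside the ball of radius \<open>R\<close>, where the cutoff is 1, this is the
    slice: 0 below \<open>k\<close>, \<open>u - k\<close> between the levels, \<open>h - k\<close>
    above.\<close>
  define q where "q = trunc \<eta> k p - trunc \<eta> h p"
  have q: "q \<in> sob0 \<O>"
   unfolding q_def by (intro subspace_diff[OF subspace_sob0] trunc_adm[OF p \<eta>(1)] k hadm)
  let ?D = "ball z R"
  let ?E = "lvl p k z R - lvl p h z R"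
  have fq: "AE x in lebesgue. fn (fst q) x = \<eta> x * max 0 (?u x - k) - \<eta> x * max 0 (?u x - h)"
   using fn_trunc[OF t, of k p] fn_trunc[OF t, of h p] fn_diff[of "fst (trunc \<eta> k p)" "fst (trunc \<eta> h p)"]
   by eventually_elim (simp add: q_def)
  have E: "?E \<in> lmeasurable" by (intro fmeasurable.Diff lvl_lmeasurable)
  have gq: "L1_on ?D (snd q $ i) <= sqrt (measure lebesgue ?E) * norm (cX \<eta> k p $ i)" for i
  proof -
   have s: "AE x in lebesgue. fn (snd (trunc \<eta> l p) $ i) x = partial_deriv i \<eta> x * max 0 (?u x - l) + \<eta> x * (if ?u x > l then fn (snd p $ i) x else 0)" for l
    unfolding trunc_def using fn_cls[OF sqint_add[OF sqint_cutoff_pos[OF test_fun_partial[OF t]] sqint_cutoff_grad[OF t]]] by simp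
   have X: "AE x in lebesgue. fn (cX \<eta> k p $ i) x = \<eta> x * (if ?u x > k then fn (snd p $ i) x else 0)"
    using fn_cls[OF sqint_cutoff_grad[OF t]] by (simp add: cX_def)
   have "L1_on ?D (snd q $ i) <= L1_on ?E (cX \<eta> k p $ i)" unfolding L1_on_def
   proof (rule integral_mono_AE)
    show "AE x in lebesgue. indicator ?D x * \<bar>fn (snd q $ i) x\<bar> <= indicator ?E x * \<bar>fn (cX \<eta> k p $ i) x\<bar>"
     using s[of k] s[of h] X fn_diff[of "snd (trunc \<eta> k p) $ i" "snd (trunc \<eta> h p) $ i"]
    proof eventually_elim
     case (elim x)
     then show ?case using \<eta>(2,4) kh by (cases "x \<in> ball z R") (auto simp: q_def lvl_def indicator_def)
    qed
   qed (intro L1_on_integrable E lmeasurable_ball)+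
   also have "\<dots> <= sqrt (measure lebesgue ?E) * norm (cX \<eta> k p $ i)" by (rule L1_on_le[OF E])
   finally show ?thesis .
  qed
  have uk: "AE x\<in>ball z (2 * R) in lebesgue. ?u x <= k + (M - k)" using u by simp
  have cY: "(\<Sum>i\<in>UNIV. norm (cY \<eta> k p $ i)) <= (\<Sum>i\<in>(UNIV::'n set). C0 / R * (M - k) * sqrt (w * 2 ^ ?n * R ^ ?n))"
  proof (rule sum_mono)
   fix i
   have "norm (cY \<eta> k p $ i) <= C0 / R * (M - k) * sqrt (measure lebesgue (lvl p k z (2 * R)))"
    using \<eta>(3) kM by (intro cY_le[OF \<eta>(1) _ uk]) auto
   also have "\<dots> <= C0 / R * (M - k) * sqrt (w * 2 ^ ?n * R ^ ?n)"
   proof (intro mult_left_mono real_sqrt_le_mono)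
    have "measure lebesgue (lvl p k z (2 * R)) <= measure lebesgue (ball z (2 * R))"
     by (rule measure_mono_fmeasurable[OF _ fmeasurableD[OF lvl_lmeasurable]]) (auto simp: lvl_def)
    also have "\<dots> = w * 2 ^ ?n * R ^ ?n"
     using R measure_ball_eq[of "2 * R" z] by (simp add: w_def power_mult_distrib)
    finally show "measure lebesgue (lvl p k z (2 * R)) <= w * 2 ^ ?n * R ^ ?n" .
   qed (use C0 R kM in auto)
   finally show "norm (cY \<eta> k p $ i) <= C0 / R * (M - k) * sqrt (w * 2 ^ ?n * R ^ ?n)" .
  qed
  have "lam * (\<Sum>i\<in>UNIV. norm (cX \<eta> k p $ i)) <= 2 * real ?n * Lam * (\<Sum>i\<in>UNIV. norm (cY \<eta> k p $ i))"
   by (rule caccioppoli[OF hm R(2) \<eta>(1) k])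
  also have "\<dots> <= 2 * real ?n * Lam * (real ?n * (C0 / R * (M - k) * sqrt (w * 2 ^ ?n * R ^ ?n)))"
   using cY Lam_nonneg by (intro mult_left_mono) auto
  finally have cX: "(\<Sum>i\<in>UNIV. norm (cX \<eta> k p $ i)) <= b * (M - k) / R * sqrt (R ^ ?n)"
   using lam_pos R by (simp add: b_def real_sqrt_mult field_simps)
  have Zl: "{x \<in> ball z R. ?u x <= k} \<in> lmeasurable"
  proof (rule fmeasurableI2[of "ball z R"])
   have "{x \<in> ball z R. ?u x <= k} = ball z R \<inter> {x. ?u x <= k}" by auto
   then show "{x \<in> ball z R. ?u x <= k} \<in> sets lebesgue" using sets.Int[OF fmeasurableD[OF lmeasurable_ball] level_set_meas(2)] by simp
  qed auto
  obtain Z where Z: "Z \<in> sets borel" "Z \<subseteq> {x \<in> ball z R. ?u x <= k}" "measure lborel Z = measure lebesgue {x \<in> ball z R. ?u x <= k}"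
   by (rule lmeasurable_borel_core[OF Zl])
  have LZ: "L1_on Z (fst q) = 0"
  proof -
   have "L1_on Z (fst q) = (LINT (x::real^'n)|lebesgue. (0::real))" unfolding L1_on_def
   proof (rule integral_cong_AE)
    show "AE x in lebesgue. indicator Z x * \<bar>fn (fst q) x\<bar> = 0"
     using fq by eventually_elim (use Z(2) kh in \<open>auto simp: indicator_def\<close>)
   next
    have "Z \<in> sets lebesgue" using Z(1) by simp
    then show "(\<lambda>x. indicator Z x * \<bar>fn (fst q) x\<bar>) \<in> borel_measurable lebesgue" by measurable
   qed simp
   then show ?thesis by simp
  qed
  have "measure lborel Z * L1_on ?D (fst q) <= (2 * R) * measure lborel (cball (0::real^'n) (2 * R)) * (\<Sum>i\<in>UNIV. L1_on ?D (snd q $ i))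
    + measure lborel ?D * L1_on Z (fst q)"
  proof (rule sob0_poincare_add[OF q])
   show "norm (y - x) <= 2 * R" if "x \<in> ball z R" "y \<in> ball z R" for x y
    using dist_triangle[of y x z] that by (simp add: dist_norm norm_minus_commute)
  qed (use Z R in auto)
  also have "\<dots> <= (2 * R) * (w * 2 ^ ?n * R ^ ?n) * (sqrt (measure lebesgue ?E) * (b * (M - k) / R * sqrt (R ^ ?n)))"
  proof -
   have "(\<Sum>i\<in>UNIV. L1_on ?D (snd q $ i)) <= sqrt (measure lebesgue ?E) * (\<Sum>i\<in>UNIV. norm (cX \<eta> k p $ i))"
    unfolding sum_distrib_left by (intro sum_mono gq)
   also have "\<dots> <= sqrt (measure lebesgue ?E) * (b * (M - k) / R * sqrt (R ^ ?n))"
    by (intro mult_left_mono cX) auto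
   finally have "(2 * R) * (w * 2 ^ ?n * R ^ ?n) * (\<Sum>i\<in>UNIV. L1_on ?D (snd q $ i))
     <= (2 * R) * (w * 2 ^ ?n * R ^ ?n) * (sqrt (measure lebesgue ?E) * (b * (M - k) / R * sqrt (R ^ ?n)))"
    using R w by (intro mult_left_mono) auto
   moreover have "measure lborel (cball (0::real^'n) (2 * R)) = w * 2 ^ ?n * R ^ ?n"
    using R measure_cball_eq[of "2 * R" "0::real^'n"] by (simp add: w_def power_mult_distrib)
   ultimately show ?thesis unfolding LZ by (simp only: mult_zero_right add_0_right)
  qed
  also have "\<dots> = R ^ ?n * ((2 * (w * 2 ^ ?n) * b) * (M - k) * (sqrt (R ^ ?n) * sqrt (measure lebesgue ?E)))"
  proof -
   have "(2 * R) * (W * P) * (e * (b * m / R * t)) = P * ((2 * W * b) * m * (t * e))" for W P e m t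
    using R by simp
   then show ?thesis .
  qed
  finally have 1: "measure lborel Z * L1_on ?D (fst q) <= R ^ ?n * ((2 * (w * 2 ^ ?n) * b) * (M - k) * (sqrt (R ^ ?n) * sqrt (measure lebesgue ?E)))" .
  have 2: "(h - k) * measure lebesgue (lvl p h z R) <= L1_on ?D (fst q)"
  proof -
   have "(h - k) * measure lebesgue (lvl p h z R) = (LINT x|lebesgue. (h - k) * indicator (lvl p h z R) x)"
    using lvl_lmeasurable[of p h z R] by simp
   also have "\<dots> <= L1_on ?D (fst q)" unfolding L1_on_def
   proof (rule integral_mono_AE)
    show "integrable lebesgue (\<lambda>x. (h - k) * indicator (lvl p h z R) x)"
     using lvl_lmeasurable[of p h z R] by (intro integrable_mult_right) (auto simp: fmeasurable_def)
    show "AE x in lebesgue. (h - k) * indicator (lvl p h z R) x <= indicator ?D x * \<bar>fn (fst q) x\<bar>"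
     using fq by eventually_elim (use \<eta>(2) kh in \<open>auto simp: indicator_def lvl_def\<close>)
   qed (intro L1_on_integrable lmeasurable_ball)
   finally show ?thesis .
  qed
  let ?A = "measure lebesgue (lvl p h z R)"
  have "\<theta> * R ^ ?n * ((M - k) / 2 * ?A) <= measure lborel Z * L1_on ?D (fst q)"
   using big 2 kM unfolding Z(3) kh(2) by (intro mult_mono) auto
  also note 1
  also have "\<theta> * R ^ ?n * ((M - k) / 2 * ?A) = (R ^ ?n * (M - k) / 2) * (\<theta> * ?A)" by simp
  also have "R ^ ?n * ((2 * (w * 2 ^ ?n) * b) * (M - k) * (sqrt (R ^ ?n) * sqrt (measure lebesgue ?E)))
    = (R ^ ?n * (M - k) / 2) * (2 * (2 * (w * 2 ^ ?n) * b) * (sqrt (R ^ ?n) * sqrt (measure lebesgue ?E)))" by simp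
  finally have "(R ^ ?n * (M - k) / 2) * (\<theta> * ?A) <= (R ^ ?n * (M - k) / 2) * (2 * (2 * (w * 2 ^ ?n) * b) * (sqrt (R ^ ?n) * sqrt (measure lebesgue ?E)))" .
  moreover have "R ^ ?n * (M - k) / 2 > 0" using R kM by simp
  ultimately have "\<theta> * ?A <= 2 * (2 * (w * 2 ^ ?n) * b) * (sqrt (R ^ ?n) * sqrt (measure lebesgue ?E))"
   by (simp only: mult_le_cancel_left_pos)
  then have "(\<theta> * ?A)\<^sup>2 <= (2 * (2 * (w * 2 ^ ?n) * b) * (sqrt (R ^ ?n) * sqrt (measure lebesgue ?E)))\<^sup>2"
   using \<theta> by (intro power_mono) auto
  also have "\<dots> = (2 * (2 * (w * 2 ^ ?n) * b))\<^sup>2 * (R ^ ?n * measure lebesgue ?E)"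
   using R by (simp only: power_mult_distrib real_sqrt_pow2 measure_nonneg zero_le_power less_imp_le)
  also have "\<dots> <= C * (R ^ ?n * measure lebesgue ?E)" using R by (intro mult_right_mono) (auto simp: C_def)
  also have "measure lebesgue ?E = measure lebesgue (lvl p k z R) - ?A"
   using kh by (intro measurable_measure_Diff lvl_lmeasurable fmeasurableD[OF lvl_lmeasurable]) (auto simp: lvl_def)
  finally show "(\<theta> * measure lebesgue (lvl p ((k + M) / 2) z R))\<^sup>2
   <= C * R ^ ?n * (measure lebesgue (lvl p k z R) - measure lebesgue (lvl p ((k + M) / 2) z R))"
   by (simp add: h_def mult.assoc)
 qed
qed

end

section \<open>Decay of oscillation at boundary and interior points\<close>

context elliptic_domain
begin

text \<open>Along levels approaching \<open>M\<close> by halving, the losses from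
  \<open>dg_shrink_step\<close> telescope and are bounded by the volume of the ball. After
  \<open>J\<close> levels the superlevel set is so small that \<open>dg_small\<close> applies and
  halves the remaining gap once more, whence \<open>c = 1 / 2 ^ Suc J\<close>.\<close>

lemma dg_osc:
 assumes \<theta>: "\<theta> > 0"
 shows "\<exists>c>0. c < 1 \<and> (\<forall>p z s R k0 M. harm p z s --> 0 < R --> 2 * R <= s --> adm k0 z (2 * R) --> k0 <= M -->
  (AE x\<in>ball z (2 * R) in lebesgue. fn (fst p) x <= M) -->
  \<theta> * R ^ CARD('n) <= measure lebesgue {x \<in> ball z R. fn (fst p) x <= k0} -->
  (AE x\<in>ball z (R / 2) in lebesgue. fn (fst p) x <= M - c * (M - k0)))"
proof -
 let ?n = "CARD('n)"
 obtain \<nu> where \<nu>: "\<nu> > 0" "\<And>p z s R k0 d. harm p z s ==> 0 < R ==> R <= s ==> adm k0 z R ==> d \<ge> 0 ==>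
  (AE x\<in>ball z R in lebesgue. fn (fst p) x <= k0 + d) ==>
  measure lebesgue (lvl p k0 z R) <= \<nu> * R ^ ?n ==>
  (AE x\<in>ball z (R / 2) in lebesgue. fn (fst p) x <= k0 + d / 2)" using dg_small by blast
 obtain C where C: "C > 0" "\<And>p z s R k M \<theta>. harm p z s ==> 0 < R ==> 2 * R <= s ==> adm k z (2 * R) ==> k < M ==> \<theta> > 0 ==>
  (AE x\<in>ball z (2 * R) in lebesgue. fn (fst p) x <= M) ==>
  \<theta> * R ^ ?n <= measure lebesgue {x \<in> ball z R. fn (fst p) x <= k} ==>
  (\<theta> * measure lebesgue (lvl p ((k + M) / 2) z R))\<^sup>2
   <= C * R ^ ?n * (measure lebesgue (lvl p k z R) - measure lebesgue (lvl p ((k + M) / 2) z R))"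
  using dg_shrink_step by blast
 define w where "w = measure lborel (cball (0::real^'n) 1)"
 have w: "w > 0" using measure_cball1_pos by (simp add: w_def)
 \<comment> \<open>Enough levels that \<open>J\<close> equal losses of the critical size would
   exceed \<open>C * w\<close>, the bound for their sum after removing powers of
   \<open>R\<close>.\<close>
 obtain J :: nat where J: "C * w / (\<theta>\<^sup>2 * \<nu>\<^sup>2) < real J" using reals_Archimedean2 by blast
 then have J': "C * w < real J * (\<theta>\<^sup>2 * \<nu>\<^sup>2)" using \<theta> \<nu>(1) by (simp add: pos_divide_less_eq)
 show ?thesis
 proof (intro exI[of _ "1 / 2 ^ Suc J"] conjI allI impI)
  show "1 / 2 ^ Suc J < (1::real)" by (simp add: divide_less_eq one_less_power del: power_Suc)
  fix p z s R k0 M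
  assume hm: "harm p z s" and R: "0 < R" "2 * R <= s" and k0: "adm k0 z (2 * R)" and kM: "k0 <= M"
   and u: "AE x\<in>ball z (2 * R) in lebesgue. fn (fst p) x <= M"
   and big: "\<theta> * R ^ ?n <= measure lebesgue {x \<in> ball z R. fn (fst p) x <= k0}"
  show "AE x\<in>ball z (R / 2) in lebesgue. fn (fst p) x <= M - 1 / 2 ^ Suc J * (M - k0)"
  proof (cases "k0 = M")
   case True
   show ?thesis using u by eventually_elim (use True R in auto)
  next
   case False
   then have kM': "k0 < M" using kM by simp
   define k where "k j = M - (M - k0) / 2 ^ j" for j :: nat
   have kS: "(k j + M) / 2 = k (Suc j)" for j by (simp add: k_def field_simps)
   have kk: "k0 <= k j" "k j < M" for j
   proof -
    have "(M - k0) / 2 ^ j <= (M - k0) / 1" using kM' by (intro divide_left_mono) auto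
    then show "k0 <= k j" by (simp add: k_def)
    show "k j < M" using kM' by (simp add: k_def)
   qed
   let ?A = "\<lambda>j. measure lebesgue (lvl p (k j) z R)"
   have step: "(\<theta> * ?A (Suc j))\<^sup>2 <= C * R ^ ?n * (?A j - ?A (Suc j))" for j
   proof -
    have adm: "adm (k j) z (2 * R)" using k0 kk(1)[of j] by (auto simp: adm_def)
    have Zl: "{x \<in> ball z R. fn (fst p) x <= l} \<in> lmeasurable" for l
    proof (rule fmeasurableI2[of "ball z R"])
     have "{x \<in> ball z R. fn (fst p) x <= l} = ball z R \<inter> {x. fn (fst p) x <= l}" by auto
     then show "{x \<in> ball z R. fn (fst p) x <= l} \<in> sets lebesgue"
      using sets.Int[OF fmeasurableD[OF lmeasurable_ball] level_set_meas(2)] by simp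
    qed auto
    have "measure lebesgue {x \<in> ball z R. fn (fst p) x <= k0} <= measure lebesgue {x \<in> ball z R. fn (fst p) x <= k j}"
     using kk(1)[of j] by (intro measure_mono_fmeasurable[OF _ fmeasurableD[OF Zl] Zl]) auto
    then show ?thesis using C(2)[OF hm R adm kk(2) \<theta> u] big unfolding kS by linarith
   qed
   have anti: "?A J <= ?A (Suc j)" if "j < J" for j
   proof -
    have "k (Suc j) <= k J"
     unfolding k_def using that kM' by (intro diff_mono divide_left_mono power_increasing) auto
    then show ?thesis by (intro lvl_measure_mono) auto
   qed
   have "real J * (\<theta> * ?A J)\<^sup>2 = (\<Sum>j<J. (\<theta> * ?A J)\<^sup>2)" by simp
   also have "\<dots> <= (\<Sum>j<J. C * R ^ ?n * (?A j - ?A (Suc j)))"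
   proof (rule sum_mono)
    fix j assume "j \<in> {..<J}"
    then have "(\<theta> * ?A J)\<^sup>2 <= (\<theta> * ?A (Suc j))\<^sup>2"
     using anti[of j] \<theta> by (intro power_mono mult_left_mono) auto
    with step[of j] show "(\<theta> * ?A J)\<^sup>2 <= C * R ^ ?n * (?A j - ?A (Suc j))" by linarith
   qed
   also have "\<dots> = C * R ^ ?n * (?A 0 - ?A J)"
    using sum_lessThan_telescope'[of ?A J] by (simp only: sum_distrib_left[symmetric])
   also have "\<dots> <= C * R ^ ?n * (w * R ^ ?n)"
   proof (intro mult_left_mono)
    have "?A 0 <= measure lebesgue (ball z R)"
     by (rule measure_mono_fmeasurable[OF _ fmeasurableD[OF lvl_lmeasurable]]) (auto simp: lvl_def)
    then have "?A 0 <= w * R ^ ?n" using measure_ball_eq[of R z] R by (simp add: w_def)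
    then show "?A 0 - ?A J <= w * R ^ ?n" using measure_nonneg[of lebesgue "lvl p (k J) z R"] by linarith
   qed (use C R in auto)
   also have "\<dots> = (C * w) * (R ^ ?n)\<^sup>2" by (simp add: power2_eq_square)
   also have "\<dots> <= (real J * (\<theta>\<^sup>2 * \<nu>\<^sup>2)) * (R ^ ?n)\<^sup>2" using J' by (intro mult_right_mono) auto
   also have "\<dots> = real J * (\<theta> * (\<nu> * R ^ ?n))\<^sup>2" by (simp add: power_mult_distrib)
   finally have "real J * (\<theta> * ?A J)\<^sup>2 <= real J * (\<theta> * (\<nu> * R ^ ?n))\<^sup>2" .
   moreover have "real J > 0"
   proof -
    have "0 < C * w / (\<theta>\<^sup>2 * \<nu>\<^sup>2)" using C(1) w \<theta> \<nu>(1) by simp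
    then show ?thesis using J by linarith
   qed
   ultimately have "(\<theta> * ?A J)\<^sup>2 <= (\<theta> * (\<nu> * R ^ ?n))\<^sup>2" by (simp only: mult_le_cancel_left_pos)
   then have "\<theta> * ?A J <= \<theta> * (\<nu> * R ^ ?n)" by (rule power2_le_imp_le) (use \<theta> \<nu>(1) R in auto)
   then have small: "?A J <= \<nu> * R ^ ?n" using \<theta> by (simp only: mult_le_cancel_left_pos)
   have "AE x\<in>ball z (R / 2) in lebesgue. fn (fst p) x <= k J + (M - k J) / 2"
   proof (rule \<nu>(2)[OF hm R(1) _ _ _ _ small])
    show "R <= s" using R by simp
    show "adm (k J) z R" using k0 kk(1)[of J] R by (auto simp: adm_def)
    show "0 <= M - k J" using kk(2)[of J] by simp
    show "AE x\<in>ball z R in lebesgue. fn (fst p) x <= k J + (M - k J)"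
     using u by eventually_elim (use R in auto)
   qed
   moreover have "k J + (M - k J) / 2 = M - 1 / 2 ^ Suc J * (M - k0)" by (simp add: k_def field_simps)
   ultimately show ?thesis by simp
  qed
 qed simp
qed

lemma harm_uminus: "harm p z s ==> harm (- p) z s"
 unfolding harm_def using subspace_neg[OF subspace_sob0, of p \<O>] by (simp add: form_linear)

text \<open>The solution vanishes outside \<open>\<O>\<close>, so exterior density supplies the
  measure condition at level 0, which is admissible for every ball. Each quartering of the radius
  multiplies the upper bound by \<open>1 - c\<close>.\<close>

lemma boundary_decay:
 assumes hm: "harm p z s" and s: "s > 0" and \<theta>: "\<theta> > 0" and R0: "R0 > 0"
  and dens: "\<And>R. 0 < R ==> R <= R0 ==> \<theta> * R ^ CARD('n) <= measure lebesgue (ball z R - \<O>)"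
  and u: "AE x in lebesgue. fn (fst p) x <= M0" and M0: "M0 \<ge> 0" and e: "e > 0"
 shows "\<exists>r>0. AE x\<in>ball z r in lebesgue. fn (fst p) x <= e"
proof -
 obtain c where c: "c > 0" "c < 1" "\<And>p z s R k0 M. harm p z s ==> 0 < R ==> 2 * R <= s ==> adm k0 z (2 * R) ==> k0 <= M ==>
  (AE x\<in>ball z (2 * R) in lebesgue. fn (fst p) x <= M) ==>
  \<theta> * R ^ CARD('n) <= measure lebesgue {x \<in> ball z R. fn (fst p) x <= k0} ==>
  (AE x\<in>ball z (R / 2) in lebesgue. fn (fst p) x <= M - c * (M - k0))" using dg_osc[OF \<theta>] by blast
 have p: "p \<in> sob0 \<O>" using hm by (simp add: harm_def)
 define R where "R j = min (s / 2) R0 / 4 ^ j" for j :: nat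
 have R: "R j > 0" "2 * R j <= s" "R j <= R0" for j
 proof -
  show "R j > 0" using s R0 by (simp add: R_def)
  have "R j <= min (s / 2) R0 / 1" unfolding R_def using s R0 by (intro divide_left_mono) auto
  then show "2 * R j <= s" "R j <= R0" by auto
 qed
 have claim: "AE x\<in>ball z (2 * R j) in lebesgue. fn (fst p) x <= (1 - c) ^ j * M0" for j
 proof (induction j)
  case 0
  show ?case using u by eventually_elim simp
 next
  case (Suc j)
  have "AE x\<in>ball z (R j / 2) in lebesgue. fn (fst p) x <= (1 - c) ^ j * M0 - c * ((1 - c) ^ j * M0 - 0)"
  proof (rule c(3)[OF hm R(1,2) _ _ Suc])
   show "adm 0 z (2 * R j)" by (simp add: adm_def)
   show "0 <= (1 - c) ^ j * M0" using c M0 by simp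
   have "measure lebesgue (ball z (R j) - \<O>) <= measure lebesgue {x \<in> ball z (R j). fn (fst p) x <= 0}"
   proof -
    have o: "ball z (R j) - \<O> \<in> lmeasurable" using fmeasurable.Diff[OF lmeasurable_ball \<O>_lmeasurable] .
    let ?Z = "{x \<in> ball z (R j). fn (fst p) x <= 0}"
    have "?Z = ball z (R j) \<inter> {x. fn (fst p) x <= 0}" by auto
    then have m: "?Z \<in> sets lebesgue" using sets.Int[OF fmeasurableD[OF lmeasurable_ball] level_set_meas(2)] by simp
    have Z: "?Z \<in> lmeasurable" by (rule fmeasurableI2[OF lmeasurable_ball _ m]) auto
    have "measure lebesgue (ball z (R j) - \<O>) = measure lebesgue ((ball z (R j) - \<O>) \<inter> ?Z)"
    proof (rule measure_eq_AE)
     show "AE x in lebesgue. x \<in> ball z (R j) - \<O> \<longleftrightarrow> x \<in> (ball z (R j) - \<O>) \<inter> ?Z"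
      using sob0_zero_outside(1)[OF p open_\<O>] by eventually_elim auto
    qed (use o Z in \<open>auto intro: fmeasurableD\<close>)
    also have "\<dots> <= measure lebesgue ?Z" using o Z by (intro measure_mono_fmeasurable) auto
    finally show ?thesis .
   qed
   then show "\<theta> * R j ^ CARD('n) <= measure lebesgue {x \<in> ball z (R j). fn (fst p) x <= 0}"
    using dens[OF R(1,3)[of j]] by linarith
  qed
  moreover have "R j / 2 = 2 * R (Suc j)" by (simp add: R_def)
  moreover have "(1 - c) ^ j * M0 - c * ((1 - c) ^ j * M0 - 0) = (1 - c) ^ Suc j * M0" by (simp add: algebra_simps)
  ultimately show ?case by simp
 qed
 have "(\<lambda>j. (1 - c) ^ j * M0) \<longlonglongrightarrow> 0 * M0" using c by (intro tendsto_mult tendsto_const LIMSEQ_realpow_zero) auto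
 then have "(\<lambda>j. (1 - c) ^ j * M0) \<longlonglongrightarrow> 0" by simp
 from order_tendstoD(2)[OF this e] obtain j where j: "(1 - c) ^ j * M0 < e"
  by (auto simp: eventually_sequentially)
 show ?thesis
 proof (intro exI[of _ "2 * R j"] conjI)
  show "AE x\<in>ball z (2 * R j) in lebesgue. fn (fst p) x <= e"
   using claim[of j] by eventually_elim (use j in auto)
 qed (use R(1)[of j] in simp)
qed

text \<open>Extracts a statement not depending on the point from an almost everywhere statement on a
  nonempty open set, which is never null.\<close>

lemma AE_ball_nonempty:
 assumes "open S" "S \<noteq> {}" "AE x::real^'n in lebesgue. x \<in> S --> P"
 shows P
proof (rule ccontr)
 assume "\<not> P"
 then have "AE x in lebesgue. x \<notin> S" using assms(3) by simp
 then have "S \<in> null_sets lebesgue" using assms(1) by (subst AE_iff_null_sets) (auto simp: borel_open)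
 then have "negligible S" by (simp add: negligible_iff_null_sets)
 then show False using open_not_negligible[OF assms(1,2)] by blast
qed

text \<open>At the middle level, either the sublevel or the superlevel set fills at least half of
  the ball, so \<open>dg_osc\<close> applies to \<open>p\<close> or to \<open>- p\<close>. The gap
  from an extreme value to the middle is half the oscillation, hence the factor
  \<open>1 - c / 2\<close>.\<close>

lemma interior_decay:
 assumes hm: "harm p z s" and s: "s > 0" "ball z s \<subseteq> \<O>"
  and u: "AE x in lebesgue. \<bar>fn (fst p) x\<bar> <= M0" and e: "e > 0"
 shows "\<exists>r>0. \<exists>c0. AE x\<in>ball z r in lebesgue. \<bar>fn (fst p) x - c0\<bar> <= e"
proof -
 define w where "w = measure lborel (cball (0::real^'n) 1)"
 have w: "w / 2 > 0" using measure_cball1_pos by (simp add: w_def)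
 obtain c where c: "c > 0" "c < 1" "\<And>p z s R k0 M. harm p z s ==> 0 < R ==> 2 * R <= s ==> adm k0 z (2 * R) ==> k0 <= M ==>
  (AE x\<in>ball z (2 * R) in lebesgue. fn (fst p) x <= M) ==>
  w / 2 * R ^ CARD('n) <= measure lebesgue {x \<in> ball z R. fn (fst p) x <= k0} ==>
  (AE x\<in>ball z (R / 2) in lebesgue. fn (fst p) x <= M - c * (M - k0))" using dg_osc[OF w] by blast
 define R where "R j = (s / 2) / 4 ^ j" for j :: nat
 have R: "R j > 0" "2 * R j <= s" for j
 proof -
  show "R j > 0" using s by (simp add: R_def)
  have "R j <= (s / 2) / 1" unfolding R_def using s by (intro divide_left_mono) auto
  then show "2 * R j <= s" by simp
 qed
 have adm: "adm k z (2 * R j)" for k j using s R(2)[of j] by (auto simp: adm_def)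
 have M0: "M0 \<ge> 0"
 proof (rule ccontr)
  assume "\<not> M0 \<ge> 0"
  then have "AE x in lebesgue. x \<in> (UNIV :: (real^'n) set) --> False" using u by (auto elim!: eventually_mono)
  then show False using AE_ball_nonempty[of UNIV False] by simp
 qed
 let ?q = "1 - c / 2"
 have claim: "\<exists>m M. m <= M \<and> M - m <= ?q ^ j * (2 * M0) \<and>
  (AE x\<in>ball z (2 * R j) in lebesgue. m <= fn (fst p) x \<and> fn (fst p) x <= M)" for j
 proof (induction j)
  case 0
  show ?case by (rule exI[of _ "- M0"], rule exI[of _ M0]) (use M0 u in \<open>auto elim!: eventually_mono\<close>)
 next
  case (Suc j)
  then obtain m M where mM: "m <= M" "M - m <= ?q ^ j * (2 * M0)"
   and b: "AE x\<in>ball z (2 * R j) in lebesgue. m <= fn (fst p) x \<and> fn (fst p) x <= M" by blast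
  let ?k = "(m + M) / 2"
  let ?Z1 = "{x \<in> ball z (R j). fn (fst p) x <= ?k}" and ?Z2 = "{x \<in> ball z (R j). fn (fst (- p)) x <= - ?k}"
  have Zl: "{x \<in> ball z (R j). fn v x <= l} \<in> lmeasurable" for l v
  proof (rule fmeasurableI2[of "ball z (R j)"])
   have "{x \<in> ball z (R j). fn v x <= l} = ball z (R j) \<inter> {x. fn v x <= l}" by auto
   then show "{x \<in> ball z (R j). fn v x <= l} \<in> sets lebesgue"
    using sets.Int[OF fmeasurableD[OF lmeasurable_ball] level_set_meas(2)] by simp
  qed auto
  have "measure lebesgue (ball z (R j)) = measure lebesgue (?Z1 \<union> ?Z2)"
  proof (rule measure_eq_AE)
   show "AE x in lebesgue. x \<in> ball z (R j) \<longleftrightarrow> x \<in> ?Z1 \<union> ?Z2"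
    using fn_uminus[of "fst p"] by eventually_elim auto
  next
   show "?Z1 \<union> ?Z2 \<in> sets lebesgue" by (rule fmeasurableD[OF fmeasurable.Un[OF Zl Zl]])
  qed (rule fmeasurableD[OF lmeasurable_ball])
  also have "\<dots> <= measure lebesgue ?Z1 + measure lebesgue ?Z2"
   by (rule measure_Un_le) (rule fmeasurableD[OF Zl])+
  finally have "w * R j ^ CARD('n) <= measure lebesgue ?Z1 + measure lebesgue ?Z2"
   using measure_ball_eq[of "R j" z] R(1)[of j] by (simp add: w_def)
  then consider "w / 2 * R j ^ CARD('n) <= measure lebesgue ?Z1" | "w / 2 * R j ^ CARD('n) <= measure lebesgue ?Z2"
   by (simp only: times_divide_eq_left) linarith
  then have disj: "(AE x\<in>ball z (R j / 2) in lebesgue. fn (fst p) x <= M - c * (M - ?k)) \<or>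
   (AE x\<in>ball z (R j / 2) in lebesgue. m + c * (?k - m) <= fn (fst p) x)"
  proof cases
   case 1
   have "AE x\<in>ball z (2 * R j) in lebesgue. fn (fst p) x <= M" using b by eventually_elim auto
   from c(3)[OF hm R adm _ this 1] mM show ?thesis by simp
  next
   case 2
   have "AE x\<in>ball z (2 * R j) in lebesgue. fn (fst (- p)) x <= - m"
    using b fn_uminus[of "fst p"] by eventually_elim auto
   from c(3)[OF harm_uminus[OF hm] R adm _ this 2] mM
   have "AE x\<in>ball z (R j / 2) in lebesgue. fn (fst (- p)) x <= - m - c * (- m - - ?k)" by simp
   then have "AE x\<in>ball z (R j / 2) in lebesgue. m + c * (?k - m) <= fn (fst p) x"
    using fn_uminus[of "fst p"] by eventually_elim (auto simp: algebra_simps)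
   then show ?thesis ..
  qed
  have RS: "R j / 2 = 2 * R (Suc j)" by (simp add: R_def)
  have b': "AE x\<in>ball z (R j / 2) in lebesgue. m <= fn (fst p) x \<and> fn (fst p) x <= M"
   using b by eventually_elim (use R(1)[of j] in auto)
  have w': "M - c * (M - ?k) - m = ?q * (M - m)" "M - (m + c * (?k - m)) = ?q * (M - m)"
   by (simp_all add: field_simps)
  have r: "?q * (M - m) <= ?q * (?q ^ j * (2 * M0))" "0 <= ?q * (M - m)"
   using mM c by (auto intro!: mult_left_mono)
  from disj show ?case
  proof
   assume a: "AE x\<in>ball z (R j / 2) in lebesgue. fn (fst p) x <= M - c * (M - ?k)"
   show ?case
   proof (rule exI[of _ m], rule exI[of _ "M - c * (M - ?k)"], intro conjI)
    show "AE x in lebesgue. x \<in> ball z (2 * R (Suc j)) --> m <= fn (fst p) x \<and> fn (fst p) x <= M - c * (M - ?k)"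
     using a b' unfolding RS[symmetric] by eventually_elim auto
    show "m <= M - c * (M - ?k)" using w'(1) r by linarith
    show "M - c * (M - ?k) - m <= ?q ^ Suc j * (2 * M0)" unfolding w'(1) using r(1) by (simp add: mult.assoc)
   qed
  next
   assume a: "AE x\<in>ball z (R j / 2) in lebesgue. m + c * (?k - m) <= fn (fst p) x"
   show ?case
   proof (rule exI[of _ "m + c * (?k - m)"], rule exI[of _ M], intro conjI)
    show "AE x in lebesgue. x \<in> ball z (2 * R (Suc j)) --> m + c * (?k - m) <= fn (fst p) x \<and> fn (fst p) x <= M"
     using a b' unfolding RS[symmetric] by eventually_elim auto
    show "m + c * (?k - m) <= M" using w'(2) r by linarith
    show "M - (m + c * (?k - m)) <= ?q ^ Suc j * (2 * M0)" unfolding w'(2) using r(1) by (simp add: mult.assoc)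
   qed
  qed
 qed
 have "(\<lambda>j. ?q ^ j * (2 * M0)) \<longlonglongrightarrow> 0 * (2 * M0)" using c by (intro tendsto_mult tendsto_const LIMSEQ_realpow_zero) auto
 then have "(\<lambda>j. ?q ^ j * (2 * M0)) \<longlonglongrightarrow> 0" by simp
 from order_tendstoD(2)[OF this e] obtain j where j: "?q ^ j * (2 * M0) < e"
  by (auto simp: eventually_sequentially)
 obtain m M where mM: "M - m <= ?q ^ j * (2 * M0)"
   and b: "AE x\<in>ball z (2 * R j) in lebesgue. m <= fn (fst p) x \<and> fn (fst p) x <= M" using claim[of j] by blast
 show ?thesis
 proof (rule exI[of _ "2 * R j"], intro conjI exI[of _ m])
  show "AE x\<in>ball z (2 * R j) in lebesgue. \<bar>fn (fst p) x - m\<bar> <= e"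
   using b by eventually_elim (use j mM in auto)
 qed (use R(1)[of j] in simp)
qed

subsection \<open>Continuity up to the boundary\<close>

lemma lip_mono_source: "lip_mono (\<lambda>x t. - fn h x) 0"
 unfolding lip_mono_def by (auto intro: sqint_uminus)

lemma nem_source: "nem (\<lambda>x t. - fn h x) u = - h"
 unfolding nem_def using cls_uminus[of "fn h"] by simp

definition lin :: "'n sob => (real^'n) L2 => bool" where
 "lin p h \<longleftrightarrow> p \<in> sob0 \<O> \<and> (\<forall>q\<in>sob0 \<O>. form (snd p) (snd q) = h \<bullet> fst q)"

lemma lin_iff: "lin p h \<longleftrightarrow> solves (\<lambda>x t. - fn h x) p"
 by (auto simp: lin_def solves_def nem_source)

lemma lin_exists: "\<exists>p. lin p h"
 unfolding lin_iff by (rule solves_exists[OF lip_mono_source])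

lemma lin_sup_bound: "lin p h ==> AE x in lebesgue. \<bar>fn (fst p) x\<bar> <= supc * norm h"
 using solves_sup_bound[OF _ lip_mono_source, of h p] cls_uminus[of "fn h"]
 by (simp add: lin_iff) (metis norm_minus_cancel)

lemma lin_diff: "lin p h ==> lin q k ==> lin (p - q) (h - k)"
 unfolding lin_def by (simp add: subspace_diff[OF subspace_sob0] form_linear inner_diff_left)

text \<open>The indicators of balls shrinking to a point tend to 0 almost everywhere, so the part of
  a source near that point has vanishing norm.\<close>

lemma mul_ball_tendsto_0:
 fixes h :: "(real^'n) L2"
 shows "(\<lambda>n. norm (mul (indicator (ball z (1 / real (Suc n)))) h)) \<longlonglongrightarrow> 0"
proof -
 have "(\<lambda>n. cls (\<lambda>x. indicator (ball z (1 / real (Suc n))) x * fn h x)) \<longlonglongrightarrow> cls (\<lambda>x. 0)"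
 proof (rule L2_dominated_convergence(3)[where g = "\<lambda>x. \<bar>fn h x\<bar>"])
  show "(\<lambda>x. indicator (ball z (1 / real (Suc n))) x * fn h x) \<in> borel_measurable lebesgue" for n
   by (intro borel_measurable_times borel_measurable_indicator fn_meas) auto
  show "AE x in lebesgue. \<bar>indicator (ball z (1 / real (Suc n))) x * fn h x\<bar> <= \<bar>fn h x\<bar>" for n
   by (auto simp: indicator_def)
  have "AE x in lebesgue. x \<noteq> z" by (intro AE_completion AE_lborel_singleton)
  then show "AE x in lebesgue. (\<lambda>n. indicator (ball z (1 / real (Suc n))) x * fn h x) \<longlonglongrightarrow> 0"
  proof eventually_elim
   case (elim x)
   then have "0 < dist z x" by simp
   then obtain N :: nat where N: "1 / real (Suc N) < dist z x"
    using reals_Archimedean[of "dist z x"] by (auto simp: inverse_eq_divide)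
   have "indicator (ball z (1 / real (Suc n))) x * fn h x = 0" if "n \<ge> N" for n
   proof -
    have "1 / real (Suc n) <= 1 / real (Suc N)" using that by (intro divide_left_mono) auto
    then show ?thesis using N by (simp add: indicator_def)
   qed
   then show ?case by (intro tendsto_eventually) (auto simp: eventually_sequentially)
  qed
 qed (auto intro: sqint_abs)
 from tendsto_norm[OF this] show ?thesis by (simp add: mul_def cls_zero)
qed

definition osc_small :: "(real^'n) L2 => real^'n => bool" where
 "osc_small u z \<longleftrightarrow> (\<forall>e>0. \<exists>r>0. \<exists>c0. AE x\<in>ball z r in lebesgue. \<bar>fn u x - c0\<bar> <= e)"

text \<open>Uniform density of the complement at small scales: the only form in which boundary
  regularity enters the continuity argument.\<close>

definition ext_dens :: "real^'n => bool" where
 "ext_dens z \<longleftrightarrow> (\<exists>\<theta>>0. \<exists>R0>0. \<forall>R. 0 < R --> R <= R0 --> \<theta> * R ^ CARD('n) <= measure lebesgue (ball z R - \<O>))"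

text \<open>The part of the source near \<open>z\<close> has small norm, hence a uniformly small solution; the
 remaining part solves the homogeneous equation near \<open>z\<close>.\<close>

lemma lin_osc_small:
 assumes l: "lin p h" and z: "z \<in> \<O> \<or> ext_dens z"
 shows "osc_small (fst p) z"
 unfolding osc_small_def
proof (intro allI impI)
 fix e :: real assume e: "e > 0"
 have "\<forall>\<^sub>F n in sequentially. norm (mul (indicator (ball z (1 / real (Suc n)))) h) < e / (2 * supc)"
  using e supc(1) by (intro order_tendstoD(2)[OF mul_ball_tendsto_0]) auto
 then obtain n where n: "norm (mul (indicator (ball z (1 / real (Suc n)))) h) < e / (2 * supc)"
  by (auto simp: eventually_sequentially)
 define s0 where "s0 = 1 / real (Suc n)"
 have s0: "s0 > 0" by (simp add: s0_def)
 define h1 where "h1 = mul (indicator (ball z s0)) h"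
 obtain p1 where p1: "lin p1 h1" using lin_exists by blast
 have u1: "AE x in lebesgue. \<bar>fn (fst p1) x\<bar> <= e / 2" using lin_sup_bound[OF p1]
 proof eventually_elim
  case (elim x)
  have "supc * norm h1 <= supc * (e / (2 * supc))"
   using n supc(1) unfolding h1_def s0_def by (intro mult_left_mono) auto
  then show ?case using elim supc(1) by simp
 qed
 define p2 where "p2 = p - p1"
 have p2: "lin p2 (h - h1)" unfolding p2_def by (rule lin_diff[OF l p1])
 have u2: "AE x in lebesgue. \<bar>fn (fst p2) x\<bar> <= supc * norm (h - h1)" by (rule lin_sup_bound[OF p2])
 have hm: "harm p2 z s" if "s <= s0" for s unfolding harm_def
 proof (intro conjI ballI impI)
  show "p2 \<in> sob0 \<O>" using p2 by (simp add: lin_def)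
  fix q assume q: "q \<in> sob0 \<O>" and zq: "AE x in lebesgue. x \<notin> ball z s --> fn (fst q) x = 0"
  have b: "bmeas (indicator (ball z s0) :: real^'n => real)" by (rule bmeas_indicator) auto
  have "(h - h1) \<bullet> fst q = (LINT x|lebesgue. fn (h - h1) x * fn (fst q) x)" by (rule inner_fn)
  also have "\<dots> = (LINT (x::real^'n)|lebesgue. (0::real))"
  proof (rule integral_cong_AE)
   show "AE x in lebesgue. fn (h - h1) x * fn (fst q) x = 0" using zq fn_diff[of h h1] fn_mul[OF b, of h] 
   proof eventually_elim
    case (elim x)
    then show ?case using that by (cases "x \<in> ball z s0") (auto simp: h1_def)
   qed
  qed measurable
  finally show "form (snd p2) (snd q) = 0" using p2 q by (simp add: lin_def)
 qed
 have eq: "AE x in lebesgue. fn (fst p) x = fn (fst p1) x + fn (fst p2) x"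
  using fn_diff[of "fst p" "fst p1"] by eventually_elim (simp add: p2_def)
 have "\<exists>r>0. \<exists>c0. AE x\<in>ball z r in lebesgue. \<bar>fn (fst p2) x - c0\<bar> <= e / 2" using z
 proof
  assume "z \<in> \<O>"
  then obtain s1 where s1: "s1 > 0" "ball z s1 \<subseteq> \<O>" using open_\<O> open_contains_ball by blast
  show ?thesis by (rule interior_decay[OF hm[of "min s0 s1"] _ _ u2]) (use s0 s1 e in auto)
 next
  assume "ext_dens z"
  then obtain \<theta> R0 where d: "\<theta> > 0" "R0 > 0" "\<And>R. 0 < R ==> R <= R0 ==> \<theta> * R ^ CARD('n) <= measure lebesgue (ball z R - \<O>)"
   unfolding ext_dens_def by blast
  have M0: "0 <= supc * norm (h - h1)" using supc(1) by simp
  have "AE x in lebesgue. fn (fst p2) x <= supc * norm (h - h1)" using u2 by eventually_elim auto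
  from boundary_decay[OF hm[OF order_refl] s0 d this M0, of "e / 2"] e
  obtain r1 where r1: "r1 > 0" "AE x\<in>ball z r1 in lebesgue. fn (fst p2) x <= e / 2" by auto
  have "AE x in lebesgue. fn (fst (- p2)) x <= supc * norm (h - h1)" using u2 fn_uminus[of "fst p2"] by eventually_elim auto
  from boundary_decay[OF harm_uminus[OF hm[OF order_refl]] s0 d this M0, of "e / 2"] e
  obtain r2 where r2: "r2 > 0" "AE x\<in>ball z r2 in lebesgue. fn (fst (- p2)) x <= e / 2" by auto
  show ?thesis
  proof (rule exI[of _ "min r1 r2"], intro conjI exI[of _ 0])
   show "AE x\<in>ball z (min r1 r2) in lebesgue. \<bar>fn (fst p2) x - 0\<bar> <= e / 2"
    using r1(2) r2(2) fn_uminus[of "fst p2"] by eventually_elim auto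
  qed (use r1 r2 in auto)
 qed
 then obtain r c0 where r: "r > 0" "AE x\<in>ball z r in lebesgue. \<bar>fn (fst p2) x - c0\<bar> <= e / 2" by blast
 show "\<exists>r>0. \<exists>c0. AE x\<in>ball z r in lebesgue. \<bar>fn (fst p) x - c0\<bar> <= e"
 proof (rule exI[of _ r], intro conjI exI[of _ c0] r(1))
  show "AE x\<in>ball z r in lebesgue. \<bar>fn (fst p) x - c0\<bar> <= e" using r(2) u1 eq
  proof eventually_elim
   case (elim x)
   show ?case
   proof
    assume "x \<in> ball z r"
    then have "\<bar>fn (fst p2) x - c0\<bar> <= e / 2" using elim by blast
    then show "\<bar>fn (fst p) x - c0\<bar> <= e" using elim(2,3) by linarith
   qed
  qed
 qed
qed

text \<open>The approximate constants at different precisions agree up to the precisions, because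
  concentric balls overlap in a set of positive measure; so they form a Cauchy sequence.\<close>

lemma osc_small_value:
 assumes "osc_small u z"
 shows "\<exists>v. \<forall>e>0. \<exists>r>0. AE x\<in>ball z r in lebesgue. \<bar>fn u x - v\<bar> <= e"
proof -
 have "\<forall>n. \<exists>r c0. r > 0 \<and> (AE x\<in>ball z r in lebesgue. \<bar>fn u x - c0\<bar> <= 1 / real (Suc n))"
 proof
  fix n
  have "1 / real (Suc n) > 0" by simp
  with assms show "\<exists>r c0. r > 0 \<and> (AE x\<in>ball z r in lebesgue. \<bar>fn u x - c0\<bar> <= 1 / real (Suc n))"
   unfolding osc_small_def by blast
 qed
 from choice[OF this] obtain r where "\<forall>n. \<exists>c0. r n > 0 \<and> (AE x\<in>ball z (r n) in lebesgue. \<bar>fn u x - c0\<bar> <= 1 / real (Suc n))"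
  by (rule exE)
 from choice[OF this] obtain c where rc': "\<forall>n. r n > 0 \<and> (AE x\<in>ball z (r n) in lebesgue. \<bar>fn u x - c n\<bar> <= 1 / real (Suc n))"
  by (rule exE)
 have rc: "r n > 0" "AE x\<in>ball z (r n) in lebesgue. \<bar>fn u x - c n\<bar> <= 1 / real (Suc n)" for n
  using rc'[rule_format, of n] by simp_all
 have cd: "\<bar>c m - c n\<bar> <= 1 / real (Suc m) + 1 / real (Suc n)" for m n
 proof (rule AE_ball_nonempty[of "ball z (min (r m) (r n))"])
  show "AE x in lebesgue. x \<in> ball z (min (r m) (r n)) --> \<bar>c m - c n\<bar> <= 1 / real (Suc m) + 1 / real (Suc n)"
   using rc(2)[of m] rc(2)[of n]
  proof eventually_elim
   case (elim x)
   show ?case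
   proof
    assume "x \<in> ball z (min (r m) (r n))"
    then have "\<bar>fn u x - c m\<bar> <= 1 / real (Suc m)" "\<bar>fn u x - c n\<bar> <= 1 / real (Suc n)" using elim by auto
    then show "\<bar>c m - c n\<bar> <= 1 / real (Suc m) + 1 / real (Suc n)" by linarith
   qed
  qed
 qed (use rc(1)[of m] rc(1)[of n] in auto)
 have "Cauchy c"
 proof (rule metric_CauchyI)
  fix e :: real assume e: "e > 0"
  obtain N where N: "1 / real (Suc N) < e / 2" using reals_Archimedean[of "e / 2"] e by (auto simp: inverse_eq_divide)
  have "dist (c m) (c n) < e" if "m \<ge> N" "n \<ge> N" for m n
  proof -
   have "1 / real (Suc m) <= 1 / real (Suc N)" "1 / real (Suc n) <= 1 / real (Suc N)"
    using that by (auto intro!: divide_left_mono)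
   then show ?thesis using cd[of m n] N by (simp add: dist_real_def)
  qed
  then show "\<exists>M. \<forall>m\<ge>M. \<forall>n\<ge>M. dist (c m) (c n) < e" by blast
 qed
 then obtain v where v: "c \<longlonglongrightarrow> v" using Cauchy_convergent_iff convergent_def by blast
 have vc: "\<bar>v - c n\<bar> <= 1 / real (Suc n)" for n
 proof -
  have l1: "(\<lambda>m. \<bar>c m - c n\<bar>) \<longlonglongrightarrow> \<bar>v - c n\<bar>" by (intro tendsto_rabs tendsto_diff v tendsto_const)
  have l2: "(\<lambda>m. 1 / real (Suc m) + 1 / real (Suc n)) \<longlonglongrightarrow> 0 + 1 / real (Suc n)"
   by (intro tendsto_add tendsto_const LIMSEQ_Suc[OF lim_1_over_n])
  have "\<bar>v - c n\<bar> <= 0 + 1 / real (Suc n)" by (rule LIMSEQ_le[OF l1 l2]) (use cd in blast)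
  then show ?thesis by simp
 qed
 show ?thesis
 proof (rule exI[of _ v], intro allI impI)
  fix e :: real assume e: "e > 0"
  obtain N where N: "1 / real (Suc N) < e / 2" using reals_Archimedean[of "e / 2"] e by (auto simp: inverse_eq_divide)
  show "\<exists>r>0. AE x\<in>ball z r in lebesgue. \<bar>fn u x - v\<bar> <= e"
  proof (intro exI[of _ "r N"] conjI rc(1))
   show "AE x\<in>ball z (r N) in lebesgue. \<bar>fn u x - v\<bar> <= e" using rc(2)[of N]
   proof eventually_elim
    case (elim x)
    show "x \<in> ball z (r N) --> \<bar>fn u x - v\<bar> <= e"
    proof
     assume "x \<in> ball z (r N)"
     with elim have "\<bar>fn u x - c N\<bar> <= 1 / real (Suc N)" by blast
     then show "\<bar>fn u x - v\<bar> <= e" using vc[of N] N by linarith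
    qed
   qed
  qed
 qed
qed

text \<open>The essential limits define a function that is continuous because overlapping balls meet
  in open sets. For agreement almost everywhere, compactness reduces the cover of the closure to
  finitely many balls, since uncountably many null sets could not be united.\<close>

lemma continuous_representative:
 assumes osc: "\<And>z. z \<in> closure \<O> ==> osc_small u z"
 shows "\<exists>y. continuous_on (closure \<O>) y \<and> (AE x\<in>\<O> in lebesgue. y x = fn u x)"
proof -
 have "\<forall>z\<in>closure \<O>. \<exists>v. \<forall>e>0. \<exists>r>0. AE x\<in>ball z r in lebesgue. \<bar>fn u x - v\<bar> <= e"
  using osc_small_value[OF osc] by blast
 from bchoice[OF this] obtain y where y': "\<forall>z\<in>closure \<O>. \<forall>e>0. \<exists>r>0. AE x\<in>ball z r in lebesgue. \<bar>fn u x - y z\<bar> <= e"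
  by (rule exE)
 have y: "\<exists>r>0. AE x\<in>ball z r in lebesgue. \<bar>fn u x - y z\<bar> <= e" if "z \<in> closure \<O>" "e > 0" for z e
  using y'[rule_format, OF that] .
 have near: "\<bar>y z' - y z\<bar> <= e"
  if z: "z \<in> closure \<O>" "z' \<in> closure \<O>" "z' \<in> ball z r" and ae: "AE x\<in>ball z r in lebesgue. \<bar>fn u x - y z\<bar> <= e" for z z' r e
 proof (rule field_le_epsilon)
  fix d :: real assume "d > 0"
  then obtain r' where r': "r' > 0" "AE x\<in>ball z' r' in lebesgue. \<bar>fn u x - y z'\<bar> <= d" using y[OF z(2)] by blast
  show "\<bar>y z' - y z\<bar> <= e + d"
  proof (rule AE_ball_nonempty[of "ball z' r' \<inter> ball z r"])
   show "ball z' r' \<inter> ball z r \<noteq> {}" using z(3) r'(1) centre_in_ball[of z' r'] by blast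
   show "AE x in lebesgue. x \<in> ball z' r' \<inter> ball z r --> \<bar>y z' - y z\<bar> <= e + d" using ae r'(2)
   proof eventually_elim
    case (elim x)
    then show ?case by (auto simp: abs_le_iff)
   qed
  qed auto
 qed
 have cont: "continuous_on (closure \<O>) y"
 proof (rule continuous_onI)
  fix z e assume z: "z \<in> closure \<O>" and e: "(e::real) > 0"
  obtain r where r: "r > 0" "AE x\<in>ball z r in lebesgue. \<bar>fn u x - y z\<bar> <= e" using y[OF z e] by blast
  show "\<exists>d>0. \<forall>z'\<in>closure \<O>. dist z' z < d --> dist (y z') (y z) <= e"
   using near[OF z _ _ r(2)] r(1) by (auto simp: dist_real_def dist_commute intro!: exI[of _ r])
 qed
 have ae: "AE x\<in>\<O> in lebesgue. \<bar>fn u x - y x\<bar> <= 2 * e" if e: "e > 0" for e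
 proof -
  have "\<forall>z\<in>closure \<O>. \<exists>r>0. AE x\<in>ball z r in lebesgue. \<bar>fn u x - y z\<bar> <= e" by (intro ballI y e)
  from bchoice[OF this] obtain r where r': "\<forall>z\<in>closure \<O>. 0 < r z \<and> (AE x\<in>ball z (r z) in lebesgue. \<bar>fn u x - y z\<bar> <= e)"
   by (rule exE)
  have r: "r z > 0" "AE x\<in>ball z (r z) in lebesgue. \<bar>fn u x - y z\<bar> <= e" if "z \<in> closure \<O>" for z
   using r'[rule_format, OF that] by simp_all
  have "compact (closure \<O>)" using bounded_\<O> by (simp add: compact_closure)
  moreover have "closure \<O> \<subseteq> (\<Union>z\<in>closure \<O>. ball z (r z))" using r(1) by force
  ultimately obtain T where T: "T \<subseteq> closure \<O>" "finite T" "closure \<O> \<subseteq> (\<Union>z\<in>T. ball z (r z))"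
   by (rule compactE_image[of "closure \<O>" "closure \<O>" "\<lambda>z. ball z (r z)", OF _ open_ball])
  have "AE x in lebesgue. \<forall>z\<in>T. x \<in> ball z (r z) --> \<bar>fn u x - y z\<bar> <= e"
   using T(1,2) r(2) by (intro AE_finite_allI) auto
  then show ?thesis
  proof eventually_elim
   case (elim x)
   show ?case
   proof
    assume "x \<in> \<O>"
    then have xc: "x \<in> closure \<O>" by (rule subsetD[OF closure_subset])
    then obtain z where z: "z \<in> T" "x \<in> ball z (r z)" using T(3) by blast
    then have "z \<in> closure \<O>" using T(1) by blast
    then have "\<bar>y x - y z\<bar> <= e" using near[OF _ xc z(2) r(2)] by blast
    moreover have "\<bar>fn u x - y z\<bar> <= e" using elim z by blast
    ultimately show "\<bar>fn u x - y x\<bar> <= 2 * e" by linarith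
   qed
  qed
 qed
 have "AE x in lebesgue. \<forall>n. x \<in> \<O> --> \<bar>fn u x - y x\<bar> <= 2 * (1 / real (Suc n))"
  unfolding AE_all_countable by (intro allI ae) simp
 then have "AE x\<in>\<O> in lebesgue. y x = fn u x"
 proof eventually_elim
  case (elim x)
  show ?case
  proof
   assume x: "x \<in> \<O>"
   have l: "(\<lambda>n. 2 * (1 / real (Suc n))) \<longlonglongrightarrow> 2 * 0"
    by (intro tendsto_mult tendsto_const LIMSEQ_Suc[OF lim_1_over_n])
   have "\<bar>fn u x - y x\<bar> <= 2 * 0" by (rule LIMSEQ_le_const[OF l]) (use elim x in blast)
   then show "y x = fn u x" by simp
  qed
 qed
 with cont show ?thesis by blast
qed

end

text \<open>A ball of radius proportional to \<open>R\<close>, centred at distance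
  \<open>R / 2\<close> from \<open>z\<close> on the side opposite to \<open>n\<close>, lies below
  the Lipschitz graph and hence outside \<open>\<O>\<close>.\<close>

lemma lipschitz_boundary_ext_dens:
 fixes \<O> :: "(real^'n) set"
 assumes lip: "lipschitz_boundary \<O>" and \<O>: "open \<O>" "bounded \<O>" and z: "z \<in> frontier \<O>"
 shows "\<exists>\<theta>>0. \<exists>R0>0. \<forall>R. 0 < R --> R <= R0 --> \<theta> * R ^ CARD('n) <= measure lebesgue (ball z R - \<O>)"
proof -
 obtain n \<gamma> r C where n: "norm n = 1" and r: "r > 0" and L: "C-lipschitz_on {v. n \<bullet> v = 0} \<gamma>"
  and eq: "\<O> \<inter> ball z r = {x \<in> ball z r. n \<bullet> (x - z) > (\<gamma> :: real^'n => real) ((x - z) - (n \<bullet> (x - z)) *\<^sub>R n)}"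
  using lip z unfolding lipschitz_boundary_def by blast
 have C: "C \<ge> 0" by (rule lipschitz_on_nonneg[OF L])
 have "z \<notin> \<O>" using z \<O>(1) by (auto simp: frontier_def interior_open)
 then have g0: "\<gamma> 0 \<ge> 0" using eq r by auto
 \<comment> \<open>With this choice the displacement along \<open>n\<close> and the variation of the
   graph together amount to at most \<open>R / 4\<close>, less than the depth \<open>R / 2\<close>
   of the centre.\<close>
 define \<kappa> where "\<kappa> = 1 / (4 * (1 + C))"
 have \<kappa>: "\<kappa> > 0" "\<kappa> * (1 + C) = 1 / 4" using C by (auto simp: \<kappa>_def)
 have \<kappa>1: "\<kappa> <= 1 / 4"
 proof -
  have "\<kappa> * 1 <= \<kappa> * (1 + C)" using \<kappa>(1) C by (intro mult_left_mono) auto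
  then show ?thesis using \<kappa>(2) by simp
 qed
 define w where "w = measure lborel (cball (0::real^'n) 1)"
 have w: "w > 0" using measure_cball1_pos by (simp add: w_def)
 show ?thesis
 proof (rule exI[of _ "w * \<kappa> ^ CARD('n)"], rule conjI, goal_cases)
  case 1
  show ?case using w \<kappa> by simp
 next
  case 2
  show ?case
  proof (rule exI[of _ r], intro conjI allI impI r)
  fix R assume R: "0 < R" "R <= r"
  let ?c = "z - (R / 2) *\<^sub>R n"
  have sub: "ball ?c (\<kappa> * R) \<subseteq> ball z R - \<O>"
  proof
   fix x assume "x \<in> ball ?c (\<kappa> * R)"
   then have x: "norm (x - ?c) < \<kappa> * R" by (simp add: dist_norm norm_minus_commute)
   define v where "v = x - ?c"
   have xz: "x - z = v - (R / 2) *\<^sub>R n" by (simp add: v_def)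
   have nn: "n \<bullet> n = 1" using n by (simp add: dot_square_norm)
   have nv: "\<bar>n \<bullet> v\<bar> <= norm v" using Cauchy_Schwarz_ineq2[of n v] n by simp
   have "norm (x - z) <= norm v + R / 2" unfolding xz using norm_triangle_ineq4[of v "(R / 2) *\<^sub>R n"] n R by simp
   moreover have kR: "\<kappa> * R <= 1 / 4 * R" using \<kappa>1 R by (intro mult_right_mono) auto
   ultimately have xR: "norm (x - z) < R" using x R unfolding v_def by linarith
   let ?t = "(x - z) - (n \<bullet> (x - z)) *\<^sub>R n"
   have t: "?t = v - (n \<bullet> v) *\<^sub>R n" unfolding xz by (simp add: inner_diff_right nn algebra_simps)
   have nt: "n \<bullet> ?t = 0" unfolding t by (simp add: inner_diff_right nn)
   have "(norm ?t)\<^sup>2 = (norm v)\<^sup>2 - (n \<bullet> v)\<^sup>2"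
    unfolding t power2_norm_eq_inner by (simp add: inner_diff_left inner_diff_right nn inner_commute power2_eq_square algebra_simps)
   then have "(norm ?t)\<^sup>2 <= (norm v)\<^sup>2" by simp
   then have tn: "norm ?t <= norm v" by (rule power2_le_imp_le) simp
   have "\<bar>\<gamma> ?t - \<gamma> 0\<bar> <= C * norm ?t" using lipschitz_onD[OF L, of ?t 0] nt by (simp add: dist_real_def)
   also have "\<dots> <= C * (\<kappa> * R)" using tn x C unfolding v_def by (intro mult_left_mono) auto
   finally have "\<gamma> ?t \<ge> - (C * (\<kappa> * R))" using g0 by linarith
   moreover have "n \<bullet> (x - z) <= \<kappa> * R - R / 2"
    unfolding xz using nv x by (simp add: inner_diff_right nn v_def)
   moreover have "\<kappa> * R + C * (\<kappa> * R) = 1 / 4 * R"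
   proof -
    have "\<kappa> * R + C * (\<kappa> * R) = \<kappa> * (1 + C) * R" by (simp add: algebra_simps)
    then show ?thesis using \<kappa>(2) by simp
   qed
   ultimately have "\<not> n \<bullet> (x - z) > \<gamma> ?t" using R by linarith
   moreover have xr: "x \<in> ball z r" "x \<in> ball z R" using xR R by (auto simp: dist_norm norm_minus_commute)
   ultimately have "x \<notin> \<O>" using eq by blast
   then show "x \<in> ball z R - \<O>" using xr by simp
  qed
  have "w * \<kappa> ^ CARD('n) * R ^ CARD('n) = measure lebesgue (ball ?c (\<kappa> * R))"
   using measure_ball_eq[of "\<kappa> * R" ?c] \<kappa> R by (simp add: w_def power_mult_distrib)
  also have "\<dots> <= measure lebesgue (ball z R - \<O>)"
   by (rule measure_mono_fmeasurable[OF sub]) (use fmeasurable.Diff[OF lmeasurable_ball lmeasurable_open[OF \<O>(2,1)]] in auto)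
  finally show "w * \<kappa> ^ CARD('n) * R ^ CARD('n) <= measure lebesgue (ball z R - \<O>)" .
 qed
 qed
qed

subsection \<open>Schauder's fixed point theorem and compactness in \<open>L\<^sup>2\<close>\<close>

text \<open>The Schauder projection replaces values of \<open>T\<close> by convex combinations of a
  finite net. The resulting map of coefficient vectors sends the cube to itself, and Kuhn's
  combinatorial lemma yields a nearly fixed vector; its combination is nearly fixed by
  \<open>T\<close>.\<close>

lemma approximate_fixed_point:
 fixes T :: "'a::real_normed_vector => 'a"
 assumes lip: "\<And>x y. dist (T x) (T y) <= l * dist x y" and l: "l \<ge> 0" and e: "e > 0"
  and F: "finite F" "range T \<subseteq> (\<Union>x\<in>F. ball x e)"
 shows "\<exists>x. dist (T x) x <= 3 * e"
proof -
 obtain y p where y: "F = y ` {i::nat. i < p}" using F(1) unfolding finite_conv_nat_seg_image by blast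
 \<comment> \<open>The width \<open>2 * e\<close> gives weight at least \<open>e\<close> to a net
   point closer than \<open>e\<close>, so the normalising sum \<open>D\<close> stays away from 0 and
   the weights \<open>g\<close> are Lipschitz.\<close>
 define \<rho> where "\<rho> i z = max 0 (2 * e - dist z (y i))" for i z
 define D where "D z = (\<Sum>i<p. \<rho> i z)" for z
 define X where "X c = (\<Sum>i<p. c i *\<^sub>R y i)" for c
 define g where "g i c = \<rho> i (T (X c)) / D (T (X c))" for i c
 define b where "b = (\<Sum>i<p. norm (y i))"
 have b: "b \<ge> 0" by (simp add: b_def sum_nonneg)
 have \<rho>0: "0 <= \<rho> i z" for i z by (simp add: \<rho>_def)
 have \<rho>: "0 <= \<rho> i z" "\<rho> i z <= D z" if "i < p" for i z
  using member_le_sum[of i "{..<p}" "\<lambda>i. \<rho> i z", OF _ \<rho>0] that by (simp_all add: D_def \<rho>0)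
 have De: "D (T x) \<ge> e" for x
 proof -
  have "T x \<in> (\<Union>x\<in>F. ball x e)" by (rule subsetD[OF F(2)]) simp
  then obtain i where i: "i < p" "dist (y i) (T x) < e" unfolding y by auto
  then have "e <= \<rho> i (T x)" by (simp add: \<rho>_def dist_commute)
  then show ?thesis using \<rho>(2)[OF i(1), of "T x"] by linarith
 qed
 have Dpos: "D (T x) > 0" for x using De[of x] e by linarith
 have g: "0 <= g i c" "g i c <= 1" if "i < p" for i c
  unfolding g_def using \<rho>[OF that, of "T (X c)"] Dpos[of "X c"]
  by (auto intro: divide_nonneg_nonneg less_imp_le)
 have gs: "(\<Sum>i<p. g i c) = 1" for c
  unfolding g_def sum_divide_distrib[symmetric] D_def[symmetric] using Dpos[of "X c"] by simp
 have gT: "norm ((\<Sum>i<p. g i c *\<^sub>R y i) - T (X c)) <= 2 * e" for c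
 proof -
  have "(\<Sum>i<p. g i c *\<^sub>R y i) - T (X c) = (\<Sum>i<p. g i c *\<^sub>R (y i - T (X c)))"
   by (simp add: scaleR_diff_right sum_subtractf scaleR_left.sum[symmetric] gs)
  also have "norm \<dots> <= (\<Sum>i<p. g i c * (2 * e))"
  proof (rule sum_norm_le)
   fix i assume "i \<in> {..<p}"
   then have i: "i < p" by simp
   show "norm (g i c *\<^sub>R (y i - T (X c))) <= g i c * (2 * e)"
   proof (cases "dist (T (X c)) (y i) <= 2 * e")
    case True
    then show ?thesis using g(1)[OF i, of c] by (simp add: dist_norm norm_minus_commute mult_left_mono)
   next
    case False
    then show ?thesis by (simp add: g_def \<rho>_def)
   qed
  qed
  also have "\<dots> = 2 * e" unfolding sum_distrib_right[symmetric] gs by simp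
  finally show ?thesis .
 qed
 have Xd: "norm ((\<Sum>i<p. c i *\<^sub>R y i) - (\<Sum>i<p. c' i *\<^sub>R y i)) <= d * b"
  if c: "\<And>i. i < p ==> \<bar>c i - c' i\<bar> <= d" for c c' d
 proof -
  have "(\<Sum>i<p. c i *\<^sub>R y i) - (\<Sum>i<p. c' i *\<^sub>R y i) = (\<Sum>i<p. (c i - c' i) *\<^sub>R y i)"
   by (simp add: scaleR_diff_left sum_subtractf)
  also have "norm \<dots> <= (\<Sum>i<p. d * norm (y i))" using c by (intro sum_norm_le) (auto intro!: mult_right_mono)
  finally show ?thesis by (simp add: b_def sum_distrib_left)
 qed
 \<comment> \<open>A Lipschitz constant of the weights in the maximum norm of the coefficients: one
   share from the numerator and \<open>p\<close> shares from the normalising sum.\<close>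
 define K where "K = (1 + real p) * (l * b) / e"
 have K: "K \<ge> 0" using l b e by (simp add: K_def)
 have glip: "\<bar>g i c - g i c'\<bar> <= K * d" if c: "\<And>i. i < p ==> \<bar>c i - c' i\<bar> <= d" and i: "i < p" for c c' d i
 proof -
  let ?z = "T (X c)" and ?z' = "T (X c')"
  define t where "t = dist ?z ?z'"
  have t0: "t \<ge> 0" by (simp add: t_def)
  have "t <= l * dist (X c) (X c')" unfolding t_def by (rule lip)
  also have "\<dots> <= l * (d * b)" unfolding X_def dist_norm using l by (intro mult_left_mono Xd c)
  finally have t: "t <= l * (d * b)" .
  have r: "\<bar>\<rho> j ?z - \<rho> j ?z'\<bar> <= t" for j
   unfolding \<rho>_def t_def using dist_triangle[of ?z "y j" ?z'] dist_triangle[of ?z' "y j" ?z]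
   by (auto simp: dist_commute abs_le_iff max_def)
  have "\<bar>D ?z - D ?z'\<bar> <= (\<Sum>j<p. \<bar>\<rho> j ?z - \<rho> j ?z'\<bar>)"
   unfolding D_def sum_subtractf[symmetric] by (rule sum_abs)
  also have "\<dots> <= p * t" using sum_bounded_above[of "{..<p}" "\<lambda>j. \<bar>\<rho> j ?z - \<rho> j ?z'\<bar>" t] r by simp
  finally have dD: "\<bar>D ?z' - D ?z\<bar> <= p * t" by (simp add: abs_minus_commute)
  have "g i c - g i c' = (\<rho> i ?z - \<rho> i ?z') / D ?z + g i c' * ((D ?z' - D ?z) / D ?z)"
   using Dpos[of "X c"] Dpos[of "X c'"] by (simp add: g_def field_simps)
  then have "\<bar>g i c - g i c'\<bar> <= \<bar>\<rho> i ?z - \<rho> i ?z'\<bar> / D ?z + \<bar>g i c'\<bar> * (\<bar>D ?z' - D ?z\<bar> / D ?z)"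
   using Dpos[of "X c"] by (simp add: abs_mult abs_divide order_trans[OF abs_triangle_ineq])
  also have "\<dots> <= t / e + 1 * (p * t / e)"
   using De[of "X c"] e r dD g[OF i, of c'] t0 by (intro add_mono mult_mono frac_le) auto
  also have "\<dots> = (1 + real p) * t / e" by (simp add: algebra_simps add_divide_distrib)
  also have "\<dots> <= (1 + real p) * (l * (d * b)) / e"
   using t e by (intro divide_right_mono mult_left_mono) auto
  finally show ?thesis by (simp add: K_def mult_ac)
 qed
 \<comment> \<open>The mesh is so fine that the coefficient error \<open>(1 + K) / n\<close>,
   multiplied by the total size \<open>b\<close> of the net, is at most \<open>e\<close>.\<close>
 obtain n :: nat where n: "n > b * (1 + K) / e" using reals_Archimedean2 by blast
 have n0: "n > 0" using n divide_nonneg_pos[OF mult_nonneg_nonneg[OF b] e, of "1 + K"] K by (intro gr0I) simp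
 \<comment> \<open>Label 0 means that the coordinate does not exceed its image. The extra clauses
   force 0 on the lower and 1 on the upper faces of the cube, as Kuhn's lemma demands; a cell with
   both labels pins the coordinate to its image.\<close>
 define lab where "lab x i = (if x i = 0 \<or> x i < n \<and> real (x i) / n <= g i (\<lambda>j. real (x j) / n) then 0 else 1 :: nat)" for x i
 have l0: "real (x i) / n <= g i (\<lambda>j. real (x j) / n)" if "lab x i = 0" "i < p" for x i
  using that g(1)[OF that(2)] by (auto simp: lab_def split: if_splits)
 have l1: "g i (\<lambda>j. real (x j) / n) <= real (x i) / n" if "lab x i \<noteq> 0" "i < p" "x i <= n" for x i
  using that g(2)[OF that(2), of "\<lambda>j. real (x j) / n"] n0 by (cases "x i = n") (auto simp: lab_def split: if_splits)
 obtain q where q: "\<forall>i<p. q i < n"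
  "\<forall>i<p. \<exists>r s. (\<forall>j<p. q j <= r j \<and> r j <= q j + 1) \<and> (\<forall>j<p. q j <= s j \<and> s j <= q j + 1) \<and> lab r i \<noteq> lab s i"
  by (rule kuhn_lemma[OF n0, of p lab]) (use n0 in \<open>auto simp: lab_def\<close>)
 define c where "c j = real (q j) / n" for j
 have near: "\<bar>c j - real (r j) / n\<bar> <= 1 / n" if "q j <= r j" "r j <= q j + 1" for r j
 proof -
  have "\<bar>real (q j) - real (r j)\<bar> <= 1" using that by linarith
  then have "\<bar>real (q j) - real (r j)\<bar> / n <= 1 / n" by (intro divide_right_mono) auto
  then show ?thesis by (simp add: c_def diff_divide_distrib[symmetric] abs_divide)
 qed
 have "\<bar>g i c - c i\<bar> <= (1 + K) / n" if i: "i < p" for i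
 proof -
  have cell: "\<bar>g i c - c i\<bar> <= (1 + K) / n"
   if r: "\<forall>j<p. q j <= r j \<and> r j <= q j + 1" and s: "\<forall>j<p. q j <= s j \<and> s j <= q j + 1"
   and lab: "lab r i = 0" "lab s i \<noteq> 0" for r s
  proof -
   have "\<bar>g i c - g i (\<lambda>j. real (r j) / n)\<bar> <= K * (1 / n)" "\<bar>g i c - g i (\<lambda>j. real (s j) / n)\<bar> <= K * (1 / n)"
    by (rule glip[OF near i]; use r s in blast)+
   moreover have "\<bar>c i - real (r i) / n\<bar> <= 1 / n" "\<bar>c i - real (s i) / n\<bar> <= 1 / n"
    by (rule near; use r s i in blast)+
   moreover have "s i <= n" using s q(1) i by fastforce
   ultimately have "\<bar>g i c - c i\<bar> <= 1 / n + K * (1 / n)" using l0[OF lab(1) i] l1[OF lab(2) i] by linarith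
   then show ?thesis by (simp add: add_divide_distrib)
  qed
  obtain r s where rs: "\<forall>j<p. q j <= r j \<and> r j <= q j + 1" "\<forall>j<p. q j <= s j \<and> s j <= q j + 1" "lab r i \<noteq> lab s i"
   using q(2) i by blast
  show ?thesis
  proof (cases "lab r i = 0")
   case True
   then show ?thesis using cell[OF rs(1,2)] rs(3) by simp
  next
   case False
   then have "lab s i = 0" using rs(3) by (auto simp: lab_def split: if_splits)
   then show ?thesis using cell[OF rs(2,1)] False by blast
  qed
 qed
 then have "norm ((\<Sum>i<p. g i c *\<^sub>R y i) - X c) <= (1 + K) / n * b" unfolding X_def by (rule Xd)
 also have "\<dots> <= e" using n n0 e by (simp add: field_simps)
 finally have "norm ((\<Sum>i<p. g i c *\<^sub>R y i) - X c) <= e" .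
 with gT[of c] have "norm (T (X c) - X c) <= 3 * e"
  using norm_triangle_ineq4[of "(\<Sum>i<p. g i c *\<^sub>R y i) - X c" "(\<Sum>i<p. g i c *\<^sub>R y i) - T (X c)"] by simp
 then show ?thesis by (auto simp: dist_norm)
qed

text \<open>Total boundedness makes the closure of the range compact, so values of \<open>T\<close>
  at approximate fixed points accumulate; the points accumulate at the same limit, which continuity
  shows to be fixed.\<close>

lemma lipschitz_schauder:
 fixes T :: "'a::{real_normed_vector,complete_space} => 'a"
 assumes lip: "\<And>x y. dist (T x) (T y) <= l * dist x y" and l: "l \<ge> 0"
  and tb: "\<And>e. e > 0 ==> \<exists>F. finite F \<and> range T \<subseteq> (\<Union>x\<in>F. ball x e)"
 shows "\<exists>x. T x = x"
proof -
 have "\<exists>x. dist (T x) x <= 3 * (1 / real (Suc n))" for n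
 proof -
  have "1 / real (Suc n) > 0" by simp
  then show ?thesis using tb approximate_fixed_point[OF lip l] by blast
 qed
 then obtain x where x: "\<And>n. dist (T (x n)) (x n) <= 3 * (1 / real (Suc n))" by metis
 have cpt: "compact (closure (range T))" unfolding compact_eq_totally_bounded
 proof (intro conjI allI impI)
  show "complete (closure (range T))" by (simp add: complete_eq_closed)
  fix e :: real assume e: "e > 0"
  then obtain F where F: "finite F" "range T \<subseteq> (\<Union>x\<in>F. ball x (e / 2))" using tb[of "e / 2"] by auto
  have "closure (range T) \<subseteq> (\<Union>x\<in>F. cball x (e / 2))"
  proof (rule closure_minimal)
   show "range T \<subseteq> (\<Union>x\<in>F. cball x (e / 2))" using F(2) ball_subset_cball by blast
   show "closed (\<Union>x\<in>F. cball x (e / 2))" using F(1) by (intro closed_UN) auto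
  qed
  also have "\<dots> \<subseteq> (\<Union>x\<in>F. ball x e)" using e by (intro UN_mono) auto
  finally show "\<exists>k. finite k \<and> closure (range T) \<subseteq> (\<Union>x\<in>k. ball x e)" using F(1) by blast
 qed
 have "\<forall>n. T (x n) \<in> closure (range T)" by (intro allI subsetD[OF closure_subset]) simp
 then obtain z r where z: "strict_mono (r :: nat => nat)" "((\<lambda>n. T (x n)) \<circ> r) \<longlonglongrightarrow> z"
  using cpt[unfolded compact_def, THEN spec, of "\<lambda>n. T (x n)"] by auto
 have d0: "(\<lambda>n. 3 * (1 / real (Suc n))) \<longlonglongrightarrow> 3 * 0"
  by (intro tendsto_mult tendsto_const LIMSEQ_Suc[OF lim_1_over_n])
 have "(\<lambda>n. dist (T (x n)) (x n)) \<longlonglongrightarrow> 0" by (rule tendsto_sandwich[OF _ _ tendsto_const]) (use x d0 in auto)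
 from LIMSEQ_subseq_LIMSEQ[OF this z(1)] have "(\<lambda>n. T (x (r n)) - x (r n)) \<longlonglongrightarrow> 0"
  by - (rule tendsto_norm_zero_cancel, simp add: o_def dist_norm)
 from tendsto_diff[OF z(2) this] have xr: "(\<lambda>n. x (r n)) \<longlonglongrightarrow> z" by (simp add: o_def)
 have "continuous_on UNIV T" using lip l by (intro lipschitz_on_continuous_on[of l] lipschitz_onI) auto
 then have "(\<lambda>n. T (x (r n))) \<longlonglongrightarrow> T z" by (rule continuous_on_tendsto_compose[OF _ xr]) auto
 then have "T z = z" using z(2) unfolding o_def by (rule LIMSEQ_unique)
 then show ?thesis by blast
qed

text \<open>By induction the set is a sum of compact segments; it contains the step functions that
  approximate bounded elements of \<open>sob0\<close>.\<close>

lemma compact_box_combinations: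
 fixes e :: "'i => 'a::real_normed_vector"
 assumes "finite G"
 shows "compact {\<Sum>k\<in>G. c k *\<^sub>R e k | c. \<forall>k. \<bar>c k\<bar> <= M}"
 using assms
proof induction
 case empty
 show ?case by (rule finite_imp_compact) (rule finite_subset[of _ "{0}"], auto)
next
 case (insert k G)
 let ?S = "(\<lambda>t. t *\<^sub>R e k) ` {-M..M}" and ?T = "{\<Sum>k\<in>G. c k *\<^sub>R e k | c. \<forall>k. \<bar>c k\<bar> <= M}"
 have "{\<Sum>k\<in>insert k G. c k *\<^sub>R e k | c. \<forall>k. \<bar>c k\<bar> <= M} = {x + y |x y. x \<in> ?S \<and> y \<in> ?T}" (is "?L = ?R")
 proof
  show "?L \<subseteq> ?R"
  proof
   fix z assume "z \<in> ?L"
   then obtain c where c: "\<And>k. \<bar>c k\<bar> <= M" "z = c k *\<^sub>R e k + (\<Sum>k\<in>G. c k *\<^sub>R e k)" using insert.hyps by auto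
   then have "c k *\<^sub>R e k \<in> ?S" using abs_le_D1[OF c(1)[of k]] abs_le_D2[OF c(1)[of k]]
    by (intro image_eqI[of _ _ "c k"]) (auto simp: minus_le_iff)
   with c show "z \<in> ?R" by blast
  qed
  show "?R \<subseteq> ?L"
  proof
   fix z assume "z \<in> ?R"
   then obtain t c where tc: "t \<in> {-M..M}" "\<And>k. \<bar>c k\<bar> <= M" "z = t *\<^sub>R e k + (\<Sum>k\<in>G. c k *\<^sub>R e k)" by blast
   have "(\<Sum>j\<in>G. (c(k := t)) j *\<^sub>R e j) = (\<Sum>k\<in>G. c k *\<^sub>R e k)" using insert.hyps by (intro sum.cong) auto
   then have "z = (\<Sum>j\<in>insert k G. (c(k := t)) j *\<^sub>R e j)" using insert.hyps tc(3) by simp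
   moreover have "\<forall>j. \<bar>(c(k := t)) j\<bar> <= M" using tc by auto
   ultimately show "z \<in> ?L" by blast
  qed
 qed
 moreover have "compact ?S" by (intro compact_continuous_image continuous_intros compact_Icc)
 ultimately show ?case using compact_sums[OF _ insert.IH] by simp
qed

text \<open>Half-open grid cells encoded by floors, so that each point lies in exactly one. The
  diameter is bounded by the sum of the sides, the volume from below by an inscribed ball of radius
  \<open>s / 4\<close>; the ratio of radii explains
  \<open>(4 * CARD('n)) ^ CARD('n)\<close>.\<close>

lemma floor_cube:
 fixes k :: "'n::finite => int"
 assumes s: "s > 0"
 defines "D \<equiv> {x::real^'n. \<forall>i. \<lfloor>x $ i / s\<rfloor> = k i}"
 shows "convex D" "D \<in> sets borel" "bounded D"
  "x \<in> D ==> y \<in> D ==> norm (y - x) <= real CARD('n) * s"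
  "measure lborel (cball (0::real^'n) (real CARD('n) * s)) <= (4 * real CARD('n)) ^ CARD('n) * measure lborel D"
  "measure lborel D > 0"
proof -
 have Deq: "D = (\<Inter>i. {x. s * k i <= x $ i} \<inter> {x. x $ i < s * (k i + 1)})"
  unfolding D_def using s by (auto simp: floor_eq_iff pos_le_divide_eq pos_divide_less_eq mult.commute)
 have "D = (\<Inter>i. (\<lambda>x. x $ i) -` {s * k i..<s * (k i + 1)})" unfolding Deq by auto
 then show "convex D"
  by (simp only:) (intro convex_INT convex_linear_vimage bounded_linear.linear[OF bounded_linear_vec_nth] convex_real_interval)
 show b: "D \<in> sets borel" unfolding D_def by measurable
 show d: "norm (y - x) <= real CARD('n) * s" if "x \<in> D" "y \<in> D" for x y
 proof -
  have "\<bar>(y - x) $ i\<bar> <= s" for i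
  proof -
   have "s * k i <= x $ i" "x $ i < s * (k i + 1)" "s * k i <= y $ i" "y $ i < s * (k i + 1)"
    using that unfolding Deq by blast+
   then show ?thesis by (auto simp: algebra_simps abs_le_iff)
  qed
  then have "(\<Sum>i\<in>UNIV. \<bar>(y - x) $ i\<bar>) <= real CARD('n) * s" using sum_bounded_above[of UNIV "\<lambda>i. \<bar>(y - x) $ i\<bar>" s] by simp
  then show ?thesis using norm_le_l1_cart[of "y - x"] by linarith
 qed
 define c where "c = (\<chi> i. s * (real_of_int (k i) + 1 / 2))"
 have sub: "cball c (s / 4) \<subseteq> D"
 proof
  fix x assume x: "x \<in> cball c (s / 4)"
  have "s * k i <= x $ i \<and> x $ i < s * (k i + 1)" for i
  proof -
   have "\<bar>(x - c) $ i\<bar> <= s / 4" using component_le_norm_cart[of "x - c" i] x by (simp add: dist_norm norm_minus_commute)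
   then have "\<bar>x $ i - (s * k i + s / 2)\<bar> <= s / 4" by (simp add: c_def distrib_left)
   then have "s * k i <= x $ i" "x $ i < s * k i + s" using s by linarith+
   then show ?thesis by (simp add: distrib_left)
  qed
  then show "x \<in> D" unfolding Deq by blast
 qed
 have cs: "s / 4 > 0" using s by simp
 have c0: "c \<in> D" using sub s by auto
 show bd: "bounded D"
  by (rule bounded_subset[OF bounded_cball[of c "real CARD('n) * s"]]) (use d c0 in \<open>auto simp: dist_norm norm_minus_commute\<close>)
 have le: "measure lborel (cball c (s / 4)) <= measure lborel D"
  by (rule measure_mono_fmeasurable[OF sub _ fmeasurableI]) (use b emeasure_bounded_finite[OF bd] in simp_all)
 moreover have eq: "(4 * real CARD('n)) ^ CARD('n) * measure lborel (cball c (s / 4)) = measure lborel (cball (0::real^'n) (real CARD('n) * s))"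
 proof -
  have "(4 * real CARD('n)) ^ CARD('n) * (s / 4) ^ CARD('n) = (real CARD('n) * s) ^ CARD('n)"
   unfolding power_mult_distrib[symmetric] by simp
  then show ?thesis
   unfolding measure_cball_eq[OF less_imp_le[OF cs], of c] using measure_cball_eq[of "real CARD('n) * s" "0::real^'n"] s
   by (simp only: mult.left_commute[of "(4 * real CARD('n)) ^ CARD('n)"]) simp
 qed
 ultimately show "measure lborel (cball (0::real^'n) (real CARD('n) * s)) <= (4 * real CARD('n)) ^ CARD('n) * measure lborel D"
  using mult_left_mono[OF le, of "(4 * real CARD('n)) ^ CARD('n)"] by simp
 have "measure lborel (cball c (s / 4)) > 0" using s measure_cball_eq[of "s / 4" c] measure_cball1_pos by simp
 then show "measure lborel D > 0" using le by linarith
qed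

text \<open>Rellich's theorem for bounded functions: replacing \<open>u\<close> by its averages on
  grid cells costs an \<open>L\<^sup>1\<close> error of the order of the mesh, which the uniform
  bound turns into an \<open>L\<^sup>2\<close> error. The averages range over a compact
  finite-dimensional set.\<close>

lemma sob0_totally_bounded:
 fixes \<O> :: "(real^'n) set"
 assumes \<O>: "open \<O>" "bounded \<O>" and e: "e > 0" and M: "M \<ge> 0" and R: "R \<ge> 0"
 shows "\<exists>F. finite F \<and> {fst p | p. p \<in> sob0 \<O> \<and> norm p <= R \<and> (AE x in lebesgue. \<bar>fn (fst p) x\<bar> <= M)} \<subseteq> (\<Union>x\<in>F. ball x e)"
proof -
 let ?N = "real CARD('n)"
 have l\<O>: "\<O> \<in> lmeasurable" by (rule lmeasurable_open[OF \<O>(2,1)])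
 \<comment> \<open>Factors in order: the conversion from \<open>L\<^sup>1\<close> to squared
   \<open>L\<^sup>2\<close>, the volume ratio of \<open>floor_cube\<close>, the diameter per mesh,
   and the total \<open>L\<^sup>1\<close> norm of the gradient.\<close>
 define c0 where "c0 = 2 * M * (4 * ?N) ^ CARD('n) * ?N * (?N * (sqrt (measure lebesgue \<O>) * R))"
 have c0: "c0 \<ge> 0" using M R by (simp add: c0_def)
 define s where "s = (e / 4)\<^sup>2 / (c0 + 1)"
 have s: "s > 0" "c0 * s <= (e / 4)\<^sup>2" using c0 e by (auto simp: s_def field_simps)
 define D where "D k = {x::real^'n. \<forall>i. \<lfloor>x $ i / s\<rfloor> = k i}" for k
 have D: "convex (D k)" "D k \<in> sets borel" "bounded (D k)"
  "\<And>x y. x \<in> D k ==> y \<in> D k ==> norm (y - x) <= ?N * s"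
  "measure lborel (cball (0::real^'n) (?N * s)) <= (4 * ?N) ^ CARD('n) * measure lborel (D k)"
  "measure lborel (D k) > 0" for k unfolding D_def using floor_cube[OF s(1), where k=k] by blast+
 have lD: "D k \<in> lmeasurable" for k by (rule bounded_borel_lmeasurable[OF D(3,2)])
 obtain r where r: "\<And>x. x \<in> \<O> ==> norm x <= r" using \<O>(2) by (auto simp: bounded_iff)
 define G where "G = (UNIV::'n set) \<rightarrow>\<^sub>E {\<lfloor>- r / s\<rfloor>..\<lfloor>r / s\<rfloor>}"
 have G: "finite G" unfolding G_def by (rule finite_PiE) auto
 have cover: "(\<lambda>i. \<lfloor>x $ i / s\<rfloor>) \<in> G" if "x \<in> \<O>" for x
 proof -
  have "\<lfloor>- r / s\<rfloor> <= \<lfloor>x $ i / s\<rfloor> \<and> \<lfloor>x $ i / s\<rfloor> <= \<lfloor>r / s\<rfloor>" for i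
  proof -
   have "\<bar>x $ i\<bar> <= r" using component_le_norm_cart[of x i] r[OF that] by linarith
   then show ?thesis using s(1) by (intro conjI floor_mono divide_right_mono) auto
  qed
  then show ?thesis by (auto simp: G_def PiE_UNIV_domain)
 qed
 \<comment> \<open>The cells are disjoint, so a sum over cells reduces at \<open>x\<close> to the
   single cell containing it.\<close>
 have Gsum: "(\<Sum>k\<in>G. f k * indicator (D k) x) = (if (\<lambda>i. \<lfloor>x $ i / s\<rfloor>) \<in> G then f (\<lambda>i. \<lfloor>x $ i / s\<rfloor>) else 0)" for f :: "_ => real" and x
 proof -
  have "f k * indicator (D k) x = (if k = (\<lambda>i. \<lfloor>x $ i / s\<rfloor>) then f k else 0)" for k
   by (auto simp: D_def indicator_def fun_eq_iff)
  then show ?thesis using G by (simp add: sum.delta)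
 qed
 let ?e = "\<lambda>k. cls (indicator (D k) :: real^'n => real)"
 define K where "K = {\<Sum>k\<in>G. c k *\<^sub>R ?e k | c. \<forall>k. \<bar>c k\<bar> <= M}"
 have "compact K" unfolding K_def by (rule compact_box_combinations[OF G])
 then obtain F where F: "finite F" "K \<subseteq> (\<Union>x\<in>F. ball x (e / 2))"
  using e unfolding compact_eq_totally_bounded by (meson half_gt_zero)
 have near: "\<exists>P\<in>K. norm (fst p - P) <= e / 4"
  if p: "p \<in> sob0 \<O>" "norm p <= R" "AE x in lebesgue. \<bar>fn (fst p) x\<bar> <= M" for p
 proof -
  let ?u = "fn (fst p)"
  define A where "A k = measure lborel (D k)" for k
  have A: "A k > 0" for k unfolding A_def by (rule D(6))
  define v where "v k = ?e k \<bullet> fst p" for k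
  have vM: "\<bar>v k / A k\<bar> <= M" for k
  proof -
   have i: "integrable lebesgue (\<lambda>x. indicator (D k) x * ?u x)" by (intro sqint_mult sqint_indicator lD) simp
   have "\<bar>v k\<bar> <= (LINT x|lebesgue. \<bar>indicator (D k) x * ?u x\<bar>)"
    unfolding v_def using inner_cls[OF sqint_indicator[OF lD[of k]], of ?u] by (simp add: integral_abs_bound)
   also have "\<dots> <= (LINT x|lebesgue. M * indicator (D k) x)"
   proof (rule integral_mono_AE)
    show "integrable lebesgue (\<lambda>x. M * indicator (D k) x)"
     using lD[of k] by (intro integrable_mult_right integrable_real_indicator) (auto simp: fmeasurable_def)
    show "AE x in lebesgue. \<bar>indicator (D k) x * ?u x\<bar> <= M * indicator (D k) x"
     using p(3) by eventually_elim (auto simp: indicator_def)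
   qed (use i in simp)
   also have "\<dots> = M * A k" unfolding A_def using D(2)[of k] by simp
   finally show ?thesis using A[of k] by (simp add: abs_divide divide_le_eq)
  qed
  define P where "P = (\<Sum>k\<in>G. (v k / A k) *\<^sub>R ?e k)"
  have PK: "P \<in> K" unfolding P_def K_def mem_Collect_eq
   by (rule exI[of _ "\<lambda>k. v k / A k"]) (simp only: vM simp_thms)
  have "AE x in lebesgue. fn P x = (\<Sum>k\<in>G. v k / A k * indicator (D k) x)"
  proof -
   have "P = cls (\<lambda>x. \<Sum>k\<in>G. v k / A k * indicator (D k) x)"
    unfolding P_def cls_scaleR[OF sqint_indicator[OF lD]] by (intro cls_sum sqint_scale sqint_indicator lD)
   then show ?thesis by (simp only:) (intro fn_cls sqint_sum sqint_scale sqint_indicator lD)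
  qed
  moreover define w where "w k = A k *\<^sub>R fst p - v k *\<^sub>R ?e k" for k
  have "AE x in lebesgue. fn (w k) x = A k * ?u x - v k * indicator (D k) x" for k
  proof -
   have "w k = cls (\<lambda>x. A k * ?u x - v k * indicator (D k) x)"
    using cls_scaleR[of ?u "A k"] by (simp add: w_def cls_scaleR sqint_indicator lD cls_diff sqint_scale)
   then show ?thesis by (simp only:) (intro fn_cls sqint_diff sqint_scale sqint_indicator lD sqint_fn)
  qed
  then have "AE x in lebesgue. \<forall>k\<in>G. fn (w k) x = A k * ?u x - v k * indicator (D k) x"
   by (intro AE_finite_allI G)
  ultimately have "AE x in lebesgue. (fn (fst p - P) x)\<^sup>2 <= (\<Sum>k\<in>G. 2 * M / A k * (indicator (D k) x * \<bar>fn (w k) x\<bar>))"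
   using p(3) sob0_zero_outside(1)[OF p(1) \<O>(1)] fn_diff[of "fst p" P]
  proof eventually_elim
   case (elim x)
   let ?k = "\<lambda>i. \<lfloor>x $ i / s\<rfloor>"
   have P0: "fn P x = (if ?k \<in> G then v ?k / A ?k else 0)" using elim(1) unfolding Gsum .
   have eq: "(\<Sum>k\<in>G. 2 * M / A k * (indicator (D k) x * \<bar>fn (w k) x\<bar>))
     = (if ?k \<in> G then 2 * M / A ?k * \<bar>fn (w ?k) x\<bar> else 0)"
    using Gsum[of "\<lambda>k. 2 * M / A k * \<bar>fn (w k) x\<bar>" x] by (simp add: mult_ac)
   show ?case
   proof (cases "?k \<in> G")
    case True
    let ?d = "?u x - v ?k / A ?k"
    have "fn (w ?k) x = A ?k * ?u x - v ?k" using elim(2) True by (simp add: D_def)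
    then have "\<bar>fn (w ?k) x\<bar> = A ?k * \<bar>?d\<bar>" using A[of ?k] by (simp add: field_simps abs_mult abs_divide)
    then have "2 * M / A ?k * \<bar>fn (w ?k) x\<bar> = 2 * M * \<bar>?d\<bar>" using A[of ?k] by simp
    moreover have "fn (fst p - P) x = ?d" using P0 elim(5) True by simp
    \<comment> \<open>Both the function and its cell average are bounded by \<open>M\<close>;
      bounding one factor of the square by \<open>2 * M\<close> leaves an \<open>L\<^sup>1\<close>
      error, to which the mean value inequality applies.\<close>
    moreover have "\<bar>?d\<bar> <= 2 * M" using elim(3) vM[of ?k] by linarith
    then have "\<bar>?d\<bar> * \<bar>?d\<bar> <= 2 * M * \<bar>?d\<bar>" by (intro mult_right_mono) auto
    ultimately show ?thesis unfolding eq using True by (simp add: power2_eq_square)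
   next
    case False
    then have "x \<notin> \<O>" using cover by blast
    then show ?thesis unfolding eq using P0 elim(4,5) False by simp
   qed
  qed
  then have "(norm (fst p - P))\<^sup>2 <= (LINT x|lebesgue. (\<Sum>k\<in>G. 2 * M / A k * (indicator (D k) x * \<bar>fn (w k) x\<bar>)))"
   unfolding norm_sq_fn
   by (intro integral_mono_AE Bochner_Integration.integrable_sum integrable_mult_right L1_on_integrable lD sqint_integrable_sq) auto
  also have "\<dots> = (\<Sum>k\<in>G. 2 * M / A k * L1_on (D k) (w k))"
   unfolding L1_on_def by (subst Bochner_Integration.integral_sum) (auto intro!: integrable_mult_right L1_on_integrable lD simp del: times_divide_eq_left)
  also have "\<dots> <= (\<Sum>k\<in>G. 2 * M * (4 * ?N) ^ CARD('n) * (?N * s) * (\<Sum>i\<in>UNIV. L1_on (D k) (snd p $ i)))"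
  proof (rule sum_mono)
   fix k
   let ?S = "\<Sum>i\<in>UNIV. L1_on (D k) (snd p $ i)"
   have S: "?S \<ge> 0" by (intro sum_nonneg L1_on_nonneg)
   have "L1_on (D k) (w k) <= ?N * s * measure lborel (cball (0::real^'n) (?N * s)) * ?S"
    unfolding w_def A_def v_def using D(4) s(1) by (intro sob0_mean_le[OF p(1) D(1-3)]) auto
   also have "\<dots> <= ?N * s * ((4 * ?N) ^ CARD('n) * A k) * ?S"
    unfolding A_def using s(1) S by (intro mult_left_mono mult_right_mono D(5)) auto
   finally have "2 * M / A k * L1_on (D k) (w k) <= 2 * M / A k * (?N * s * ((4 * ?N) ^ CARD('n) * A k) * ?S)"
    using M A[of k] by (intro mult_left_mono) auto
   also have "\<dots> = 2 * M * (4 * ?N) ^ CARD('n) * (?N * s) * ?S" using A[of k] by simp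
   finally show "2 * M / A k * L1_on (D k) (w k) <= 2 * M * (4 * ?N) ^ CARD('n) * (?N * s) * ?S" .
  qed
  also have "\<dots> = 2 * M * (4 * ?N) ^ CARD('n) * (?N * s) * (\<Sum>i\<in>UNIV. \<Sum>k\<in>G. L1_on (D k) (snd p $ i))"
   unfolding sum_distrib_left[symmetric] by (subst sum.swap) (rule refl)
  also have "\<dots> <= 2 * M * (4 * ?N) ^ CARD('n) * (?N * s) * (\<Sum>i\<in>(UNIV::'n set). sqrt (measure lebesgue \<O>) * R)"
  proof (intro mult_left_mono sum_mono)
   fix i
   have "(\<Sum>k\<in>G. L1_on (D k) (snd p $ i)) = (LINT x|lebesgue. (\<Sum>k\<in>G. indicator (D k) x * \<bar>fn (snd p $ i) x\<bar>))"
    unfolding L1_on_def by (subst Bochner_Integration.integral_sum) (auto intro!: L1_on_integrable lD)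
   also have "\<dots> <= L1_on \<O> (snd p $ i)" unfolding L1_on_def
   proof (intro integral_mono_AE Bochner_Integration.integrable_sum L1_on_integrable lD l\<O>)
    show "AE x in lebesgue. (\<Sum>k\<in>G. indicator (D k) x * \<bar>fn (snd p $ i) x\<bar>) <= indicator \<O> x * \<bar>fn (snd p $ i) x\<bar>"
     using sob0_zero_outside(2)[OF p(1) \<O>(1), of i]
    proof eventually_elim
     case (elim x)
     have "(\<Sum>k\<in>G. indicator (D k) x * \<bar>fn (snd p $ i) x\<bar>) = (\<Sum>k\<in>G. 1 * indicator (D k) x) * \<bar>fn (snd p $ i) x\<bar>"
      by (simp add: sum_distrib_right)
     then show ?case unfolding Gsum using elim by (cases "x \<in> \<O>") auto
    qed
   qed
   also have "\<dots> <= sqrt (measure lebesgue \<O>) * norm (snd p $ i)" by (rule L1_on_le[OF l\<O>])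
   also have "\<dots> <= sqrt (measure lebesgue \<O>) * R"
    using Finite_Cartesian_Product.norm_nth_le[of "snd p" i] norm_snd_le_norm[of p] p(2) by (intro mult_left_mono) auto
   finally show "(\<Sum>k\<in>G. L1_on (D k) (snd p $ i)) <= sqrt (measure lebesgue \<O>) * R" .
  qed (use M s(1) in auto)
  also have "\<dots> = c0 * s" by (simp add: c0_def)
  also have "\<dots> <= (e / 4)\<^sup>2" by (rule s(2))
  finally have "norm (fst p - P) <= e / 4" by (rule power2_le_imp_le) (use e in simp)
  with PK show ?thesis by blast
 qed
 show ?thesis
 proof (rule exI[of _ F], intro conjI F(1) subsetI)
  fix u assume "u \<in> {fst p | p. p \<in> sob0 \<O> \<and> norm p <= R \<and> (AE x in lebesgue. \<bar>fn (fst p) x\<bar> <= M)}"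
  then obtain P where P: "P \<in> K" "norm (u - P) <= e / 4" using near by blast
  then obtain x where "x \<in> F" "dist x P < e / 2" using F(2) by auto
  moreover from this have "dist x u < e" using P(2) e dist_triangle[of x u P] by (simp add: dist_norm norm_minus_commute)
  ultimately show "u \<in> (\<Union>x\<in>F. ball x e)" by auto
 qed
qed

subsection \<open>The semilinear state equation\<close>

definition clip :: "real => real => real" where
 "clip M t = max (- M) (min M t)"

lemma clip: "M \<ge> 0 ==> \<bar>clip M t\<bar> <= M" "\<bar>clip M s - clip M t\<bar> <= \<bar>s - t\<bar>"
 "\<bar>t\<bar> <= M ==> clip M t = t" "s <= t ==> clip M s <= clip M t" by (auto simp: clip_def max_def min_def)

lemma clip_meas [measurable]: "clip M \<in> borel_measurable borel"
 unfolding clip_def by measurable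

lemma DERIV_lipschitz_bound:
 fixes g :: "real => real"
 assumes g: "\<And>t. (g has_real_derivative g' t) (at t)" and c: "\<And>t. t \<in> closed_segment a b ==> \<bar>g' t\<bar> <= C"
 shows "\<bar>g b - g a\<bar> <= C * \<bar>b - a\<bar>"
 using field_differentiable_bound[of "closed_segment a b" g g' C b a] c has_field_derivative_at_within[OF g]
 by auto

text \<open>The mean value inequality for \<open>g t - g' a * t\<close>, whose derivative on the
  segment is at most \<open>C * \<bar>b - a\<bar>\<close>. A locally Lipschitz first derivative is
  all that this uses.\<close>

lemma DERIV_taylor_bound:
 fixes g :: "real => real"
 assumes g: "\<And>t. (g has_real_derivative g' t) (at t)" and ab: "\<bar>a\<bar> <= M" "\<bar>b\<bar> <= M" and C: "C \<ge> 0"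
  and c: "\<And>s t. \<bar>s\<bar> <= M ==> \<bar>t\<bar> <= M ==> \<bar>g' s - g' t\<bar> <= C * \<bar>s - t\<bar>"
 shows "\<bar>g b - g a - g' a * (b - a)\<bar> <= C * (b - a)\<^sup>2"
proof -
 have "\<bar>(g b - g' a * b) - (g a - g' a * a)\<bar> <= C * \<bar>b - a\<bar> * \<bar>b - a\<bar>"
 proof (rule DERIV_lipschitz_bound)
  show "((\<lambda>t. g t - g' a * t) has_real_derivative g' t - g' a) (at t)" for t
   by (auto intro!: derivative_eq_intros g)
  fix t assume t: "t \<in> closed_segment a b"
  then have "\<bar>t\<bar> <= M" "\<bar>t - a\<bar> <= \<bar>b - a\<bar>" using ab by (auto simp: closed_segment_eq_real_ivl split: if_splits)
  then show "\<bar>g' t - g' a\<bar> <= C * \<bar>b - a\<bar>" using c[OF _ ab(1), of t] C by (meson mult_left_mono order_trans)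
 qed
 then show ?thesis by (simp add: power2_eq_square abs_mult_self_eq algebra_simps)
qed

text \<open>What the state nonlinearity and the cost integrands have in common, required at every
  point. The bound on the derivative is only square integrable in \<open>x\<close>, as the cost
  integrands demand.\<close>

definition nonlin :: "(real^'n => real => real) => (real^'n => real => real) => bool" where
 "nonlin g g' \<longleftrightarrow> (\<forall>t. (\<lambda>x. g x t) \<in> borel_measurable lebesgue) \<and>
  (\<forall>x t. (g x has_real_derivative g' x t) (at t)) \<and>
  (\<forall>M. \<exists>\<psi>. sqint \<psi> \<and> (\<forall>x t. \<bar>t\<bar> <= M --> \<bar>g' x t\<bar> <= \<psi> x)) \<and>
  (\<forall>M. \<exists>C. \<forall>x s t. \<bar>s\<bar> <= M --> \<bar>t\<bar> <= M --> \<bar>g' x s - g' x t\<bar> <= C * \<bar>s - t\<bar>)"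

lemma nonlinD:
 assumes "nonlin g g'"
 shows "(\<lambda>x. g x t) \<in> borel_measurable lebesgue" "(g x has_real_derivative g' x t) (at t)"
  "\<exists>\<psi>. sqint \<psi> \<and> (\<forall>x t. \<bar>t\<bar> <= M --> \<bar>g' x t\<bar> <= \<psi> x)"
  "\<exists>C. C \<ge> 0 \<and> (\<forall>x s t. \<bar>s\<bar> <= M --> \<bar>t\<bar> <= M --> \<bar>g' x s - g' x t\<bar> <= C * \<bar>s - t\<bar>)"
proof -
 obtain C where C: "\<forall>x s t. \<bar>s\<bar> <= M --> \<bar>t\<bar> <= M --> \<bar>g' x s - g' x t\<bar> <= C * \<bar>s - t\<bar>"
  using assms unfolding nonlin_def by blast
 have "\<bar>g' x s - g' x t\<bar> <= max 0 C * \<bar>s - t\<bar>" if "\<bar>s\<bar> <= M" "\<bar>t\<bar> <= M" for x s t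
  using C[rule_format, OF that, of x] mult_right_mono[of C "max 0 C" "\<bar>s - t\<bar>"] by simp
 then show "\<exists>C. C \<ge> 0 \<and> (\<forall>x s t. \<bar>s\<bar> <= M --> \<bar>t\<bar> <= M --> \<bar>g' x s - g' x t\<bar> <= C * \<bar>s - t\<bar>)"
  by (intro exI[of _ "max 0 C"]) simp
qed (use assms in \<open>auto simp: nonlin_def\<close>)

lemma nonlin_cont: "nonlin g g' ==> continuous_on UNIV (g x)"
 by (intro continuous_at_imp_continuous_on ballI DERIV_isCont[OF nonlinD(2)])

lemma nonlin_deriv_meas: "nonlin g g' ==> (\<lambda>x. g' x t) \<in> borel_measurable lebesgue"
proof (rule borel_measurable_LIMSEQ_real)
 assume g: "nonlin g g'"
 show "(\<lambda>x. (g x (t + 1 / real (Suc n)) - g x t) / (1 / real (Suc n))) \<in> borel_measurable lebesgue" for n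
  by (intro borel_measurable_divide borel_measurable_diff nonlinD(1)[OF g] borel_measurable_const)
 fix x
 have "((\<lambda>h. (g x (t + h) - g x t) / h) \<longlongrightarrow> g' x t) (at 0)" using nonlinD(2)[OF g] by (simp add: DERIV_def)
 moreover have "filterlim (\<lambda>n. 1 / real (Suc n)) (at 0) sequentially"
  by (rule filterlim_atI[OF LIMSEQ_Suc[OF lim_1_over_n]]) simp
 ultimately show "(\<lambda>n. (g x (t + 1 / real (Suc n)) - g x t) / (1 / real (Suc n))) \<longlonglongrightarrow> g' x t"
  by (rule filterlim_compose)
qed

lemma nonlin_deriv_cont: assumes g: "nonlin g g'" shows "continuous_on UNIV (g' x)"
proof (rule continuous_at_imp_continuous_on, intro ballI)
 fix t
 obtain C where C: "C \<ge> 0" "\<And>s r. \<bar>s\<bar> <= \<bar>t\<bar> + 1 ==> \<bar>r\<bar> <= \<bar>t\<bar> + 1 ==> \<bar>g' x s - g' x r\<bar> <= C * \<bar>s - r\<bar>"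
  using nonlinD(4)[OF g, of "\<bar>t\<bar> + 1"] by blast
 have "C-lipschitz_on (ball t 1) (g' x)" using C by (intro lipschitz_onI) (auto simp: dist_real_def)
 from lipschitz_on_continuous_on[OF this] show "continuous (at t) (g' x)"
  by (simp add: continuous_on_eq_continuous_at)
qed

lemma nonlin_deriv_sqint:
 assumes g: "nonlin g g'" and M: "M \<ge> 0" and u: "u \<in> borel_measurable lebesgue"
 shows "sqint (\<lambda>x. g' x (clip M (u x)))"
proof -
 obtain \<psi> where \<psi>: "sqint \<psi>" "\<And>x t. \<bar>t\<bar> <= M ==> \<bar>g' x t\<bar> <= \<psi> x" using nonlinD(3)[OF g] by blast
 show ?thesis
 proof (rule sqint_mono_AE[OF caratheodory_measurable[OF nonlin_deriv_meas[OF g] nonlin_deriv_cont[OF g]] \<psi>(1) AE_I2])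
  show "(\<lambda>x. clip M (u x)) \<in> borel_measurable lebesgue" using u by measurable
  show "\<bar>g' x (clip M (u x))\<bar> <= \<bar>\<psi> x\<bar>" for x using \<psi>(2)[OF clip(1)[OF M], of x "u x"] by linarith
 qed
qed

lemma nonlin_taylor:
 assumes g: "nonlin g g'"
 shows "\<exists>C\<ge>0. \<forall>x s t. \<bar>s\<bar> <= M --> \<bar>t\<bar> <= M --> \<bar>g x t - g x s - g' x s * (t - s)\<bar> <= C * (t - s)\<^sup>2"
proof -
 obtain C where C: "C \<ge> 0" "\<And>x s t. \<bar>s\<bar> <= M ==> \<bar>t\<bar> <= M ==> \<bar>g' x s - g' x t\<bar> <= C * \<bar>s - t\<bar>"
  using nonlinD(4)[OF g] by blast
 have "\<bar>g x t - g x s - g' x s * (t - s)\<bar> <= C * (t - s)\<^sup>2" if "\<bar>s\<bar> <= M" "\<bar>t\<bar> <= M" for x s t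
  by (rule DERIV_taylor_bound[OF nonlinD(2)[OF g] that C])
 then show ?thesis using C(1) by blast
qed

lemma nonlin_integrable:
 assumes g: "nonlin g g'" and M: "M \<ge> 0" and u: "sqint u" and 0: "integrable lebesgue (\<lambda>x. g x 0)"
 shows "integrable lebesgue (\<lambda>x. g x (clip M (u x)))"
proof -
 obtain \<psi> where \<psi>: "sqint \<psi>" "\<And>x t. \<bar>t\<bar> <= M ==> \<bar>g' x t\<bar> <= \<psi> x" using nonlinD(3)[OF g] by blast
 have um: "(\<lambda>x. clip M (u x)) \<in> borel_measurable lebesgue" using sqint_meas[OF u] by measurable
 show ?thesis
 proof (rule Bochner_Integration.integrable_bound)
  show "integrable lebesgue (\<lambda>x. \<bar>g x 0\<bar> + \<psi> x * \<bar>u x\<bar>)"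
   by (intro Bochner_Integration.integrable_add integrable_abs 0 sqint_mult \<psi>(1) sqint_abs u)
  show "(\<lambda>x. g x (clip M (u x))) \<in> borel_measurable lebesgue"
   by (rule caratheodory_measurable[OF nonlinD(1)[OF g] nonlin_cont[OF g] um])
  show "AE x in lebesgue. norm (g x (clip M (u x))) <= norm (\<bar>g x 0\<bar> + \<psi> x * \<bar>u x\<bar>)"
  proof (rule AE_I2)
   fix x
   let ?c = "clip M (u x)"
   have c: "\<bar>?c\<bar> <= M" by (rule clip(1)[OF M])
   have "\<bar>g x ?c - g x 0\<bar> <= \<psi> x * \<bar>?c - 0\<bar>" by (rule DERIV_lipschitz_bound[OF nonlinD(2)[OF g] \<psi>(2)])
     (use c in \<open>auto simp: closed_segment_eq_real_ivl split: if_splits\<close>)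
   also have "\<dots> <= \<psi> x * \<bar>u x\<bar>"
   proof (rule mult_left_mono)
    show "\<bar>?c - 0\<bar> <= \<bar>u x\<bar>" using clip(2)[of M "u x" 0] clip(3)[of 0 M] M by simp
    show "0 <= \<psi> x" using \<psi>(2)[of 0 x] M by fastforce
   qed
   finally show "norm (g x ?c) <= norm (\<bar>g x 0\<bar> + \<psi> x * \<bar>u x\<bar>)" by simp
  qed
 qed
qed

text \<open>In contrast to a general \<open>nonlin\<close> function, the derivative of
  \<open>f\<close> is bounded uniformly in \<open>x\<close> on bounded ranges; this makes the
  clipped \<open>f\<close> Lipschitz on \<open>L\<^sup>2\<close>.\<close>

locale semilinear = elliptic_domain a lam Lam \<O>
 for a :: "'n::finite => 'n => real^'n => real" and lam Lam \<O> +
 fixes f f' :: "real^'n => real => real"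
 assumes f: "nonlin f f'" and f0: "sqint (\<lambda>x. f x 0)" and f'_nonneg: "\<And>x t. 0 <= f' x t"
  and f'_bound: "\<And>M. \<exists>C. \<forall>x t. \<bar>t\<bar> <= M --> f' x t <= C"
begin

lemma f_clip: assumes M: "M \<ge> 0" shows "\<exists>K. lip_mono (\<lambda>x t. f x (clip M t)) K"
proof -
 obtain C where C: "\<And>x t. \<bar>t\<bar> <= M ==> f' x t <= C" using f'_bound by blast
 have C0: "C \<ge> 0" using C[of 0 undefined] f'_nonneg[of undefined 0] M by simp
 have "lip_mono (\<lambda>x t. f x (clip M t)) C" unfolding lip_mono_def
 proof (intro conjI allI impI)
  show "(\<lambda>x. f x (clip M t)) \<in> borel_measurable lebesgue" for t by (rule nonlinD(1)[OF f])
  show "sqint (\<lambda>x. f x (clip M 0))" using f0 unfolding clip(3)[of 0 M, simplified, OF M] .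
  show "f x (clip M s) <= f x (clip M t)" if "s <= t" for x s t
   by (rule DERIV_nonneg_imp_nondecreasing[OF clip(4)[OF that]]) (use nonlinD(2)[OF f] f'_nonneg in blast)
  fix x s t
  have "\<bar>f x (clip M s) - f x (clip M t)\<bar> <= C * \<bar>clip M s - clip M t\<bar>"
  proof (rule DERIV_lipschitz_bound[OF nonlinD(2)[OF f]])
   fix r assume "r \<in> closed_segment (clip M t) (clip M s)"
   then have "\<bar>r\<bar> <= M" using clip(1)[OF M, of s] clip(1)[OF M, of t]
    by (auto simp: closed_segment_eq_real_ivl split: if_splits)
   then show "\<bar>f' x r\<bar> <= C" using C f'_nonneg[of x r] by simp
  qed
  also have "\<dots> <= C * \<bar>s - t\<bar>" by (intro mult_left_mono clip(2) C0)
  finally show "\<bar>f x (clip M s) - f x (clip M t)\<bar> <= C * \<bar>s - t\<bar>" .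
 qed
 then show ?thesis by blast
qed

lemma sqint_f_clip: "M \<ge> 0 ==> sqint u ==> sqint (\<lambda>x. f x (clip M (u x)))"
 using f_clip[of M] sqint_nem by blast

lemma sqint_f_bounded: "sqint u ==> AE x in lebesgue. \<bar>u x\<bar> <= M ==> sqint (\<lambda>x. f x (u x))"
proof -
 assume u: "sqint u" "AE x in lebesgue. \<bar>u x\<bar> <= M"
 have "AE x in lebesgue. f x (clip (max 0 M) (u x)) = f x (u x)"
  using u(2) by eventually_elim (simp add: clip(3))
 then show ?thesis by (rule sqint_AE_cong[OF sqint_f_clip[OF _ u(1)], rotated]) simp
qed

text \<open>Essential boundedness is part of the notion: it ensures that the unclipped
  \<open>f\<close> at the solution is square integrable, so that the class formed with
  \<open>cls\<close> is meaningful.\<close>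

definition weaksol :: "(real^'n) L2 => 'n sob => bool" where
 "weaksol W p \<longleftrightarrow> p \<in> sob0 \<O> \<and> (\<exists>M. AE x in lebesgue. \<bar>fn (fst p) x\<bar> <= M) \<and>
  (\<forall>q\<in>sob0 \<O>. form (snd p) (snd q) + cls (\<lambda>x. f x (fn (fst p) x)) \<bullet> fst q = W \<bullet> fst q)"

definition fM :: "real => (real^'n) L2 => real^'n => real => real" where
 "fM M W x t = f x (clip M t) - fn W x"

text \<open>A bound for the state that does not involve the clipping level, because clipping at a
  nonnegative level leaves the value at 0 unchanged.\<close>

definition ybound :: "(real^'n) L2 => real" where
 "ybound W = supc * norm (cls (\<lambda>x. f x 0) - W)"

lemma ybound_nonneg: "ybound W \<ge> 0"
 using supc(1) by (simp add: ybound_def)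

lemma fM_lip_mono: "M \<ge> 0 ==> \<exists>K. lip_mono (fM M W) K"
proof -
 assume M: "M \<ge> 0"
 obtain K where K: "lip_mono (\<lambda>x t. f x (clip M t)) K" using f_clip[OF M] by blast
 have "lip_mono (fM M W) K"
  unfolding lip_mono_def fM_def using lip_monoD[OF K] by (auto intro!: borel_measurable_diff sqint_diff)
 then show ?thesis by blast
qed

lemma nem_fM: "M \<ge> 0 ==> nem (fM M W) u = cls (\<lambda>x. f x (clip M (fn u x))) - W"
 unfolding nem_def fM_def using cls_diff[OF sqint_f_clip[OF _ sqint_fn, of M u] sqint_fn[of W]] by simp

lemma cls_f_clip:
 assumes "M \<ge> 0" "AE x in lebesgue. \<bar>fn u x\<bar> <= M"
 shows "cls (\<lambda>x. f x (clip M (fn u x))) = cls (\<lambda>x. f x (fn u x))"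
 by (rule cls_eqI[OF sqint_f_clip[OF assms(1) sqint_fn]]) (use assms(2) in eventually_elim, simp add: clip(3))

lemma solves_fM_iff: "M \<ge> 0 ==> AE x in lebesgue. \<bar>fn (fst p) x\<bar> <= M ==> solves (fM M W) p \<longleftrightarrow> weaksol W p"
 unfolding solves_def weaksol_def by (auto simp: nem_fM cls_f_clip inner_diff_left algebra_simps)

lemma solves_fM_bound: 
 assumes "M \<ge> 0" "solves (fM M W) p" shows "AE x in lebesgue. \<bar>fn (fst p) x\<bar> <= ybound W"
proof -
 obtain K where K: "lip_mono (fM M W) K" using fM_lip_mono[OF assms(1)] by blast
 have "cls (\<lambda>x. fM M W x 0) = cls (\<lambda>x. f x 0) - W"
  unfolding fM_def using clip(3)[of 0 M] assms(1) cls_diff[OF f0 sqint_fn[of W]] by simp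
 then show ?thesis using solves_sup_bound[OF assms(2) K] by (simp add: ybound_def)
qed

text \<open>Clip at the level of the a priori bound; the solution obtained respects that bound, so
  the clipping is inactive and can be removed.\<close>

lemma weaksol_exists: "\<exists>p. weaksol W p"
proof -
 obtain K where K: "lip_mono (fM (ybound W) W) K" using fM_lip_mono[OF ybound_nonneg] by blast
 obtain p where "solves (fM (ybound W) W) p" using solves_exists[OF K] by blast
 then show ?thesis using solves_fM_iff[OF ybound_nonneg solves_fM_bound[OF ybound_nonneg]] by blast
qed

lemma weaksol_bound: assumes w: "weaksol W p" shows "AE x in lebesgue. \<bar>fn (fst p) x\<bar> <= ybound W"
proof -
 obtain M where "AE x in lebesgue. \<bar>fn (fst p) x\<bar> <= M" using w by (auto simp: weaksol_def)
 then have M: "AE x in lebesgue. \<bar>fn (fst p) x\<bar> <= max 0 M" by eventually_elim linarith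
 show ?thesis by (rule solves_fM_bound[of "max 0 M"]) (use solves_fM_iff[OF _ M] w in auto)
qed

lemma weaksol_solves: "weaksol W p ==> M \<ge> ybound W ==> solves (fM M W) p"
proof -
 assume w: "weaksol W p" and M: "M \<ge> ybound W"
 have "AE x in lebesgue. \<bar>fn (fst p) x\<bar> <= M" using weaksol_bound[OF w] by eventually_elim (use M in linarith)
 then show ?thesis using solves_fM_iff[of M p W] w M ybound_nonneg[of W] by linarith
qed

text \<open>At a common clipping level the two equations differ only in their sources, so the
  stability constant does not depend on the level.\<close>

lemma weaksol_stable: assumes w: "weaksol W p" "weaksol V q" shows "norm (p - q) <= norm (W - V) / coer"
proof -
 define M where "M = max (ybound W) (ybound V)"
 have M: "M \<ge> 0" using ybound_nonneg[of W] by (simp add: M_def)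
 obtain K where K: "lip_mono (fM M W) K" using fM_lip_mono[OF M] by blast
 have "nem (fM M W) (fst q) - nem (fM M V) (fst q) = - (W - V)" by (simp add: nem_fM[OF M])
 then show ?thesis
  using solves_stable[OF weaksol_solves[OF w(1)] weaksol_solves[OF w(2), of M] K] by (simp add: M_def norm_minus_commute)
qed

lemma weaksol_unique: "weaksol W p ==> weaksol W q ==> p = q"
 using weaksol_stable[of W p W q] by simp

definition S :: "(real^'n) L2 => 'n sob" where
 "S W = (SOME p. weaksol W p)"

lemma S: "weaksol W (S W)"
 unfolding S_def by (rule someI_ex[OF weaksol_exists])

lemma S_eq: "weaksol W p ==> S W = p"
 by (rule weaksol_unique[OF S])

text \<open>Boundedness puts \<open>f\<close> at the solution into \<open>L\<^sup>2\<close>; moved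
  to the right-hand side, it leaves a linear equation to which the oscillation estimates
  apply.\<close>

lemma weaksol_continuous:
 assumes w: "weaksol W p" and b: "\<And>z. z \<in> frontier \<O> ==> ext_dens z"
 shows "\<exists>y. continuous_on (closure \<O>) y \<and> (AE x\<in>\<O> in lebesgue. y x = fn (fst p) x)"
proof (rule continuous_representative)
 fix z assume "z \<in> closure \<O>"
 then have "z \<in> \<O> \<or> ext_dens z" using b open_\<O> by (auto simp: frontier_def interior_open)
 moreover have "lin p (W - cls (\<lambda>x. f x (fn (fst p) x)))"
  using w by (auto simp: lin_def weaksol_def inner_diff_left algebra_simps)
 ultimately show "osc_small (fst p) z" by (rule lin_osc_small[rotated])
qed

section \<open>Return from the modified data to the data of the problem\<close>

context
 fixes a0 :: "'n => 'n => real^'n => real" and f0 :: "real^'n => real => real"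
 assumes a0: "\<And>i j. AE x\<in>\<O> in lebesgue. a0 i j x = a i j x"
  and f_eq: "AE x\<in>\<O> in lebesgue. (\<forall>t. f0 x t = f x t)"
begin

lemma weak_form_eq:
 assumes y: "y \<in> H10_fun \<O>" and v: "v \<in> H10_fun \<O>" and w: "w \<in> L2_fun \<O>"
  and M: "AE x in lebesgue. \<bar>fn (l2 \<O> y) x\<bar> <= M"
 defines "p \<equiv> wsob \<O> y (weak_gradient \<O> y)" and "q \<equiv> wsob \<O> v (weak_gradient \<O> v)"
 shows "(LINT x|lebesgue_on \<O>. (\<Sum>i\<in>UNIV. \<Sum>j\<in>UNIV. a0 i j x * weak_gradient \<O> y x $ i * weak_gradient \<O> v x $ j)) = form (snd p) (snd q)"
  "(LINT x|lebesgue_on \<O>. f0 x (y x) * v x) = cls (\<lambda>x. f x (fn (fst p) x)) \<bullet> fst q"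
  "(LINT x|lebesgue_on \<O>. w x * v x) = l2 \<O> w \<bullet> fst q"
proof -
 note fl = fn_l2[OF open_\<O>]
 note yD = H10_funD[OF open_\<O> y] and vD = H10_funD[OF open_\<O> v]
 have pq: "fst p = l2 \<O> y" "fst q = l2 \<O> v" "\<And>i. snd p $ i = l2 \<O> (\<lambda>x. weak_gradient \<O> y x $ i)"
  "\<And>i. snd q $ i = l2 \<O> (\<lambda>x. weak_gradient \<O> v x $ i)" by (simp_all add: p_def q_def wsob_def)
 have cong: "(LINT x|lebesgue. g x) = (LINT x|lebesgue. h x)"
  if g: "integrable lebesgue g" and gh: "AE x in lebesgue. g x = h x" for g h :: "real^'n => real"
  by (rule integral_cong_AE[OF _ borel_measurable_AE gh]) (use g gh in auto)
 have ii: "integrable lebesgue (\<lambda>x. a i j x * fn (snd p $ i) x * fn (snd q $ j) x)" for i j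
  by (intro sqint_mult sqint_bmeas_mult bmeas_a sqint_fn)
 have "form (snd p) (snd q) = (LINT x|lebesgue. (\<Sum>i\<in>UNIV. \<Sum>j\<in>UNIV. a i j x * fn (snd p $ i) x * fn (snd q $ j) x))"
  by (simp add: form_eq inner_mul[OF bmeas_a] Bochner_Integration.integral_sum ii)
 also have "\<dots> = (LINT x|lebesgue. ext \<O> (\<lambda>x. \<Sum>i\<in>UNIV. \<Sum>j\<in>UNIV. a0 i j x * weak_gradient \<O> y x $ i * weak_gradient \<O> v x $ j) x)"
 proof (rule cong)
  have "AE x in lebesgue. \<forall>i j. x \<in> \<O> --> a0 i j x = a i j x" unfolding AE_all_countable by (intro allI a0)
  moreover have "AE x in lebesgue. \<forall>i. fn (snd p $ i) x = ext \<O> (\<lambda>x. weak_gradient \<O> y x $ i) x"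
   "AE x in lebesgue. \<forall>i. fn (snd q $ i) x = ext \<O> (\<lambda>x. weak_gradient \<O> v x $ i) x"
   unfolding pq AE_all_countable by (intro allI fl yD(3) vD(3))+
  ultimately show "AE x in lebesgue. (\<Sum>i\<in>UNIV. \<Sum>j\<in>UNIV. a i j x * fn (snd p $ i) x * fn (snd q $ j) x)
   = ext \<O> (\<lambda>x. \<Sum>i\<in>UNIV. \<Sum>j\<in>UNIV. a0 i j x * weak_gradient \<O> y x $ i * weak_gradient \<O> v x $ j) x"
   by eventually_elim (simp add: ext_def)
 qed (intro Bochner_Integration.integrable_sum ii)
 finally show "(LINT x|lebesgue_on \<O>. (\<Sum>i\<in>UNIV. \<Sum>j\<in>UNIV. a0 i j x * weak_gradient \<O> y x $ i * weak_gradient \<O> v x $ j)) = form (snd p) (snd q)"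
  by (simp add: integral_lebesgue_on[OF open_\<O>])
 have sf: "sqint (\<lambda>x. f x (fn (fst p) x))" unfolding pq by (rule sqint_f_bounded[OF sqint_fn M])
 have "cls (\<lambda>x. f x (fn (fst p) x)) \<bullet> fst q = (LINT x|lebesgue. f x (fn (fst p) x) * fn (fst q) x)"
  using inner_cls[OF sf sqint_fn[of "fst q"]] by simp
 also have "\<dots> = (LINT x|lebesgue. ext \<O> (\<lambda>x. f0 x (y x) * v x) x)"
 proof (rule cong[OF sqint_mult[OF sf sqint_fn]])
  show "AE x in lebesgue. f x (fn (fst p) x) * fn (fst q) x = ext \<O> (\<lambda>x. f0 x (y x) * v x) x"
   using f_eq fl[OF yD(2)] fl[OF vD(2)] unfolding pq by eventually_elim (auto simp: ext_def)
 qed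
 finally show "(LINT x|lebesgue_on \<O>. f0 x (y x) * v x) = cls (\<lambda>x. f x (fn (fst p) x)) \<bullet> fst q"
  by (simp add: integral_lebesgue_on[OF open_\<O>])
 show "(LINT x|lebesgue_on \<O>. w x * v x) = l2 \<O> w \<bullet> fst q"
  using L2_inner_eq[OF open_\<O> w vD(2)] by (simp add: L2_inner_def pq)
qed

lemma is_weak_solutionI:
 assumes s: "weaksol (l2 \<O> w) p" and w: "w \<in> L2_fun \<O>" and c: "continuous_on (closure \<O>) y"
  and y: "AE x\<in>\<O> in lebesgue. y x = fn (fst p) x"
 shows "is_weak_solution \<O> a0 f0 w y"
proof -
 have p: "p \<in> sob0 \<O>" using s by (simp add: weaksol_def)
 note H = H10_funI[OF open_\<O> p y]
 have "l2 \<O> y = fst p" using arg_cong[OF H(2), of fst] by (simp add: wsob_def)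
 then have M: "AE x in lebesgue. \<bar>fn (l2 \<O> y) x\<bar> <= ybound (l2 \<O> w)" using weaksol_bound[OF s] by simp
 show ?thesis unfolding is_weak_solution_def
  using c H(1) weak_form_eq[OF H(1) _ w M] s H10_funD(1)[OF open_\<O>] unfolding H(2) weaksol_def by simp
qed

text \<open>Continuity on the compact closure gives the boundedness required by
  \<open>weaksol\<close>; every element of \<open>sob0\<close> has a representative in
  \<open>H10_fun\<close> to test with.\<close>

lemma is_weak_solutionD:
 assumes s: "is_weak_solution \<O> a0 f0 w y" and w: "w \<in> L2_fun \<O>"
 shows "weaksol (l2 \<O> w) (wsob \<O> y (weak_gradient \<O> y))" "AE x\<in>\<O> in lebesgue. y x = fn (l2 \<O> y) x"
proof -
 have y: "y \<in> H10_fun \<O>" and c: "continuous_on (closure \<O>) y" using s by (auto simp: is_weak_solution_def)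
 note yD = H10_funD[OF open_\<O> y]
 have fl: "AE x in lebesgue. fn (l2 \<O> y) x = ext \<O> y x" by (rule fn_l2[OF open_\<O> yD(2)])
 then show "AE x\<in>\<O> in lebesgue. y x = fn (l2 \<O> y) x" by eventually_elim (simp add: ext_def)
 have "compact (y ` closure \<O>)" by (rule compact_continuous_image[OF c]) (simp add: bounded_\<O> compact_closure)
 then obtain M where M: "M > 0" "\<forall>t\<in>y ` closure \<O>. norm t <= M" using compact_imp_bounded bounded_pos by blast
 have M': "AE x in lebesgue. \<bar>fn (l2 \<O> y) x\<bar> <= M" using fl
 proof eventually_elim
  case (elim x)
  then show ?case using M subsetD[OF closure_subset, of x \<O>] by (simp add: ext_def)
 qed
 show "weaksol (l2 \<O> w) (wsob \<O> y (weak_gradient \<O> y))" unfolding weaksol_def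
 proof (intro conjI ballI yD(1))
  show "\<exists>M. AE x in lebesgue. \<bar>fn (fst (wsob \<O> y (weak_gradient \<O> y))) x\<bar> <= M"
   using M' by (auto simp: wsob_def)
  fix q assume q: "q \<in> sob0 \<O>"
  have "AE x\<in>\<O> in lebesgue. fn (fst q) x = fn (fst q) x" by simp
  note H = H10_funI[OF open_\<O> q this]
  show "form (snd (wsob \<O> y (weak_gradient \<O> y))) (snd q)
    + cls (\<lambda>x. f x (fn (fst (wsob \<O> y (weak_gradient \<O> y))) x)) \<bullet> fst q = l2 \<O> w \<bullet> fst q"
   using bspec[OF conjunct2[OF conjunct2[OF s[unfolded is_weak_solution_def]]] H(1)]
   unfolding weak_form_eq[OF y H(1) w M'] H(2) .
 qed
qed

text \<open>\<open>state\<close> is a choice, meaningful only if a weak solution continuous up to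
  the boundary exists. Regularity provides one, and uniqueness identifies whichever is chosen almost
  everywhere.\<close>

lemma state_eq_S:
 assumes w: "w \<in> L2_fun \<O>" and b: "\<And>z. z \<in> frontier \<O> ==> ext_dens z"
 shows "AE x\<in>\<O> in lebesgue. state \<O> a0 f0 w x = fn (fst (S (l2 \<O> w))) x"
proof -
 obtain y where "continuous_on (closure \<O>) y" "AE x\<in>\<O> in lebesgue. y x = fn (fst (S (l2 \<O> w))) x"
  using weaksol_continuous[OF S b] by blast
 then have "is_weak_solution \<O> a0 f0 w y" by (rule is_weak_solutionI[OF S w])
 then have "is_weak_solution \<O> a0 f0 w (state \<O> a0 f0 w)" unfolding state_def by (rule someI[of "is_weak_solution \<O> a0 f0 w"])
 note D = is_weak_solutionD[OF this w]
 show ?thesis using D(2) S_eq[OF D(1)] by (simp add: wsob_def)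
qed

end

end

subsection \<open>Adjoint states and the expansion of the cost\<close>

context semilinear
begin

interpretation T: elliptic_domain "\<lambda>i j. a j i" lam Lam \<O> by (rule elliptic_domain_transpose)

text \<open>With the transposed form, \<open>solves\<close> for this function is the adjoint
  equation with potential \<open>f'\<close> and source \<open>l'\<close>, both evaluated at the
  clipped state. Clipping defines it for every \<open>u\<close> in \<open>L\<^sup>2\<close>, as a
  fixed point map on the whole space requires.\<close>

definition adjF :: "real => (real^'n => real => real) => (real^'n) L2 => real^'n => real => real" where
 "adjF M l' u x t = f' x (clip M (fn u x)) * t - l' x (clip M (fn u x))"

definition adj :: "real => (real^'n => real => real) => (real^'n) L2 => 'n sob" where
 "adj M l' u = (SOME \<phi>. T.solves (adjF M l' u) \<phi>)"

lemma f'_clip: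
 assumes M: "M \<ge> 0" and u: "u \<in> borel_measurable lebesgue"
 shows "bmeas (\<lambda>x. f' x (clip M (u x)))"
proof -
 obtain C where C: "\<And>x t. \<bar>t\<bar> <= M ==> f' x t <= C" using f'_bound by blast
 have "(\<lambda>x. f' x (clip M (u x))) \<in> borel_measurable lebesgue"
  by (rule caratheodory_measurable[OF nonlin_deriv_meas[OF f] nonlin_deriv_cont[OF f]]) (use u in measurable)
 moreover have "\<bar>f' x (clip M (u x))\<bar> <= C" for x using C[OF clip(1)[OF M]] f'_nonneg by simp
 ultimately show ?thesis unfolding bmeas_def by blast
qed

lemma adjF_lip_mono:
 assumes M: "M \<ge> 0" and l: "nonlin l l'" shows "\<exists>K. lip_mono (adjF M l' u) K"
proof -
 have b: "bmeas (\<lambda>x. f' x (clip M (fn u x)))" by (rule f'_clip[OF M fn_meas])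
 then obtain C where C: "\<And>x. \<bar>f' x (clip M (fn u x))\<bar> <= C" unfolding bmeas_def by blast
 have s: "sqint (\<lambda>x. l' x (clip M (fn u x)))" by (rule nonlin_deriv_sqint[OF l M fn_meas])
 have "lip_mono (adjF M l' u) C" unfolding lip_mono_def
 proof (intro conjI allI impI)
  show "(\<lambda>x. adjF M l' u x t) \<in> borel_measurable lebesgue" for t
   unfolding adjF_def using b[THEN bmeas_meas] sqint_meas[OF s] by (intro borel_measurable_diff borel_measurable_times) auto
  show "sqint (\<lambda>x. adjF M l' u x 0)" unfolding adjF_def using sqint_uminus[OF s] by simp
  show "adjF M l' u x s <= adjF M l' u x t" if "s <= t" for x s t
   unfolding adjF_def using mult_left_mono[OF that f'_nonneg] by (intro diff_right_mono)
  fix x s t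
  have "adjF M l' u x s - adjF M l' u x t = f' x (clip M (fn u x)) * (s - t)" by (simp add: adjF_def algebra_simps)
  then show "\<bar>adjF M l' u x s - adjF M l' u x t\<bar> <= C * \<bar>s - t\<bar>"
   using mult_right_mono[OF C[of x] abs_ge_zero[of "s - t"]] by (simp add: abs_mult)
 qed
 then show ?thesis by blast
qed

lemma adj: assumes "M \<ge> 0" "nonlin l l'" shows "T.solves (adjF M l' u) (adj M l' u)"
proof -
 obtain K where "lip_mono (adjF M l' u) K" using adjF_lip_mono[OF assms] by blast
 then show ?thesis unfolding adj_def by (rule someI_ex[OF T.solves_exists])
qed

lemma nem_adjF:
 assumes M: "M \<ge> 0" and l: "nonlin l l'"
 shows "nem (adjF M l' u) v = cls (\<lambda>x. f' x (clip M (fn u x)) * fn v x) - cls (\<lambda>x. l' x (clip M (fn u x)))"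
 unfolding nem_def adjF_def
 by (rule cls_diff[symmetric]) (intro sqint_bmeas_mult f'_clip[OF M] nonlin_deriv_sqint[OF l M] fn_meas sqint_fn)+

text \<open>The sup bound involves only the value at 0, here \<open>- l'\<close> at a clipped
  argument, which has a square integrable majorant independent of \<open>u\<close>.\<close>

lemma adj_bound:
 assumes M: "M \<ge> 0" and l: "nonlin l l'"
 shows "\<exists>Z\<ge>0. \<forall>u. AE x in lebesgue. \<bar>fn (fst (adj M l' u)) x\<bar> <= Z"
proof -
 obtain \<psi> where \<psi>: "sqint \<psi>" "\<And>x t. \<bar>t\<bar> <= M ==> \<bar>l' x t\<bar> <= \<psi> x" using nonlinD(3)[OF l] by blast
 show ?thesis
 proof (rule exI[of _ "T.supc * norm (cls \<psi>)"], intro conjI allI)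
  show "0 <= T.supc * norm (cls \<psi>)" using T.supc(1) by simp
  fix u
  obtain K where K: "lip_mono (adjF M l' u) K" using adjF_lip_mono[OF M l] by blast
  have s: "sqint (\<lambda>x. adjF M l' u x 0)" by (rule lip_monoD(2)[OF K])
  have "norm (cls (\<lambda>x. adjF M l' u x 0)) <= norm (cls \<psi>)"
  proof (rule norm_cls_mono[OF s \<psi>(1)], rule AE_I2)
   fix x show "\<bar>adjF M l' u x 0\<bar> <= \<bar>\<psi> x\<bar>" using \<psi>(2)[OF clip(1)[OF M], of x "fn u x"] by (simp add: adjF_def)
  qed
  then have "T.supc * norm (cls (\<lambda>x. adjF M l' u x 0)) <= T.supc * norm (cls \<psi>)"
   using T.supc(1) by (intro mult_left_mono) auto
  with T.solves_sup_bound[OF adj[OF M l, of u] K] show "AE x in lebesgue. \<bar>fn (fst (adj M l' u)) x\<bar> <= T.supc * norm (cls \<psi>)"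
   by (auto elim!: eventually_mono)
 qed
qed

text \<open>Stability compares the two equations at one adjoint state. There the difference contains
  the change of \<open>f'\<close> times that state, which is in \<open>L\<^sup>2\<close> only
  because adjoint states are uniformly bounded.\<close>

lemma adj_lipschitz:
 assumes M: "M \<ge> 0" and l: "nonlin l l'"
 shows "\<exists>K\<ge>0. \<forall>u v. norm (fst (adj M l' u) - fst (adj M l' v)) <= K * norm (u - v)"
proof -
 obtain Z where Z: "Z \<ge> 0" "\<And>u. AE x in lebesgue. \<bar>fn (fst (adj M l' u)) x\<bar> <= Z" using adj_bound[OF M l] by blast
 obtain C where C: "C \<ge> 0" "\<And>x s t. \<bar>s\<bar> <= M ==> \<bar>t\<bar> <= M ==> \<bar>f' x s - f' x t\<bar> <= C * \<bar>s - t\<bar>"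
  using nonlinD(4)[OF f, of M] by blast
 obtain D where D: "D \<ge> 0" "\<And>x s t. \<bar>s\<bar> <= M ==> \<bar>t\<bar> <= M ==> \<bar>l' x s - l' x t\<bar> <= D * \<bar>s - t\<bar>"
  using nonlinD(4)[OF l, of M] by blast
 show ?thesis
 proof (rule exI[of _ "(C * Z + D) / T.coer"], intro conjI allI)
  show "0 <= (C * Z + D) / T.coer" using C(1) D(1) Z(1) T.coer_pos by (intro divide_nonneg_pos) auto
  fix u v
  obtain K where K: "lip_mono (adjF M l' u) K" using adjF_lip_mono[OF M l] by blast
  let ?z = "fst (adj M l' v)" and ?y = "\<lambda>u x. clip M (fn u x)"
  let ?E = "\<lambda>x. (f' x (?y u x) * fn ?z x - l' x (?y u x)) - (f' x (?y v x) * fn ?z x - l' x (?y v x))"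
  note sq = sqint_bmeas_mult[OF f'_clip[OF M fn_meas] sqint_fn] nonlin_deriv_sqint[OF l M fn_meas]
  have nE: "nem (adjF M l' u) ?z - nem (adjF M l' v) ?z = cls ?E"
   unfolding nem_adjF[OF M l] by (simp add: cls_diff sq sqint_diff)
  have n1: "norm (cls ?E) <= norm (cls (\<lambda>x. (C * Z + D) * (fn u x - fn v x)))"
  proof (rule norm_cls_mono)
   show "sqint ?E" by (intro sqint_diff sq)
   show "sqint (\<lambda>x. (C * Z + D) * (fn u x - fn v x))" by (intro sqint_scale sqint_diff sqint_fn)
   show "AE x in lebesgue. \<bar>?E x\<bar> <= \<bar>(C * Z + D) * (fn u x - fn v x)\<bar>" using Z(2)[of v]
   proof eventually_elim
    case (elim x)
    have yy: "\<bar>?y u x - ?y v x\<bar> <= \<bar>fn u x - fn v x\<bar>" by (rule clip(2))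
    have "\<bar>f' x (?y u x) - f' x (?y v x)\<bar> <= C * \<bar>fn u x - fn v x\<bar>"
     by (rule order_trans[OF C(2)[OF clip(1)[OF M] clip(1)[OF M]] mult_left_mono[OF yy C(1)]])
    then have "\<bar>f' x (?y u x) - f' x (?y v x)\<bar> * \<bar>fn ?z x\<bar> <= C * \<bar>fn u x - fn v x\<bar> * Z"
     using elim C(1) by (intro mult_mono) auto
    moreover have "\<bar>l' x (?y u x) - l' x (?y v x)\<bar> <= D * \<bar>fn u x - fn v x\<bar>"
     by (rule order_trans[OF D(2)[OF clip(1)[OF M] clip(1)[OF M]] mult_left_mono[OF yy D(1)]])
    moreover have "?E x = (f' x (?y u x) - f' x (?y v x)) * fn ?z x - (l' x (?y u x) - l' x (?y v x))"
     by (simp add: algebra_simps)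
    then have "\<bar>?E x\<bar> <= \<bar>f' x (?y u x) - f' x (?y v x)\<bar> * \<bar>fn ?z x\<bar> + \<bar>l' x (?y u x) - l' x (?y v x)\<bar>"
     unfolding abs_mult[symmetric] by linarith
    ultimately have "\<bar>?E x\<bar> <= (C * Z + D) * \<bar>fn u x - fn v x\<bar>" by (simp add: algebra_simps)
    then show ?case using C(1) D(1) Z(1) by (simp add: abs_mult)
   qed
  qed
  have n2: "cls (\<lambda>x. (C * Z + D) * (fn u x - fn v x)) = (C * Z + D) *\<^sub>R (u - v)"
   unfolding cls_scaleR[OF sqint_diff[OF sqint_fn sqint_fn], symmetric] cls_diff[OF sqint_fn sqint_fn, symmetric] cls_fn ..
  have n: "norm (nem (adjF M l' u) ?z - nem (adjF M l' v) ?z) <= (C * Z + D) * norm (u - v)"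
   using n1 C(1) D(1) Z(1) unfolding nE n2 by simp
  have "norm (fst (adj M l' u) - fst (adj M l' v)) <= norm (adj M l' u - adj M l' v)"
   using norm_fst_le_norm[of "adj M l' u - adj M l' v"] by simp
  also have "\<dots> <= norm (nem (adjF M l' u) ?z - nem (adjF M l' v) ?z) / T.coer"
   by (rule T.solves_stable[OF adj[OF M l] adj[OF M l] K])
  also have "\<dots> <= (C * Z + D) * norm (u - v) / T.coer" using n T.coer_pos by (intro divide_right_mono) auto
  finally show "norm (fst (adj M l' u) - fst (adj M l' v)) <= (C * Z + D) / T.coer * norm (u - v)" by simp
 qed
qed

definition Gf :: "(real^'n => real => real) => (real^'n) L2 => real" where
 "Gf l W = (LINT x|lebesgue. l x (fn (fst (S W)) x))"

lemma ybound_add: "ybound (W + h) <= ybound W + supc * norm h"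
proof -
 have "norm (cls (\<lambda>x. f x 0) - (W + h)) <= norm (cls (\<lambda>x. f x 0) - W) + norm h"
  using norm_triangle_ineq4[of "cls (\<lambda>x. f x 0) - W" h] by (simp add: algebra_simps)
 from mult_left_mono[OF this, of supc] show ?thesis using supc(1) by (simp add: ybound_def distrib_left)
qed

lemma Gf_clip:
 assumes l: "nonlin l l'" and i: "integrable lebesgue (\<lambda>x. l x 0)" and M: "M \<ge> ybound W"
 shows "integrable lebesgue (\<lambda>x. l x (clip M (fn (fst (S W)) x)))" "Gf l W = (LINT x|lebesgue. l x (clip M (fn (fst (S W)) x)))"
proof -
 have M0: "M \<ge> 0" using M ybound_nonneg[of W] by linarith
 show I: "integrable lebesgue (\<lambda>x. l x (clip M (fn (fst (S W)) x)))"
  by (rule nonlin_integrable[OF l M0 sqint_fn i])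
 have ae: "AE x in lebesgue. l x (clip M (fn (fst (S W)) x)) = l x (fn (fst (S W)) x)"
  using weaksol_bound[OF S[of W]] by eventually_elim (use M in \<open>simp add: clip(3)\<close>)
 show "Gf l W = (LINT x|lebesgue. l x (clip M (fn (fst (S W)) x)))"
  unfolding Gf_def using I by (intro integral_cong_AE[symmetric] borel_measurable_AE[OF _ ae] ae) auto
qed

text \<open>Testing the difference of two state equations with the adjoint state leaves only the Taylor
 remainders of \<open>l\<close> and \<open>f\<close>; they are quadratic in the difference of the states.\<close>

lemma Gf_expansion:
 assumes l: "nonlin l l'" and i: "integrable lebesgue (\<lambda>x. l x 0)" and M: "M \<ge> ybound W + supc"
 shows "\<exists>K\<ge>0. \<forall>h. norm h <= 1 --> \<bar>Gf l (W + h) - Gf l W - h \<bullet> fst (adj M l' (fst (S W)))\<bar> <= K * (norm h)\<^sup>2"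
proof -
 have M0: "M \<ge> 0" using M ybound_nonneg[of W] supc(1) by linarith
 let ?\<Phi> = "adj M l' (fst (S W))"
 obtain Z where Z: "Z \<ge> 0" "AE x in lebesgue. \<bar>fn (fst ?\<Phi>) x\<bar> <= Z" using adj_bound[OF M0 l] by blast
 obtain C where C: "C \<ge> 0" "\<And>x s t. \<bar>s\<bar> <= M ==> \<bar>t\<bar> <= M ==> \<bar>f x t - f x s - f' x s * (t - s)\<bar> <= C * (t - s)\<^sup>2"
  using nonlin_taylor[OF f, of M] by blast
 obtain D where D: "D \<ge> 0" "\<And>x s t. \<bar>s\<bar> <= M ==> \<bar>t\<bar> <= M ==> \<bar>l x t - l x s - l' x s * (t - s)\<bar> <= D * (t - s)\<^sup>2"
  using nonlin_taylor[OF l, of M] by blast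
 show ?thesis
 proof (rule exI[of _ "(D + C * Z) / coer\<^sup>2"], intro conjI allI impI)
  show "0 <= (D + C * Z) / coer\<^sup>2" using C(1) D(1) Z(1) by simp
  fix h :: "(real^'n) L2" assume h: "norm h <= 1"
  have "supc * norm h <= supc" using h supc(1) by simp
  \<comment> \<open>The margin \<open>supc\<close> in the hypothesis on \<open>M\<close> keeps the
    states of all perturbations of norm at most 1 below the clipping level.\<close>
  then have MM: "ybound W <= M" "ybound (W + h) <= M" using ybound_add[of W h] M supc(1) by linarith+
  let ?p = "S W" and ?q = "S (W + h)"
  define d where "d = ?q - ?p"
  define y where "y x = clip M (fn (fst ?p) x)" for x
  define z where "z x = clip M (fn (fst ?q) x)" for x
  define \<phi> where "\<phi> = fn (fst ?\<Phi>)"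
  define \<delta> where "\<delta> = fn (fst d)"
  have yz: "\<bar>y x\<bar> <= M" "\<bar>z x\<bar> <= M" for x unfolding y_def z_def by (rule clip(1)[OF M0])+
  have dae: "AE x in lebesgue. \<delta> x = z x - y x"
   using fn_diff[of "fst ?q" "fst ?p"] weaksol_bound[OF S[of W]] weaksol_bound[OF S[of "W + h"]]
   unfolding y_def z_def \<delta>_def d_def by eventually_elim (use MM in \<open>simp add: clip(3)\<close>)
  have sq: "sqint (\<lambda>x. f x (y x))" "sqint (\<lambda>x. f x (z x))" "sqint (\<lambda>x. f' x (y x) * \<phi> x)" "sqint (\<lambda>x. l' x (y x))" "sqint \<phi>" "sqint \<delta>"
   unfolding y_def z_def \<phi>_def \<delta>_def
   by (intro sqint_f_clip[OF M0] sqint_bmeas_mult f'_clip[OF M0] nonlin_deriv_sqint[OF l M0] fn_meas sqint_fn)+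
  have dS: "d \<in> sob0 \<O>" using S[of W] S[of "W + h"] by (simp add: d_def weaksol_def subspace_diff[OF subspace_sob0])
  have \<Phi>: "?\<Phi> \<in> sob0 \<O>" "T.form (snd ?\<Phi>) (snd d) + nem (adjF M l' (fst ?p)) (fst ?\<Phi>) \<bullet> fst d = 0"
   using adj[OF M0 l, of "fst ?p"] dS by (auto simp: T.solves_def)
  have "form (snd d) (snd ?\<Phi>) = (cls (\<lambda>x. l' x (y x)) - cls (\<lambda>x. f' x (y x) * \<phi> x)) \<bullet> fst d"
   using \<Phi>(2) unfolding form_transpose nem_adjF[OF M0 l] y_def \<phi>_def by (simp add: inner_diff_left)
  also have "\<dots> = (LINT x|lebesgue. (l' x (y x) - f' x (y x) * \<phi> x) * \<delta> x)"
   using inner_cls[OF sqint_diff[OF sq(4,3)] sq(6)] by (simp add: cls_diff sq \<delta>_def)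
  finally have e1: "form (snd d) (snd ?\<Phi>) = (LINT x|lebesgue. (l' x (y x) - f' x (y x) * \<phi> x) * \<delta> x)" .
  have "form (snd ?p) (snd ?\<Phi>) + (cls (\<lambda>x. f x (y x)) - W) \<bullet> fst ?\<Phi> = 0"
   "form (snd ?q) (snd ?\<Phi>) + (cls (\<lambda>x. f x (z x)) - (W + h)) \<bullet> fst ?\<Phi> = 0"
   using weaksol_solves[OF S MM(1)] weaksol_solves[OF S MM(2)] \<Phi>(1)
   unfolding solves_def nem_fM[OF M0] y_def z_def by blast+
  then have "form (snd d) (snd ?\<Phi>) = h \<bullet> fst ?\<Phi> - (cls (\<lambda>x. f x (z x)) - cls (\<lambda>x. f x (y x))) \<bullet> fst ?\<Phi>"
   by (simp add: d_def form_linear inner_diff_left inner_add_left)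
  moreover have "(cls (\<lambda>x. f x (z x)) - cls (\<lambda>x. f x (y x))) \<bullet> fst ?\<Phi> = (LINT x|lebesgue. (f x (z x) - f x (y x)) * \<phi> x)"
   using inner_cls[OF sqint_diff[OF sq(2,1)] sq(5)] by (simp add: cls_diff sq \<phi>_def)
  ultimately have e2: "h \<bullet> fst ?\<Phi> = (LINT x|lebesgue. (l' x (y x) - f' x (y x) * \<phi> x) * \<delta> x) + (LINT x|lebesgue. (f x (z x) - f x (y x)) * \<phi> x)"
   using e1 by simp
  have G: "Gf l (W + h) = (LINT x|lebesgue. l x (z x))" "Gf l W = (LINT x|lebesgue. l x (y x))"
   unfolding y_def z_def by (rule Gf_clip(2)[OF l i]; rule MM)+
  have I: "integrable lebesgue (\<lambda>x. l x (z x))" "integrable lebesgue (\<lambda>x. l x (y x))"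
   "integrable lebesgue (\<lambda>x. (l' x (y x) - f' x (y x) * \<phi> x) * \<delta> x)" "integrable lebesgue (\<lambda>x. (f x (z x) - f x (y x)) * \<phi> x)"
   using Gf_clip(1)[OF l i MM(1)] Gf_clip(1)[OF l i MM(2)] by (auto simp: y_def[symmetric] z_def[symmetric] intro!: sqint_mult sqint_diff sq)
  let ?E = "\<lambda>x. l x (z x) - l x (y x) - ((l' x (y x) - f' x (y x) * \<phi> x) * \<delta> x + (f x (z x) - f x (y x)) * \<phi> x)"
  have GE: "Gf l (W + h) - Gf l W - h \<bullet> fst ?\<Phi> = (LINT x|lebesgue. ?E x)" unfolding G e2 using I by simp
  have "\<bar>LINT x|lebesgue. ?E x\<bar> <= (LINT x|lebesgue. \<bar>?E x\<bar>)" by (rule integral_abs_bound)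
  also have "\<dots> <= (LINT x|lebesgue. (D + C * Z) * (\<delta> x)\<^sup>2)"
  proof (rule integral_mono_AE)
   show "integrable lebesgue (\<lambda>x. \<bar>?E x\<bar>)" using I by (intro integrable_abs Bochner_Integration.integrable_diff Bochner_Integration.integrable_add)
   show "integrable lebesgue (\<lambda>x. (D + C * Z) * (\<delta> x)\<^sup>2)" by (intro integrable_mult_right sqint_integrable_sq sq)
   show "AE x in lebesgue. \<bar>?E x\<bar> <= (D + C * Z) * (\<delta> x)\<^sup>2" using dae Z(2)
   proof eventually_elim
    case (elim x)
    let ?t = "z x - y x"
    have E: "?E x = (l x (z x) - l x (y x) - l' x (y x) * ?t) - (f x (z x) - f x (y x) - f' x (y x) * ?t) * \<phi> x"
     unfolding elim(1) by (simp add: algebra_simps)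
    have "\<bar>f x (z x) - f x (y x) - f' x (y x) * ?t\<bar> * \<bar>\<phi> x\<bar> <= C * ?t\<^sup>2 * Z"
     using C(2)[OF yz] elim(2) C(1) unfolding \<phi>_def by (intro mult_mono) auto
    then have "\<bar>?E x\<bar> <= D * ?t\<^sup>2 + C * ?t\<^sup>2 * Z"
     using D(2)[OF yz, of x] abs_triangle_ineq4 unfolding E abs_mult[symmetric] by (meson add_mono order_trans)
    then show ?case unfolding elim(1) by (simp add: algebra_simps)
   qed
  qed
  also have "\<dots> = (D + C * Z) * (norm (fst d))\<^sup>2" by (simp add: norm_sq_fn \<delta>_def)
  also have "\<dots> <= (D + C * Z) * (norm h / coer)\<^sup>2"
  proof -
   have "norm (fst d) <= norm d" by (rule norm_fst_le_norm)
   also have "\<dots> <= norm h / coer" using weaksol_stable[OF S[of "W + h"] S[of W]] by (simp add: d_def)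
   finally show ?thesis using C(1) D(1) Z(1) by (intro mult_left_mono power_mono) auto
  qed
  finally show "\<bar>Gf l (W + h) - Gf l W - h \<bullet> fst ?\<Phi>\<bar> <= (D + C * Z) / coer\<^sup>2 * (norm h)\<^sup>2"
   unfolding GE by (simp add: power_divide)
 qed
qed

end

subsection \<open>Best responses and their fixed point\<close>

definition lipc :: "('a::real_normed_vector => 'b::real_normed_vector) => bool" where
 "lipc f \<longleftrightarrow> (\<exists>K\<ge>0. \<forall>u v. norm (f u - f v) <= K * norm (u - v))"

lemma lipc_compose: "lipc f ==> lipc g ==> lipc (\<lambda>x. f (g x))"
proof -
 assume "lipc f" "lipc g"
 then obtain K L where K: "K \<ge> 0" "\<And>u v. norm (f u - f v) <= K * norm (u - v)"
  and L: "L \<ge> 0" "\<And>u v. norm (g u - g v) <= L * norm (u - v)" unfolding lipc_def by blast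
 have "norm (f (g u) - f (g v)) <= K * L * norm (u - v)" for u v
  using order_trans[OF K(2) mult_left_mono[OF L(2) K(1)]] by (simp add: mult.assoc)
 then show ?thesis unfolding lipc_def using K(1) L(1) by (intro exI[of _ "K * L"]) simp
qed

lemma lipc_sum: "(\<And>k. k \<in> I ==> lipc (f k)) ==> lipc (\<lambda>x. \<Sum>k\<in>I. f k x)"
proof (induction I rule: infinite_finite_induct)
 case (insert k I)
 then have "lipc (f k)" "lipc (\<lambda>x. \<Sum>k\<in>I. f k x)" by auto
 then obtain K L where K: "K \<ge> 0" "\<And>u v. norm (f k u - f k v) <= K * norm (u - v)"
  and L: "L \<ge> 0" "\<And>u v. norm ((\<Sum>k\<in>I. f k u) - (\<Sum>k\<in>I. f k v)) <= L * norm (u - v)" unfolding lipc_def by blast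
 have "norm ((f k u + (\<Sum>k\<in>I. f k u)) - (f k v + (\<Sum>k\<in>I. f k v))) <= (K + L) * norm (u - v)" for u v
  using norm_diff_triangle_ineq[of "f k u" "\<Sum>k\<in>I. f k u" "f k v" "\<Sum>k\<in>I. f k v"] K(2)[of u v] L(2)[of u v]
  by (simp add: distrib_right)
 then show ?case using insert K(1) L(1) unfolding lipc_def by (intro exI[of _ "K + L"]) simp
qed (auto simp: lipc_def)

lemma lipc_mul: "bmeas c ==> lipc (mul c)"
proof -
 assume c: "bmeas c"
 then obtain C where C: "\<And>x. \<bar>c x\<bar> <= C" by (auto simp: bmeas_def)
 have "norm (mul c u - mul c v) <= C * norm (u - v)" for u v
  using norm_mul_le[OF c C, of "u - v"] by (simp add: mul_diff c)
 then show ?thesis unfolding lipc_def using C[of undefined] by (intro exI[of _ C]) auto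
qed

lemma inner_mul_ge:
 assumes z: "bmeas z" and z0: "\<And>x. z x \<ge> z0"
 shows "z0 * (norm u)\<^sup>2 <= mul z u \<bullet> u"
proof -
 have "z0 * (norm u)\<^sup>2 = (LINT x|lebesgue. z0 * (fn u x)\<^sup>2)" by (simp add: norm_sq_fn)
 also have "\<dots> <= (LINT x|lebesgue. z x * fn u x * fn u x)"
  by (intro integral_mono_AE integrable_mult_right sqint_integrable_sq sqint_mult sqint_bmeas_mult z sqint_fn AE_I2)
   (use z0 in \<open>auto simp: power2_eq_square mult.assoc intro!: mult_right_mono\<close>)
 finally show ?thesis by (simp add: inner_mul[OF z])
qed

text \<open>Not a minimiser of the cost but the solution of its first-order condition with the
  adjoint term \<open>\<psi>\<close> frozen.\<close>

definition br :: "'a::euclidean_space L2 set => ('a => real) => 'a L2 => 'a L2" where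
 "br K z \<psi> = (SOME v. v \<in> K \<and> (\<forall>w\<in>K. (\<psi> + mul z v) \<bullet> (w - v) \<ge> 0))"

text \<open>Existence is the variational inequality with the strongly monotone operator
  \<open>mul z\<close>. Testing two such inequalities with each other's solution and adding gives
  the Lipschitz constant \<open>1 / z0\<close>.\<close>

lemma
 fixes K :: "'a::euclidean_space L2 set"
 assumes K: "closed K" "convex K" "K \<noteq> {}" and z: "bmeas z" "\<And>x. z x \<ge> z0" "z0 > 0"
 shows br_in: "br K z \<psi> \<in> K" and br: "w \<in> K ==> (\<psi> + mul z (br K z \<psi>)) \<bullet> (w - br K z \<psi>) \<ge> 0" and br_lipc: "lipc (br K z)"
proof -
 obtain C where C: "\<And>x. \<bar>z x\<bar> <= C" using z(1) by (auto simp: bmeas_def)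
 have ex: "\<exists>v\<in>K. \<forall>w\<in>K. (\<psi> + mul z v) \<bullet> (w - v) \<ge> 0" for \<psi>
 proof (rule variational_ineq_exists[OF K z(3)])
  fix u v
  show "z0 * (norm (u - v))\<^sup>2 <= (\<psi> + mul z u - (\<psi> + mul z v)) \<bullet> (u - v)"
   using inner_mul_ge[OF z(1,2), of "u - v"] by (simp add: mul_diff z(1))
  show "norm (\<psi> + mul z u - (\<psi> + mul z v)) <= C * norm (u - v)"
   using norm_mul_le[OF z(1) C, of "u - v"] by (simp add: mul_diff z(1))
 qed
 have *: "br K z \<psi> \<in> K \<and> (\<forall>w\<in>K. (\<psi> + mul z (br K z \<psi>)) \<bullet> (w - br K z \<psi>) \<ge> 0)" for \<psi>
  unfolding br_def by (rule someI_ex[OF ex[of \<psi>, unfolded Bex_def]])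
 then show "br K z \<psi> \<in> K" "w \<in> K ==> (\<psi> + mul z (br K z \<psi>)) \<bullet> (w - br K z \<psi>) \<ge> 0" by blast+
 have "norm (br K z \<psi> - br K z \<eta>) <= 1 / z0 * norm (\<psi> - \<eta>)" for \<psi> \<eta>
 proof -
  let ?u = "br K z \<psi>" and ?v = "br K z \<eta>"
  have "(\<psi> + mul z ?u) \<bullet> (?v - ?u) \<ge> 0" "(\<eta> + mul z ?v) \<bullet> (?u - ?v) \<ge> 0" using * by blast+
  then have "mul z (?u - ?v) \<bullet> (?u - ?v) <= (\<psi> - \<eta>) \<bullet> (?v - ?u)"
   by (simp add: mul_diff z(1) inner_diff_left inner_diff_right inner_add_left)
  also have "\<dots> <= norm (\<psi> - \<eta>) * norm (?u - ?v)" using norm_cauchy_schwarz[of "\<psi> - \<eta>" "?v - ?u"] by (simp add: norm_minus_commute)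
  finally have "norm (?u - ?v) * (z0 * norm (?u - ?v)) <= norm (?u - ?v) * norm (\<psi> - \<eta>)"
   using inner_mul_ge[OF z(1,2), of "?u - ?v"] by (simp add: power2_eq_square mult_ac)
  then have "z0 * norm (?u - ?v) <= norm (\<psi> - \<eta>) \<or> norm (?u - ?v) = 0"
   using norm_ge_zero[of "?u - ?v"] by (metis mult_le_cancel_left_pos order_le_less)
  then show ?thesis using z(3) by (auto simp: pos_le_divide_eq mult.commute)
 qed
 then show "lipc (br K z)" unfolding lipc_def using z(3) by (intro exI[of _ "1 / z0"]) simp
qed

section \<open>Existence of an equilibrium in terms of classes\<close>

context semilinear
begin

text \<open>The iteration variable is a single function, the candidate state, not the tuple of
  controls: controls depend on it in a Lipschitz way but lie only in bounded sets, whereas the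
  states they produce form a totally bounded set.\<close>

lemma equilibrium_exists:
 fixes K :: "nat => (real^'n) L2 set"
 assumes l: "\<And>k. k \<in> I ==> nonlin (l k) (l' k)"
  and K: "\<And>k. k \<in> I ==> closed (K k)" "\<And>k. k \<in> I ==> convex (K k)" "\<And>k. k \<in> I ==> K k \<noteq> {}" "\<And>k. k \<in> I ==> bounded (K k)"
  and b: "\<And>k. k \<in> I ==> bmeas (b k)" and z: "\<And>k. k \<in> I ==> bmeas (z k)" "\<And>k x. k \<in> I ==> z k x \<ge> z0 k" "\<And>k. k \<in> I ==> z0 k > 0"
 shows "\<exists>v M. (\<forall>k\<in>I. v k \<in> K k) \<and> M \<ge> ybound (\<Sum>k\<in>I. mul (b k) (v k)) + supc \<and>
  (\<forall>k\<in>I. \<forall>w\<in>K k. (mul (b k) (fst (adj M (l' k) (fst (S (\<Sum>k\<in>I. mul (b k) (v k)))))) + mul (z k) (v k)) \<bullet> (w - v k) \<ge> 0)"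
proof -
 have "\<exists>r. \<forall>v\<in>K k. norm (mul (b k) v) <= r" if k: "k \<in> I" for k
  using bounded_linear_image[OF K(4)[OF k] mul_bounded_linear[OF b[OF k]]] by (auto simp: bounded_iff)
 then have "\<forall>k\<in>I. \<exists>r. \<forall>v\<in>K k. norm (mul (b k) v) <= r" by blast
 from bchoice[OF this] obtain r where r: "\<And>k v. k \<in> I ==> v \<in> K k ==> norm (mul (b k) v) <= r k" by blast
 define R where "R = (\<Sum>k\<in>I. \<bar>r k\<bar>)"
 have R: "norm (\<Sum>k\<in>I. mul (b k) (v k)) <= R" if "\<And>k. k \<in> I ==> v k \<in> K k" for v
  unfolding R_def by (intro sum_norm_le order_trans[OF r[OF _ that] abs_ge_self])
 have R0: "R \<ge> 0" by (simp add: R_def sum_nonneg)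
 \<comment> \<open>Bounds the states of all sources of norm at most \<open>R\<close>, hence of all
   admissible controls, with the margin \<open>supc\<close> that differentiating the cost
   requires.\<close>
 define M where "M = ybound 0 + supc * R + supc"
 have M: "ybound W + supc <= M" if "norm W <= R" for W
  using ybound_add[of 0 W] mult_left_mono[OF that less_imp_le[OF supc(1)]] unfolding M_def add_0 by linarith
 have M0: "M \<ge> 0" using ybound_nonneg[of 0] supc(1) R0 by (simp add: M_def)
 define v where "v u k = br (K k) (z k) (mul (b k) (fst (adj M (l' k) u)))" for u k
 define W where "W u = (\<Sum>k\<in>I. mul (b k) (v u k))" for u
 note brK = K(1-3) z
 have vK: "v u k \<in> K k" if "k \<in> I" for u k unfolding v_def by (rule br_in[OF brK]) (rule that)+
 have WR: "norm (W u) <= R" for u unfolding W_def by (rule R[OF vK])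
 have adjl: "lipc (\<lambda>u. fst (adj M (l' k) u))" if "k \<in> I" for k
  unfolding lipc_def using adj_lipschitz[OF M0 l[OF that]] by simp
 have "lipc (\<lambda>W. fst (S W))" unfolding lipc_def
 proof (rule exI[of _ "1 / coer"], intro conjI allI)
  fix V W
  have "norm (fst (S V) - fst (S W)) <= norm (S V - S W)" using norm_fst_le_norm[of "S V - S W"] by simp
  then show "norm (fst (S V) - fst (S W)) <= 1 / coer * norm (V - W)" using weaksol_stable[OF S[of V] S[of W]] by simp
 qed (use coer_pos in simp)
 moreover have "lipc W"
  unfolding W_def v_def by (intro lipc_sum lipc_compose[OF lipc_mul[OF b]] lipc_compose[OF br_lipc[OF brK]] adjl)
 ultimately have "lipc (\<lambda>u. fst (S (W u)))" by (rule lipc_compose)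
 then obtain C where C: "C \<ge> 0" "\<And>u v. norm (fst (S (W u)) - fst (S (W v))) <= C * norm (u - v)" unfolding lipc_def by blast
 have "\<exists>u. fst (S (W u)) = u"
 proof (rule lipschitz_schauder[where T = "\<lambda>u. fst (S (W u))" and l = C])
  show "dist (fst (S (W u))) (fst (S (W v))) <= C * dist u v" for u v using C(2) by (simp add: dist_norm)
  fix e :: real assume e: "e > 0"
  \<comment> \<open>Stability relative to the zero source bounds all states in the Sobolev norm, the
    second ingredient of total boundedness besides \<open>M\<close>.\<close>
  define \<rho> where "\<rho> = norm (S 0) + R / coer"
  have "\<rho> \<ge> 0" using R0 coer_pos by (simp add: \<rho>_def)
  then obtain F where F: "finite F" "{fst p | p. p \<in> sob0 \<O> \<and> norm p <= \<rho> \<and> (AE x in lebesgue. \<bar>fn (fst p) x\<bar> <= M)} \<subseteq> (\<Union>x\<in>F. ball x e)"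
   using sob0_totally_bounded[OF open_\<O> bounded_\<O> e M0] by blast
  have "S (W u) \<in> sob0 \<O> \<and> norm (S (W u)) <= \<rho> \<and> (AE x in lebesgue. \<bar>fn (fst (S (W u))) x\<bar> <= M)" for u
  proof (intro conjI)
   show "S (W u) \<in> sob0 \<O>" using S by (simp add: weaksol_def)
   have "norm (S (W u)) <= norm (S 0) + norm (S (W u) - S 0)" by (rule norm_triangle_sub)
   also have "norm (S (W u) - S 0) <= norm (W u) / coer" using weaksol_stable[OF S[of "W u"] S[of 0]] by simp
   also have "\<dots> <= R / coer" using WR coer_pos by (intro divide_right_mono) auto
   finally show "norm (S (W u)) <= \<rho>" by (simp add: \<rho>_def)
   show "AE x in lebesgue. \<bar>fn (fst (S (W u))) x\<bar> <= M"
    using weaksol_bound[OF S[of "W u"]] by eventually_elim (use M[OF WR[of u]] supc(1) in linarith)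
  qed
  then have "range (\<lambda>u. fst (S (W u))) \<subseteq> (\<Union>x\<in>F. ball x e)" using F(2) by blast
  with F(1) show "\<exists>F. finite F \<and> range (\<lambda>u. fst (S (W u))) \<subseteq> (\<Union>x\<in>F. ball x e)" by blast
 qed (rule C(1))
 then obtain u where u: "fst (S (W u)) = u" by blast
 have "(mul (b k) (fst (adj M (l' k) (fst (S (W u))))) + mul (z k) (v u k)) \<bullet> (w - v u k) \<ge> 0" if "k \<in> I" "w \<in> K k" for k w
  unfolding u v_def by (rule br[OF brK]) (rule that)+
 then show ?thesis
  using vK[of _ u] M[OF WR[of u]] unfolding W_def by (intro exI[of _ "v u"] exI[of _ M]) blast
qed

end

subsection \<open>Modification of the data on null sets, and partial gradients\<close>

text \<open>Wherever a required property fails the function is replaced by 0, which satisfies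
  everything. Bounds are collected only for integer ranges, so that countably many null sets are
  discarded; \<open>P\<close> carries additional pointwise requirements.\<close>

lemma clean_nonlin:
 fixes g :: "real^'n => real => real"
 assumes \<O>: "open \<O>" and car: "caratheodory \<O> g" and c2: "AE x in lebesgue_on \<O>. C2_real (g x)"
  and bd: "\<And>M. M > 0 ==> \<exists>C>0. \<exists>\<psi>\<in>L2_fun \<O>. AE x in lebesgue_on \<O>. \<forall>y. \<bar>y\<bar> <= M -->
      \<bar>deriv (g x) y\<bar> <= \<psi> x \<and> \<bar>deriv (deriv (g x)) y\<bar> <= C"
  and P: "AE x in lebesgue_on \<O>. P x"
 shows "\<exists>h. nonlin h (\<lambda>x. deriv (h x)) \<and> (AE x\<in>\<O> in lebesgue. (\<forall>t. g x t = h x t)) \<and>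
     (\<forall>x. x \<in> \<O> \<and> P x \<and> h x = g x \<or> h x = (\<lambda>_. 0)) \<and> (\<forall>x. x \<notin> \<O> --> h x = (\<lambda>_. 0))"
proof -
 have "\<forall>n. \<exists>q. snd q \<in> L2_fun \<O> \<and> (AE x in lebesgue_on \<O>. \<forall>y. \<bar>y\<bar> <= real (Suc n) -->
      \<bar>deriv (g x) y\<bar> <= snd q x \<and> \<bar>deriv (deriv (g x)) y\<bar> <= fst q)"
 proof
  fix n
  obtain C \<psi> where "\<psi> \<in> L2_fun \<O>" "AE x in lebesgue_on \<O>. \<forall>y. \<bar>y\<bar> <= real (Suc n) -->
      \<bar>deriv (g x) y\<bar> <= \<psi> x \<and> \<bar>deriv (deriv (g x)) y\<bar> <= C" using bd[of "real (Suc n)"] by auto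
  then show "\<exists>q. snd q \<in> L2_fun \<O> \<and> (AE x in lebesgue_on \<O>. \<forall>y. \<bar>y\<bar> <= real (Suc n) -->
      \<bar>deriv (g x) y\<bar> <= snd q x \<and> \<bar>deriv (deriv (g x)) y\<bar> <= fst q)" by (intro exI[of _ "(C, \<psi>)"]) simp
 qed
 from choice[OF this] obtain q where q: "\<And>n. snd (q n) \<in> L2_fun \<O>"
  "\<And>n. AE x in lebesgue_on \<O>. \<forall>y. \<bar>y\<bar> <= real (Suc n) --> \<bar>deriv (g x) y\<bar> <= snd (q n) x \<and> \<bar>deriv (deriv (g x)) y\<bar> <= fst (q n)"
  by blast
 define good where "good x \<longleftrightarrow> C2_real (g x) \<and> P x \<and> (\<forall>n y. \<bar>y\<bar> <= real (Suc n) -->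
  \<bar>deriv (g x) y\<bar> <= snd (q n) x \<and> \<bar>deriv (deriv (g x)) y\<bar> <= fst (q n))" for x
 have "AE x in lebesgue_on \<O>. \<forall>n. \<forall>y. \<bar>y\<bar> <= real (Suc n) --> \<bar>deriv (g x) y\<bar> <= snd (q n) x \<and> \<bar>deriv (deriv (g x)) y\<bar> <= fst (q n)"
  unfolding AE_all_countable by (intro allI q(2))
 with c2 P have "AE x in lebesgue_on \<O>. good x" by eventually_elim (unfold good_def, blast)
 then have ae: "AE x\<in>\<O> in lebesgue. good x" by (simp add: AE_lebesgue_on[OF \<O>])
 define h where "h x = (if x \<in> \<O> \<and> good x then g x else (\<lambda>_. 0))" for x
 have hd: "(h x has_real_derivative deriv (h x) t) (at t)" for x t
  by (auto simp: h_def good_def C2_real_def DERIV_deriv_iff_field_differentiable)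
 have "nonlin h (\<lambda>x. deriv (h x))" unfolding nonlin_def
 proof (intro conjI allI hd)
  fix t
  have "ext \<O> (\<lambda>x. g x t) \<in> borel_measurable lebesgue"
   using car measurable_lebesgue_on[OF \<O>] by (auto simp: caratheodory_def)
  moreover have "AE x in lebesgue. ext \<O> (\<lambda>x. g x t) x = h x t" using ae by eventually_elim (auto simp: ext_def h_def)
  ultimately show "(\<lambda>x. h x t) \<in> borel_measurable lebesgue" by (rule borel_measurable_AE)
 next
  fix M :: real
  obtain n where "M <= real n" using real_arch_simple by blast
  then have n: "M <= real (Suc n)" by simp
  show "\<exists>\<psi>. sqint \<psi> \<and> (\<forall>x t. \<bar>t\<bar> <= M --> \<bar>deriv (h x) t\<bar> <= \<psi> x)"
  proof (intro exI conjI allI impI)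
   show "sqint (\<lambda>x. \<bar>ext \<O> (snd (q n)) x\<bar>)" using q(1) L2_fun_iff[OF \<O>] by (intro sqint_abs) blast
   fix x t assume "\<bar>t\<bar> <= M"
   with n have t: "\<bar>t\<bar> <= real (Suc n)" by linarith
   show "\<bar>deriv (h x) t\<bar> <= \<bar>ext \<O> (snd (q n)) x\<bar>"
   proof (cases "x \<in> \<O> \<and> good x")
    case True
    then have "\<bar>deriv (g x) t\<bar> <= snd (q n) x" using t unfolding good_def by blast
    then show ?thesis using True by (simp add: h_def ext_def)
   qed (auto simp: h_def)
  qed
  have "\<bar>deriv (h x) s - deriv (h x) t\<bar> <= \<bar>fst (q n)\<bar> * \<bar>s - t\<bar>" if st: "\<bar>s\<bar> <= M" "\<bar>t\<bar> <= M" for x s t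
  proof (cases "x \<in> \<O> \<and> good x")
   case True
   have "\<bar>deriv (g x) s - deriv (g x) t\<bar> <= \<bar>fst (q n)\<bar> * \<bar>s - t\<bar>"
   proof (rule DERIV_lipschitz_bound)
    show "(deriv (g x) has_real_derivative deriv (deriv (g x)) r) (at r)" for r
     using True by (simp add: good_def C2_real_def DERIV_deriv_iff_field_differentiable)
    fix r assume "r \<in> closed_segment t s"
    then have "\<bar>r\<bar> <= real (Suc n)" using st n by (auto simp: closed_segment_eq_real_ivl split: if_splits)
    then have "\<bar>deriv (deriv (g x)) r\<bar> <= fst (q n)" using True unfolding good_def by blast
    then show "\<bar>deriv (deriv (g x)) r\<bar> <= \<bar>fst (q n)\<bar>" by linarith
   qed
   then show ?thesis using True by (simp add: h_def)
  qed (auto simp: h_def)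
  then show "\<exists>C. \<forall>x s t. \<bar>s\<bar> <= M --> \<bar>t\<bar> <= M --> \<bar>deriv (h x) s - deriv (h x) t\<bar> <= C * \<bar>s - t\<bar>" by blast
 qed
 moreover have "AE x\<in>\<O> in lebesgue. (\<forall>t. g x t = h x t)" using ae by eventually_elim (simp add: h_def)
 moreover have "x \<in> \<O> \<and> P x \<and> h x = g x \<or> h x = (\<lambda>_. 0)" "x \<notin> \<O> --> h x = (\<lambda>_. 0)" for x by (auto simp: h_def good_def)
 ultimately show ?thesis by blast
qed

text \<open>The value \<open>d\<close> used off the good set is left open, since positivity of
  \<open>\<zeta>\<^sub>k\<close> and ellipticity call for different substitutes.\<close>

lemma clean_coeff:
 fixes c :: "real^'n => real"  and d C :: real
 assumes \<O>: "open \<O>" and c: "c \<in> Linf_fun \<O>" and Q: "AE x in lebesgue_on \<O>. Q x"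
  and C: "\<And>x. Q x ==> \<bar>c x\<bar> <= C"
 defines "c' \<equiv> \<lambda>x. if x \<in> \<O> \<and> Q x then c x else d"
 shows "c' \<in> borel_measurable lebesgue" "AE x\<in>\<O> in lebesgue. c x = c' x" "\<bar>c' x\<bar> <= max C \<bar>d\<bar>"
proof -
 have e: "ext \<O> c \<in> borel_measurable lebesgue" using c measurable_lebesgue_on[OF \<O>] by (auto simp: Linf_fun_def)
 have Q': "AE x\<in>\<O> in lebesgue. Q x" using Q by (simp add: AE_lebesgue_on[OF \<O>])
 have "AE x in lebesgue. ext \<O> c x + d * indicator (- \<O>) x = c' x" using Q' by eventually_elim (auto simp: c'_def ext_def)
 moreover have "(\<lambda>x. ext \<O> c x + d * indicator (- \<O>) x) \<in> borel_measurable lebesgue"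
  using \<O> by (intro borel_measurable_add e borel_measurable_times borel_measurable_const borel_measurable_indicator) (auto simp: borel_open)
 ultimately show "c' \<in> borel_measurable lebesgue" by (rule borel_measurable_AE[rotated])
 show "AE x\<in>\<O> in lebesgue. c x = c' x" using Q' by eventually_elim (simp add: c'_def)
 show "\<bar>c' x\<bar> <= max C \<bar>d\<bar>" using C[of x] by (auto simp: c'_def)
qed

lemma Linf_fun_clean:
 fixes c :: "real^'n => real"
 assumes \<O>: "open \<O>" and c: "c \<in> Linf_fun \<O>" and Q: "AE x in lebesgue_on \<O>. c x \<ge> d"
 shows "\<exists>c'. bmeas c' \<and> (AE x\<in>\<O> in lebesgue. c x = c' x) \<and> (\<forall>x. c' x \<ge> d)"
proof -
 obtain C where C: "AE x in lebesgue_on \<O>. \<bar>c x\<bar> <= C" using c by (auto simp: Linf_fun_def)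
 let ?Q = "\<lambda>x. \<bar>c x\<bar> <= C \<and> c x \<ge> d"
 have "AE x in lebesgue_on \<O>. ?Q x" using C Q by eventually_elim simp
 note cc = clean_coeff[OF \<O> c this, where C = C and d = d]
 define c' where "c' x = (if x \<in> \<O> \<and> ?Q x then c x else d)" for x
 have "c' \<in> borel_measurable lebesgue" "AE x\<in>\<O> in lebesgue. c x = c' x" "\<bar>c' x\<bar> <= max C \<bar>d\<bar>" "c' x \<ge> d" for x
  unfolding c'_def[abs_def] using cc by auto
 then show ?thesis unfolding bmeas_def by blast
qed

lemma L2_inner_fn:
 assumes \<O>: "open \<O>" and h: "h \<in> L2_fun \<O>"
 shows "L2_inner \<O> (fn G) h = l2 \<O> h \<bullet> G"
proof -
 have "ext \<O> (\<lambda>x. fn G x * h x) = (\<lambda>x. ext \<O> h x * fn G x)" by (auto simp: ext_def)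
 then show ?thesis
  using l2_inner_ext[OF \<O> h sqint_fn[of G]] by (simp only: L2_inner_def integral_lebesgue_on[OF \<O>] cls_fn)
qed

section \<open>The cost functionals and their partial gradients\<close>

context semilinear
begin

context
 fixes a0 :: "'n => 'n => real^'n => real" and g0 :: "real^'n => real => real" and m k :: nat
  and B \<zeta> b :: "nat => real^'n => real" and z :: "real^'n => real" and L :: "nat => real^'n => real => real"
  and l l' :: "real^'n => real => real"
 assumes a0: "\<And>i j. AE x\<in>\<O> in lebesgue. a0 i j x = a i j x"
  and g0: "AE x\<in>\<O> in lebesgue. (\<forall>t. g0 x t = f x t)"
  and dens: "\<And>z. z \<in> frontier \<O> ==> ext_dens z"
  and b: "\<And>i. i \<in> {1..m} ==> bmeas (b i)" "\<And>i. i \<in> {1..m} ==> AE x\<in>\<O> in lebesgue. B i x = b i x"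
  and z: "bmeas z" "AE x\<in>\<O> in lebesgue. \<zeta> k x = z x"
  and k: "k \<in> {1..m}" and l: "nonlin l l'" "AE x\<in>\<O> in lebesgue. (\<forall>t. L k x t = l x t)"
   "\<And>x. x \<notin> \<O> ==> l x = (\<lambda>_. 0)" "integrable lebesgue (\<lambda>x. l x 0)"
begin

text \<open>All integrals ignore null sets, so the cost with the original data and the chosen state
  becomes the functional \<open>Gf\<close> of the class of the source plus a quadratic form.\<close>

lemma cost_eq:
 assumes u: "\<And>i. i \<in> {1..m} ==> u i \<in> L2_fun \<O>"
 shows "cost \<O> a0 g0 m B L \<zeta> k u = Gf l (\<Sum>i\<in>{1..m}. mul (b i) (l2 \<O> (u i))) + 1 / 2 * (mul z (l2 \<O> (u k)) \<bullet> l2 \<O> (u k))"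
proof -
 let ?w = "\<lambda>x. \<Sum>i=1..m. B i x * u i x" and ?W = "\<Sum>i\<in>{1..m}. mul (b i) (l2 \<O> (u i))"
 have e: "sqint (ext \<O> (u i))" if "i \<in> {1..m}" for i using u[OF that] L2_fun_iff[OF open_\<O>] by blast
 have sq: "sqint (\<lambda>x. \<Sum>i=1..m. b i x * ext \<O> (u i) x)" by (intro sqint_sum sqint_bmeas_mult b(1) e)
 have "AE x in lebesgue. \<forall>i\<in>{1..m}. x \<in> \<O> --> B i x = b i x" by (intro AE_finite_allI b(2)) simp
 then have ae: "AE x in lebesgue. (\<Sum>i=1..m. b i x * ext \<O> (u i) x) = ext \<O> ?w x"
  by eventually_elim (auto simp: ext_def)
 have w: "?w \<in> L2_fun \<O>" using sqint_AE_cong[OF sq ae] L2_fun_iff[OF open_\<O>] by blast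
 have "?W = (\<Sum>i\<in>{1..m}. cls (\<lambda>x. b i x * ext \<O> (u i) x))"
  unfolding l2_def by (intro sum.cong refl mul_cls b(1) e)
 also have "\<dots> = cls (\<lambda>x. \<Sum>i=1..m. b i x * ext \<O> (u i) x)" by (intro cls_sum sqint_bmeas_mult b(1) e)
 also have "\<dots> = l2 \<O> ?w" unfolding l2_def by (rule cls_eqI[OF sq ae])
 finally have W: "l2 \<O> ?w = ?W" ..
 have cong: "(LINT x|lebesgue. g x) = (LINT x|lebesgue. h x)"
  if g: "g \<in> borel_measurable lebesgue" and gh: "AE x in lebesgue. g x = h x" for g h :: "real^'n => real"
  by (rule integral_cong_AE[OF g borel_measurable_AE[OF g gh] gh])
 have st: "AE x\<in>\<O> in lebesgue. state \<O> a0 g0 ?w x = fn (fst (S (l2 \<O> ?w))) x"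
  by (rule state_eq_S[OF a0 g0 w dens])
 have "Gf l ?W = (LINT x|lebesgue. ext \<O> (\<lambda>x. L k x (state \<O> a0 g0 ?w x)) x)" unfolding Gf_def
 proof (rule cong)
  show "(\<lambda>x. l x (fn (fst (S ?W)) x)) \<in> borel_measurable lebesgue"
   by (rule caratheodory_measurable[OF nonlinD(1)[OF l(1)] nonlin_cont[OF l(1)] fn_meas])
  show "AE x in lebesgue. l x (fn (fst (S ?W)) x) = ext \<O> (\<lambda>x. L k x (state \<O> a0 g0 ?w x)) x"
   using l(2) st unfolding W by eventually_elim (auto simp: ext_def l(3))
 qed
 moreover have "mul z (l2 \<O> (u k)) \<bullet> l2 \<O> (u k) = (LINT x|lebesgue. z x * ext \<O> (u k) x * ext \<O> (u k) x)"
  unfolding l2_def mul_cls[OF z(1) e[OF k]] by (rule inner_cls[OF sqint_bmeas_mult[OF z(1) e[OF k]] e[OF k]])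
 moreover have "\<dots> = (LINT x|lebesgue. ext \<O> (\<lambda>x. \<zeta> k x * (u k x)\<^sup>2) x)"
 proof (rule cong)
  show "(\<lambda>x. z x * ext \<O> (u k) x * ext \<O> (u k) x) \<in> borel_measurable lebesgue"
   using bmeas_meas[OF z(1)] sqint_meas[OF e[OF k]] by measurable
  show "AE x in lebesgue. z x * ext \<O> (u k) x * ext \<O> (u k) x = ext \<O> (\<lambda>x. \<zeta> k x * (u k x)\<^sup>2) x"
   using z(2) by eventually_elim (auto simp: ext_def power2_eq_square)
 qed
 ultimately show ?thesis unfolding cost_def integral_lebesgue_on[OF open_\<O>] by simp
qed

text \<open>A remainder quadratic in the perturbation gives Frechet differentiability. The adjoint
  state, multiplied by \<open>b k\<close>, represents the derivative of the state term because only
  the component \<open>k\<close> of the source varies.\<close>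

lemma cost_gradient:
 assumes u: "\<And>i. i \<in> {1..m} ==> u i \<in> L2_fun \<O>"
 defines "W \<equiv> \<Sum>i\<in>{1..m}. mul (b i) (l2 \<O> (u i))"
 assumes M: "M \<ge> ybound W + supc"
 defines "G \<equiv> mul (b k) (fst (adj M l' (fst (S W)))) + mul z (l2 \<O> (u k))"
 shows "has_partial_gradient \<O> (cost \<O> a0 g0 m B L \<zeta> k) k (fn G) u"
proof -
 obtain K where K: "K \<ge> 0" "\<And>h. norm h <= 1 ==> \<bar>Gf l (W + h) - Gf l W - h \<bullet> fst (adj M l' (fst (S W)))\<bar> <= K * (norm h)\<^sup>2"
  using Gf_expansion[OF l(1,4) M] by blast
 obtain Cb where Cb: "\<And>x. \<bar>b k x\<bar> <= Cb" using b(1)[OF k] by (auto simp: bmeas_def)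
 obtain Cz where Cz: "\<And>x. \<bar>z x\<bar> <= Cz" using z(1) by (auto simp: bmeas_def)
 have C0: "Cb \<ge> 0" "Cz \<ge> 0" using Cb[of undefined] Cz[of undefined] by linarith+
 \<comment> \<open>The first summand bounds the state remainder for the perturbation
   \<open>mul (b k)\<close> of the source; the second bounds, generously, the exact quadratic
   remainder of the control cost.\<close>
 define K' where "K' = K * Cb\<^sup>2 + Cz"
 have K': "K' \<ge> 0" using K(1) C0 by (simp add: K'_def)
 let ?F = "\<lambda>v. cost \<O> a0 g0 m B L \<zeta> k (u(k := v))" and ?X = "l2 \<O> (u k)"
 have expand: "\<bar>?F (\<lambda>x. u k x + h x) - ?F (u k) - L2_inner \<O> (fn G) h\<bar> <= K' * (norm (l2 \<O> h))\<^sup>2"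
  if h: "h \<in> L2_fun \<O>" and hs: "Cb * norm (l2 \<O> h) <= 1" for h
 proof -
  let ?H = "l2 \<O> h"
  have uk: "(\<lambda>x. u k x + h x) \<in> L2_fun \<O>" "l2 \<O> (\<lambda>x. u k x + h x) = ?X + ?H"
   using L2_fun_linear(1)[OF open_\<O> u[OF k] h] l2_linear(1)[OF open_\<O> u[OF k] h] by auto
  have "(\<Sum>i\<in>{1..m}. mul (b i) (l2 \<O> ((u(k := (\<lambda>x. u k x + h x))) i))) = W + mul (b k) ?H"
   unfolding W_def sum.remove[OF finite_atLeastAtMost k] using uk(2) by (simp add: mul_add b(1)[OF k])
  then have F1: "?F (\<lambda>x. u k x + h x) = Gf l (W + mul (b k) ?H) + 1 / 2 * (mul z (?X + ?H) \<bullet> (?X + ?H))"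
   using cost_eq[of "u(k := (\<lambda>x. u k x + h x))"] u uk by (simp add: fun_upd_def)
  have F0: "?F (u k) = Gf l W + 1 / 2 * (mul z ?X \<bullet> ?X)" using cost_eq[of u] u by (simp add: W_def)
  have "L2_inner \<O> (fn G) h = ?H \<bullet> G" by (rule L2_inner_fn[OF open_\<O> h])
  moreover have sym: "mul c p \<bullet> q = mul c q \<bullet> p" if "bmeas c" for c and p q :: "(real^'n) L2"
   by (simp add: inner_mul[OF that] mult_ac)
  ultimately have in': "L2_inner \<O> (fn G) h = mul (b k) ?H \<bullet> fst (adj M l' (fst (S W))) + mul z ?X \<bullet> ?H"
   unfolding sym[OF b(1)[OF k], of ?H] by (simp add: G_def inner_add_right inner_commute)
  have "?F (\<lambda>x. u k x + h x) - ?F (u k) - L2_inner \<O> (fn G) h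
    = (Gf l (W + mul (b k) ?H) - Gf l W - mul (b k) ?H \<bullet> fst (adj M l' (fst (S W)))) + 1 / 2 * (mul z ?H \<bullet> ?H)"
   unfolding F0 F1 in' using sym[OF z(1), of ?H ?X] by (simp add: mul_add z(1) inner_add_left inner_add_right add_divide_distrib)
  moreover have "\<bar>Gf l (W + mul (b k) ?H) - Gf l W - mul (b k) ?H \<bullet> fst (adj M l' (fst (S W)))\<bar> <= K * Cb\<^sup>2 * (norm ?H)\<^sup>2"
  proof -
   have n: "norm (mul (b k) ?H) <= Cb * norm ?H" by (rule norm_mul_le[OF b(1)[OF k] Cb])
   have "K * (norm (mul (b k) ?H))\<^sup>2 <= K * (Cb * norm ?H)\<^sup>2" using n K(1) by (intro mult_left_mono power_mono) auto
   then show ?thesis using K(2)[of "mul (b k) ?H"] n hs by (simp add: power_mult_distrib mult.assoc)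
  qed
  moreover have "\<bar>mul z ?H \<bullet> ?H\<bar> <= Cz * (norm ?H)\<^sup>2"
   using Cauchy_Schwarz_ineq2[of "mul z ?H" ?H] mult_right_mono[OF norm_mul_le[OF z(1) Cz, of ?H], of "norm ?H"]
   by (simp add: power2_eq_square mult.assoc)
  moreover have "Cz * (norm ?H)\<^sup>2 \<ge> 0" using C0 by simp
  ultimately show ?thesis by (simp only: K'_def distrib_right)
 qed
 show ?thesis unfolding has_partial_gradient_def has_L2_gradient_def
 proof (intro conjI allI impI fn_in_L2_fun open_\<O>)
  fix e :: real assume e: "e > 0"
  define d where "d = min (1 / (Cb + 1)) (e / (K' + 1))"
  have d: "d > 0" "Cb * d <= 1" "K' * d <= e"
  proof -
   show "d > 0" using e C0 K' by (simp add: d_def)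
   have "Cb * d <= Cb * (1 / (Cb + 1))" using C0 by (intro mult_left_mono) (auto simp: d_def)
   also have "\<dots> <= 1" using C0 by (simp add: field_simps)
   finally show "Cb * d <= 1" .
   have "K' * d <= K' * (e / (K' + 1))" using K' by (intro mult_left_mono) (auto simp: d_def)
   also have "\<dots> <= e" using K' e by (simp add: field_simps)
   finally show "K' * d <= e" .
  qed
  show "\<exists>d>0. \<forall>h\<in>L2_fun \<O>. L2_norm \<O> h < d -->
    \<bar>?F (\<lambda>x. u k x + h x) - ?F (u k) - L2_inner \<O> (fn G) h\<bar> <= e * L2_norm \<O> h"
  proof (rule exI[of _ d], intro conjI d(1) ballI impI)
   fix h assume h: "h \<in> L2_fun \<O>" "L2_norm \<O> h < d"
   then have n: "norm (l2 \<O> h) <= d" by (simp add: L2_norm_eq[OF open_\<O>])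
   have "Cb * norm (l2 \<O> h) <= 1" using mult_left_mono[OF n C0(1)] d(2) by linarith
   note expand[OF h(1) this]
   also have "K' * (norm (l2 \<O> h))\<^sup>2 <= e * norm (l2 \<O> h)"
    using mult_right_mono[OF order_trans[OF mult_left_mono[OF n K'] d(3)], of "norm (l2 \<O> h)"]
    by (simp add: power2_eq_square mult.assoc)
   finally show "\<bar>?F (\<lambda>x. u k x + h x) - ?F (u k) - L2_inner \<O> (fn G) h\<bar> <= e * L2_norm \<O> h"
    by (simp add: L2_norm_eq[OF open_\<O> h(1)])
  qed
 qed
qed

end

end

section \<open>Transfer of the admissible sets and repair of the data\<close>

lemma l2_image_closed:
 fixes U :: "(real^'n => real) set"
 assumes \<O>: "open \<O>" and U: "U \<subseteq> L2_fun \<O>" "L2_closed \<O> U"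
 shows "closed (l2 \<O> ` U)"
 unfolding closed_sequential_limits
proof (intro allI impI, elim conjE)
 fix s V assume s: "\<forall>n. s n \<in> l2 \<O> ` U" and V: "s \<longlonglongrightarrow> V"
 from s have "\<forall>n. \<exists>v. v \<in> U \<and> s n = l2 \<O> v" by blast
 from choice[OF this] obtain v where v: "\<And>n. v n \<in> U" "\<And>n. s n = l2 \<O> (v n)" by blast
 let ?P = "mul (indicator \<O>) :: (real^'n) L2 => _"
 have bi: "bmeas (indicator \<O> :: real^'n => real)" using \<O> by (intro bmeas_indicator) (auto simp: borel_open)
 have Pl2: "?P W = l2 \<O> (fn W)" for W by (simp add: mul_def l2_def ext_indicator[abs_def])
 have Ps: "?P (s n) = s n" for n
 proof -
  have "sqint (ext \<O> (v n))" using v(1) U(1) L2_fun_iff[OF \<O>] by blast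
  from mul_cls[OF bi this] have "?P (s n) = cls (\<lambda>x. indicator \<O> x * ext \<O> (v n) x)" by (simp add: v(2) l2_def)
  also have "(\<lambda>x. indicator \<O> x * ext \<O> (v n) x) = ext \<O> (v n)" by (auto simp: ext_def)
  finally show ?thesis by (simp add: v(2) l2_def)
 qed
 \<comment> \<open>Multiplication by the indicator of \<open>\<O>\<close> fixes every element of the
   image, hence the limit: the limit vanishes off \<open>\<O>\<close> and is recovered from its
   restriction.\<close>
 from bounded_linear.tendsto[OF mul_bounded_linear[OF bi] V] have "s \<longlonglongrightarrow> ?P V" by (simp only: Ps)
 from LIMSEQ_unique[OF V this] have PV: "l2 \<O> (fn V) = V" by (simp add: Pl2)
 have "fn V \<in> U"
 proof (rule U(2)[unfolded L2_closed_def, rule_format])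
  show "v n \<in> U" for n by (rule v)
  show "fn V \<in> L2_fun \<O>" by (rule fn_in_L2_fun[OF \<O>])
  have "L2_norm \<O> (\<lambda>x. v n x - fn V x) = norm (s n - V)" for n
  proof -
   have vn: "v n \<in> L2_fun \<O>" using v(1) U(1) by blast
   show ?thesis
    using L2_norm_eq[OF \<O> L2_fun_linear(2)[OF \<O> vn fn_in_L2_fun[OF \<O>]]] l2_linear(2)[OF \<O> vn fn_in_L2_fun[OF \<O>]]
    by (simp add: v(2) PV)
  qed
  then show "(\<lambda>n. L2_norm \<O> (\<lambda>x. v n x - fn V x)) \<longlonglongrightarrow> 0" using tendsto_norm[OF LIM_zero[OF V]] by simp
 qed
 with PV show "V \<in> l2 \<O> ` U" by (intro image_eqI[of _ _ "fn V"]) auto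
qed

lemma l2_image_convex:
 assumes \<O>: "open \<O>" and U: "U \<subseteq> L2_fun \<O>" "L2_convex U"
 shows "convex (l2 \<O> ` U)"
 unfolding convex_alt
proof (intro ballI allI impI, elim imageE)
 fix x y t u v assume t: "0 <= t \<and> t <= (1::real)" and uv: "x = l2 \<O> u" "y = l2 \<O> v" "u \<in> U" "v \<in> U"
 then have L: "u \<in> L2_fun \<O>" "v \<in> L2_fun \<O>" using U(1) by auto
 have "(\<lambda>x. (1 - t) * u x + t * v x) \<in> U" using U(2) uv t by (auto simp: L2_convex_def)
 moreover have "l2 \<O> (\<lambda>x. (1 - t) * u x + t * v x) = (1 - t) *\<^sub>R x + t *\<^sub>R y"
  using l2_linear(1)[OF \<O> L2_fun_linear(3)[OF \<O> L(1)] L2_fun_linear(3)[OF \<O> L(2)], of "1 - t" t]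
   l2_linear(3)[OF \<O> L(1)] l2_linear(3)[OF \<O> L(2)] uv by simp
 ultimately show "(1 - t) *\<^sub>R x + t *\<^sub>R y \<in> l2 \<O> ` U" by (intro image_eqI[OF sym])
qed

lemma clean_elliptic:
 fixes a :: "'n::finite => 'n => real^'n => real"
 assumes \<O>: "open \<O>" and a: "\<And>i j. a i j \<in> Linf_fun \<O>" and lam: "lam > 0"
  and ell: "AE x in lebesgue_on \<O>. \<forall>\<xi>::real ^ 'n. lam * (norm \<xi>)\<^sup>2 <= (\<Sum>i\<in>UNIV. \<Sum>j\<in>UNIV. a i j x * \<xi> $ i * \<xi> $ j)"
 shows "\<exists>a' Lam. elliptic a' lam Lam \<and> (\<forall>i j. AE x\<in>\<O> in lebesgue. a i j x = a' i j x)"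
proof -
 have "\<forall>p. \<exists>C. AE x in lebesgue_on \<O>. \<bar>a (fst p) (snd p) x\<bar> <= C" using a by (simp add: Linf_fun_def)
 from choice[OF this] obtain A0 where A0: "\<And>p. AE x in lebesgue_on \<O>. \<bar>a (fst p) (snd p) x\<bar> <= A0 p" by blast
 define A where "A = (\<Sum>p\<in>UNIV. \<bar>A0 p\<bar>)"
 have A: "\<bar>A0 p\<bar> <= A" for p unfolding A_def by (rule member_le_sum[where f = "\<lambda>p. \<bar>A0 p\<bar>"]) auto
 define Q where "Q x \<longleftrightarrow> (\<forall>i j. \<bar>a i j x\<bar> <= A) \<and>
  (\<forall>\<xi>::real^'n. lam * (norm \<xi>)\<^sup>2 <= (\<Sum>i\<in>UNIV. \<Sum>j\<in>UNIV. a i j x * \<xi> $ i * \<xi> $ j))" for x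
 have "AE x in lebesgue_on \<O>. \<forall>p. \<bar>a (fst p) (snd p) x\<bar> <= A0 p" unfolding AE_all_countable by (intro allI A0)
 with ell have Q: "AE x in lebesgue_on \<O>. Q x"
 proof eventually_elim
  case (elim x)
  have "\<bar>a i j x\<bar> <= A" for i j using elim(2)[rule_format, of "(i, j)"] A[of "(i, j)"] by simp
  with elim(1) show ?case unfolding Q_def by blast
 qed
 \<comment> \<open>Off the good set the coefficients are \<open>lam\<close> times the identity
   matrix, so ellipticity with the same constant holds at every point.\<close>
 define a' where "a' i j x = (if x \<in> \<O> \<and> Q x then a i j x else if i = j then lam else 0)" for i j x
 have Qa: "\<bar>a i j x\<bar> <= A" if "Q x" for i j x using that unfolding Q_def by blast
 have a'': "a' i j = (\<lambda>x. if x \<in> \<O> \<and> Q x then a i j x else if i = j then lam else 0)" for i j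
  by (simp add: a'_def[abs_def])
 have cc: "a' i j \<in> borel_measurable lebesgue" "AE x\<in>\<O> in lebesgue. a i j x = a' i j x"
  "\<bar>a' i j x\<bar> <= max A \<bar>if i = j then lam else 0\<bar>" for i j x
  unfolding a'' by (rule clean_coeff[OF \<O> a Q Qa], assumption)+
 have "elliptic a' lam (max A lam)"
 proof
  show "a' i j \<in> borel_measurable lebesgue" for i j by (rule cc(1))
  show "\<bar>a' i j x\<bar> <= max A lam" for i j x using cc(3)[of i j x] lam by (auto split: if_splits)
  fix x and \<xi> :: "'n => real"
  show "lam * (\<Sum>i\<in>UNIV. (\<xi> i)\<^sup>2) <= (\<Sum>i\<in>UNIV. \<Sum>j\<in>UNIV. a' i j x * \<xi> i * \<xi> j)"
  proof (cases "x \<in> \<O> \<and> Q x")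
   case True
   then have "lam * (norm (\<chi> i. \<xi> i))\<^sup>2 <= (\<Sum>i\<in>UNIV. \<Sum>j\<in>UNIV. a i j x * (\<chi> i. \<xi> i) $ i * (\<chi> i. \<xi> i) $ j)"
    unfolding Q_def by blast
   moreover have "(norm (\<chi> i. \<xi> i))\<^sup>2 = (\<Sum>i\<in>UNIV. (\<xi> i)\<^sup>2)"
    by (simp add: norm_vec_def L2_set_def sum_nonneg)
   ultimately show ?thesis using True by (simp add: a'_def)
  next
   case False
   then have "a' i j x * \<xi> i * \<xi> j = (if j = i then lam * (\<xi> i)\<^sup>2 else 0)" for i j by (auto simp: a'_def power2_eq_square)
   then show ?thesis by (simp add: sum_distrib_left)
  qed
 qed (rule lam)
 then show ?thesis using cc(2) by blast
qed

text \<open>The sign and the local bound of the derivative are passed to \<open>clean_nonlin\<close>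
  through \<open>P\<close>; both survive replacement by the zero function.\<close>

lemma clean_f:
 fixes f :: "real^'n => real => real"
 assumes \<O>: "open \<O>" "bounded \<O>" and f: "f_assumption \<O> f"
 shows "\<exists>h. nonlin h (\<lambda>x. deriv (h x)) \<and> (AE x\<in>\<O> in lebesgue. (\<forall>t. f x t = h x t)) \<and>
  sqint (\<lambda>x. h x 0) \<and> (\<forall>x t. 0 <= deriv (h x) t) \<and> (\<forall>M. \<exists>C. \<forall>x t. \<bar>t\<bar> <= M --> deriv (h x) t <= C)"
proof -
 have bd: "\<exists>C>0. AE x in lebesgue_on \<O>. \<forall>y. \<bar>y\<bar> <= M --> \<bar>deriv (f x) y\<bar> + \<bar>deriv (deriv (f x)) y\<bar> <= C" if "M > 0" for M
  using f that unfolding f_assumption_def by blast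
 have "\<forall>n. \<exists>C. AE x in lebesgue_on \<O>. \<forall>y. \<bar>y\<bar> <= real (Suc n) --> \<bar>deriv (f x) y\<bar> + \<bar>deriv (deriv (f x)) y\<bar> <= C"
 proof
  fix n
  obtain C where "AE x in lebesgue_on \<O>. \<forall>y. \<bar>y\<bar> <= real (Suc n) --> \<bar>deriv (f x) y\<bar> + \<bar>deriv (deriv (f x)) y\<bar> <= C"
   using bd[of "real (Suc n)"] by auto
  then show "\<exists>C. AE x in lebesgue_on \<O>. \<forall>y. \<bar>y\<bar> <= real (Suc n) --> \<bar>deriv (f x) y\<bar> + \<bar>deriv (deriv (f x)) y\<bar> <= C" ..
 qed
 from choice[OF this] obtain C where C: "\<And>n. AE x in lebesgue_on \<O>. \<forall>y. \<bar>y\<bar> <= real (Suc n) --> \<bar>deriv (f x) y\<bar> + \<bar>deriv (deriv (f x)) y\<bar> <= C n"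
  by blast
 define P where "P x \<longleftrightarrow> (\<forall>y. deriv (f x) y \<ge> 0) \<and> (\<forall>n y. \<bar>y\<bar> <= real (Suc n) --> deriv (f x) y <= C n)" for x
 have "AE x in lebesgue_on \<O>. \<forall>n y. \<bar>y\<bar> <= real (Suc n) --> \<bar>deriv (f x) y\<bar> + \<bar>deriv (deriv (f x)) y\<bar> <= C n"
  unfolding AE_all_countable by (intro allI C)
 moreover have "AE x in lebesgue_on \<O>. \<forall>y. deriv (f x) y \<ge> 0" using f by (simp add: f_assumption_def)
 ultimately have P: "AE x in lebesgue_on \<O>. P x"
 proof eventually_elim
  case (elim x)
  have "deriv (f x) y <= C n" if "\<bar>y\<bar> <= real (Suc n)" for n y
   using elim(1)[rule_format, OF that] by linarith
  with elim(2) show ?case unfolding P_def by blast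
 qed
 have bd': "\<exists>C>0. \<exists>\<psi>\<in>L2_fun \<O>. AE x in lebesgue_on \<O>. \<forall>y. \<bar>y\<bar> <= M -->
   \<bar>deriv (f x) y\<bar> <= \<psi> x \<and> \<bar>deriv (deriv (f x)) y\<bar> <= C" if M: "M > 0" for M
 proof -
  obtain D where D: "D > 0" "AE x in lebesgue_on \<O>. \<forall>y. \<bar>y\<bar> <= M --> \<bar>deriv (f x) y\<bar> + \<bar>deriv (deriv (f x)) y\<bar> <= D"
   using bd[OF M] by blast
  have "ext \<O> (\<lambda>_. D) = (\<lambda>x. D * indicator \<O> x)" by (auto simp: ext_def)
  then have "(\<lambda>_. D) \<in> L2_fun \<O>"
   unfolding L2_fun_iff[OF \<O>(1)] using sqint_scale[OF sqint_indicator[OF lmeasurable_open[OF \<O>(2,1)]], of D] by simp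
  moreover have "AE x in lebesgue_on \<O>. \<forall>y. \<bar>y\<bar> <= M --> \<bar>deriv (f x) y\<bar> <= D \<and> \<bar>deriv (deriv (f x)) y\<bar> <= D"
   using D(2)
  proof eventually_elim
   case (elim x)
   have "\<bar>deriv (f x) y\<bar> <= D \<and> \<bar>deriv (deriv (f x)) y\<bar> <= D" if "\<bar>y\<bar> <= M" for y
    using elim[rule_format, OF that] by linarith
   then show ?case by blast
  qed
  ultimately show ?thesis using D(1) by (intro exI[of _ D] conjI bexI[of _ "\<lambda>_. D"])
 qed
 have "caratheodory \<O> f" "AE x in lebesgue_on \<O>. C2_real (f x)" using f by (auto simp: f_assumption_def)
 from clean_nonlin[OF \<O>(1) this bd' P] obtain h where h: "nonlin h (\<lambda>x. deriv (h x))"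
  "AE x\<in>\<O> in lebesgue. (\<forall>t. f x t = h x t)" "\<And>x. x \<in> \<O> \<and> P x \<and> h x = f x \<or> h x = (\<lambda>_. 0)" "\<And>x. x \<notin> \<O> ==> h x = (\<lambda>_. 0)"
  by blast
 have "sqint (ext \<O> (\<lambda>x. f x 0))" using f L2_fun_iff[OF \<O>(1)] by (simp add: f_assumption_def)
 moreover have "AE x in lebesgue. ext \<O> (\<lambda>x. f x 0) x = h x 0" using h(2) by eventually_elim (auto simp: ext_def h(4))
 ultimately have "sqint (\<lambda>x. h x 0)" by (rule sqint_AE_cong)
 moreover have "0 <= deriv (h x) t" for x t using h(3)[of x] by (auto simp: P_def)
 moreover have "\<exists>C. \<forall>x t. \<bar>t\<bar> <= M --> deriv (h x) t <= C" for M
 proof -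
  obtain n where "M <= real n" using real_arch_simple by blast
  then have n: "M <= real (Suc n)" by simp
  have "deriv (h x) t <= max 0 (C n)" if "\<bar>t\<bar> <= M" for x t
  proof (cases "h x = (\<lambda>_. 0)")
   case False
   then have "P x" "h x = f x" using h(3)[of x] by auto
   then have "deriv (h x) t <= C n" using that n unfolding P_def by (metis order_trans)
   then show ?thesis by simp
  qed simp
  then show ?thesis by blast
 qed
 ultimately show ?thesis using h(1,2) by blast
qed

lemma clean_L:
 fixes L :: "real^'n => real => real"
 assumes \<O>: "open \<O>" and L: "L_assumption \<O> L"
 shows "\<exists>h. nonlin h (\<lambda>x. deriv (h x)) \<and> (AE x\<in>\<O> in lebesgue. (\<forall>t. L x t = h x t)) \<and>
  (\<forall>x. x \<notin> \<O> --> h x = (\<lambda>_. 0)) \<and> integrable lebesgue (\<lambda>x. h x 0)"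
proof -
 have L': "caratheodory \<O> L" "AE x in lebesgue_on \<O>. C2_real (L x)" using L by (auto simp: L_assumption_def)
 have "\<exists>C>0. \<exists>\<psi>\<in>L2_fun \<O>. AE x in lebesgue_on \<O>. \<forall>y. \<bar>y\<bar> <= M -->
   \<bar>deriv (L x) y\<bar> <= \<psi> x \<and> \<bar>deriv (deriv (L x)) y\<bar> <= C" if "M > 0" for M
  using L that unfolding L_assumption_def by blast
 from clean_nonlin[OF \<O> L' this, where P = "\<lambda>_. True"] obtain h where h: "nonlin h (\<lambda>x. deriv (h x))"
  "AE x\<in>\<O> in lebesgue. (\<forall>t. L x t = h x t)" "\<And>x. x \<notin> \<O> ==> h x = (\<lambda>_. 0)" by auto
 have i: "integrable lebesgue (ext \<O> (\<lambda>x. L x 0))"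
  using L integrable_lebesgue_on[OF \<O>] by (auto simp: L_assumption_def L1_fun_def)
 have "AE x in lebesgue. ext \<O> (\<lambda>x. L x 0) x = h x 0" using h(2) by eventually_elim (auto simp: ext_def h(3))
 then have "integrable lebesgue (\<lambda>x. h x 0)" by (rule integrable_cong_AE_imp[OF i nonlinD(1)[OF h(1)]])
 then show ?thesis using h by blast
qed

theorem theorem3p1:
  fixes \<Omega> :: "(real ^ 'n) set"
    and a :: "'n \<Rightarrow> 'n \<Rightarrow> real ^ 'n \<Rightarrow> real"
    and lam :: real
    and m :: nat
    and f :: "real ^ 'n \<Rightarrow> real \<Rightarrow> real"
    and L :: "nat \<Rightarrow> real ^ 'n \<Rightarrow> real \<Rightarrow> real"
    and \<zeta> B :: "nat \<Rightarrow> real ^ 'n \<Rightarrow> real"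
    and \<zeta>0 :: "nat \<Rightarrow> real"
    and U :: "nat \<Rightarrow> (real ^ 'n \<Rightarrow> real) set"
  assumes "m \<ge> 1"
    and "CARD('n) \<in> {1, 2, 3}"
    and "open \<Omega>" and "connected \<Omega>" and "\<Omega> \<noteq> {}" and "bounded \<Omega>"
    and "lipschitz_boundary \<Omega>"
    and "\<And>i j. a i j \<in> Linf_fun \<Omega>"
    and "lam > 0"
    and "AE x in lebesgue_on \<Omega>. \<forall>\<xi>::real ^ 'n.
           lam * (norm \<xi>)\<^sup>2 \<le> (\<Sum>i\<in>UNIV. \<Sum>j\<in>UNIV. a i j x * \<xi> $ i * \<xi> $ j)"
    and "\<And>k. k \<in> {1..m} \<Longrightarrow> \<zeta> k \<in> Linf_fun \<Omega>"
    and "\<And>k. k \<in> {1..m} \<Longrightarrow> B k \<in> Linf_fun \<Omega>"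
    and "\<And>k. k \<in> {1..m} \<Longrightarrow> \<zeta>0 k > 0"
    and "\<And>k. k \<in> {1..m} \<Longrightarrow> AE x in lebesgue_on \<Omega>. \<zeta> k x \<ge> \<zeta>0 k"
    and "f_assumption \<Omega> f"
    and "\<And>k. k \<in> {1..m} \<Longrightarrow> L_assumption \<Omega> (L k)"
    and "\<And>k. k \<in> {1..m} \<Longrightarrow> U k \<subseteq> L2_fun \<Omega>"
    and "\<And>k. k \<in> {1..m} \<Longrightarrow> U k \<noteq> {}"
    and "\<And>k. k \<in> {1..m} \<Longrightarrow> L2_convex (U k)"
    and "\<And>k. k \<in> {1..m} \<Longrightarrow> L2_closed \<Omega> (U k)"
    and "\<And>k. k \<in> {1..m} \<Longrightarrow> L2_bounded \<Omega> (U k)"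
  shows "\<exists>u. variational_nash \<Omega> m (cost \<Omega> a f m B L \<zeta>) U u"
proof -
 note \<Omega> = \<open>open \<Omega>\<close> \<open>bounded \<Omega>\<close>
 note U = \<open>\<And>k. k \<in> {1..m} ==> U k \<subseteq> L2_fun \<Omega>\<close>
 obtain a' Lam where a': "elliptic a' lam Lam" "\<And>i j. AE x\<in>\<Omega> in lebesgue. a i j x = a' i j x"
  using clean_elliptic[OF \<Omega>(1) assms(8-10)] by blast
 obtain g where g: "nonlin g (\<lambda>x. deriv (g x))" "AE x\<in>\<Omega> in lebesgue. (\<forall>t. f x t = g x t)"
  "sqint (\<lambda>x. g x 0)" "\<And>x t. 0 <= deriv (g x) t" "\<And>M. \<exists>C. \<forall>x t. \<bar>t\<bar> <= M --> deriv (g x) t <= C"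
  using clean_f[OF \<Omega> \<open>f_assumption \<Omega> f\<close>] by blast
 have "CARD('n) <= 3" using assms(2) by auto
 \<comment> \<open>From here classes and solution operators refer to the modified data;
   \<open>cost_gradient\<close> relates them to the cost built from the original data.\<close>
 then interpret semilinear a' lam Lam \<Omega> g "\<lambda>x. deriv (g x)"
  using a'(1) \<Omega> g by (simp add: semilinear_def elliptic_domain_def elliptic_domain_axioms_def semilinear_axioms_def)
 have dens: "ext_dens z" if "z \<in> frontier \<Omega>" for z
  unfolding ext_dens_def by (rule lipschitz_boundary_ext_dens[OF \<open>lipschitz_boundary \<Omega>\<close> \<Omega> that])
 have "\<forall>k\<in>{1..m}. \<exists>h. nonlin h (\<lambda>x. deriv (h x)) \<and> (AE x\<in>\<Omega> in lebesgue. (\<forall>t. L k x t = h x t)) \<and>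
  (\<forall>x. x \<notin> \<Omega> --> h x = (\<lambda>_. 0)) \<and> integrable lebesgue (\<lambda>x. h x 0)"
  by (intro ballI clean_L[OF \<Omega>(1)] assms(16))
 from bchoice[OF this] obtain l where l: "\<And>k. k \<in> {1..m} ==> nonlin (l k) (\<lambda>x. deriv (l k x))"
  "\<And>k. k \<in> {1..m} ==> AE x\<in>\<Omega> in lebesgue. (\<forall>t. L k x t = l k x t)"
  "\<And>k x. k \<in> {1..m} ==> x \<notin> \<Omega> ==> l k x = (\<lambda>_. 0)" "\<And>k. k \<in> {1..m} ==> integrable lebesgue (\<lambda>x. l k x 0)"
  by blast
 have "\<forall>k\<in>{1..m}. \<exists>c. bmeas c \<and> (AE x\<in>\<Omega> in lebesgue. \<zeta> k x = c x) \<and> (\<forall>x. c x \<ge> \<zeta>0 k)"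
  by (intro ballI Linf_fun_clean[OF \<Omega>(1)] assms(11,14))
 from bchoice[OF this] obtain z where z: "\<And>k. k \<in> {1..m} ==> bmeas (z k)"
  "\<And>k. k \<in> {1..m} ==> AE x\<in>\<Omega> in lebesgue. \<zeta> k x = z k x" "\<And>k x. k \<in> {1..m} ==> z k x \<ge> \<zeta>0 k" by blast
 have "\<exists>c. bmeas c \<and> (AE x\<in>\<Omega> in lebesgue. B k x = c x)" if k: "k \<in> {1..m}" for k
 proof -
  obtain C where "AE x in lebesgue_on \<Omega>. \<bar>B k x\<bar> <= C" using assms(12)[OF k] by (auto simp: Linf_fun_def)
  \<comment> \<open>\<open>Linf_fun_clean\<close> needs a lower bound to serve as default value;
    essential boundedness provides one.\<close>
  then have "AE x in lebesgue_on \<Omega>. B k x \<ge> - C" by eventually_elim linarith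
  from Linf_fun_clean[OF \<Omega>(1) assms(12)[OF k] this] show ?thesis by blast
 qed
 then have "\<forall>k\<in>{1..m}. \<exists>c. bmeas c \<and> (AE x\<in>\<Omega> in lebesgue. B k x = c x)" by blast
 from bchoice[OF this] obtain b where b: "\<And>k. k \<in> {1..m} ==> bmeas (b k)"
  "\<And>k. k \<in> {1..m} ==> AE x\<in>\<Omega> in lebesgue. B k x = b k x" by blast
 define K where "K k = l2 \<Omega> ` U k" for k
 have K: "closed (K k)" "convex (K k)" "K k \<noteq> {}" "bounded (K k)" if k: "k \<in> {1..m}" for k
 proof -
  show "closed (K k)" unfolding K_def by (rule l2_image_closed[OF \<Omega>(1) U[OF k] assms(20)[OF k]])
  show "convex (K k)" unfolding K_def by (rule l2_image_convex[OF \<Omega>(1) U[OF k] assms(19)[OF k]])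
  show "K k \<noteq> {}" using assms(18)[OF k] by (simp add: K_def)
  obtain R where "\<And>u. u \<in> U k ==> L2_norm \<Omega> u <= R" using assms(21)[OF k] by (auto simp: L2_bounded_def)
  then show "bounded (K k)" unfolding K_def bounded_iff using L2_norm_eq[OF \<Omega>(1)] U[OF k] by force
 qed
 have "\<exists>v M. (\<forall>k\<in>{1..m}. v k \<in> K k) \<and> M \<ge> ybound (\<Sum>k\<in>{1..m}. mul (b k) (v k)) + supc \<and>
  (\<forall>k\<in>{1..m}. \<forall>w\<in>K k. (mul (b k) (fst (adj M (\<lambda>x. deriv (l k x)) (fst (S (\<Sum>k\<in>{1..m}. mul (b k) (v k)))))) + mul (z k) (v k)) \<bullet> (w - v k) \<ge> 0)"
  by (rule equilibrium_exists[where ?z0.0 = \<zeta>0]) (rule l(1) K b(1) z(1,3) assms(13), assumption)+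
 then obtain v M where v: "\<forall>k\<in>{1..m}. v k \<in> K k" and M: "M \<ge> ybound (\<Sum>k\<in>{1..m}. mul (b k) (v k)) + supc"
  and VI: "\<forall>k\<in>{1..m}. \<forall>w\<in>K k.
   (mul (b k) (fst (adj M (\<lambda>x. deriv (l k x)) (fst (S (\<Sum>k\<in>{1..m}. mul (b k) (v k)))))) + mul (z k) (v k)) \<bullet> (w - v k) \<ge> 0"
  by (elim exE conjE)
 have "\<forall>k\<in>{1..m}. \<exists>u. u \<in> U k \<and> v k = l2 \<Omega> u" using v unfolding K_def by blast
 from bchoice[OF this] obtain u where u: "\<And>k. k \<in> {1..m} ==> u k \<in> U k" "\<And>k. k \<in> {1..m} ==> v k = l2 \<Omega> (u k)" by blast
 have uL: "u k \<in> L2_fun \<Omega>" if "k \<in> {1..m}" for k using u(1) U that by blast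
 define W where "W = (\<Sum>i\<in>{1..m}. mul (b i) (l2 \<Omega> (u i)))"
 have Wv: "(\<Sum>k\<in>{1..m}. mul (b k) (v k)) = W" unfolding W_def by (intro sum.cong refl arg_cong[of _ _ "mul _"] u(2))
 define G where "G k = mul (b k) (fst (adj M (\<lambda>x. deriv (l k x)) (fst (S W)))) + mul (z k) (l2 \<Omega> (u k))" for k
 have nash: "\<exists>h. has_partial_gradient \<Omega> (cost \<Omega> a f m B L \<zeta> k) k h u \<and>
   (\<lambda>x. 0) \<in> {(\<lambda>x. h x + \<nu> x) | \<nu>. \<nu> \<in> normal_cone \<Omega> (u k) (U k)}" if k: "k \<in> {1..m}" for k
 \<comment> \<open>The normal vector is the negative of the gradient; its membership in the normal
   cone is the variational inequality of the equilibrium, read through \<open>l2\<close>.\<close>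
 proof (rule exI[of _ "fn (G k)"], rule conjI)
  show "has_partial_gradient \<Omega> (cost \<Omega> a f m B L \<zeta> k) k (fn (G k)) u" unfolding G_def W_def
   by (rule cost_gradient) (assumption | rule a'(2) g(2) dens b z(1,2) l uL k M[unfolded Wv W_def])+
  have nL: "(\<lambda>x. - fn (G k) x) \<in> L2_fun \<Omega>" using L2_fun_linear(3)[OF \<Omega>(1) fn_in_L2_fun[OF \<Omega>(1)], of "-1" "G k"] by simp
  have "L2_inner \<Omega> (\<lambda>x. - fn (G k) x) (\<lambda>x. w x - u k x) <= 0" if w: "w \<in> U k" for w
  proof -
   have wL: "w \<in> L2_fun \<Omega>" using w U[OF k] by blast
   have "L2_inner \<Omega> (\<lambda>x. - fn (G k) x) (\<lambda>x. w x - u k x) = - L2_inner \<Omega> (fn (G k)) (\<lambda>x. w x - u k x)"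
    by (simp add: L2_inner_def)
   also have "\<dots> = - (G k \<bullet> (l2 \<Omega> w - v k))"
    using L2_inner_fn[OF \<Omega>(1) L2_fun_linear(2)[OF \<Omega>(1) wL uL[OF k]], of "G k"] l2_linear(2)[OF \<Omega>(1) wL uL[OF k]]
    by (simp add: inner_commute u(2)[OF k])
   also have "\<dots> <= 0" using bspec[OF bspec[OF VI k], of "l2 \<Omega> w"] w unfolding Wv G_def K_def u(2)[OF k] by simp
   finally show ?thesis .
  qed
  then have "(\<lambda>x. - fn (G k) x) \<in> normal_cone \<Omega> (u k) (U k)" using u(1)[OF k] nL by (simp add: normal_cone_def)
  then show "(\<lambda>x. 0) \<in> {(\<lambda>x. fn (G k) x + \<nu> x) | \<nu>. \<nu> \<in> normal_cone \<Omega> (u k) (U k)}"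
   by (intro CollectI exI[of _ "\<lambda>x. - fn (G k) x"]) auto
 qed
 have "variational_nash \<Omega> m (cost \<Omega> a f m B L \<zeta>) U u"
  unfolding variational_nash_def by (intro conjI ballI u(1) nash)
 then show ?thesis by blast
qed

end
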